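(* Let $d\ge2$, $\gamma\ge 2$, and let $\Omega\subset\mathbb{R}^d$ satisfy the standing assumptions below. For every $p\ge1$ there is a constant $c>0$ independent of $R$ such that for all sufficiently large $R$ $$\left\{\int_{SO(d)}\int_{\mathbb{T}^d}|D_{R\Omega}(\sigma,t)|^p\,dt\,d\sigma\right\}^{1/p}\ge c R^{\frac{d-1}{2}}.$$
   Context: Standing assumptions: $d\ge 2$ and $\Omega\subset\mathbb{R}^d$ is a convex body whose boundary $\partial\Omega$ is smooth with strictly positive Gaussian curvature at every point except the origin $0\in\partial\Omega$; in a neighborhood of the origin, $\partial\Omega$ coincides with the graph $\{(x,y)\in\mathbb{R}^{d-1}\times\mathbb{R}: y=|x|^\gamma\}$, with $\gamma\ge 2$ fixed. $|\Omega|$ denotes the Lebesgue measure of $\Omega$. For $R\ge1$, $\sigma\in SO(d)$, $t\in\mathbb{T}^d=\mathbb{R}^d/\mathbb{Z}^d$, the discrepancy is $D_{R\Omega}(\sigma,t)=R^d|\Omega|-\mathrm{card}\big(\mathbb{Z}^d\cap(R\sigma(\Omega)+t)\big)$. $d\sigma$ is normalized Haar measure on $SO(d)$, $dt$ Lebesgue measure on $\mathbb{T}^d$. *)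

theory Defs
  imports "HOL-Analysis.Analysis" "HOL-Probability.Probability"
begin

text \<open>Orthogonal projection onto the coordinate hyperplane {x. x$j = 0};
  this hyperplane is our model of R^(d-1), the coordinate j playing the role of y.\<close>
definition hproj :: "'n::finite \<Rightarrow> real^'n \<Rightarrow> real^'n" where
  "hproj j x = (\<chi> i. if i = j then 0 else x $ i)"

fun Ck_on :: "nat \<Rightarrow> ('a::euclidean_space) set \<Rightarrow> ('a \<Rightarrow> real) \<Rightarrow> bool" where
  "Ck_on 0 U f = continuous_on U f"
| "Ck_on (Suc k) U f =
     (f differentiable_on U \<and> (\<forall>v. Ck_on k U (\<lambda>x. frechet_derivative f (at x) v)))"

definition smooth_on :: "('a::euclidean_space) set \<Rightarrow> ('a \<Rightarrow> real) \<Rightarrow> bool" where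
  "smooth_on U f \<longleftrightarrow> (\<forall>k. Ck_on k U f)"

definition pderiv_coord :: "'n::finite \<Rightarrow> (real^'n \<Rightarrow> real) \<Rightarrow> real^'n \<Rightarrow> real" where
  "pderiv_coord i f x = frechet_derivative f (at x) (axis i 1)"

text \<open>Gaussian curvature, with respect to the upward (inward) normal, of the graph
  {z. z$j = f (hproj j z)} over the hyperplane {x$j = 0}, at the point over x:
  K = det (Hess f) / (1 + |grad f|^2)^((d+1)/2), where Hess f is the (d-1)x(d-1) Hessian
  in the coordinates i \<noteq> j (embedded as a d x d matrix with a 1 in the (j,j) slot).\<close>
definition graph_gauss_curv :: "'n::finite \<Rightarrow> (real^'n \<Rightarrow> real) \<Rightarrow> real^'n \<Rightarrow> real" where
  "graph_gauss_curv j f x =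
     det (\<chi> a b. if a = j \<or> b = j then (if a = b then 1 else 0)
                  else pderiv_coord b (pderiv_coord a f) x)
     / (1 + (\<Sum>i\<in>UNIV - {j}. (pderiv_coord i f x)\<^sup>2)) powr ((real CARD('n) + 1) / 2)"

definition smooth_pos_curv_at :: "'n::finite \<Rightarrow> (real^'n) set \<Rightarrow> real^'n \<Rightarrow> bool" where
  "smooth_pos_curv_at j \<Omega> p \<longleftrightarrow>
     (\<exists>Q U f \<epsilon>. orthogonal_matrix (Q :: real^'n^'n) \<and> open U \<and> smooth_on U f \<and> \<epsilon> > 0 \<and>
        (\<forall>w\<in>ball p \<epsilon>. hproj j (Q *v w) \<in> U \<and>
            (w \<in> \<Omega> \<longleftrightarrow> f (hproj j (Q *v w)) \<le> (Q *v w) $ j)) \<and>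
        graph_gauss_curv j f (hproj j (Q *v p)) > 0)"

definition convex_body :: "(real^'n::finite) set \<Rightarrow> bool" where
  "convex_body \<Omega> \<longleftrightarrow> convex \<Omega> \<and> compact \<Omega> \<and> interior \<Omega> \<noteq> {}"

definition standing_assms :: "'n::finite \<Rightarrow> real \<Rightarrow> (real^'n) set \<Rightarrow> bool" where
  "standing_assms j \<gamma> \<Omega> \<longleftrightarrow>
     convex_body \<Omega> \<and>
     (\<forall>p\<in>frontier \<Omega>. p \<noteq> 0 \<longrightarrow> smooth_pos_curv_at j \<Omega> p) \<and>
     (\<exists>\<epsilon>>0. \<forall>w\<in>ball 0 \<epsilon>. w \<in> frontier \<Omega> \<longleftrightarrow> w $ j = norm (hproj j w) powr \<gamma>)"

definition SOd :: "(real^'n^'n::finite) set" where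
  "SOd = {A. orthogonal_matrix A \<and> det A = 1}"

text \<open>Normalized Haar measure on SO(d): a left-invariant Borel probability measure on SO(d)
  (unique, so quantifying over all such measures is the same as using the Haar measure).\<close>
definition haar_SO :: "(real^'n^'n::finite) measure \<Rightarrow> bool" where
  "haar_SO \<mu> \<longleftrightarrow> prob_space \<mu> \<and> space \<mu> = SOd \<and> sets \<mu> = sets (restrict_space borel SOd) \<and>
     (\<forall>\<rho>\<in>SOd. distr \<mu> \<mu> (\<lambda>\<sigma>. \<rho> ** \<sigma>) = \<mu>)"

definition int_lattice :: "(real^'n::finite) set" where
  "int_lattice = {z. \<forall>i. z $ i \<in> \<int>}"

definition discrepancy :: "(real^'n::finite) set \<Rightarrow> real \<Rightarrow> real^'n^'n \<Rightarrow> real^'n \<Rightarrow> real" where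
  "discrepancy \<Omega> R \<sigma> t =
     R ^ CARD('n) * measure lebesgue \<Omega>
     - real (card (int_lattice \<inter> (\<lambda>x. R *\<^sub>R (\<sigma> *v x) + t) ` \<Omega>))"

end

theory Submission
  imports Defs "HOL-Complex_Analysis.Cauchy_Integral_Theorem" "HOL-Real_Asymp.Real_Asymp"
begin

text \<open>By the power mean inequality it suffices to bound the first moment, and the Fourier coefficient of
  the discrepancy at a unit lattice vector is \<open>R^d\<close> times the Fourier transform of \<open>\<Omega>\<close> at a rotated
  frequency of modulus \<open>l = 2 pi R\<close>. If the theorem failed, the means of \<open>l^((d+1)/2) |fhat \<Omega>|\<close> over
  the sphere of radius \<open>l\<close> would tend to 0 along a sequence, hence so would, for a dense set of
  directions \<open>E\<close>, the averages of \<open>fhat \<Omega>\<close> against Gaussian wave packets concentrated at \<open>l E\<close> and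
  modulated to the boundary point \<open>x0 E\<close> with inner normal \<open>E\<close>. Such an average splits into the
  contributions of the two ends of the chord of \<open>\<Omega>\<close> through \<open>x0 E\<close> in direction \<open>E\<close>. The first one
  does not vanish, so the second one has to cancel it; by the Riemann-Lebesgue lemma this forces the
  chord to be normal to the boundary at both ends, and the two limits to have equal modulus.

  So the directions near the pole all belong to double normals. For \<open>\<gamma> > 2\<close> this is impossible because the
  boundary is too flat at the origin. For \<open>\<gamma> = 2\<close> the double normals have constant length, which
  determines the curvature at the far ends, and equality of the moduli then fails for all but one
  value of the slope.\<close>

section \<open>Integration along lines\<close>

text \<open>At a large frequency the Fourier transform of a body is to leading order a sum of two
  oscillating terms, one from each boundary point with normal along the frequency. For a given
  radius they may cancel in all directions at once, as for a ball at the zeros of its Bessel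
  function. The bound is claimed for all large radii, so no averaging over the radius is available:
  cancellation has to be refuted by geometry, and the only explicit piece of the boundary is the
  neighbourhood of the origin. Wave packets replace a stationary phase expansion because they see
  the body only near one chord: no expansion uniform in the direction is needed, and the origin is
  never an end of a chord that is expanded. For gamma > 2, a double normal starting at distance r
  from the axis would force r^gamma <= C r^(2 gamma - 2), false for small r. For gamma = 2, equality
  of the moduli says that the products of the principal radii at the two ends agree; as functions of
  the slope one increases and the other decreases.\<close>

lemma nn_integral_lborel_translate:
  fixes f :: "'a::euclidean_space \<Rightarrow> ennreal"
  assumes [measurable]: "f \<in> borel_measurable borel"
  shows "(\<integral>\<^sup>+x. f (x + a) \<partial>lborel) = (\<integral>\<^sup>+x. f x \<partial>lborel)"
proof -
  have "(\<integral>\<^sup>+x. f x \<partial>lborel) = (\<integral>\<^sup>+x. f x \<partial>(distr lborel borel ((+) a)))"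
    by (simp add: lborel_distr_plus)
  also have "\<dots> = (\<integral>\<^sup>+x. f (x + a) \<partial>lborel)"
    by (subst nn_integral_distr) (auto simp: add.commute)
  finally show ?thesis ..
qed

lemma integral_lborel_translate:
  fixes f :: "'a::euclidean_space \<Rightarrow> 'b::{banach, second_countable_topology}"
  assumes [measurable]: "f \<in> borel_measurable borel"
  shows "(\<integral>x. f (x + a) \<partial>lborel) = (\<integral>x. f x \<partial>lborel)"
proof -
  have "(\<integral>x. f x \<partial>lborel) = (\<integral>x. f x \<partial>(distr lborel borel ((+) a)))"
    by (simp add: lborel_distr_plus)
  also have "\<dots> = (\<integral>x. f (x + a) \<partial>lborel)"
    by (subst integral_distr) (auto simp: add.commute)
  finally show ?thesis ..
qed

lemma integral_lborel_scale:
  fixes f :: "'a::euclidean_space \<Rightarrow> 'b::{banach, second_countable_topology}"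
  assumes [measurable]: "f \<in> borel_measurable borel" and "c > 0"
  shows "(\<integral>x. f (c *\<^sub>R x) \<partial>lborel) = (1 / c ^ DIM('a)) *\<^sub>R (\<integral>x. f x \<partial>lborel)"
proof -
  have "(\<integral>x. f x \<partial>lborel)
      = (\<integral>x. f x \<partial>(density (distr lborel borel (\<lambda>x. 0 + c *\<^sub>R x)) (\<lambda>_. ennreal (\<bar>c\<bar>^DIM('a)))))"
    using lborel_affine[of c "0::'a"] assms by simp
  also have "\<dots> = (c ^ DIM('a)) *\<^sub>R (\<integral>x. f (c *\<^sub>R x) \<partial>lborel)"
    using assms by (subst integral_density) (auto simp: integral_distr)
  finally show ?thesis using assms by simp
qed

lemma integrable_lborel_scale_iff:
  fixes f :: "'a::euclidean_space \<Rightarrow> 'b::{banach, second_countable_topology}"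
  assumes [measurable]: "f \<in> borel_measurable borel" and "c > 0"
  shows "integrable lborel (\<lambda>x. f (c *\<^sub>R x)) \<longleftrightarrow> integrable lborel f"
proof -
  have "integrable lborel f \<longleftrightarrow>
      integrable (density (distr lborel borel (\<lambda>x. 0 + c *\<^sub>R x)) (\<lambda>_. ennreal (\<bar>c\<bar>^DIM('a)))) f"
    using lborel_affine[of c "0::'a"] assms by simp
  also have "\<dots> \<longleftrightarrow> integrable lborel (\<lambda>x. c ^ DIM('a) *\<^sub>R f (c *\<^sub>R x))"
    using assms by (subst integrable_density) (auto simp: integrable_distr_eq)
  also have "\<dots> \<longleftrightarrow> integrable lborel (\<lambda>x. f (c *\<^sub>R x))"
    using assms integrable_scaleR_right[of "1 / c ^ DIM('a)" lborel "\<lambda>x. c ^ DIM('a) *\<^sub>R f (c *\<^sub>R x)"]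
      integrable_scaleR_right[of "c ^ DIM('a)" lborel "\<lambda>x. f (c *\<^sub>R x)"] by auto
  finally show ?thesis ..
qed

text \<open>Uniqueness of translation invariant measures: the image measure is translation invariant
  and agrees with Lebesgue measure on the unit ball.\<close>
lemma lborel_distr_orthogonal:
  fixes T :: "'a::euclidean_space \<Rightarrow> 'a"
  assumes T: "orthogonal_transformation T"
  shows "distr lborel borel T = lborel"
proof -
  define \<nu> where "\<nu> = distr lborel borel T"
  have lin: "linear T" using T orthogonal_transformation_linear by blast
  have [measurable]: "T \<in> borel_measurable borel"
    using lin by (intro borel_measurable_continuous_onI linear_continuous_on) (simp add: linear_conv_bounded_linear)
  have bij: "bij T" using T orthogonal_transformation_bij by blast
  have invT: "orthogonal_transformation (inv T)" using T orthogonal_transformation_inv by blast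
  have [measurable]: "inv T \<in> borel_measurable borel"
    using orthogonal_transformation_linear[OF invT]
    by (intro borel_measurable_continuous_onI linear_continuous_on) (simp add: linear_conv_bounded_linear)
  have sf: "sigma_finite_measure \<nu>"
  proof (rule sigma_finite_measure.intro, intro exI conjI)
    show "countable (range (\<lambda>n::nat. ball (0::'a) (real n)))" by simp
    show "range (\<lambda>n::nat. ball (0::'a) (real n)) \<subseteq> sets \<nu>" by (auto simp: \<nu>_def)
    show "\<Union> (range (\<lambda>n::nat. ball (0::'a) (real n))) = space \<nu>"
      by (auto simp: \<nu>_def) (meson reals_Archimedean2)
    have "T -` ball 0 (real n) = ball 0 (real n)" for n
      using T by (auto simp: orthogonal_transformation_norm)
    then show "\<forall>a\<in>range (\<lambda>n::nat. ball (0::'a) (real n)). emeasure \<nu> a \<noteq> \<infinity>"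
      using emeasure_lborel_ball_finite[of "0::'a"]
      by (auto simp: \<nu>_def emeasure_distr) (metis less_irrefl)
  qed
  interpret \<nu>: sigma_finite_measure \<nu> by fact
  interpret P: pair_sigma_finite lborel \<nu> ..
  define f :: "'a \<Rightarrow> ennreal" where "f = indicator (ball 0 1)"
  have [measurable]: "f \<in> borel_measurable borel"
    unfolding f_def by (intro borel_measurable_indicator) simp
  have sym: "f (- x) = f x" for x by (simp add: f_def indicator_def)
  have fT: "f (T x) = f x" for x using T by (simp add: f_def indicator_def orthogonal_transformation_norm)
  have trans: "(\<integral>\<^sup>+y. g (y + x) \<partial>\<nu>) = (\<integral>\<^sup>+y. g y \<partial>\<nu>)" if [measurable]: "g \<in> borel_measurable borel"
    for g :: "'a \<Rightarrow> ennreal" and x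
  proof -
    obtain z where z: "x = T z" using bij by (metis bij_pointE)
    have "(\<integral>\<^sup>+y. g (y + x) \<partial>\<nu>) = (\<integral>\<^sup>+y. g (T y + T z) \<partial>lborel)"
      unfolding \<nu>_def by (subst nn_integral_distr) (auto simp: z)
    also have "\<dots> = (\<integral>\<^sup>+y. g (T (y + z)) \<partial>lborel)"
      using lin by (simp add: linear_add)
    also have "\<dots> = (\<integral>\<^sup>+y. g (T y) \<partial>lborel)"
      using nn_integral_lborel_translate[of "\<lambda>y. g (T y)" z] by simp
    also have "\<dots> = (\<integral>\<^sup>+y. g y \<partial>\<nu>)"
      unfolding \<nu>_def by (subst nn_integral_distr) auto
    finally show ?thesis .
  qed
  have setsnu[measurable_cong]: "sets \<nu> = sets borel" by (simp add: \<nu>_def)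
  have f\<nu>: "(\<integral>\<^sup>+y. f y \<partial>\<nu>) = (\<integral>\<^sup>+y. f y \<partial>lborel)"
    unfolding \<nu>_def by (subst nn_integral_distr) (auto simp: fT)
  have fb: "(\<integral>\<^sup>+y. f y \<partial>lborel) = emeasure lborel (ball (0::'a) 1)" by (simp add: f_def)
  have f0: "(\<integral>\<^sup>+y. f y \<partial>lborel) \<noteq> 0" "(\<integral>\<^sup>+y. f y \<partial>lborel) \<noteq> \<infinity>"
    unfolding fb by (simp_all add: emeasure_ball ennreal_eq_0_iff unit_ball_vol_pos not_le)
  have eq: "(\<integral>\<^sup>+x. g x \<partial>\<nu>) = (\<integral>\<^sup>+x. g x \<partial>lborel)" if [measurable]: "g \<in> borel_measurable borel"
    for g :: "'a \<Rightarrow> ennreal"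
  proof -
    \<comment> \<open>The double integral of \<open>f x * g (y + x)\<close> is evaluated in two
      ways. Both measures are translation invariant, and evenness of \<open>f\<close> allows the
      translation to be moved from \<open>g\<close> to \<open>f\<close>.\<close>
    have "(\<integral>\<^sup>+x. f x \<partial>lborel) * (\<integral>\<^sup>+y. g y \<partial>\<nu>) = (\<integral>\<^sup>+x. (\<integral>\<^sup>+y. f x * g (y + x) \<partial>\<nu>) \<partial>lborel)"
      by (simp add: nn_integral_cmult trans nn_integral_multc)
    also have "\<dots> = (\<integral>\<^sup>+y. (\<integral>\<^sup>+x. f x * g (y + x) \<partial>lborel) \<partial>\<nu>)"
      by (subst P.Fubini') auto
    also have "\<dots> = (\<integral>\<^sup>+y. (\<integral>\<^sup>+x. f (x + (-y)) * g x \<partial>lborel) \<partial>\<nu>)"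
    proof (rule nn_integral_cong)
      fix y
      show "(\<integral>\<^sup>+x. f x * g (y + x) \<partial>lborel) = (\<integral>\<^sup>+x. f (x + (-y)) * g x \<partial>lborel)"
        using nn_integral_lborel_translate[of "\<lambda>x. f (x + (-y)) * g x" y] by (simp add: add.commute)
    qed
    also have "\<dots> = (\<integral>\<^sup>+x. (\<integral>\<^sup>+y. f (x + (-y)) * g x \<partial>\<nu>) \<partial>lborel)"
      by (subst P.Fubini') auto
    also have "\<dots> = (\<integral>\<^sup>+x. (\<integral>\<^sup>+y. f (y + (-x)) \<partial>\<nu>) * g x \<partial>lborel)"
    proof (rule nn_integral_cong)
      fix x
      have "f (x + (-y)) = f (y + (-x))" for y using sym[of "x - y"] by simp
      then show "(\<integral>\<^sup>+y. f (x + (-y)) * g x \<partial>\<nu>) = (\<integral>\<^sup>+y. f (y + (-x)) \<partial>\<nu>) * g x"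
        by (simp add: nn_integral_multc)
    qed
    also have "\<dots> = (\<integral>\<^sup>+y. f y \<partial>lborel) * (\<integral>\<^sup>+x. g x \<partial>lborel)"
      by (simp add: trans f\<nu> nn_integral_cmult del: add_uminus_conv_diff)
    finally show ?thesis using f0 by (simp add: ennreal_mult_cancel_left)
  qed
  have "\<nu> = lborel"
  proof (rule measure_eqI)
    fix A assume "A \<in> sets \<nu>"
    then have [measurable]: "A \<in> sets borel" by (simp add: setsnu)
    show "emeasure \<nu> A = emeasure lborel A"
      using eq[of "indicator A"] by (simp add: setsnu)
  qed (simp add: \<nu>_def)
  then show ?thesis by (simp add: \<nu>_def)
qed

definition perp :: "'a::euclidean_space \<Rightarrow> 'a \<Rightarrow> 'a" where
  "perp E x = x - (x \<bullet> E) *\<^sub>R E"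

lemma perp_measurable [measurable]: "perp E \<in> borel_measurable borel"
  unfolding perp_def by measurable

lemma perp_add_line [simp]: "norm E = 1 \<Longrightarrow> perp E (x + r *\<^sub>R E) = perp E x"
  by (simp add: perp_def algebra_simps inner_add_left dot_square_norm)

text \<open>The shear replacing \<open>x\<close> by \<open>x - r *\<^sub>R E\<close> turns the
  integrand into \<open>\<phi> (x \<bullet> E - r) * H x\<close>, whose integral over
  \<open>r\<close> is \<open>H x\<close> times a constant.\<close>

lemma line_pair_integrable:
  fixes H :: "'a::euclidean_space \<Rightarrow> complex" and \<phi> :: "real \<Rightarrow> complex"
  assumes E: "norm E = 1" and H: "integrable lborel H" and \<phi>: "integrable lborel \<phi>"
  shows "integrable (lborel \<Otimes>\<^sub>M lborel) (\<lambda>(x, r). \<phi> (x \<bullet> E) * H (x + r *\<^sub>R E))"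
    and "(\<integral>x. (\<integral>r. \<phi> (x \<bullet> E) * H (x + r *\<^sub>R E) \<partial>lborel) \<partial>lborel)
      = (\<integral>r. \<phi> r \<partial>lborel) * (\<integral>x. H x \<partial>lborel)"
proof -
  have [measurable]: "H \<in> borel_measurable borel" "\<phi> \<in> borel_measurable borel"
    using H \<phi> borel_measurable_integrable by force+
  have EE: "E \<bullet> E = 1" using E by (simp add: dot_square_norm)
  have reflect: "(\<integral>\<^sup>+r. ennreal (norm (\<phi> (a - r))) \<partial>lborel) = (\<integral>\<^sup>+r. ennreal (norm (\<phi> r)) \<partial>lborel)" for a
    using nn_integral_real_affine[of "\<lambda>r. ennreal (norm (\<phi> r))" "-1" a] by simp
  have reflect': "(\<integral>r. \<phi> (a - r) \<partial>lborel) = (\<integral>r. \<phi> r \<partial>lborel)" for a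
    using lborel_integral_real_affine[of "-1" \<phi> a] by simp
  let ?G = "\<lambda>(x, r). \<phi> (x \<bullet> E) * H (x + r *\<^sub>R E)"
  let ?G' = "\<lambda>(x, r). \<phi> (x \<bullet> E - r) * H x"
  have G': "integrable (lborel \<Otimes>\<^sub>M lborel) ?G'"
  proof (rule integrableI_bounded)
    have "(\<integral>\<^sup>+z. ennreal (norm (?G' z)) \<partial>(lborel \<Otimes>\<^sub>M lborel))
      = (\<integral>\<^sup>+x. (\<integral>\<^sup>+r. ennreal (norm (\<phi> (x \<bullet> E - r))) * ennreal (norm (H x)) \<partial>lborel) \<partial>lborel)"
      by (subst lborel.nn_integral_fst[symmetric]) (auto simp: norm_mult ennreal_mult)
    also have "\<dots> = (\<integral>\<^sup>+r. ennreal (norm (\<phi> r)) \<partial>lborel) * (\<integral>\<^sup>+x. ennreal (norm (H x)) \<partial>lborel)"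
      by (simp add: nn_integral_multc reflect nn_integral_cmult)
    also have "\<dots> < \<infinity>"
      using H \<phi> by (simp add: integrable_iff_bounded ennreal_mult_less_top)
    finally show "(\<integral>\<^sup>+z. ennreal (norm (?G' z)) \<partial>(lborel \<Otimes>\<^sub>M lborel)) < \<infinity>" .
  qed measurable
  have shift: "(x - r *\<^sub>R E) \<bullet> E = x \<bullet> E - r" for x r by (simp add: inner_diff_left EE)
  show G: "integrable (lborel \<Otimes>\<^sub>M lborel) ?G"
  proof (rule integrableI_bounded)
    have "(\<integral>\<^sup>+z. ennreal (norm (?G z)) \<partial>(lborel \<Otimes>\<^sub>M lborel))
      = (\<integral>\<^sup>+x. (\<integral>\<^sup>+r. ennreal (norm (?G (x, r))) \<partial>lborel) \<partial>lborel)"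
      by (subst lborel.nn_integral_fst[symmetric]) auto
    also have "\<dots> = (\<integral>\<^sup>+r. (\<integral>\<^sup>+x. ennreal (norm (?G (x, r))) \<partial>lborel) \<partial>lborel)"
      by (subst lborel_pair.Fubini') auto
    also have "\<dots> = (\<integral>\<^sup>+r. (\<integral>\<^sup>+x. ennreal (norm (?G' (x, r))) \<partial>lborel) \<partial>lborel)"
    proof (rule nn_integral_cong)
      fix r :: real
      show "(\<integral>\<^sup>+x. ennreal (norm (?G (x, r))) \<partial>lborel) = (\<integral>\<^sup>+x. ennreal (norm (?G' (x, r))) \<partial>lborel)"
        using nn_integral_lborel_translate[of "\<lambda>x. ennreal (norm (?G (x, r)))" "- r *\<^sub>R E"]
        by (simp add: shift)
    qed
    also have "\<dots> = (\<integral>\<^sup>+x. (\<integral>\<^sup>+r. ennreal (norm (?G' (x, r))) \<partial>lborel) \<partial>lborel)"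
      by (subst lborel_pair.Fubini') auto
    also have "\<dots> = (\<integral>\<^sup>+z. ennreal (norm (?G' z)) \<partial>(lborel \<Otimes>\<^sub>M lborel))"
      by (subst lborel.nn_integral_fst[symmetric]) auto
    also have "\<dots> < \<infinity>" using G' by (simp add: integrable_iff_bounded)
    finally show "(\<integral>\<^sup>+z. ennreal (norm (?G z)) \<partial>(lborel \<Otimes>\<^sub>M lborel)) < \<infinity>" .
  qed measurable
  have "(\<integral>x. (\<integral>r. \<phi> (x \<bullet> E) * H (x + r *\<^sub>R E) \<partial>lborel) \<partial>lborel)
      = (\<integral>r. (\<integral>x. \<phi> (x \<bullet> E) * H (x + r *\<^sub>R E) \<partial>lborel) \<partial>lborel)"
    using lborel_pair.Fubini_integral[of "\<lambda>x r. \<phi> (x \<bullet> E) * H (x + r *\<^sub>R E)"] G by simp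
  also have "\<dots> = (\<integral>r. (\<integral>x. \<phi> (x \<bullet> E - r) * H x \<partial>lborel) \<partial>lborel)"
  proof (rule Bochner_Integration.integral_cong[OF refl])
    fix r :: real
    show "(\<integral>x. \<phi> (x \<bullet> E) * H (x + r *\<^sub>R E) \<partial>lborel) = (\<integral>x. \<phi> (x \<bullet> E - r) * H x \<partial>lborel)"
      using integral_lborel_translate[of "\<lambda>x. \<phi> (x \<bullet> E) * H (x + r *\<^sub>R E)" "- r *\<^sub>R E"]
      by (simp add: shift)
  qed
  also have "\<dots> = (\<integral>x. (\<integral>r. \<phi> (x \<bullet> E - r) * H x \<partial>lborel) \<partial>lborel)"
    using lborel_pair.Fubini_integral[of "\<lambda>x r. \<phi> (x \<bullet> E - r) * H x"] G' by simp
  also have "\<dots> = (\<integral>r. \<phi> r \<partial>lborel) * (\<integral>x. H x \<partial>lborel)"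
    by (simp add: reflect')
  finally show "(\<integral>x. (\<integral>r. \<phi> (x \<bullet> E) * H (x + r *\<^sub>R E) \<partial>lborel) \<partial>lborel)
      = (\<integral>r. \<phi> r \<partial>lborel) * (\<integral>x. H x \<partial>lborel)" .
qed

text \<open>Fubini along a line and its orthogonal hyperplane; the hyperplane is not given a measure of
  its own: the redundant coordinate is integrated against an arbitrary density \<open>\<phi>\<close>.\<close>
lemma integral_along_line:
  fixes H :: "'a::euclidean_space \<Rightarrow> complex" and \<phi> :: "real \<Rightarrow> complex"
  assumes E: "norm E = 1" and H: "integrable lborel H" and \<phi>: "integrable lborel \<phi>"
  shows "(\<integral>r. \<phi> r \<partial>lborel) * (\<integral>x. H x \<partial>lborel)
    = (\<integral>x. \<phi> (x \<bullet> E) * (\<integral>r. H (perp E x + r *\<^sub>R E) \<partial>lborel) \<partial>lborel)"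
    and "integrable lborel (\<lambda>x. \<phi> (x \<bullet> E) * (\<integral>r. H (perp E x + r *\<^sub>R E) \<partial>lborel))"
proof -
  have [measurable]: "H \<in> borel_measurable borel" "\<phi> \<in> borel_measurable borel"
    using H \<phi> borel_measurable_integrable by force+
  have eq: "(\<integral>r. \<phi> (x \<bullet> E) * H (x + r *\<^sub>R E) \<partial>lborel)
      = \<phi> (x \<bullet> E) * (\<integral>r. H (perp E x + r *\<^sub>R E) \<partial>lborel)" for x
  proof -
    have "(\<integral>r. H (x + r *\<^sub>R E) \<partial>lborel) = (\<integral>r. H (perp E x + (r + x \<bullet> E) *\<^sub>R E) \<partial>lborel)"
      by (simp add: perp_def algebra_simps)
    also have "\<dots> = (\<integral>r. H (perp E x + r *\<^sub>R E) \<partial>lborel)"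
      using integral_lborel_translate[of "\<lambda>r. H (perp E x + r *\<^sub>R E)" "x \<bullet> E"] by simp
    finally show ?thesis by simp
  qed
  show "(\<integral>r. \<phi> r \<partial>lborel) * (\<integral>x. H x \<partial>lborel)
    = (\<integral>x. \<phi> (x \<bullet> E) * (\<integral>r. H (perp E x + r *\<^sub>R E) \<partial>lborel) \<partial>lborel)"
    using line_pair_integrable(2)[OF assms] by (simp only: eq)
  show "integrable lborel (\<lambda>x. \<phi> (x \<bullet> E) * (\<integral>r. H (perp E x + r *\<^sub>R E) \<partial>lborel))"
    using lborel_pair.integrable_fst'[OF line_pair_integrable(1)[OF assms]] by (simp only: eq split_conv)
qed

section \<open>Gaussian integrals and contour shifts\<close>

lemma integrable_exp_abs_real:
  assumes "a > 0"
  shows "(\<integral>\<^sup>+x. ennreal (exp (- a * \<bar>x\<bar>)) \<partial>lborel) < \<infinity>"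
proof -
  let ?E = "\<lambda>x::real. ennreal (exponential_density a x)"
  have one: "(\<integral>\<^sup>+x. ?E x \<partial>lborel) = 1"
  proof -
    interpret prob_space "density lborel (exponential_density a)"
      using prob_space_exponential_density[OF assms] .
    show ?thesis using emeasure_space_1 by (simp add: emeasure_density)
  qed
  have one': "(\<integral>\<^sup>+x. ?E (- x) \<partial>lborel) = 1"
    using nn_integral_real_affine[of ?E "-1" 0] one by simp
  have "(\<integral>\<^sup>+x. ennreal (exp (- a * \<bar>x\<bar>)) \<partial>lborel)
     \<le> (\<integral>\<^sup>+x. ennreal (1 / a) * (?E x + ?E (- x)) \<partial>lborel)"
  proof (rule nn_integral_mono)
    fix x :: real
    have "exp (- a * \<bar>x\<bar>) \<le> (1 / a) * (exponential_density a x + exponential_density a (-x))"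
      using assms by (auto simp: exponential_density_def abs_if field_simps)
    then show "ennreal (exp (- a * \<bar>x\<bar>)) \<le> ennreal (1 / a) * (?E x + ?E (- x))"
      using assms by (simp add: ennreal_plus[symmetric] ennreal_mult'[symmetric] exponential_density_def
          ennreal_leI del: ennreal_plus)
  qed
  also have "\<dots> = ennreal (1 / a) * (1 + 1)"
    using one one' by (simp add: nn_integral_cmult nn_integral_add)
  also have "\<dots> < \<infinity>" by (simp add: ennreal_mult_less_top)
  finally show ?thesis .
qed

text \<open>Every coordinate is bounded by the norm, so distributing \<open>a\<close> evenly over
  the coordinates dominates the function by a product of one-dimensional exponentials.\<close>

lemma integrable_exp_norm:
  assumes "a > 0"
  shows "integrable lborel (\<lambda>x::'a::euclidean_space. exp (- a * norm x))"
proof (rule integrableI_bounded)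
  let ?d = "a / DIM('a)"
  have d: "?d > 0" using assms by simp
  have "(\<integral>\<^sup>+(x::'a). ennreal (norm (exp (- a * norm x))) \<partial>lborel)
     \<le> (\<integral>\<^sup>+(x::'a). (\<Prod>b\<in>Basis. ennreal (exp (- ?d * \<bar>x \<bullet> b\<bar>))) \<partial>lborel)"
  proof (rule nn_integral_mono)
    fix x :: 'a
    have "(\<Sum>b\<in>Basis. ?d * \<bar>x \<bullet> b\<bar>) \<le> (\<Sum>b\<in>(Basis::'a set). ?d * norm x)"
      using d by (intro sum_mono mult_left_mono Basis_le_norm) auto
    then have "exp (- a * norm x) \<le> exp (\<Sum>b\<in>Basis. - ?d * \<bar>x \<bullet> b\<bar>)"
      by (simp add: sum_negf)
    also have "\<dots> = (\<Prod>b\<in>Basis. exp (- ?d * \<bar>x \<bullet> b\<bar>))"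
      by (simp add: exp_sum)
    finally show "ennreal (norm (exp (- a * norm x))) \<le> (\<Prod>b\<in>Basis. ennreal (exp (- ?d * \<bar>x \<bullet> b\<bar>)))"
      by (simp add: prod_ennreal ennreal_leI)
  qed
  also have "\<dots> = (\<Prod>b\<in>(Basis::'a set). (\<integral>\<^sup>+x. ennreal (exp (- ?d * \<bar>x\<bar>)) \<partial>lborel))"
    using nn_integral_lborel_prod[where 'a='a and f="\<lambda>_ x. exp (- ?d * \<bar>x\<bar>)"] by (simp add: prod_ennreal)
  also have "\<dots> < \<infinity>"
    using integrable_exp_abs_real[OF d] by (simp add: power_less_top_ennreal)
  finally show "(\<integral>\<^sup>+(x::'a). ennreal (norm (exp (- a * norm x))) \<partial>lborel) < \<infinity>" .
qed measurable

lemma integrable_exp_quadratic: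
  assumes "a > 0"
  shows "integrable lborel (\<lambda>x::'a::euclidean_space. exp (b * norm x - a * (norm x)\<^sup>2))"
proof (rule Bochner_Integration.integrable_bound)
  \<comment> \<open>The maximum of (b + 1) r - a r^2; using b + 1 in place of b leaves a spare
    factor exp (- r).\<close>
  let ?k = "(b + 1)\<^sup>2 / (4 * a)"
  show "integrable lborel (\<lambda>x::'a. exp ?k * exp (- 1 * norm x))"
    by (intro integrable_mult_right integrable_exp_norm) simp
  have "b * r - a * r\<^sup>2 \<le> ?k - r" for r :: real
  proof -
    have "?k - r - (b * r - a * r\<^sup>2) = (2 * a * r - (b + 1))\<^sup>2 / (4 * a)"
      using assms by (simp add: power2_eq_square field_simps)
    also have "\<dots> \<ge> 0" using assms by simp
    finally show ?thesis by simp
  qed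
  then show "AE x in lborel. norm (exp (b * norm (x::'a) - a * (norm x)\<^sup>2)) \<le> norm (exp ?k * exp (- 1 * norm x))"
    by (simp add: exp_add[symmetric])
qed measurable

lemma integrable_gauss:
  assumes "a > 0"
  shows "integrable lborel (\<lambda>x::'a::euclidean_space. exp (- a * (norm x)\<^sup>2))"
  using integrable_exp_quadratic[OF assms, of 0, where 'a='a] by simp

text \<open>A primitive on the convex set takes the place of contour integrals: the integrals over
  [-T, T] on the two levels are differences of its values, and the two short sides tend to 0 by the
  Gaussian bound.\<close>

lemma contour_shift_line:
  fixes f :: "complex \<Rightarrow> complex"
  assumes S: "convex S" "open S" and f: "f holomorphic_on S"
    and strip: "\<And>r s. 0 \<le> s \<Longrightarrow> s \<le> 1 \<Longrightarrow> of_real r + of_real s * \<zeta> \<in> S"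
    and bound: "\<And>r s. 0 \<le> s \<Longrightarrow> s \<le> 1 \<Longrightarrow> norm (f (of_real r + of_real s * \<zeta>)) \<le> M * exp (- \<epsilon> * r\<^sup>2)"
    and "\<epsilon> > 0"
  shows "(\<integral>r. f (of_real r + \<zeta>) \<partial>lborel) = (\<integral>r. f (of_real r) \<partial>lborel)"
proof -
  obtain G where G: "\<And>x. x \<in> S \<Longrightarrow> (G has_field_derivative f x) (at x within S)"
    using holomorphic_convex_primitive'[OF S f] by metis
  then have G': "(G has_field_derivative f x) (at x)" if "x \<in> S" for x
    using that S(2) by (metis at_within_open)
  have contf: "continuous_on S f" using f by (rule holomorphic_on_imp_continuous_on)
  have conv: "((\<lambda>T. \<integral>r. indicator {-T..T} r *\<^sub>R f (of_real r + of_real s * \<zeta>) \<partial>lborel) \<longlongrightarrow>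
      (\<integral>r. f (of_real r + of_real s * \<zeta>) \<partial>lborel)) at_top" if s: "0 \<le> s" "s \<le> 1" for s
  proof (rule integral_dominated_convergence_at_top)
    have "continuous_on UNIV (\<lambda>r. f (of_real r + of_real s * \<zeta>))"
      using strip s by (intro continuous_on_compose2[OF contf] continuous_intros) auto
    then show m: "(\<lambda>r. f (of_real r + of_real s * \<zeta>)) \<in> borel_measurable lborel"
      by (simp add: borel_measurable_continuous_onI)
    then show "(\<lambda>r. indicator {-T..T} r *\<^sub>R f (of_real r + of_real s * \<zeta>)) \<in> borel_measurable lborel" for T
      by simp
    show "integrable lborel (\<lambda>r::real. M * exp (- \<epsilon> * r\<^sup>2))"
      using integrable_gauss[OF \<open>\<epsilon> > 0\<close>, where 'a=real] by simp
    show "AE r in lborel. ((\<lambda>T. indicator {-T..T} r *\<^sub>R f (of_real r + of_real s * \<zeta>)) \<longlongrightarrow> f (of_real r + of_real s * \<zeta>)) at_top"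
    proof (rule AE_I2, rule tendsto_eventually)
      fix r :: real
      show "\<forall>\<^sub>F T in at_top. indicator {-T..T} r *\<^sub>R f (of_real r + of_real s * \<zeta>) = f (of_real r + of_real s * \<zeta>)"
        using eventually_ge_at_top[of "\<bar>r\<bar>"] by eventually_elim (auto simp: indicator_def)
    qed
    show "\<forall>\<^sub>F T in at_top. AE r in lborel.
        norm (indicator {-T..T} r *\<^sub>R f (of_real r + of_real s * \<zeta>)) \<le> M * exp (- \<epsilon> * r\<^sup>2)"
      using bound[OF s] order_trans[OF norm_ge_zero bound[OF s]]
      by (intro always_eventually allI) (auto simp: indicator_def)
  qed
  have ftc: "(\<integral>r. indicator {-T..T} r *\<^sub>R f (of_real r + of_real s * \<zeta>) \<partial>lborel)
     = G (of_real T + of_real s * \<zeta>) - G (of_real (-T) + of_real s * \<zeta>)" if s: "0 \<le> s" "s \<le> 1" and T: "T \<ge> 0" for s T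
  proof (rule integral_FTC_atLeastAtMost)
    show "- T \<le> T" using T by simp
    show "continuous_on {-T..T} (\<lambda>r. f (of_real r + of_real s * \<zeta>))"
      using strip s by (intro continuous_on_compose2[OF contf] continuous_intros) auto
    fix r
    have "((\<lambda>r. G (of_real r + of_real s * \<zeta>)) has_vector_derivative 1 * f (of_real r + of_real s * \<zeta>)) (at r within {-T..T})"
    proof (rule field_vector_diff_chain_within[where g=G and f="\<lambda>r. of_real r + of_real s * \<zeta>", unfolded o_def])
      show "((\<lambda>r. of_real r + of_real s * \<zeta>) has_vector_derivative 1) (at r within {-T..T})"
        by (auto intro!: derivative_eq_intros has_vector_derivative_of_real)
      show "(G has_field_derivative f (of_real r + of_real s * \<zeta>))
         (at (of_real r + of_real s * \<zeta>) within (\<lambda>r. of_real r + of_real s * \<zeta>) ` {-T..T})"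
        using G'[OF strip[OF s]] by (rule has_field_derivative_at_within)
    qed
    then show "((\<lambda>r. G (of_real r + of_real s * \<zeta>)) has_vector_derivative f (of_real r + of_real s * \<zeta>)) (at r within {-T..T})"
      by simp
  qed
  have side: "norm (G (of_real T + \<zeta>) - G (of_real T)) \<le> M * exp (- \<epsilon> * T\<^sup>2) * norm \<zeta>" for T :: real
  proof -
    have seg: "\<exists>s. 0 \<le> s \<and> s \<le> 1 \<and> z = of_real T + of_real s * \<zeta>" if "z \<in> closed_segment (of_real T) (of_real T + \<zeta>)" for z
      using that by (auto simp: in_segment algebra_simps scaleR_conv_of_real)
    have "norm (G (of_real T + \<zeta>) - G (of_real T)) \<le> M * exp (- \<epsilon> * T\<^sup>2) * norm ((of_real T + \<zeta>) - of_real T)"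
    proof (rule field_differentiable_bound[where S="closed_segment (of_real T) (of_real T + \<zeta>)" and f'=f])
      show "(G has_field_derivative f z) (at z within closed_segment (of_real T) (of_real T + \<zeta>))"
        if "z \<in> closed_segment (of_real T) (of_real T + \<zeta>)" for z
        using seg[OF that] G' strip by (metis has_field_derivative_at_within)
      show "norm (f z) \<le> M * exp (- \<epsilon> * T\<^sup>2)"
        if "z \<in> closed_segment (of_real T) (of_real T + \<zeta>)" for z
        using seg[OF that] bound by auto
    qed auto
    then show ?thesis by simp
  qed
  have lim0: "((\<lambda>T. M * exp (- \<epsilon> * T\<^sup>2) * norm \<zeta>) \<longlongrightarrow> 0) at_top"
    using \<open>\<epsilon> > 0\<close> by real_asymp
  have z: "((\<lambda>T::real. (G (of_real T + \<zeta>) - G (of_real T)) - (G (of_real (-T) + \<zeta>) - G (of_real (-T)))) \<longlongrightarrow> 0 - 0) at_top"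
  proof (intro tendsto_diff)
    show "((\<lambda>T::real. G (of_real T + \<zeta>) - G (of_real T)) \<longlongrightarrow> 0) at_top"
      by (rule Lim_null_comparison[OF _ lim0], rule always_eventually, rule allI, rule side)
    show "((\<lambda>T::real. G (of_real (-T) + \<zeta>) - G (of_real (-T))) \<longlongrightarrow> 0) at_top"
    proof (rule Lim_null_comparison[OF _ lim0], rule always_eventually, rule allI)
      fix T :: real
      show "norm (G (of_real (-T) + \<zeta>) - G (of_real (-T))) \<le> M * exp (- \<epsilon> * T\<^sup>2) * norm \<zeta>"
        using side[of "-T"] by simp
    qed
  qed
  have "((\<lambda>T. (\<integral>r. indicator {-T..T} r *\<^sub>R f (of_real r + of_real 1 * \<zeta>) \<partial>lborel)
     - (\<integral>r. indicator {-T..T} r *\<^sub>R f (of_real r + of_real 0 * \<zeta>) \<partial>lborel)) \<longlongrightarrow> 0) at_top"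
  proof (rule Lim_transform_eventually)
    show "((\<lambda>T::real. (G (of_real T + \<zeta>) - G (of_real T)) - (G (of_real (-T) + \<zeta>) - G (of_real (-T)))) \<longlongrightarrow> 0) at_top"
      using z by simp
    show "\<forall>\<^sub>F T in at_top. (G (of_real T + \<zeta>) - G (of_real T)) - (G (of_real (-T) + \<zeta>) - G (of_real (-T))) =
       (\<integral>r. indicator {-T..T} r *\<^sub>R f (of_real r + of_real 1 * \<zeta>) \<partial>lborel)
     - (\<integral>r. indicator {-T..T} r *\<^sub>R f (of_real r + of_real 0 * \<zeta>) \<partial>lborel)"
      using eventually_ge_at_top[of 0]
    proof eventually_elim
      case (elim T)
      show ?case using ftc[of 1 T] ftc[of 0 T] elim by simp
    qed
  qed
  moreover have "((\<lambda>T. (\<integral>r. indicator {-T..T} r *\<^sub>R f (of_real r + of_real 1 * \<zeta>) \<partial>lborel)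
     - (\<integral>r. indicator {-T..T} r *\<^sub>R f (of_real r + of_real 0 * \<zeta>) \<partial>lborel)) \<longlongrightarrow>
      (\<integral>r. f (of_real r + of_real 1 * \<zeta>) \<partial>lborel) - (\<integral>r. f (of_real r + of_real 0 * \<zeta>) \<partial>lborel)) at_top"
    by (intro tendsto_diff conv) auto
  ultimately have "(\<integral>r. f (of_real r + of_real 1 * \<zeta>) \<partial>lborel) - (\<integral>r. f (of_real r + of_real 0 * \<zeta>) \<partial>lborel) = 0"
    by (metis (no_types, lifting) tendsto_unique trivial_limit_at_top_linorder)
  then show ?thesis by simp
qed

lemma integral_lborel_pos:
  fixes f :: "'a::euclidean_space \<Rightarrow> real"
  assumes "integrable lborel f" "\<And>x. f x > 0"
  shows "(\<integral>x. f x \<partial>lborel) > 0"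
proof -
  have "(\<integral>x. f x \<partial>lborel) \<noteq> 0"
  proof
    assume "(\<integral>x. f x \<partial>lborel) = 0"
    then have "AE x in (lborel::'a measure). f x = 0"
      using assms by (subst (asm) integral_nonneg_eq_0_iff_AE) (auto intro!: always_eventually less_imp_le)
    then have "AE x in (lborel::'a measure). False"
      by (rule AE_mp) (use assms(2) in \<open>auto intro!: always_eventually simp: less_le\<close>)
    then show False
      by (subst (asm) AE_iff_measurable[OF _ refl]) (auto simp: emeasure_lborel_UNIV)
  qed
  moreover have "(\<integral>x. f x \<partial>lborel) \<ge> 0" by (intro Bochner_Integration.integral_nonneg less_imp_le assms(2))
  ultimately show ?thesis by simp
qed

text \<open>For Re c > 0 this is (2 pi / c) to the power d / 2, principal branch. Only its modulus
  and its values at positive reals are evaluated, so no branch has to be chosen. The type argument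
  carries the dimension.\<close>

definition Kd :: "'a::euclidean_space itself \<Rightarrow> complex \<Rightarrow> complex" where
  "Kd _ c = (\<integral>(v::'a). exp (- (c / 2) * of_real ((norm v)\<^sup>2)) \<partial>lborel)"

lemma norm_exp_gauss: "norm (exp (- (c / 2) * of_real ((norm v)\<^sup>2))) = exp (- (Re c / 2) * (norm v)\<^sup>2)"
  by (simp add: norm_exp_eq_Re)

lemma integrable_cgauss:
  assumes "Re c > 0"
  shows "integrable lborel (\<lambda>v::'a::euclidean_space. exp (- (c / 2) * of_real ((norm v)\<^sup>2)))"
proof (rule Bochner_Integration.integrable_bound)
  show "integrable lborel (\<lambda>v::'a. exp (- (Re c / 2) * (norm v)\<^sup>2))"
    using assms by (intro integrable_gauss) simp
qed (auto simp: norm_exp_gauss simp del: of_real_power)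

lemma Kd_real_pos:
  assumes "a > 0"
  shows "Kd TYPE('a::euclidean_space) (of_real a) = of_real (\<integral>(v::'a). exp (- (a / 2) * (norm v)\<^sup>2) \<partial>lborel)"
    and "(\<integral>(v::'a). exp (- (a / 2) * (norm v)\<^sup>2) \<partial>lborel) > 0"
proof -
  show "Kd TYPE('a) (of_real a) = of_real (\<integral>(v::'a). exp (- (a / 2) * (norm v)\<^sup>2) \<partial>lborel)"
    unfolding Kd_def integral_complex_of_real[symmetric] exp_of_real[symmetric] by simp
  show "(\<integral>(v::'a). exp (- (a / 2) * (norm v)\<^sup>2) \<partial>lborel) > 0"
  proof (rule integral_lborel_pos)
    show "integrable lborel (\<lambda>v::'a. exp (- (a / 2) * (norm v)\<^sup>2))"
      by (rule integrable_gauss) (use assms in simp)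
  qed simp
qed

lemma Kd_scale:
  assumes "t > 0"
  shows "Kd TYPE('a::euclidean_space) (of_real t) = Kd TYPE('a) 1 / of_real (sqrt t ^ DIM('a))"
proof -
  have "(\<integral>(v::'a). exp (- (1 / 2) * of_real ((norm (sqrt t *\<^sub>R v))\<^sup>2) :: complex) \<partial>lborel)
     = (1 / sqrt t ^ DIM('a)) *\<^sub>R Kd TYPE('a) 1"
    unfolding Kd_def using assms
    by (intro integral_lborel_scale[of "\<lambda>v::'a. exp (- (1 / 2) * of_real ((norm v)\<^sup>2) :: complex)"]) auto
  moreover have "(norm (sqrt t *\<^sub>R v))\<^sup>2 = t * (norm v)\<^sup>2" for v :: 'a
    using assms by (simp add: power_mult_distrib)
  moreover have "(complex_of_real (sqrt t))\<^sup>2 = of_real t"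
    using assms by (metis of_real_power real_sqrt_pow2 less_imp_le)
  ultimately show ?thesis
    by (simp add: Kd_def scaleR_conv_of_real field_simps)
qed

text \<open>\<open>F v t\<close> stands for an analytic function at the complex point v + t e, which
  is what \<open>equi\<close> expresses. The one-dimensional shift is applied on every line in
  direction \<open>e\<close>, and \<open>integral_along_line\<close> reassembles the lines.\<close>

lemma contour_shift:
  fixes F :: "'a::euclidean_space \<Rightarrow> complex \<Rightarrow> complex"
  assumes e: "norm e = 1" and S: "convex S" "open S"
    and equi: "\<And>v r t. F (v + r *\<^sub>R e) t = F v (of_real r + t)"
    and hol: "\<And>v. F v holomorphic_on S"
    and strip: "\<And>r s. 0 \<le> s \<Longrightarrow> s \<le> 1 \<Longrightarrow> of_real r + of_real s * \<zeta> \<in> S"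
    and bound: "\<And>v. \<exists>M \<epsilon>. \<epsilon> > 0 \<and> (\<forall>r s. 0 \<le> s \<longrightarrow> s \<le> 1 \<longrightarrow>
        norm (F (perp e v) (of_real r + of_real s * \<zeta>)) \<le> M * exp (- \<epsilon> * r\<^sup>2))"
    and int: "integrable lborel (\<lambda>v. F v 0)" "integrable lborel (\<lambda>v. F v \<zeta>)"
  shows "(\<integral>v. F v \<zeta> \<partial>lborel) = (\<integral>v. F v 0 \<partial>lborel)"
proof -
  define \<phi> :: "real \<Rightarrow> complex" where "\<phi> = (\<lambda>r. exp (- (1 / 2) * of_real ((norm r)\<^sup>2)))"
  have \<phi>: "integrable lborel \<phi>" unfolding \<phi>_def by (rule integrable_cgauss) simp
  have "(\<integral>r. \<phi> r \<partial>lborel) = Kd TYPE(real) (of_real 1)" by (simp add: \<phi>_def Kd_def)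
  then have \<phi>0: "(\<integral>r. \<phi> r \<partial>lborel) \<noteq> 0"
    using Kd_real_pos[of 1, where 'a=real] by simp
  have line: "(\<integral>r. \<phi> r \<partial>lborel) * (\<integral>v. F v t \<partial>lborel)
     = (\<integral>v. \<phi> (v \<bullet> e) * (\<integral>r. F (perp e v) (of_real r + t) \<partial>lborel) \<partial>lborel)"
    if "integrable lborel (\<lambda>v. F v t)" for t
    using integral_along_line(1)[OF e that \<phi>] by (simp add: equi)
  have "(\<integral>r. F (perp e v) (of_real r + \<zeta>) \<partial>lborel) = (\<integral>r. F (perp e v) (of_real r) \<partial>lborel)" for v
  proof -
    obtain M \<epsilon> where "\<epsilon> > 0" and "\<And>r s. 0 \<le> s \<Longrightarrow> s \<le> 1 \<Longrightarrow>
        norm (F (perp e v) (of_real r + of_real s * \<zeta>)) \<le> M * exp (- \<epsilon> * r\<^sup>2)"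
      using bound by meson
    then show ?thesis by (intro contour_shift_line[OF S hol strip])
  qed
  then have "(\<integral>r. \<phi> r \<partial>lborel) * (\<integral>v. F v \<zeta> \<partial>lborel) = (\<integral>r. \<phi> r \<partial>lborel) * (\<integral>v. F v 0 \<partial>lborel)"
    by (simp add: line[OF int(1)] line[OF int(2)])
  then show ?thesis using \<phi>0 by simp
qed

lemma gauss_fourier:
  fixes y :: "'a::euclidean_space"
  assumes c: "Re c > 0"
  shows "integrable lborel (\<lambda>v. exp (- (c / 2) * of_real ((norm v)\<^sup>2) - \<i> * of_real (y \<bullet> v)))" (is ?int)
    and "(\<integral>v. exp (- (c / 2) * of_real ((norm v)\<^sup>2) - \<i> * of_real (y \<bullet> v)) \<partial>lborel)
      = exp (- of_real ((norm y)\<^sup>2) / (2 * c)) * Kd TYPE('a) c" (is ?eq)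
proof -
  have c0: "c \<noteq> 0" using c by auto
  show ?int
  proof (rule Bochner_Integration.integrable_bound[OF integrable_cgauss[OF c, where 'a='a]])
    show "AE v in lborel. norm (exp (- (c / 2) * of_real ((norm v)\<^sup>2) - \<i> * of_real (y \<bullet> v)))
        \<le> norm (exp (- (c / 2) * of_real ((norm v)\<^sup>2)))"
      by (rule AE_I2) (simp add: norm_exp_eq_Re)
  qed measurable
  show ?eq
  proof (cases "y = 0")
    case True then show ?thesis by (simp add: Kd_def)
  next
    case False
    define e where "e = y /\<^sub>R norm y"
    define n where "n = norm y"
    have e: "norm e = 1" and ye: "y = n *\<^sub>R e" and n: "n > 0" using False by (auto simp: e_def n_def)
    have ee: "e \<bullet> e = 1" using e by (simp add: dot_square_norm)
    define F :: "'a \<Rightarrow> complex \<Rightarrow> complex" where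
      "F v t = exp (- (c / 2) * (of_real ((norm v)\<^sup>2 - (v \<bullet> e)\<^sup>2) + (of_real (v \<bullet> e) + t)\<^sup>2))" for v t
    \<comment> \<open>Shifting by this amount in the direction of \<open>y\<close> completes the
      square in the exponent.\<close>
    define \<zeta> where "\<zeta> = \<i> * of_real n / c"
    have F0: "F v 0 = exp (- (c / 2) * of_real ((norm v)\<^sup>2))" for v
      by (simp add: F_def)
    have F\<zeta>: "F v \<zeta> = exp (of_real (n\<^sup>2) / (2 * c)) * exp (- (c / 2) * of_real ((norm v)\<^sup>2) - \<i> * of_real (y \<bullet> v))" for v
    proof -
      have "- (c / 2) * (of_real ((norm v)\<^sup>2 - (v \<bullet> e)\<^sup>2) + (of_real (v \<bullet> e) + \<zeta>)\<^sup>2)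
         = of_real (n\<^sup>2) / (2 * c) + (- (c / 2) * of_real ((norm v)\<^sup>2) - \<i> * of_real (n * (v \<bullet> e)))"
        using c0 by (simp add: \<zeta>_def field_simps power2_eq_square)
      moreover have "y \<bullet> v = n * (v \<bullet> e)" by (simp add: ye inner_commute)
      ultimately show ?thesis by (simp only: F_def exp_add)
    qed
    have "(\<integral>v. F v \<zeta> \<partial>lborel) = (\<integral>v. F v 0 \<partial>lborel)"
    proof (rule contour_shift[OF e, where S=UNIV])
      show "F (v + r *\<^sub>R e) t = F v (of_real r + t)" for v r t
      proof -
        have "(norm (v + r *\<^sub>R e))\<^sup>2 - ((v + r *\<^sub>R e) \<bullet> e)\<^sup>2 = (norm v)\<^sup>2 - (v \<bullet> e)\<^sup>2"
          unfolding power2_norm_eq_inner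
          by (simp add: inner_add_left inner_add_right ee inner_commute power2_eq_square algebra_simps)
        then show ?thesis unfolding F_def
          by (simp add: inner_add_left ee add.assoc del: of_real_diff of_real_power)
      qed
      show "F v holomorphic_on UNIV" for v unfolding F_def by (intro holomorphic_intros)
      show "integrable lborel (\<lambda>v. F v 0)" unfolding F0 by (rule integrable_cgauss[OF c])
      show "integrable lborel (\<lambda>v. F v \<zeta>)" unfolding F\<zeta> using \<open>?int\<close> by (intro integrable_mult_right)
      show "\<exists>M \<epsilon>. \<epsilon> > 0 \<and> (\<forall>r s. 0 \<le> s \<longrightarrow> s \<le> 1 \<longrightarrow>
        norm (F (perp e v) (of_real r + of_real s * \<zeta>)) \<le> M * exp (- \<epsilon> * r\<^sup>2))" for v
      proof (intro exI conjI allI impI)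
        show "Re c / 2 > 0" using c by simp
        fix r s :: real assume s: "0 \<le> s" "s \<le> 1"
        let ?p = "perp e v"
        let ?A = "(norm ?p)\<^sup>2"
        have pe: "?p \<bullet> e = 0" by (simp add: perp_def inner_diff_left ee)
        define w where "w = 1 / c"
        \<comment> \<open>The cross term is purely imaginary, so moving along the shift lowers the
          real part by at most n^2 Re (1 / c), uniformly in \<open>r\<close>.\<close>
        have "c * (of_real r + of_real s * \<zeta>)\<^sup>2 = c * of_real (r\<^sup>2) + 2 * \<i> * of_real (r * s * n) - of_real (s\<^sup>2 * n\<^sup>2) * w"
          using c0 by (simp add: \<zeta>_def w_def field_simps power2_eq_square)
        then have "Re (c * (of_real r + of_real s * \<zeta>)\<^sup>2) = Re c * r\<^sup>2 - s\<^sup>2 * n\<^sup>2 * Re (1 / c)"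
          unfolding w_def[symmetric] by (simp del: of_real_power of_real_mult)
        moreover have "s\<^sup>2 * n\<^sup>2 * Re (1 / c) \<le> 1 * n\<^sup>2 * Re (1 / c)"
          using s c by (intro mult_right_mono) (auto simp: power_le_one Re_divide)
        ultimately have le: "Re (c * (of_real r + of_real s * \<zeta>)\<^sup>2) \<ge> Re c * r\<^sup>2 - n\<^sup>2 * Re (1 / c)" by simp
        have A0: "Re c * ?A \<ge> 0" using c by simp
        have "norm (F ?p (of_real r + of_real s * \<zeta>))
          = exp (- (1/2) * (Re c * ?A + Re (c * (of_real r + of_real s * \<zeta>)\<^sup>2)))"
          unfolding F_def norm_exp_eq_Re by (simp add: pe field_simps)
        also have "\<dots> \<le> exp (n\<^sup>2 * Re (1 / c) / 2 - (Re c / 2) * r\<^sup>2)"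
          unfolding exp_le_cancel_iff using le A0 by (simp add: field_simps del: times_complex.sel)
        finally show "norm (F ?p (of_real r + of_real s * \<zeta>)) \<le> exp (n\<^sup>2 * Re (1 / c) / 2) * exp (- (Re c / 2) * r\<^sup>2)"
          by (simp add: exp_add[symmetric])
      qed
    qed auto
    then have "exp (of_real (n\<^sup>2) / (2 * c)) * (\<integral>v. exp (- (c / 2) * of_real ((norm v)\<^sup>2) - \<i> * of_real (y \<bullet> v)) \<partial>lborel) = Kd TYPE('a) c"
      unfolding F\<zeta> F0 Kd_def by simp
    then show ?thesis by (simp add: exp_minus n_def field_simps)
  qed
qed

section \<open>Gaussian chirps\<close>

text \<open>With \<open>g\<close> the conjugate of \<open>f\<close> this writes the squared modulus
  of an integral as the total integral of an autocorrelation.\<close>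

lemma conv_pair_integrable:
  fixes f g :: "'a::euclidean_space \<Rightarrow> complex"
  assumes f: "integrable lborel f" and g: "integrable lborel g"
  shows "integrable (lborel \<Otimes>\<^sub>M lborel) (\<lambda>(m, u). f (u + m) * g u)"
    and "(\<integral>m. (\<integral>u. f (u + m) * g u \<partial>lborel) \<partial>lborel) = (\<integral>x. f x \<partial>lborel) * (\<integral>x. g x \<partial>lborel)"
proof -
  have [measurable]: "f \<in> borel_measurable borel" "g \<in> borel_measurable borel"
    using f g borel_measurable_integrable by force+
  show int: "integrable (lborel \<Otimes>\<^sub>M lborel) (\<lambda>(m, u). f (u + m) * g u)"
  proof (rule integrableI_bounded)
    have "(\<integral>\<^sup>+z. ennreal (norm (case z of (m, u) \<Rightarrow> f (u + m) * g u)) \<partial>(lborel \<Otimes>\<^sub>M lborel))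
       = (\<integral>\<^sup>+m. (\<integral>\<^sup>+u. ennreal (norm (f (u + m))) * ennreal (norm (g u)) \<partial>lborel) \<partial>lborel)"
      by (subst lborel.nn_integral_fst[symmetric]) (auto simp: norm_mult ennreal_mult)
    also have "\<dots> = (\<integral>\<^sup>+u. (\<integral>\<^sup>+m. ennreal (norm (f (u + m))) * ennreal (norm (g u)) \<partial>lborel) \<partial>lborel)"
      by (subst lborel_pair.Fubini') auto
    also have "\<dots> = (\<integral>\<^sup>+u. (\<integral>\<^sup>+m. ennreal (norm (f m)) \<partial>lborel) * ennreal (norm (g u)) \<partial>lborel)"
    proof (rule nn_integral_cong)
      fix u
      show "(\<integral>\<^sup>+m. ennreal (norm (f (u + m))) * ennreal (norm (g u)) \<partial>lborel)
         = (\<integral>\<^sup>+m. ennreal (norm (f m)) \<partial>lborel) * ennreal (norm (g u))"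
        using nn_integral_lborel_translate[of "\<lambda>x. ennreal (norm (f x))" u]
        by (simp add: nn_integral_multc add.commute)
    qed
    also have "\<dots> < \<infinity>"
      using f g by (simp add: nn_integral_cmult integrable_iff_bounded ennreal_mult_less_top)
    finally show "(\<integral>\<^sup>+z. ennreal (norm (case z of (m, u) \<Rightarrow> f (u + m) * g u)) \<partial>(lborel \<Otimes>\<^sub>M lborel)) < \<infinity>" .
  qed measurable
  have "(\<integral>m. (\<integral>u. f (u + m) * g u \<partial>lborel) \<partial>lborel) = (\<integral>u. (\<integral>m. f (u + m) * g u \<partial>lborel) \<partial>lborel)"
    using lborel_pair.Fubini_integral[of "\<lambda>m u. f (u + m) * g u"] int by simp
  also have "\<dots> = (\<integral>u. (\<integral>m. f m \<partial>lborel) * g u \<partial>lborel)"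
  proof (rule Bochner_Integration.integral_cong[OF refl])
    fix u
    show "(\<integral>m. f (u + m) * g u \<partial>lborel) = (\<integral>m. f m \<partial>lborel) * g u"
      using integral_lborel_translate[of f u] by (simp add: add.commute)
  qed
  finally show "(\<integral>m. (\<integral>u. f (u + m) * g u \<partial>lborel) \<partial>lborel) = (\<integral>x. f x \<partial>lborel) * (\<integral>x. g x \<partial>lborel)"
    by simp
qed

lemma integrable_chirp:
  fixes q :: "'a::euclidean_space \<Rightarrow> real"
  assumes "(a::real) > 0" and [measurable]: "q \<in> borel_measurable borel"
  shows "integrable lborel (\<lambda>u. exp (- complex_of_real ((a / 2) * (norm u)\<^sup>2) - (\<i> / 2) * of_real (q u)) :: complex)"
proof (rule Bochner_Integration.integrable_bound[OF integrable_cgauss[of "of_real a", where 'a='a]])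
  show "AE u in lborel. norm (exp (- complex_of_real ((a / 2) * (norm u)\<^sup>2) - (\<i> / 2) * of_real (q u)) :: complex)
        \<le> norm (exp (- (of_real a / 2) * of_real ((norm u)\<^sup>2) :: complex))"
    by (rule AE_I2) (simp add: norm_exp_eq_Re)
qed (use assms in auto)

text \<open>In \<open>|I|\<^sup>2 = \<integral>\<integral> f (u + m) cnj (f u)\<close> the quadratic phase becomes linear in \<open>u\<close> after
  centering, so that the inner integral is the Fourier transform of a Gaussian.\<close>
lemma norm_gauss_chirp:
  fixes B :: "'a::euclidean_space \<Rightarrow> 'a"
  assumes a: "a > 0" and B: "linear B" and sym: "\<And>u v. B u \<bullet> v = u \<bullet> B v"
  shows "complex_of_real ((norm (\<integral>u. exp (- complex_of_real ((a / 2) * (norm u)\<^sup>2) - (\<i> / 2) * of_real (B u \<bullet> u)) \<partial>lborel))\<^sup>2)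
     = Kd TYPE('a) (of_real (2 * a)) * of_real (\<integral>m. exp (- (a / 4) * (norm m)\<^sup>2 - (norm (B m))\<^sup>2 / (4 * a)) \<partial>lborel)"
proof -
  have [measurable]: "B \<in> borel_measurable borel"
    using B by (intro borel_measurable_continuous_onI linear_continuous_on) (simp add: linear_conv_bounded_linear)
  define f :: "'a \<Rightarrow> complex" where "f u = exp (- complex_of_real ((a / 2) * (norm u)\<^sup>2) - (\<i> / 2) * of_real (B u \<bullet> u))" for u
  have f: "integrable lborel f" unfolding f_def using a by (intro integrable_chirp) measurable
  have [measurable]: "f \<in> borel_measurable borel" unfolding f_def by measurable
  have "complex_of_real ((norm (\<integral>u. f u \<partial>lborel))\<^sup>2) = (\<integral>u. f u \<partial>lborel) * (\<integral>u. cnj (f u) \<partial>lborel)"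
    using complex_norm_square[of "\<integral>u. f u \<partial>lborel"] by simp
  also have "\<dots> = (\<integral>m. (\<integral>u. f (u + m) * cnj (f u) \<partial>lborel) \<partial>lborel)"
    using conv_pair_integrable(2)[OF f, of "\<lambda>u. cnj (f u)"] f by simp
  also have "\<dots> = (\<integral>m. Kd TYPE('a) (of_real (2 * a)) * of_real (exp (- (a / 4) * (norm m)\<^sup>2 - (norm (B m))\<^sup>2 / (4 * a))) \<partial>lborel)"
  proof (rule Bochner_Integration.integral_cong[OF refl])
    fix m :: 'a
    let ?h = "(1/2) *\<^sub>R m"
    have eq: "f (u + ?h) * cnj (f (u - ?h)) =
      of_real (exp (- (a / 4) * (norm m)\<^sup>2)) * exp (- (of_real (2 * a) / 2) * of_real ((norm u)\<^sup>2) - \<i> * of_real (B m \<bullet> u))" for u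
    proof -
      have 1: "(norm (u + ?h))\<^sup>2 + (norm (u - ?h))\<^sup>2 = 2 * (norm u)\<^sup>2 + (norm m)\<^sup>2 / 2"
        unfolding power2_norm_eq_inner by (simp add: inner_add_left inner_add_right inner_diff_left inner_diff_right inner_commute)
      have 2: "B (u + ?h) \<bullet> (u + ?h) - B (u - ?h) \<bullet> (u - ?h) = 2 * (B m \<bullet> u)"
        using sym[of u m] by (simp add: linear_add[OF B] linear_diff[OF B] linear_scale[OF B]
            inner_add_left inner_add_right inner_diff_left inner_diff_right inner_commute)
      have "f (u + ?h) * cnj (f (u - ?h)) = exp (- complex_of_real ((a / 2) * ((norm (u + ?h))\<^sup>2 + (norm (u - ?h))\<^sup>2))
         - (\<i> / 2) * of_real (B (u + ?h) \<bullet> (u + ?h) - B (u - ?h) \<bullet> (u - ?h)))"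
        unfolding f_def by (simp add: exp_cnj exp_add[symmetric] algebra_simps)
      also have "\<dots> = exp (of_real (- (a / 4) * (norm m)\<^sup>2) + (- (of_real (2 * a) / 2) * of_real ((norm u)\<^sup>2) - \<i> * of_real (B m \<bullet> u)))"
        unfolding 1 2 by (simp add: algebra_simps)
      finally show ?thesis by (simp only: exp_add exp_of_real)
    qed
    have "(\<integral>u. f (u + m) * cnj (f u) \<partial>lborel) = (\<integral>u. f (u + ?h) * cnj (f (u - ?h)) \<partial>lborel)"
    proof -
      have hm: "?h + ?h = m" by (simp add: scaleR_left_distrib[symmetric])
      have e: "u + - ?h + m = u + ?h" for u
        using hm by (metis add.assoc add.left_commute add_minus_cancel minus_add_cancel)
      have "(\<integral>u. f (u + - ?h + m) * cnj (f (u + - ?h)) \<partial>lborel) = (\<integral>u. f (u + m) * cnj (f u) \<partial>lborel)"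
        using f by (intro integral_lborel_translate borel_measurable_times borel_measurable_integrable[of lborel "\<lambda>u. cnj (f u)", simplified]) auto
      then show ?thesis unfolding e by simp
    qed
    also have "\<dots> = of_real (exp (- (a / 4) * (norm m)\<^sup>2)) *
        (exp (- of_real ((norm (B m))\<^sup>2) / (2 * of_real (2 * a))) * Kd TYPE('a) (of_real (2 * a)))"
      unfolding eq using gauss_fourier(2)[of "of_real (2 * a)" "B m"] a by simp
    also have "exp (- of_real ((norm (B m))\<^sup>2) / (2 * of_real (2 * a))) = complex_of_real (exp (- (norm (B m))\<^sup>2 / (4 * a)))"
      by (simp add: exp_of_real[symmetric])
    also have "of_real (exp (- (a / 4) * (norm m)\<^sup>2)) * (of_real (exp (- (norm (B m))\<^sup>2 / (4 * a))) * Kd TYPE('a) (of_real (2 * a)))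
      = of_real (exp (- (a / 4) * (norm m)\<^sup>2) * exp (- (norm (B m))\<^sup>2 / (4 * a))) * Kd TYPE('a) (of_real (2 * a))"
      by (simp only: of_real_mult mult.assoc)
    also have "exp (- (a / 4) * (norm m)\<^sup>2) * exp (- (norm (B m))\<^sup>2 / (4 * a)) = exp (- (a / 4) * (norm m)\<^sup>2 - (norm (B m))\<^sup>2 / (4 * a))"
      by (simp add: exp_add[symmetric])
    also have "of_real (exp (- (a / 4) * (norm m)\<^sup>2 - (norm (B m))\<^sup>2 / (4 * a))) * Kd TYPE('a) (of_real (2 * a)) = Kd TYPE('a) (of_real (2 * a)) * of_real (exp (- (a / 4) * (norm m)\<^sup>2 - (norm (B m))\<^sup>2 / (4 * a)))"
      by (rule mult.commute)
    finally show "(\<integral>u. f (u + m) * cnj (f u) \<partial>lborel) =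
      Kd TYPE('a) (of_real (2 * a)) * of_real (exp (- (a / 4) * (norm m)\<^sup>2 - (norm (B m))\<^sup>2 / (4 * a)))" .
  qed
  also have "\<dots> = Kd TYPE('a) (of_real (2 * a)) * of_real (\<integral>m. exp (- (a / 4) * (norm m)\<^sup>2 - (norm (B m))\<^sup>2 / (4 * a)) \<partial>lborel)"
    by (simp add: integral_complex_of_real[symmetric] del: integral_complex_of_real)
  finally show ?thesis unfolding f_def .
qed

text \<open>By \<open>norm_gauss_chirp\<close> the squared modulus is a product of two integrals of
  positive functions. This covers indefinite and degenerate \<open>B\<close>, and nothing has to be
  diagonalized.\<close>

lemma gauss_chirp_nonzero:
  fixes B :: "'a::euclidean_space \<Rightarrow> 'a"
  assumes a: "a > 0" and B: "linear B" and sym: "\<And>u v. B u \<bullet> v = u \<bullet> B v"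
  shows "(\<integral>u. exp (- complex_of_real ((a / 2) * (norm u)\<^sup>2) - (\<i> / 2) * of_real (B u \<bullet> u)) \<partial>lborel) \<noteq> (0::complex)"
proof -
  have [measurable]: "B \<in> borel_measurable borel"
    using B by (intro borel_measurable_continuous_onI linear_continuous_on) (simp add: linear_conv_bounded_linear)
  have int: "integrable lborel (\<lambda>m::'a. exp (- (a / 4) * (norm m)\<^sup>2 - (norm (B m))\<^sup>2 / (4 * a)))"
  proof (rule Bochner_Integration.integrable_bound[OF integrable_gauss[of "a/4", where 'a='a]])
    show "AE m in lborel. norm (exp (- (a / 4) * (norm m)\<^sup>2 - (norm (B m))\<^sup>2 / (4 * a))) \<le> norm (exp (- (a / 4) * (norm m)\<^sup>2))"
      using a by (intro AE_I2) simp
  qed (use a in auto)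
  have "(\<integral>m. exp (- (a / 4) * (norm m)\<^sup>2 - (norm (B m))\<^sup>2 / (4 * a)) \<partial>lborel) > 0"
    by (rule integral_lborel_pos[OF int]) simp
  moreover have "Kd TYPE('a) (of_real (2 * a)) \<noteq> 0"
    using Kd_real_pos[of "2 * a", where 'a='a] a by simp
  ultimately have "(norm (\<integral>u. exp (- complex_of_real ((a / 2) * (norm u)\<^sup>2) - (\<i> / 2) * of_real (B u \<bullet> u)) \<partial>lborel))\<^sup>2 \<noteq> 0"
    using norm_gauss_chirp[OF a B sym]
    by (metis (no_types, lifting) less_irrefl mult_eq_0_iff of_real_eq_0_iff of_real_0)
  then show ?thesis by auto
qed

definition K1 :: "'a::euclidean_space itself \<Rightarrow> real" where
  "K1 _ = (\<integral>(v::'a). exp (- (1 / 2) * (norm v)\<^sup>2) \<partial>lborel)"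

lemma K1_pos: "K1 TYPE('a::euclidean_space) > 0"
  using Kd_real_pos(2)[of 1, where 'a='a] by (simp add: K1_def)

text \<open>With a = Re c, b = Im c and \<open>B\<close> equal to b times the identity,
  \<open>norm_gauss_chirp\<close> expresses the squared modulus as \<open>Kd (2 * a)\<close> times
  \<open>Kd t\<close>: a / 4 + b^2 / (4 a) = t / 2 with t = (norm c)^2 / (2 a). Both arguments are
  real, where \<open>Kd_scale\<close> applies, and their product is (norm c)^2.\<close>

lemma norm_Kd:
  assumes c: "Re c > 0"
  shows "norm (Kd TYPE('a::euclidean_space) c) = K1 TYPE('a) / sqrt (norm c) ^ DIM('a)"
proof -
  define a b where "a = Re c" and "b = Im c"
  have a: "a > 0" using c by (simp add: a_def)
  have n2: "(norm c)\<^sup>2 = a\<^sup>2 + b\<^sup>2" by (simp add: a_def b_def cmod_power2)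
  have n0: "norm c > 0" using c by auto
  define t where "t = (norm c)\<^sup>2 / (2 * a)"
  have t: "t > 0" using a n0 by (simp add: t_def)
  have "sqrt (2 * a) * sqrt t = sqrt ((norm c)\<^sup>2)"
    using a by (simp add: t_def real_sqrt_mult[symmetric])
  then have st: "sqrt (2 * a) * sqrt t = norm c" by simp
  have K1: "Kd TYPE('a) 1 = of_real (K1 TYPE('a))" using Kd_real_pos(1)[of 1, where 'a='a] by (simp add: K1_def)
  have sc: "Kd TYPE('a) c = (\<integral>(u::'a). exp (- complex_of_real ((a / 2) * (norm u)\<^sup>2) - (\<i> / 2) * of_real ((b *\<^sub>R u) \<bullet> u)) \<partial>lborel)"
  proof -
    have "c = of_real a + \<i> * of_real b" by (simp add: a_def b_def complex_eq)
    then show ?thesis unfolding Kd_def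
      by (intro Bochner_Integration.integral_cong refl arg_cong[where f=exp]) (simp add: power2_norm_eq_inner field_simps)
  qed
  have "complex_of_real ((norm (Kd TYPE('a) c))\<^sup>2) = Kd TYPE('a) (of_real (2 * a)) *
      of_real (\<integral>(m::'a). exp (- (a / 4) * (norm m)\<^sup>2 - (norm (b *\<^sub>R m))\<^sup>2 / (4 * a)) \<partial>lborel)"
    unfolding sc by (rule norm_gauss_chirp[OF a]) (auto intro!: linearI simp: algebra_simps)
  also have "(\<integral>(m::'a). exp (- (a / 4) * (norm m)\<^sup>2 - (norm (b *\<^sub>R m))\<^sup>2 / (4 * a)) \<partial>lborel)
    = (\<integral>(m::'a). exp (- (t / 2) * (norm m)\<^sup>2) \<partial>lborel)"
    unfolding t_def n2 using a by (intro Bochner_Integration.integral_cong refl arg_cong[where f=exp])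
      (simp add: power_mult_distrib field_simps power2_eq_square)
  also have "of_real (\<integral>(m::'a). exp (- (t / 2) * (norm m)\<^sup>2) \<partial>lborel) = Kd TYPE('a) (of_real t)"
    using Kd_real_pos(1)[OF t, where 'a='a] by simp
  also have "Kd TYPE('a) (of_real (2 * a)) * Kd TYPE('a) (of_real t)
     = of_real ((K1 TYPE('a))\<^sup>2 / (sqrt (2 * a) ^ DIM('a) * sqrt t ^ DIM('a)))"
  proof -
    have "0 < 2 * a" using a by simp
    from Kd_scale[OF this, where 'a='a] Kd_scale[OF t, where 'a='a] show ?thesis
      unfolding K1 by (simp only: of_real_divide of_real_mult of_real_power power2_eq_square times_divide_times_eq)
  qed
  also have "sqrt (2 * a) ^ DIM('a) * sqrt t ^ DIM('a) = norm c ^ DIM('a)"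
    by (simp only: power_mult_distrib[symmetric] st)
  finally have "(norm (Kd TYPE('a) c))\<^sup>2 = (K1 TYPE('a))\<^sup>2 / norm c ^ DIM('a)"
    by (simp only: of_real_eq_iff)
  also have "norm c ^ DIM('a) = (sqrt (norm c) ^ DIM('a))\<^sup>2"
    using n0 by (metis power_mult mult.commute real_sqrt_pow2 less_imp_le)
  finally show ?thesis
    using K1_pos[where 'a='a] by (simp add: power_divide[symmetric] power2_eq_iff_nonneg less_imp_le)
qed

text \<open>The integrand separates into a function of \<open>x \<bullet> E\<close> and one of
  \<open>perp E x\<close>, so the first factor can be exchanged at the price of the ratio of the
  one-dimensional integrals. In this way Gaussians with different parameters in different directions
  are reduced to isotropic ones.\<close>

lemma integral_line_factor:
  fixes h :: "'a::euclidean_space \<Rightarrow> complex" and k k' :: "real \<Rightarrow> complex"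
  assumes E: "norm E = 1" and int: "integrable lborel (\<lambda>x. k (x \<bullet> E) * h (perp E x))"
    and k': "integrable lborel k'"
  shows "(\<integral>r. k' r \<partial>lborel) * (\<integral>x. k (x \<bullet> E) * h (perp E x) \<partial>lborel)
     = (\<integral>r. k r \<partial>lborel) * (\<integral>x. k' (x \<bullet> E) * h (perp E x) \<partial>lborel)"
proof -
  have EE: "E \<bullet> E = 1" using E by (simp add: dot_square_norm)
  have "perp E (perp E x) = perp E x" "perp E x \<bullet> E = 0" for x
    by (simp_all add: perp_def inner_diff_left EE)
  then have "k ((perp E x + r *\<^sub>R E) \<bullet> E) * h (perp E (perp E x + r *\<^sub>R E)) = k r * h (perp E x)" for x r
    using E by (simp add: inner_add_left EE)
  then have "(\<integral>r. k' r \<partial>lborel) * (\<integral>x. k (x \<bullet> E) * h (perp E x) \<partial>lborel)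
     = (\<integral>x. k' (x \<bullet> E) * ((\<integral>r. k r \<partial>lborel) * h (perp E x)) \<partial>lborel)"
    using integral_along_line(1)[OF E int k'] by simp
  also have "\<dots> = (\<integral>x. (\<integral>r. k r \<partial>lborel) * (k' (x \<bullet> E) * h (perp E x)) \<partial>lborel)"
    by (intro Bochner_Integration.integral_cong refl) (simp only: mult.left_commute)
  finally show ?thesis by simp
qed

section \<open>Wave packets\<close>

lemma norm_integral_le:
  fixes f :: "'a \<Rightarrow> 'b::{banach, second_countable_topology}"
  assumes f: "f \<in> borel_measurable M" and g: "integrable M g" and le: "\<And>x. norm (f x) \<le> g x"
  shows "integrable M f" "norm (\<integral>x. f x \<partial>M) \<le> (\<integral>x. g x \<partial>M)"
proof -
  show i: "integrable M f"
    by (rule Bochner_Integration.integrable_bound[OF g f]) (use order_trans[OF le abs_ge_self] in auto)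
  have "norm (\<integral>x. f x \<partial>M) \<le> (\<integral>x. norm (f x) \<partial>M)" by (rule integral_norm_bound)
  also have "\<dots> \<le> (\<integral>x. g x \<partial>M)" using i g le by (intro integral_mono) auto
  finally show "norm (\<integral>x. f x \<partial>M) \<le> (\<integral>x. g x \<partial>M)" .
qed

text \<open>The factor of the inverse stereographic projection: with w = \<open>perp E v\<close> /
  sqrt l it is 1 / (1 + (norm w)^2 / 4), and the point of the sphere over w is (2 kap - 1) E + kap
  w.\<close>

definition kap :: "real \<Rightarrow> 'a::euclidean_space \<Rightarrow> 'a \<Rightarrow> real" where
  "kap l E v = 1 / (1 + (norm (perp E v))\<^sup>2 / (4 * l))"

text \<open>Contribution of one end of a slice of the body: \<open>s\<close> is the position of the
  end on the line in direction \<open>E\<close>, \<open>u\<close> / sqrt l is the offset of that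
  line, and the main phase l s has been split off (see \<open>Tpk_slice\<close>).\<close>

definition Psi :: "real \<Rightarrow> 'a::euclidean_space \<Rightarrow> real \<Rightarrow> 'a \<Rightarrow> complex" where
  "Psi l E s u = (\<integral>v. exp (- of_real ((norm v)\<^sup>2 / 2)
      + \<i> * of_real (kap l E v * (s * (norm (perp E v))\<^sup>2 / 2 - u \<bullet> perp E v))) \<partial>lborel)"

text \<open>The phase of \<open>Psi\<close> off the real axis: \<open>z\<close> is the complexified
  coordinate along \<open>u\<close>, \<open>N0\<close> the rest of the squared norm of
  \<open>perp E v\<close>, and c = 1 / (4 l). The imaginary part determines the modulus of the
  integrand after a contour shift by \<open>\<beta>\<close>.\<close>

lemma packet_phase_Im:
  fixes c n s x \<beta> N0 :: real
  defines "z \<equiv> Complex x (-\<beta>)"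
  defines "D \<equiv> (1 + c * (N0 + x\<^sup>2 - \<beta>\<^sup>2))\<^sup>2 + (2 * c * x * \<beta>)\<^sup>2"
  shows "Im ((of_real (s/2) * (of_real N0 + z\<^sup>2) - of_real n * z) / (1 + of_real c * (of_real N0 + z\<^sup>2)))
     = (- s * x * \<beta> + n * \<beta> * (1 + c * N0 - c * (x\<^sup>2 + \<beta>\<^sup>2))) / D"
proof -
  have D: "(Re (1 + of_real c * (of_real N0 + z\<^sup>2)))\<^sup>2 + (Im (1 + of_real c * (of_real N0 + z\<^sup>2)))\<^sup>2 = D"
    by (simp add: z_def D_def power2_eq_square algebra_simps)
  show ?thesis unfolding Im_divide D
    by (rule arg_cong[where f="\<lambda>a. a / D"]) (simp add: z_def power2_eq_square field_simps)
qed

text \<open>\<open>P\<close> and \<open>D\<close> are the real part and the squared modulus of the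
  denominator 1 + c (N0 + z^2) at z = x - i beta. The bound c <= 1/4, which is l >= 1, keeps it away
  from 0 for beta <= 1.\<close>

context
  fixes c n s x \<beta> N0 S P m D :: real
  assumes c: "0 < c" "c \<le> 1/4" and N0: "0 \<le> N0" and \<beta>: "0 \<le> \<beta>" "\<beta> \<le> 1"
    and s: "\<bar>s\<bar> \<le> S" and n: "0 \<le> n"
    and P: "P = 1 + c * (N0 + x\<^sup>2 - \<beta>\<^sup>2)" and m: "m = c * (x\<^sup>2 + \<beta>\<^sup>2)"
    and D: "D = P\<^sup>2 + (2 * c * x * \<beta>)\<^sup>2"
begin

private lemma cN: "0 \<le> c * N0" "0 \<le> m"
  using c N0 m by simp_all

private lemma P_ge: "P \<ge> 3/4" "P \<ge> 1/2 + m"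
proof -
  have cb: "c * \<beta>\<^sup>2 \<le> 1/4"
  proof -
    have "c * \<beta>\<^sup>2 \<le> (1/4) * 1" using c \<beta> by (intro mult_mono) (auto simp: power_le_one)
    then show ?thesis by simp
  qed
  have nn: "0 \<le> c * x\<^sup>2" using c by simp
  show "P \<ge> 3/4" using cb nn cN P by (simp add: algebra_simps)
  show "P \<ge> 1/2 + m" using cb nn cN P m by (simp add: algebra_simps)
qed

private lemma D_ge: "D \<ge> P\<^sup>2" "D \<ge> 9/16" "D > 0"
proof -
  show 1: "D \<ge> P\<^sup>2" unfolding D by simp
  have "(3/4)\<^sup>2 \<le> P\<^sup>2" by (rule power_mono) (use P_ge in auto)
  then show "D \<ge> 9/16" using 1 by (simp add: power2_eq_square)
  then show "D > 0" by simp
qed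

private lemma sterm: "s * x * \<beta> / D \<le> 2 * S * \<bar>x\<bar>"
proof -
  have "s * x * \<beta> \<le> \<bar>s * x * \<beta>\<bar>" by simp
  also have "\<dots> = \<bar>s\<bar> * \<bar>x\<bar> * \<beta>" using \<beta> by (simp add: abs_mult)
  also have "\<dots> \<le> S * \<bar>x\<bar> * 1" using s \<beta> by (intro mult_mono) auto
  finally have 1: "s * x * \<beta> \<le> S * \<bar>x\<bar>" by simp
  have "s * x * \<beta> / D \<le> (S * \<bar>x\<bar>) / D" using 1 D_ge by (intro divide_right_mono) auto
  also have "\<dots> \<le> (S * \<bar>x\<bar>) / (9/16)" using s D_ge by (intro divide_left_mono) auto
  also have "\<dots> \<le> 2 * S * \<bar>x\<bar>" using s by (simp add: mult_right_mono)
  finally show ?thesis .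
qed

private lemma mD: "m / D \<le> 2"
proof -
  have "m \<le> P" using P_ge by simp
  then have "m * 1 \<le> P * (2 * P)" using P_ge cN by (intro mult_mono) auto
  also have "\<dots> \<le> 2 * D" using D_ge(1) by (simp add: power2_eq_square)
  finally show "m / D \<le> 2" using D_ge by (simp add: field_simps)
qed

text \<open>Gives the convergence needed during the shift, hence for every \<open>\<beta>\<close> in
  [0, 1]; it shows no decay in \<open>n\<close>.\<close>

lemma packet_phase_crude:
  "(s * x * \<beta> - n * \<beta> * (1 + c * N0 - m)) / D \<le> 2 * S * \<bar>x\<bar> + 2 * n"
proof -
  have "- (n * \<beta> * (1 + c * N0 - m)) \<le> n * m"
  proof -
    have "(n * m) * \<beta> \<le> (n * m) * 1" using \<beta> n cN by (intro mult_left_mono) auto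
    moreover have "n * \<beta> * (1 + c * N0) \<ge> 0" using n \<beta> cN by simp
    ultimately show ?thesis by (simp add: algebra_simps)
  qed
  then have "- (n * \<beta> * (1 + c * N0 - m)) / D \<le> (n * m) / D"
    using D_ge by (intro divide_right_mono) auto
  also have "\<dots> = n * (m / D)" by simp
  also have "\<dots> \<le> n * 2" using mD n by (intro mult_left_mono) auto
  finally show ?thesis using sterm by (simp add: diff_divide_distrib)
qed

text \<open>At the full shift, if c N0 + m < 1/2 then the term linear in \<open>n\<close> gains n
  (1/2) / (9/4) >= n / 5. Otherwise \<open>w\<close>, which will be the norm of the Gaussian
  variable, is of order sqrt l or larger; as \<open>nS\<close> bounds n by a multiple of sqrt l,
  this gives n <= S (w + 1), and a term linear in \<open>w\<close> pays for everything, which the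
  Gaussian can afford.\<close>

lemma packet_phase_refined:
  assumes "\<beta> = 1" and nS: "4 * c * n\<^sup>2 \<le> S\<^sup>2" and w: "N0 + x\<^sup>2 \<le> w\<^sup>2" "0 \<le> w"
  shows "(s * x * \<beta> - n * \<beta> * (1 + c * N0 - m)) / D \<le> 2 * S * \<bar>x\<bar> + 3 * S * (w + 1) - n / 5"
proof (cases "c * N0 + m < 1/2")
  case True
  have "D = (1 + c * N0 + m)\<^sup>2 - 4 * c * \<beta>\<^sup>2 * (1 + c * N0)"
    unfolding D P m by (simp add: power2_eq_square algebra_simps)
  also have "\<dots> \<le> (1 + c * N0 + m)\<^sup>2" using c cN by simp
  also have "\<dots> \<le> (3/2)\<^sup>2" using True cN by (intro power_mono) auto
  finally have D: "D \<le> 9/4" by (simp add: power2_eq_square)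
  have "n / 5 * D \<le> n / 5 * (9/4)" using n D by (intro mult_left_mono) auto
  also have "\<dots> \<le> n * (1/2)" using n by simp
  also have "\<dots> \<le> n * (1 + c * N0 - m)" using n True cN by (intro mult_left_mono) auto
  finally have "n / 5 \<le> n * (1 + c * N0 - m) / D" using D_ge(3) by (simp add: field_simps)
  moreover have "0 \<le> 3 * S * (w + 1)" using s w by auto
  ultimately show ?thesis using sterm assms(1) by (simp add: diff_divide_distrib)
next
  case False
  have S0: "0 \<le> S" using s by auto
  have "1 \<le> 2 * c * (N0 + x\<^sup>2 + 1)" using False assms(1) m by (simp add: algebra_simps)
  then have "n\<^sup>2 * 1 \<le> n\<^sup>2 * (2 * c * (N0 + x\<^sup>2 + 1))" by (intro mult_left_mono) auto
  also have "\<dots> = (4 * c * n\<^sup>2) * ((N0 + x\<^sup>2 + 1) / 2)" by simp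
  also have "\<dots> \<le> S\<^sup>2 * ((N0 + x\<^sup>2 + 1) / 2)" using nS N0 by (intro mult_right_mono) auto
  also have "\<dots> \<le> S\<^sup>2 * (w + 1)\<^sup>2"
  proof (rule mult_left_mono)
    have "(w + 1)\<^sup>2 = w\<^sup>2 + 2 * w + 1" by (simp add: power2_eq_square algebra_simps)
    moreover have "N0 + x\<^sup>2 \<le> 2 * w\<^sup>2" by (rule order_trans[OF w(1)]) simp
    ultimately show "(N0 + x\<^sup>2 + 1) / 2 \<le> (w + 1)\<^sup>2" using w(2) by simp
  qed simp
  finally have "n\<^sup>2 \<le> (S * (w + 1))\<^sup>2" by (simp add: power_mult_distrib)
  then have nb: "n \<le> S * (w + 1)" by (rule power2_le_imp_le) (use S0 w in simp)
  show ?thesis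
  proof (rule order_trans[OF packet_phase_crude])
    have "n * (11/5) \<le> 3 * (S * (w + 1))" using nb n by simp
    then show "2 * S * \<bar>x\<bar> + 2 * n \<le> 2 * S * \<bar>x\<bar> + 3 * S * (w + 1) - n / 5" by simp
  qed
qed

end

text \<open>The 1/2 comes from the Gaussian factor shifted by \<open>\<beta>\<close> = 1; 3 S and 5
  S = 2 S + 3 S come from \<open>packet_phase_refined\<close>, with the coordinate along
  \<open>y\<close> bounded by \<open>norm v\<close>.\<close>

definition packet_const :: "'a::euclidean_space itself \<Rightarrow> real \<Rightarrow> real" where
  "packet_const _ S = exp (1/2 + 3 * S) * (\<integral>(v::'a). exp (5 * S * norm v - (1/2) * (norm v)\<^sup>2) \<partial>lborel)"

lemma norm_perp_sq:
  assumes "norm E = 1"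
  shows "(norm (perp E v))\<^sup>2 = (norm v)\<^sup>2 - (v \<bullet> E)\<^sup>2"
proof -
  have EE: "E \<bullet> E = 1" using assms by (simp add: dot_square_norm)
  show ?thesis unfolding power2_norm_eq_inner perp_def
    by (simp add: inner_diff_left inner_diff_right EE inner_commute power2_eq_square algebra_simps)
qed

text \<open>Decay transversal to the beam: the contour is shifted by \<open>-\<i>\<close> in the direction of \<open>y\<close>.\<close>
lemma norm_Psi_le:
  fixes E y :: "'a::euclidean_space"
  assumes E: "norm E = 1" and yE: "y \<bullet> E = 0" and l: "l \<ge> 1" and s: "\<bar>s\<bar> \<le> S"
    and yS: "norm y \<le> S * sqrt l"
  shows "norm (Psi l E s y) \<le> packet_const TYPE('a) S * exp (- norm y / 5)"
proof -
  have S0: "0 \<le> S" using s by auto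
  have EE: "E \<bullet> E = 1" using E by (simp add: dot_square_norm)
  have yp: "y \<bullet> perp E v = y \<bullet> v" for v by (simp add: perp_def inner_diff_right yE)
  have majint: "integrable lborel (\<lambda>v::'a. exp (5 * S * norm v - (1/2) * (norm v)\<^sup>2))"
    by (rule integrable_exp_quadratic) simp
  show ?thesis
  proof (cases "y = 0")
    case True
    have "norm (Psi l E s y) \<le> (\<integral>(v::'a). exp (1/2 + 3 * S) * exp (5 * S * norm v - (1/2) * (norm v)\<^sup>2) \<partial>lborel)"
      unfolding Psi_def
    proof (rule norm_integral_le(2))
      show "integrable lborel (\<lambda>v::'a. exp (1/2 + 3 * S) * exp (5 * S * norm v - (1/2) * (norm v)\<^sup>2))"
        using majint by (rule integrable_mult_right)
      show "norm (exp (- of_real ((norm v)\<^sup>2 / 2) + \<i> * of_real (kap l E v * (s * (norm (perp E v))\<^sup>2 / 2 - y \<bullet> perp E v))))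
         \<le> exp (1/2 + 3 * S) * exp (5 * S * norm v - (1/2) * (norm v)\<^sup>2)" for v
        using S0 by (simp add: norm_exp_eq_Re exp_add[symmetric] del: of_real_power)
    qed (simp add: kap_def)
    then show ?thesis using True by (simp add: packet_const_def)
  next
    case False
    define e where "e = y /\<^sub>R norm y"
    define n where "n = norm y"
    define c where "c = 1 / (4 * l)"
    have e: "norm e = 1" and ye: "y = n *\<^sub>R e" and n: "n > 0" using False by (auto simp: e_def n_def)
    have ee: "e \<bullet> e = 1" using e by (simp add: dot_square_norm)
    have eE: "e \<bullet> E = 0" using yE by (simp add: e_def)
    have c: "0 < c" "c \<le> 1/4" using l by (auto simp: c_def field_simps)
    have nc: "4 * c * n\<^sup>2 \<le> S\<^sup>2"
    proof -
      have "n\<^sup>2 \<le> (S * sqrt l)\<^sup>2" unfolding n_def by (rule power_mono[OF yS]) simp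
      also have "\<dots> = S\<^sup>2 * l" using l by (simp add: power_mult_distrib)
      finally show ?thesis using l by (simp add: c_def field_simps)
    qed
    \<comment> \<open>Squared norms of \<open>v\<close> and of \<open>perp E v\<close> without the
      component along \<open>e\<close>. Both are invariant under translation along \<open>e\<close>,
      which gives \<open>F\<close> the equivariance that \<open>contour_shift\<close> asks
      for.\<close>
    define M N where "M v = (norm v)\<^sup>2 - (v \<bullet> e)\<^sup>2" and "N v = (norm (perp E v))\<^sup>2 - (v \<bullet> e)\<^sup>2" for v
    have M0: "M v \<ge> 0" for v unfolding M_def using norm_perp_sq[OF e, of v] by (metis zero_le_power2)
    have Ee: "E \<bullet> e = 0" using eE by (simp add: inner_commute)
    have ve: "v \<bullet> e = perp E v \<bullet> e" for v by (simp add: perp_def inner_diff_left Ee)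
    have N0: "N v \<ge> 0" for v unfolding N_def using norm_perp_sq[OF e, of "perp E v"] ve by (metis zero_le_power2)
    have NM: "N v + (v \<bullet> e)\<^sup>2 \<le> (norm v)\<^sup>2" for v unfolding N_def by (simp add: norm_perp_sq[OF E])
    define F :: "'a \<Rightarrow> complex \<Rightarrow> complex" where
      "F v t = exp (- (of_real (M v) + (of_real (v \<bullet> e) + t)\<^sup>2) / 2
         + \<i> * ((of_real (s/2) * (of_real (N v) + (of_real (v \<bullet> e) + t)\<^sup>2) - of_real n * (of_real (v \<bullet> e) + t))
             / (1 + of_real c * (of_real (N v) + (of_real (v \<bullet> e) + t)\<^sup>2))))" for v t
    have normF: "norm (F v (of_real r + of_real \<beta> * (-\<i>))) = exp (- (M v + ((v \<bullet> e) + r)\<^sup>2 - \<beta>\<^sup>2) / 2 +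
       (s * ((v \<bullet> e) + r) * \<beta> - n * \<beta> * (1 + c * N v - c * (((v \<bullet> e) + r)\<^sup>2 + \<beta>\<^sup>2)))
         / ((1 + c * (N v + ((v \<bullet> e) + r)\<^sup>2 - \<beta>\<^sup>2))\<^sup>2 + (2 * c * ((v \<bullet> e) + r) * \<beta>)\<^sup>2))" for v r \<beta>
    proof -
      let ?z = "Complex ((v \<bullet> e) + r) (-\<beta>)"
      have z: "of_real (v \<bullet> e) + (of_real r + of_real \<beta> * (-\<i>)) = ?z" by (simp add: complex_eq_iff)
      have "Re (- (of_real (M v) + ?z\<^sup>2) / 2) = - (M v + ((v \<bullet> e) + r)\<^sup>2 - \<beta>\<^sup>2) / 2"
        by (simp add: power2_eq_square)
      then show ?thesis unfolding F_def z norm_exp_eq_Re plus_complex.sel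
        by (simp only: Re_i_times packet_phase_Im) (simp add: minus_divide_left)
    qed
    have F0: "F v 0 = exp (- of_real ((norm v)\<^sup>2 / 2) + \<i> * of_real (kap l E v * (s * (norm (perp E v))\<^sup>2 / 2 - y \<bullet> perp E v)))" for v
    proof -
      have "y \<bullet> v = n * (v \<bullet> e)" by (simp add: ye inner_commute)
      then show ?thesis
        unfolding F_def M_def N_def kap_def yp c_def by (simp add: field_simps)
    qed
    have refined: "norm (F v (-\<i>)) \<le> exp (- n / 5) * (exp (1/2 + 3 * S) * exp (5 * S * norm v - (1/2) * (norm v)\<^sup>2))" for v
    proof -
      have "norm (F v (-\<i>)) = exp (- ((norm v)\<^sup>2 - 1) / 2 +
       (s * (v \<bullet> e) * 1 - n * 1 * (1 + c * N v - c * ((v \<bullet> e)\<^sup>2 + 1\<^sup>2)))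
         / ((1 + c * (N v + (v \<bullet> e)\<^sup>2 - 1\<^sup>2))\<^sup>2 + (2 * c * (v \<bullet> e) * 1)\<^sup>2))"
        using normF[of v 0 1] by (simp add: M_def)
      also have "\<dots> \<le> exp (- ((norm v)\<^sup>2 - 1) / 2 + (2 * S * \<bar>v \<bullet> e\<bar> + 3 * S * (norm v + 1) - n / 5))"
        using packet_phase_refined[OF c N0 _ _ s _ refl refl refl, of 1 n v "v \<bullet> e" "norm v"] n nc NM[of v] by simp
      also have "\<dots> \<le> exp (- ((norm v)\<^sup>2 - 1) / 2 + (2 * S * norm v + 3 * S * (norm v + 1) - n / 5))"
        using Cauchy_Schwarz_ineq2[of v e] e S0 by (simp add: mult_left_mono)
      also have "\<dots> = exp (- n / 5) * (exp (1/2 + 3 * S) * exp (5 * S * norm v - (1/2) * (norm v)\<^sup>2))"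
        unfolding exp_add[symmetric] by (rule arg_cong[where f=exp]) (simp add: field_simps)
      finally show ?thesis .
    qed
    \<comment> \<open>Since c <= 1/4, the condition on Im t gives c (Im t)^2 < 1; this fixes the
      strip used below.\<close>
    have den: "1 + of_real c * (of_real (N v) + (of_real (v \<bullet> e) + t)\<^sup>2) \<noteq> 0" if "\<bar>Im t\<bar> < 2" for v t
    proof -
      have "Re (1 + of_real c * (of_real (N v) + (of_real (v \<bullet> e) + t)\<^sup>2)) = 1 + c * (N v + ((v \<bullet> e) + Re t)\<^sup>2) - c * (Im t)\<^sup>2"
        by (simp add: power2_eq_square algebra_simps)
      moreover have "(Im t)\<^sup>2 < 2\<^sup>2" using that by (metis abs_ge_zero power2_abs power_strict_mono zero_less_numeral)
      then have "c * (Im t)\<^sup>2 < c * 2\<^sup>2" using c(1) by (rule mult_strict_left_mono)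
      then have "c * (Im t)\<^sup>2 < c * 4" by simp
      then have "c * (Im t)\<^sup>2 < 1" using c by linarith
      moreover have "0 \<le> c * (N v + ((v \<bullet> e) + Re t)\<^sup>2)" using c N0 by simp
      ultimately show ?thesis by (metis add_pos_nonneg diff_gt_0_iff_gt less_irrefl zero_complex.sel(1) add_diff_eq add.commute)
    qed
    have meas: "(\<lambda>v. F v t) \<in> borel_measurable borel" for t
      unfolding F_def M_def N_def by measurable
    have majint': "integrable lborel (\<lambda>v::'a. exp (- n / 5) * (exp (1/2 + 3 * S) * exp (5 * S * norm v - (1/2) * (norm v)\<^sup>2)))"
      by (intro integrable_mult_right majint)
    have meas': "(\<lambda>v. F v t) \<in> borel_measurable lborel" for t using meas by simp
    note intz = norm_integral_le[OF meas' majint' refined]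
    have "(\<integral>v. F v (-\<i>) \<partial>lborel) = (\<integral>v. F v 0 \<partial>lborel)"
    proof (rule contour_shift[OF e, where S="{t. -2 < Im t} \<inter> {t. Im t < 2}"])
      show "convex ({t. -2 < Im t} \<inter> {t. Im t < 2})"
        by (intro convex_Int convex_halfspace_Im_gt convex_halfspace_Im_lt)
      show "open ({t. -2 < Im t} \<inter> {t. Im t < 2})"
        by (intro open_Int open_halfspace_Im_gt open_halfspace_Im_lt)
      show "F (v + r *\<^sub>R e) t = F v (of_real r + t)" for v r t
      proof -
        have 1: "M (v + r *\<^sub>R e) = M v" unfolding M_def power2_norm_eq_inner
          by (simp add: inner_add_left inner_add_right ee inner_commute power2_eq_square algebra_simps)
        have 2: "N (v + r *\<^sub>R e) = N v" unfolding N_def norm_perp_sq[OF E] unfolding power2_norm_eq_inner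
          by (simp add: inner_add_left inner_add_right ee eE inner_commute[of e v] power2_eq_square algebra_simps)
        show ?thesis unfolding F_def 1 2 by (simp add: inner_add_left ee add.assoc)
      qed
      show "F v holomorphic_on {t. -2 < Im t} \<inter> {t. Im t < 2}" for v
        unfolding F_def using den by (intro holomorphic_intros) auto
      show "of_real r + of_real \<beta> * (-\<i>) \<in> {t. -2 < Im t} \<inter> {t. Im t < 2}" if "0 \<le> \<beta>" "\<beta> \<le> 1" for r \<beta>
        using that by auto
      show "integrable lborel (\<lambda>v. F v 0)"
        by (rule Bochner_Integration.integrable_bound[OF integrable_gauss[of "1/2", where 'a='a]])
          (auto simp: F0 norm_exp_eq_Re kap_def)
      show "integrable lborel (\<lambda>v. F v (-\<i>))" by (rule intz(1))
      show "\<exists>M \<epsilon>. \<epsilon> > 0 \<and> (\<forall>r s. 0 \<le> s \<longrightarrow> s \<le> 1 \<longrightarrow>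
        norm (F (perp e v) (of_real r + of_real s * (-\<i>))) \<le> M * exp (- \<epsilon> * r\<^sup>2))" for v
      proof (intro exI conjI allI impI)
        show "(1/4::real) > 0" by simp
        fix r \<beta> :: real assume \<beta>: "0 \<le> \<beta>" "\<beta> \<le> 1"
        let ?p = "perp e v"
        have pe: "?p \<bullet> e = 0" by (simp add: perp_def inner_diff_left ee)
        have "norm (F ?p (of_real r + of_real \<beta> * (-\<i>))) \<le> exp (- (M ?p + r\<^sup>2 - \<beta>\<^sup>2) / 2 + (2 * S * \<bar>r\<bar> + 2 * n))"
          unfolding normF pe using packet_phase_crude[OF c N0[of ?p] \<beta> s _ refl refl refl, where n=n and x=r] n by simp
        also have "\<dots> \<le> exp (1 / 2 + 2 * n + 4 * S\<^sup>2 - (1/4) * r\<^sup>2)"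
        proof -
          \<comment> \<open>Half of the Gaussian exponent r^2 / 2 pays for the linear term; the
            other half remains as decay.\<close>
          have "0 \<le> (2 * S - \<bar>r\<bar> / 2)\<^sup>2" by simp
          then have "2 * S * \<bar>r\<bar> \<le> 4 * S\<^sup>2 + r\<^sup>2 / 4" by (simp add: power2_eq_square algebra_simps)
          moreover have "\<beta>\<^sup>2 \<le> 1" using \<beta> by (simp add: power_le_one)
          ultimately show ?thesis using M0[of ?p] unfolding exp_le_cancel_iff by (simp add: field_simps)
        qed
        also have "\<dots> = exp (1 / 2 + 2 * n + 4 * S\<^sup>2) * exp (- (1/4) * r\<^sup>2)" by (simp add: exp_add[symmetric])
        finally show "norm (F ?p (of_real r + of_real \<beta> * (-\<i>))) \<le> exp (1 / 2 + 2 * n + 4 * S\<^sup>2) * exp (- (1/4) * r\<^sup>2)" .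
      qed
    qed
    then have "norm (Psi l E s y) = norm (\<integral>v. F v (-\<i>) \<partial>lborel)"
      by (simp add: Psi_def F0)
    also have "\<dots> \<le> (\<integral>(v::'a). exp (- n / 5) * (exp (1/2 + 3 * S) * exp (5 * S * norm v - (1/2) * (norm v)\<^sup>2)) \<partial>lborel)"
      by (rule intz(2))
    also have "\<dots> = packet_const TYPE('a) S * exp (- norm y / 5)"
      by (simp add: packet_const_def n_def)
    finally show ?thesis .
  qed
qed

text \<open>The limit of \<open>Psi\<close> for l tending to infinity, where \<open>kap\<close>
  tends to 1.\<close>

definition PsiL :: "'a::euclidean_space \<Rightarrow> real \<Rightarrow> 'a \<Rightarrow> complex" where
  "PsiL E s u = (\<integral>v. exp (- of_real ((norm v)\<^sup>2 / 2)
      + \<i> * of_real (s * (norm (perp E v))\<^sup>2 / 2 - u \<bullet> perp E v)) \<partial>lborel)"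

lemma kap_measurable [measurable]: "kap l E \<in> borel_measurable borel"
  unfolding kap_def by measurable

lemma kap_bounds: "l > 0 \<Longrightarrow> 0 < kap l E v" "l > 0 \<Longrightarrow> kap l E v \<le> 1"
  unfolding kap_def by (auto simp: add_pos_nonneg)

lemma kap_tendsto: "((\<lambda>l. kap l E v) \<longlongrightarrow> 1) at_top"
  unfolding kap_def by real_asymp

lemma integrable_gauss_half: "integrable lborel (\<lambda>v::'a::euclidean_space. exp (- ((norm v)\<^sup>2 / 2)))"
  using integrable_gauss[of "1/2", where 'a='a] by simp

lemma tendsto_Psi:
  assumes "((\<lambda>l. s l) \<longlongrightarrow> s0) at_top"
  shows "((\<lambda>l. Psi l E (s l) u) \<longlongrightarrow> PsiL E s0 u) at_top"
  unfolding Psi_def PsiL_def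
proof (rule integral_dominated_convergence_at_top[where w="\<lambda>v. exp (- ((norm v)\<^sup>2 / 2))"])
  show "AE v in lborel. ((\<lambda>l. exp (- of_real ((norm v)\<^sup>2 / 2) + \<i> * of_real (kap l E v * (s l * (norm (perp E v))\<^sup>2 / 2 - u \<bullet> perp E v))))
     \<longlongrightarrow> exp (- of_real ((norm v)\<^sup>2 / 2) + \<i> * of_real (s0 * (norm (perp E v))\<^sup>2 / 2 - u \<bullet> perp E v))) at_top"
  proof (rule AE_I2)
    fix v
    have "((\<lambda>l. kap l E v * (s l * (norm (perp E v))\<^sup>2 / 2 - u \<bullet> perp E v)) \<longlongrightarrow> 1 * (s0 * (norm (perp E v))\<^sup>2 / 2 - u \<bullet> perp E v)) at_top"
      by (intro tendsto_intros kap_tendsto assms) simp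
    then show "((\<lambda>l. exp (- of_real ((norm v)\<^sup>2 / 2) + \<i> * of_real (kap l E v * (s l * (norm (perp E v))\<^sup>2 / 2 - u \<bullet> perp E v))))
     \<longlongrightarrow> exp (- of_real ((norm v)\<^sup>2 / 2) + \<i> * of_real (s0 * (norm (perp E v))\<^sup>2 / 2 - u \<bullet> perp E v))) at_top"
      by (intro tendsto_intros) simp
  qed
  show "\<forall>\<^sub>F l in at_top. AE v in lborel. norm (exp (- of_real ((norm v)\<^sup>2 / 2) + \<i> * of_real (kap l E v * (s l * (norm (perp E v))\<^sup>2 / 2 - u \<bullet> perp E v))))
     \<le> exp (- ((norm v)\<^sup>2 / 2))"
    by (intro always_eventually allI AE_I2) (simp add: norm_exp_eq_Re)
qed (use integrable_gauss_half in auto)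

text \<open>The Gaussian has parameter \<open>c\<close> orthogonally to \<open>E\<close> but
  parameter 1 along \<open>E\<close>. Trading the factor along \<open>E\<close> by
  \<open>integral_line_factor\<close> makes it isotropic, and \<open>gauss_fourier\<close> applies;
  the two one-dimensional constants are the price.\<close>

lemma PsiL_formula:
  fixes E u :: "'a::euclidean_space" and s :: real
  assumes E: "norm E = 1"
  defines "c \<equiv> 1 - \<i> * of_real s"
  shows "Kd TYPE(real) c * PsiL E s u = Kd TYPE(real) 1 * (exp (- of_real ((norm (perp E u))\<^sup>2) / (2 * c)) * Kd TYPE('a) c)"
proof -
  have c: "Re c > 0" by (simp add: c_def)
  let ?y = "perp E u"
  define k k' :: "real \<Rightarrow> complex" where "k r = exp (- (1 / 2) * of_real ((norm r)\<^sup>2))"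
    and "k' r = exp (- (c / 2) * of_real ((norm r)\<^sup>2))" for r
  define h :: "'a \<Rightarrow> complex" where "h x = exp (- (c / 2) * of_real ((norm x)\<^sup>2) - \<i> * of_real (?y \<bullet> x))" for x
  have EE: "E \<bullet> E = 1" using E by (simp add: dot_square_norm)
  have yp: "?y \<bullet> perp E v = u \<bullet> perp E v" "?y \<bullet> perp E v = ?y \<bullet> v" for v
    by (simp_all add: perp_def inner_diff_left inner_diff_right EE inner_commute)
  have n: "(norm v)\<^sup>2 = (norm (perp E v))\<^sup>2 + (v \<bullet> E)\<^sup>2" for v by (simp add: norm_perp_sq[OF E])
  have 1: "k (v \<bullet> E) * h (perp E v) = exp (- of_real ((norm v)\<^sup>2 / 2)
      + \<i> * of_real (s * (norm (perp E v))\<^sup>2 / 2 - u \<bullet> perp E v))" for v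
    unfolding k_def h_def n[of v] exp_add[symmetric] c_def yp(1) real_norm_def power2_abs
    by (rule arg_cong[where f=exp]) (simp add: field_simps)
  have 2: "k' (v \<bullet> E) * h (perp E v) = exp (- (c / 2) * of_real ((norm v)\<^sup>2) - \<i> * of_real (?y \<bullet> v))" for v
    unfolding k'_def h_def n[of v] exp_add[symmetric] yp(2) real_norm_def power2_abs
    by (rule arg_cong[where f=exp]) (simp add: field_simps)
  have "integrable lborel (\<lambda>v. k (v \<bullet> E) * h (perp E v))"
    unfolding 1 by (rule norm_integral_le(1)[OF _ integrable_gauss_half]) (auto simp: norm_exp_eq_Re)
  moreover have "integrable lborel k'" unfolding k'_def by (rule integrable_cgauss[OF c])
  ultimately have "(\<integral>r. k' r \<partial>lborel) * (\<integral>v. k (v \<bullet> E) * h (perp E v) \<partial>lborel)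
      = (\<integral>r. k r \<partial>lborel) * (\<integral>v. k' (v \<bullet> E) * h (perp E v) \<partial>lborel)"
    by (rule integral_line_factor[OF E])
  moreover have "(\<integral>r. k' r \<partial>lborel) = Kd TYPE(real) c" "(\<integral>r. k r \<partial>lborel) = Kd TYPE(real) 1"
    by (simp_all add: k_def k'_def Kd_def)
  moreover have "(\<integral>v. k' (v \<bullet> E) * h (perp E v) \<partial>lborel) = exp (- of_real ((norm ?y)\<^sup>2) / (2 * c)) * Kd TYPE('a) c"
    unfolding 2 by (rule gauss_fourier(2)[OF c])
  ultimately show ?thesis unfolding PsiL_def 1 by simp
qed

text \<open>Inverse stereographic projection of \<open>perp E v / sqrt l\<close>: this is exactly a unit vector, and by the choice
  of the weight in \<open>Lpk\<close> the phase along a slice is exactly \<open>kap\<close> times a quadratic polynomial.\<close>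
definition theta :: "real \<Rightarrow> 'a::euclidean_space \<Rightarrow> 'a \<Rightarrow> 'a" where
  "theta l E v = (2 * kap l E v - 1) *\<^sub>R E + (kap l E v / sqrt l) *\<^sub>R perp E v"

definition fhat :: "'a::euclidean_space set \<Rightarrow> 'a \<Rightarrow> complex" where
  "fhat \<Omega> \<xi> = (\<integral>x. indicator \<Omega> x * cis (- (\<xi> \<bullet> x)) \<partial>lborel)"

text \<open>A Gaussian average of \<open>fhat\<close> over a cap of size sqrt l around l E on the
  sphere of radius l. The modulation recentres the body at \<open>x0\<close>. The power of
  \<open>l\<close> is the inverse of the decay rate of \<open>fhat\<close> produced by curved
  boundary points. The weight 2 kap - 1 is the component of \<open>theta\<close> along
  \<open>E\<close>, that is, up to \<open>l\<close> the derivative of the phase along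
  \<open>E\<close>; it makes the integration over slices exact.\<close>

definition Lpk :: "'a::euclidean_space set \<Rightarrow> 'a \<Rightarrow> 'a \<Rightarrow> real \<Rightarrow> complex" where
  "Lpk \<Omega> x0 E l = of_real (l powr ((real DIM('a) + 1) / 2)) *
     (\<integral>v. of_real (exp (- ((norm v)\<^sup>2 / 2)) * (2 * kap l E v - 1)) * cis (l * (theta l E v \<bullet> x0)) * fhat \<Omega> (l *\<^sub>R theta l E v) \<partial>lborel)"

lemma theta_measurable [measurable]: "theta l E \<in> borel_measurable borel"
  unfolding theta_def by measurable

lemma perp_orth: "norm E = 1 \<Longrightarrow> perp E v \<bullet> E = 0" "norm E = 1 \<Longrightarrow> E \<bullet> perp E v = 0"
  by (simp_all add: perp_def inner_diff_left inner_diff_right dot_square_norm inner_commute)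

lemma norm_theta:
  assumes E: "norm E = 1" and l: "l > 0"
  shows "norm (theta l E v) = 1"
proof -
  let ?N = "(norm (perp E v))\<^sup>2" and ?k = "kap l E v"
  have EE: "E \<bullet> E = 1" using E by (simp add: dot_square_norm)
  have "(norm (theta l E v))\<^sup>2 = (2 * ?k - 1)\<^sup>2 + (?k / sqrt l)\<^sup>2 * ?N"
    unfolding theta_def power2_norm_eq_inner
    by (simp add: inner_add_left inner_add_right EE perp_orth[OF E] power2_eq_square algebra_simps)
  also have "(?k / sqrt l)\<^sup>2 = ?k\<^sup>2 / l" using l by (simp add: power_divide)
  also have "(2 * ?k - 1)\<^sup>2 + ?k\<^sup>2 / l * ?N = 1 + 4 * ?k * (?k * (1 + ?N / (4 * l)) - 1)"
    using l by (simp add: power2_eq_square field_simps)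
  also have "?k * (1 + ?N / (4 * l)) = 1"
    unfolding kap_def using l by (simp add: add_pos_nonneg less_imp_neq[THEN not_sym])
  finally show ?thesis by (simp add: norm_eq_sqrt_inner power2_norm_eq_inner)
qed

text \<open>The defining relation of \<open>kap\<close> gives 2 kap - 1 = 1 - kap (norm (perp E
  v))^2 / (2 l). Hence the phase of a slice end is l s plus \<open>kap\<close> times a quadratic
  polynomial, with no remainder to estimate.\<close>

lemma theta_inner:
  assumes E: "norm E = 1" and l: "l > 0" and y: "y \<bullet> E = 0"
  shows "l * (theta l E v \<bullet> (s *\<^sub>R E + (1 / sqrt l) *\<^sub>R y)) = l * s * (2 * kap l E v - 1) + kap l E v * (y \<bullet> perp E v)"
    and "l * s * (2 * kap l E v - 1) = l * s - s * kap l E v * (norm (perp E v))\<^sup>2 / 2"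
proof -
  let ?N = "(norm (perp E v))\<^sup>2" and ?k = "kap l E v"
  have EE: "E \<bullet> E = 1" using E by (simp add: dot_square_norm)
  have Ey: "E \<bullet> y = 0" using y by (simp add: inner_commute)
  have "theta l E v \<bullet> (s *\<^sub>R E + (1 / sqrt l) *\<^sub>R y) = s * (2 * ?k - 1) + ?k * (y \<bullet> perp E v) / (sqrt l * sqrt l)"
    unfolding theta_def by (simp add: inner_add_left inner_add_right EE Ey perp_orth[OF E] inner_commute)
  then show "l * (theta l E v \<bullet> (s *\<^sub>R E + (1 / sqrt l) *\<^sub>R y)) = l * s * (2 * kap l E v - 1) + kap l E v * (y \<bullet> perp E v)"
    using l by (simp add: field_simps)
  have "?k * (1 + ?N / (4 * l)) = 1"
    unfolding kap_def using l by (simp add: add_pos_nonneg less_imp_neq[THEN not_sym])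
  then have k: "?k = 1 - ?k * ?N / (4 * l)" by (simp add: algebra_simps)
  have "l * s * (2 * ?k - 1) = l * s * (2 * (1 - ?k * ?N / (4 * l)) - 1)" using k by simp
  also have "\<dots> = l * s - s * ?k * ?N / 2" using l by (simp add: field_simps)
  finally show "l * s * (2 * kap l E v - 1) = l * s - s * kap l E v * (norm (perp E v))\<^sup>2 / 2" .
qed

text \<open>Average over the caps of the sphere of radius \<open>l\<close>, before the integration over the body.\<close>
definition Ipk :: "'a::euclidean_space \<Rightarrow> real \<Rightarrow> 'a \<Rightarrow> complex" where
  "Ipk E l x = (\<integral>v. of_real (exp (- ((norm v)\<^sup>2 / 2)) * (2 * kap l E v - 1)) * cis (- (l * (theta l E v \<bullet> x))) \<partial>lborel)"

lemma Ipk_measurable [measurable]: "Ipk E l \<in> borel_measurable borel"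
  unfolding Ipk_def cis_conv_exp by measurable

lemma cis_measurable [measurable]: "cis \<in> borel_measurable borel"
  by (intro borel_measurable_continuous_onI continuous_intros)

lemma weight_le: "l > 0 \<Longrightarrow> norm (complex_of_real (exp (- ((norm v)\<^sup>2 / 2)) * (2 * kap l E v - 1))) \<le> exp (- ((norm v)\<^sup>2 / 2))"
proof -
  assume "l > 0"
  then have "\<bar>2 * kap l E v - 1\<bar> \<le> 1" using kap_bounds[of l E v] by (simp add: abs_le_iff)
  then have "exp (- ((norm v)\<^sup>2 / 2)) * \<bar>2 * kap l E v - 1\<bar> \<le> exp (- ((norm v)\<^sup>2 / 2)) * 1"
    by (intro mult_left_mono) auto
  then show ?thesis by (simp only: norm_of_real abs_mult abs_exp_cancel mult_1_right)
qed

lemma finite_measure_compact: "compact (\<Omega>::'a::euclidean_space set) \<Longrightarrow> integrable lborel (\<lambda>x. indicator \<Omega> x :: real)"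
  using emeasure_bounded_finite[OF compact_imp_bounded, of \<Omega>]
  by (intro integrable_real_indicator) (auto simp: compact_imp_closed)

lemma Lpk_eq:
  fixes \<Omega> :: "'a::euclidean_space set"
  assumes l: "l > 0" and \<Omega>: "compact \<Omega>"
  shows "integrable lborel (\<lambda>x. indicator \<Omega> (x0 + x) * Ipk E l x)"
    and "Lpk \<Omega> x0 E l = of_real (l powr ((real DIM('a) + 1) / 2)) * (\<integral>x. indicator \<Omega> (x0 + x) * Ipk E l x \<partial>lborel)"
proof -
  have [measurable]: "\<Omega> \<in> sets borel" using \<Omega> by (simp add: compact_imp_closed borel_closed)
  define w where "w v = complex_of_real (exp (- ((norm v)\<^sup>2 / 2)) * (2 * kap l E v - 1))" for v
  have [measurable]: "w \<in> borel_measurable borel" unfolding w_def by measurable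
  have int: "integrable (lborel \<Otimes>\<^sub>M lborel) (\<lambda>(v, x). w v * cis (- (l * (theta l E v \<bullet> x))) * indicator \<Omega> (x0 + x))"
  proof (rule norm_integral_le(1))
    have 1: "integrable lborel (\<lambda>x. indicator \<Omega> (x0 + x) :: real)"
    proof -
      have "integrable lborel (\<lambda>x. indicator \<Omega> (x + x0) :: real) \<longleftrightarrow> integrable (distr lborel borel ((+) x0)) (\<lambda>x. indicator \<Omega> x :: real)"
        by (subst integrable_distr_eq) (auto simp: add.commute)
      then show ?thesis using finite_measure_compact[OF \<Omega>] by (simp add: lborel_distr_plus add.commute)
    qed
    show "integrable (lborel \<Otimes>\<^sub>M lborel) (\<lambda>(v::'a, x). exp (- ((norm v)\<^sup>2 / 2)) * indicator \<Omega> (x0 + x) :: real)"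
      by (rule lborel_pair.Fubini_integrable) (use 1 integrable_gauss_half[where 'a='a] in auto)
    show "norm (case z of (v, x) \<Rightarrow> w v * cis (- (l * (theta l E v \<bullet> x))) * indicator \<Omega> (x0 + x))
      \<le> (case z of (v, x) \<Rightarrow> exp (- ((norm v)\<^sup>2 / 2)) * indicator \<Omega> (x0 + x))" for z
      using weight_le[OF l, of "fst z" E] by (auto simp: norm_mult indicator_def w_def split: prod.splits)
  qed measurable
  have sw: "(\<integral>v. w v * cis (- (l * (theta l E v \<bullet> x))) * indicator \<Omega> (x0 + x) \<partial>lborel) = indicator \<Omega> (x0 + x) * Ipk E l x" for x
    by (simp add: Ipk_def w_def mult.commute)
  show "integrable lborel (\<lambda>x. indicator \<Omega> (x0 + x) * Ipk E l x)"
    using lborel_pair.integrable_snd[OF int] by (simp only: sw)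
  have "(\<integral>x. indicator \<Omega> (x0 + x) * Ipk E l x \<partial>lborel)
     = (\<integral>v. (\<integral>x. w v * cis (- (l * (theta l E v \<bullet> x))) * indicator \<Omega> (x0 + x) \<partial>lborel) \<partial>lborel)"
    using lborel_pair.Fubini_integral[OF int] by (simp only: sw)
  also have "\<dots> = (\<integral>v. w v * cis (l * (theta l E v \<bullet> x0)) * fhat \<Omega> (l *\<^sub>R theta l E v) \<partial>lborel)"
  proof (rule Bochner_Integration.integral_cong[OF refl])
    fix v
    let ?th = "l *\<^sub>R theta l E v"
    have "(\<integral>x. w v * cis (- (l * (theta l E v \<bullet> x))) * indicator \<Omega> (x0 + x) \<partial>lborel)
      = (\<integral>x. w v * cis (?th \<bullet> x0) * (indicator \<Omega> (x + x0) * cis (- (?th \<bullet> (x + x0)))) \<partial>lborel)"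
      by (intro Bochner_Integration.integral_cong refl) (simp add: cis_mult inner_add_right add.commute mult_ac)
    also have "\<dots> = w v * cis (?th \<bullet> x0) * fhat \<Omega> ?th"
      unfolding fhat_def using integral_lborel_translate[of "\<lambda>x. indicator \<Omega> x * cis (- (?th \<bullet> x))" x0] by simp
    finally show "(\<integral>x. w v * cis (- (l * (theta l E v \<bullet> x))) * indicator \<Omega> (x0 + x) \<partial>lborel)
      = w v * cis (l * (theta l E v \<bullet> x0)) * fhat \<Omega> (l *\<^sub>R theta l E v)" by simp
  qed
  finally show "Lpk \<Omega> x0 E l = of_real (l powr ((real DIM('a) + 1) / 2)) * (\<integral>x. indicator \<Omega> (x0 + x) * Ipk E l x \<partial>lborel)"
    by (simp add: Lpk_def w_def)
qed

text \<open>Integral over one slice of the body recentred at \<open>x0\<close>. The factor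
  \<open>l\<close> compensates the 1 / l produced by integrating the exponential along the
  slice.\<close>

definition Tpk :: "'a::euclidean_space set \<Rightarrow> 'a \<Rightarrow> 'a \<Rightarrow> real \<Rightarrow> 'a \<Rightarrow> complex" where
  "Tpk \<Omega> x0 E l u = of_real l * (\<integral>r. indicator \<Omega> (x0 + ((1 / sqrt l) *\<^sub>R perp E u + r *\<^sub>R E)) * Ipk E l ((1 / sqrt l) *\<^sub>R perp E u + r *\<^sub>R E) \<partial>lborel)"

text \<open>Rescaling the d - 1 directions orthogonal to \<open>E\<close> by sqrt l consumes the
  power (d - 1) / 2 of \<open>l\<close>, and the remaining factor \<open>l\<close> sits in
  \<open>Tpk\<close>. The Gaussian in \<open>u \<bullet> E\<close> is the density for the redundant
  coordinate.\<close>

lemma Lpk_Tpk: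
  fixes \<Omega> :: "'a::euclidean_space set"
  assumes E: "norm E = 1" and l: "l > 0" and \<Omega>: "compact \<Omega>"
  shows "Kd TYPE(real) 1 * Lpk \<Omega> x0 E l = (\<integral>u. exp (- (1 / 2) * of_real ((u \<bullet> E)\<^sup>2)) * Tpk \<Omega> x0 E l u \<partial>lborel)"
proof -
  have [measurable]: "\<Omega> \<in> sets borel" using \<Omega> by (simp add: compact_imp_closed borel_closed)
  define \<phi> :: "real \<Rightarrow> complex" where "\<phi> r = exp (- (1 / 2) * of_real (r\<^sup>2))" for r
  have [measurable]: "\<phi> \<in> borel_measurable borel" unfolding \<phi>_def by measurable
  have \<phi>int: "integrable lborel \<phi>" and \<phi>K: "(\<integral>r. \<phi> r \<partial>lborel) = Kd TYPE(real) 1"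
    using integrable_cgauss[of 1, where 'a=real] by (simp_all add: \<phi>_def[abs_def] Kd_def)
  define H where "H x = indicator \<Omega> (x0 + x) * Ipk E l x" for x
  define J where "J y = (\<integral>r. H (y + r *\<^sub>R E) \<partial>lborel)" for y
  have [measurable]: "H \<in> borel_measurable borel" unfolding H_def by measurable
  have [measurable]: "J \<in> borel_measurable borel" unfolding J_def by measurable
  have H: "integrable lborel H" unfolding H_def by (rule Lpk_eq[OF l \<Omega>])
  have pl: "perp E ((sqrt l) *\<^sub>R x) = (sqrt l) *\<^sub>R perp E x" for x by (simp add: perp_def algebra_simps)
  have sl: "sqrt l > 0" using l by simp
  have "(\<integral>r. \<phi> (sqrt l * r) \<partial>lborel) * (\<integral>x. H x \<partial>lborel)
     = (\<integral>x. \<phi> (sqrt l * (x \<bullet> E)) * J (perp E x) \<partial>lborel)"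
    unfolding J_def
    using integral_along_line(1)[OF E H, of "\<lambda>r. \<phi> (sqrt l * r)"] integrable_lborel_scale_iff[of \<phi> "sqrt l"] \<phi>int sl by simp
  also have "\<dots> = (\<integral>x. \<phi> ((sqrt l *\<^sub>R x) \<bullet> E) * J ((1 / sqrt l) *\<^sub>R perp E (sqrt l *\<^sub>R x)) \<partial>lborel)"
    using sl by (simp add: pl)
  also have "\<dots> = (1 / sqrt l ^ DIM('a)) *\<^sub>R (\<integral>u. \<phi> (u \<bullet> E) * J ((1 / sqrt l) *\<^sub>R perp E u) \<partial>lborel)"
    by (rule integral_lborel_scale[OF _ sl]) measurable
  also have "(\<integral>r. \<phi> (sqrt l * r) \<partial>lborel) = (1 / sqrt l) *\<^sub>R Kd TYPE(real) 1"
    using integral_lborel_scale[of \<phi> "sqrt l"] sl \<phi>K by simp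
  finally have e: "((1 / sqrt l) *\<^sub>R Kd TYPE(real) 1) * (\<integral>x. H x \<partial>lborel)
      = (1 / sqrt l ^ DIM('a)) *\<^sub>R (\<integral>u. \<phi> (u \<bullet> E) * J ((1 / sqrt l) *\<^sub>R perp E u) \<partial>lborel)" .
  have p: "l powr ((real DIM('a) + 1) / 2) = sqrt l ^ DIM('a) * sqrt l"
  proof -
    have "l powr ((real DIM('a) + 1) / 2) = (l powr (1/2)) powr (real (DIM('a) + 1))"
      by (simp add: powr_powr add_divide_distrib add.commute)
    also have "\<dots> = sqrt l ^ (DIM('a) + 1)" using l powr_realpow[of "sqrt l" "DIM('a) + 1"]
      by (simp add: powr_half_sqrt del: of_nat_add of_nat_Suc power_Suc)
    finally show ?thesis by simp
  qed
  have "Kd TYPE(real) 1 * Lpk \<Omega> x0 E l = of_real (sqrt l ^ DIM('a) * l) * (((1 / sqrt l) *\<^sub>R Kd TYPE(real) 1) * (\<integral>x. H x \<partial>lborel))"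
    unfolding Lpk_eq(2)[OF l \<Omega>] H_def[symmetric] p using l
    by (simp add: scaleR_conv_of_real field_simps of_real_mult[symmetric] del: of_real_mult of_real_power)
  also have "\<dots> = of_real l * (\<integral>u. \<phi> (u \<bullet> E) * J ((1 / sqrt l) *\<^sub>R perp E u) \<partial>lborel)"
    unfolding e using l by (simp add: scaleR_conv_of_real)
  also have "\<dots> = (\<integral>u. \<phi> (u \<bullet> E) * Tpk \<Omega> x0 E l u \<partial>lborel)"
    by (simp add: Tpk_def J_def H_def mult.left_commute flip: integral_mult_right_zero)
  finally show ?thesis by (simp add: \<phi>_def)
qed

text \<open>An identity, not an asymptotic formula: the weight is the derivative of the phase up to
  \<open>l\<close>, so the integral over the slice is a difference of boundary terms, and
  \<open>theta_inner\<close> turns each of them into a value of \<open>Psi\<close>.\<close>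

lemma Tpk_slice:
  fixes \<Omega> :: "'a::euclidean_space set"
  assumes E: "norm E = 1" and l: "l > 0" and \<Omega>: "compact \<Omega>" and ab: "a \<le> b"
    and slice: "{r. x0 + ((1 / sqrt l) *\<^sub>R perp E u + r *\<^sub>R E) \<in> \<Omega>} = {a..b}"
  shows "Tpk \<Omega> x0 E l u = \<i> * (cis (- (l * b)) * Psi l E b u - cis (- (l * a)) * Psi l E a u)"
proof -
  define w where "w v = complex_of_real (exp (- ((norm v)\<^sup>2 / 2)))" for v :: 'a
  define k where "k v = 2 * kap l E v - 1" for v
  define g where "g v = kap l E v * (u \<bullet> perp E v)" for v
  have [measurable]: "w \<in> borel_measurable borel" "k \<in> borel_measurable borel" "g \<in> borel_measurable borel"
    unfolding w_def k_def g_def by measurable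
  have EE: "E \<bullet> E = 1" using E by (simp add: dot_square_norm)
  have up: "perp E u \<bullet> perp E v = u \<bullet> perp E v" for v
    by (simp add: perp_def inner_diff_left inner_diff_right EE inner_commute)
  have I: "Ipk E l ((1 / sqrt l) *\<^sub>R perp E u + r *\<^sub>R E) = (\<integral>v. w v * k v * cis (- (l * r * k v + g v)) \<partial>lborel)" for r
    unfolding Ipk_def w_def k_def g_def
    using theta_inner(1)[OF E l perp_orth(1)[OF E, of u], of _ r] by (simp add: up add.commute)
  have int: "integrable (lborel \<Otimes>\<^sub>M lborel) (\<lambda>(r, v). indicator {a..b} r * (w v * k v * cis (- (l * r * k v + g v))))"
  proof (rule norm_integral_le(1))
    show "integrable (lborel \<Otimes>\<^sub>M lborel) (\<lambda>(r::real, v::'a). indicator {a..b} r * exp (- ((norm v)\<^sup>2 / 2)) :: real)"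
      by (rule lborel_pair.Fubini_integrable) (use integrable_gauss_half[where 'a='a] finite_measure_compact[of "{a..b}"] in \<open>auto simp: abs_mult\<close>)
    show "norm (case z of (r, v) \<Rightarrow> indicator {a..b} r * (w v * k v * cis (- (l * r * k v + g v))))
      \<le> (case z of (r, v) \<Rightarrow> indicator {a..b} r * exp (- ((norm v)\<^sup>2 / 2)))" for z
      using weight_le[OF l, of "snd z" E] by (auto simp: norm_mult indicator_def w_def k_def split: prod.splits)
  qed measurable
  have ftc: "(\<integral>r. indicator {a..b} r * (of_real (k v) * cis (- (l * r * k v + g v))) \<partial>lborel)
     = (\<i> / l) * (cis (- (l * b * k v + g v)) - cis (- (l * a * k v + g v)))" for v
  proof -
    have "(\<integral>r. indicator {a..b} r *\<^sub>R (of_real (k v) * cis (- (l * r * k v + g v))) \<partial>lborel)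
       = (\<i> / l) * cis (- (l * b * k v + g v)) - (\<i> / l) * cis (- (l * a * k v + g v))"
    proof (rule integral_FTC_atLeastAtMost[OF ab])
      show "continuous_on {a..b} (\<lambda>r. of_real (k v) * cis (- (l * r * k v + g v)))"
        by (intro continuous_intros)
      fix r
      have "((\<lambda>z. (\<i> / l) * exp (\<i> * (- (of_real l * z * of_real (k v) + of_real (g v))))) has_field_derivative
         (\<i> / l) * (exp (\<i> * (- (of_real l * of_real r * of_real (k v) + of_real (g v)))) * (\<i> * - (of_real l * of_real (k v))))) (at (of_real r))"
        by (auto intro!: derivative_eq_intros simp: algebra_simps)
      from has_vector_derivative_real_field[OF this]
      have "((\<lambda>r. (\<i> / l) * exp (\<i> * of_real (- (l * r * k v + g v)))) has_vector_derivative
         (\<i> / l) * ((\<i> * of_real (- (l * k v))) * exp (\<i> * of_real (- (l * r * k v + g v))))) (at r within {a..b})"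
        by (simp add: mult_ac)
      then show "((\<lambda>r. (\<i> / l) * cis (- (l * r * k v + g v))) has_vector_derivative of_real (k v) * cis (- (l * r * k v + g v))) (at r within {a..b})"
        using l by (simp add: cis_conv_exp field_simps)
    qed
    moreover have "indicator {a..b} r *\<^sub>R z = indicator {a..b} r * z" for r and z :: complex
      by (simp add: indicator_def)
    ultimately show ?thesis by (simp add: right_diff_distrib)
  qed
  have P: "(\<integral>v. w v * cis (- (l * s * k v + g v)) \<partial>lborel) = cis (- (l * s)) * Psi l E s u" for s
  proof -
    have "w v * cis (- (l * s * k v + g v)) = cis (- (l * s)) * exp (- of_real ((norm v)\<^sup>2 / 2)
      + \<i> * of_real (kap l E v * (s * (norm (perp E v))\<^sup>2 / 2 - u \<bullet> perp E v)))" for v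
    proof -
      define X where "X = kap l E v * (s * (norm (perp E v))\<^sup>2 / 2 - u \<bullet> perp E v)"
      have "l * s * k v + g v = l * s - X"
        unfolding k_def g_def X_def using theta_inner(2)[OF E l perp_orth(1)[OF E, of u], of s v] by (simp add: algebra_simps)
      then have "cis (- (l * s * k v + g v)) = cis (- (l * s)) * cis X" by (simp add: cis_mult)
      moreover have "w v = exp (- of_real ((norm v)\<^sup>2 / 2))" by (simp add: w_def exp_of_real[symmetric])
      ultimately show ?thesis
        unfolding X_def[symmetric] by (simp only: exp_add cis_conv_exp mult.left_commute)
    qed
    then show ?thesis unfolding Psi_def by simp
  qed
  have wint: "integrable lborel (\<lambda>v. w v * cis (- (l * s * k v + g v)))" for s
    by (rule norm_integral_le(1)[OF _ integrable_gauss_half]) (auto simp: w_def norm_mult)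
  have ind: "indicator \<Omega> (x0 + ((1 / sqrt l) *\<^sub>R perp E u + r *\<^sub>R E)) = (indicator {a..b} r :: complex)" for r
    using slice by (auto simp: indicator_def set_eq_iff)
  have "Tpk \<Omega> x0 E l u = of_real l * (\<integral>r. (\<integral>v. indicator {a..b} r * (w v * k v * cis (- (l * r * k v + g v))) \<partial>lborel) \<partial>lborel)"
    unfolding Tpk_def ind I by simp
  also have "\<dots> = of_real l * (\<integral>v. (\<integral>r. indicator {a..b} r * (w v * k v * cis (- (l * r * k v + g v))) \<partial>lborel) \<partial>lborel)"
    using lborel_pair.Fubini_integral[OF int] by simp
  also have "\<dots> = of_real l * (\<integral>v. w v * ((\<i> / l) * (cis (- (l * b * k v + g v)) - cis (- (l * a * k v + g v)))) \<partial>lborel)"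
    unfolding ftc[symmetric] by (simp add: mult_ac flip: integral_mult_right_zero)
  also have "\<dots> = \<i> * (\<integral>v. w v * cis (- (l * b * k v + g v)) - w v * cis (- (l * a * k v + g v)) \<partial>lborel)"
    using l by (simp add: algebra_simps flip: integral_mult_right_zero)
  also have "\<dots> = \<i> * (cis (- (l * b)) * Psi l E b u - cis (- (l * a)) * Psi l E a u)"
    by (simp only: Bochner_Integration.integral_diff[OF wint wint] P)
  finally show ?thesis .
qed

lemma compact_slice:
  fixes \<Omega> :: "'a::euclidean_space set"
  assumes \<Omega>: "compact \<Omega>" "convex \<Omega>" and E: "norm E = 1"
  obtains "{r. p + r *\<^sub>R E \<in> \<Omega>} = {}" | a b where "a \<le> b" "{r. p + r *\<^sub>R E \<in> \<Omega>} = {a..b}"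
proof -
  let ?S = "{r. p + r *\<^sub>R E \<in> \<Omega>}"
  have "convex ?S"
  proof (rule convexI)
    fix x y u v :: real assume xy: "x \<in> ?S" "y \<in> ?S" and uv: "0 \<le> u" "0 \<le> v" "u + v = 1"
    have "u *\<^sub>R (p + x *\<^sub>R E) + v *\<^sub>R (p + y *\<^sub>R E) \<in> \<Omega>"
      using xy uv \<Omega>(2) by (intro convexD) auto
    moreover have "u *\<^sub>R (p + x *\<^sub>R E) + v *\<^sub>R (p + y *\<^sub>R E) = (u + v) *\<^sub>R p + (u * x + v * y) *\<^sub>R E"
      by (simp add: algebra_simps)
    ultimately show "u *\<^sub>R x + v *\<^sub>R y \<in> ?S" using uv by simp
  qed
  moreover have "compact ?S"
  proof (rule compact_eq_bounded_closed[THEN iffD2], intro conjI)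
    have "?S = (\<lambda>r. p + r *\<^sub>R E) -` \<Omega>" by auto
    then show "closed ?S" using closed_vimage[OF compact_imp_closed[OF \<Omega>(1)], of "\<lambda>r. p + r *\<^sub>R E"]
      by (simp add: continuous_intros)
    obtain B where B: "\<And>x. x \<in> \<Omega> \<Longrightarrow> norm x \<le> B" using compact_imp_bounded[OF \<Omega>(1)] by (auto simp: bounded_iff)
    have "norm r \<le> B + norm p" if "r \<in> ?S" for r
      using B[of "p + r *\<^sub>R E"] that norm_triangle_ineq4[of "p + r *\<^sub>R E" p] E by simp
    then show "bounded ?S" by (auto simp: bounded_iff)
  qed
  ultimately obtain a b where "?S = {a..b}"
    using connected_compact_interval_1[of ?S] convex_connected by (metis box_real(2))
  then show thesis using that by (cases "a \<le> b") auto
qed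

lemma Psi_perp: "norm E = 1 \<Longrightarrow> Psi l E s (perp E u) = Psi l E s u" "norm E = 1 \<Longrightarrow> PsiL E s (perp E u) = PsiL E s u"
proof -
  assume "norm E = 1"
  then have "perp E u \<bullet> perp E v = u \<bullet> perp E v" for v
    using perp_orth(2)[of E v] by (simp add: perp_def[of E u] inner_diff_left)
  then show "Psi l E s (perp E u) = Psi l E s u" "PsiL E s (perp E u) = PsiL E s u"
    by (simp_all add: Psi_def PsiL_def)
qed

text \<open>The majorant for dominated convergence: uniform in \<open>l\<close> and valid for every
  compact convex body. A nonempty slice forces \<open>norm (perp E u) \<le> S * sqrt l\<close>,
  which is exactly the range in which \<open>norm_Psi_le\<close> gives decay.\<close>

lemma norm_Tpk_le:
  fixes \<Omega> :: "'a::euclidean_space set"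
  assumes \<Omega>: "compact \<Omega>" "convex \<Omega>" and E: "norm E = 1" and l: "l \<ge> 1"
    and S: "\<And>x. x \<in> \<Omega> \<Longrightarrow> norm (x - x0) \<le> S"
  shows "norm (Tpk \<Omega> x0 E l u) \<le> 2 * \<bar>packet_const TYPE('a) S\<bar> * exp (- norm (perp E u) / 5)"
proof -
  let ?y = "perp E u"
  let ?C = "packet_const TYPE('a) S"
  have yE: "?y \<bullet> E = 0" using perp_orth(1)[OF E] .
  consider "{r. (x0 + (1 / sqrt l) *\<^sub>R ?y) + r *\<^sub>R E \<in> \<Omega>} = {}"
    | a b where "a \<le> b" "{r. (x0 + (1 / sqrt l) *\<^sub>R ?y) + r *\<^sub>R E \<in> \<Omega>} = {a..b}"
    using compact_slice[OF \<Omega> E] by metis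
  then show ?thesis
  proof cases
    case 1
    then have "indicator \<Omega> (x0 + ((1 / sqrt l) *\<^sub>R ?y + r *\<^sub>R E)) = (0::complex)" for r
      by (auto simp: indicator_def add.assoc)
    then show ?thesis by (simp add: Tpk_def)
  next
    case (2 a b)
    have slice: "{r. x0 + ((1 / sqrt l) *\<^sub>R ?y + r *\<^sub>R E) \<in> \<Omega>} = {a..b}"
      using 2(2) by (simp add: add.assoc)
    have pt: "\<bar>r\<bar> \<le> S \<and> norm ?y \<le> S * sqrt l" if "r \<in> {a..b}" for r
    proof -
      let ?x = "(1 / sqrt l) *\<^sub>R ?y + r *\<^sub>R E"
      have "x0 + ?x \<in> \<Omega>" using that slice by blast
      from S[OF this] have n: "norm ?x \<le> S" by simp
      have "?x \<bullet> E = r" using yE E by (simp add: inner_add_left dot_square_norm)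
      then have r: "\<bar>r\<bar> \<le> S" using Cauchy_Schwarz_ineq2[of ?x E] E n by simp
      have "perp E ?x = (1 / sqrt l) *\<^sub>R ?y" using \<open>?x \<bullet> E = r\<close> by (simp add: perp_def[of E ?x])
      then have "(norm ((1 / sqrt l) *\<^sub>R ?y))\<^sup>2 \<le> (norm ?x)\<^sup>2" using norm_perp_sq[OF E, of ?x] by simp
      then have "norm ((1 / sqrt l) *\<^sub>R ?y) \<le> norm ?x" by (rule power2_le_imp_le) simp
      then have "norm ?y / sqrt l \<le> S" using n l by simp
      then show ?thesis using r l by (simp add: pos_divide_le_eq)
    qed
    have P: "norm (Psi l E r u) \<le> \<bar>?C\<bar> * exp (- norm ?y / 5)" if "r \<in> {a..b}" for r
    proof -
      have "norm (Psi l E r ?y) \<le> ?C * exp (- norm ?y / 5)"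
        using pt[OF that] by (intro norm_Psi_le[OF E yE l]) auto
      also have "\<dots> \<le> \<bar>?C\<bar> * exp (- norm ?y / 5)" by (intro mult_right_mono) auto
      finally show ?thesis by (simp add: Psi_perp[OF E])
    qed
    have "Tpk \<Omega> x0 E l u = \<i> * (cis (- (l * b)) * Psi l E b u - cis (- (l * a)) * Psi l E a u)"
      by (rule Tpk_slice[OF E _ \<Omega>(1) 2(1) slice]) (use l in simp)
    then have "norm (Tpk \<Omega> x0 E l u) = norm (cis (- (l * b)) * Psi l E b u - cis (- (l * a)) * Psi l E a u)"
      by (simp only: norm_mult norm_ii mult_1_left)
    also have "\<dots> \<le> norm (cis (- (l * b)) * Psi l E b u) + norm (cis (- (l * a)) * Psi l E a u)"
      by (rule norm_triangle_ineq4)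
    also have "\<dots> \<le> 2 * \<bar>?C\<bar> * exp (- norm ?y / 5)"
      using P[of a] P[of b] 2(1) by (simp add: norm_mult)
    finally show ?thesis .
  qed
qed

section \<open>Decay of the limit kernel and the Riemann-Lebesgue lemma\<close>

lemma PsiL_gauss:
  fixes E :: "'a::euclidean_space" and s :: real
  assumes E: "norm E = 1"
  defines "c \<equiv> 1 - \<i> * of_real s"
  obtains \<kappa> where "\<And>u. PsiL E s u = \<kappa> * exp (- of_real ((norm (perp E u))\<^sup>2) / (2 * c))"
    "norm \<kappa> = K1 TYPE('a) * sqrt (norm c) / sqrt (norm c) ^ DIM('a)" "s = 0 \<Longrightarrow> \<kappa> = Kd TYPE('a) 1"
proof
  have c: "Re c > 0" by (simp add: c_def)
  then have c0: "norm c > 0" by auto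
  have K: "norm (Kd TYPE(real) c) = K1 TYPE(real) / sqrt (norm c)" "norm (Kd TYPE(real) 1) = K1 TYPE(real)"
    using norm_Kd[OF c, where 'a=real] norm_Kd[of 1, where 'a=real] by simp_all
  have Kp: "K1 TYPE(real) > 0" by (rule K1_pos)
  have K0: "Kd TYPE(real) c \<noteq> 0" using K Kp c0 by auto
  show "PsiL E s u = (Kd TYPE(real) 1 * Kd TYPE('a) c / Kd TYPE(real) c) * exp (- of_real ((norm (perp E u))\<^sup>2) / (2 * c))" for u
    using PsiL_formula[OF E, of s u] K0 unfolding c_def[symmetric] by (simp add: field_simps)
  show "norm (Kd TYPE(real) 1 * Kd TYPE('a) c / Kd TYPE(real) c) = K1 TYPE('a) * sqrt (norm c) / sqrt (norm c) ^ DIM('a)"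
    using Kp c0 by (simp add: norm_mult norm_divide K norm_Kd[OF c])
  show "Kd TYPE(real) 1 * Kd TYPE('a) c / Kd TYPE(real) c = Kd TYPE('a) 1" if "s = 0"
  proof -
    have "c = 1" using that by (simp add: c_def)
    then show ?thesis using K0 by simp
  qed
qed

lemma Re_inverse_c: "Re (1 / (1 - \<i> * of_real s)) = 1 / (1 + s\<^sup>2)"
  by (simp add: Re_divide)

lemma gauss_exp_decay:
  assumes E: "norm E = 1"
  shows "exp (- ((u \<bullet> E)\<^sup>2 / 2)) * exp (- norm (perp E u) / 5) \<le> 2 * exp (- (1/5) * norm (u::'a::euclidean_space))"
proof -
  have "norm u \<le> norm (perp E u) + norm ((u \<bullet> E) *\<^sub>R E)"
    using norm_triangle_ineq[of "perp E u" "(u \<bullet> E) *\<^sub>R E"] by (simp add: perp_def)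
  then have 1: "norm u \<le> norm (perp E u) + \<bar>u \<bullet> E\<bar>" using E by simp
  \<comment> \<open>Replacing the Gaussian along \<open>E\<close> by an exponential of rate 1/5
    costs a factor exp (1/50), which the factor 2 covers.\<close>
  have "0 \<le> (\<bar>u \<bullet> E\<bar> - 1/5)\<^sup>2" by simp
  then have 2: "\<bar>u \<bullet> E\<bar> / 5 \<le> (u \<bullet> E)\<^sup>2 / 2 + 1/50" by (simp add: power2_eq_square algebra_simps)
  have "exp (1/50) \<le> (2::real)" using exp_bound[of "1/50"] by (simp add: power2_eq_square)
  moreover have "exp (- ((u \<bullet> E)\<^sup>2 / 2)) * exp (- norm (perp E u) / 5) \<le> exp (1/50) * exp (- (1/5) * norm u)"
    unfolding exp_add[symmetric] exp_le_cancel_iff using 1 2 by simp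
  ultimately show ?thesis by (meson exp_ge_zero mult_right_mono order_trans)
qed

lemma PsiL_decay:
  assumes E: "norm E = 1"
  obtains C where "\<And>u::'a::euclidean_space. norm (PsiL E s u) \<le> C * exp (- norm (perp E u) / 5)" "C \<ge> 0"
proof -
  obtain \<kappa> where k: "\<And>u. PsiL E s u = \<kappa> * exp (- of_real ((norm (perp E u))\<^sup>2) / (2 * (1 - \<i> * of_real s)))"
    using PsiL_gauss[OF E, of s] by metis
  define d where "d = 1 / (2 * (1 + s\<^sup>2))"
  have d: "d > 0" by (simp add: d_def add_pos_nonneg)
  have "norm (PsiL E s u) \<le> (norm \<kappa> * exp (1 / (100 * d))) * exp (- norm (perp E u) / 5)" for u :: 'a
  proof -
    let ?n = "norm (perp E u)"
    have "Re (- of_real (?n\<^sup>2) / (2 * (1 - \<i> * of_real s))) = - ?n\<^sup>2 / 2 * Re (1 / (1 - \<i> * of_real s))"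
    proof -
      define w where "w = 1 / (1 - \<i> * of_real s)"
      have "- of_real (?n\<^sup>2) / (2 * (1 - \<i> * of_real s)) = of_real (- ?n\<^sup>2 / 2) * w"
        by (simp add: w_def)
      then show ?thesis unfolding w_def[symmetric] by (simp del: of_real_divide of_real_minus of_real_power)
    qed
    then have "norm (PsiL E s u) = norm \<kappa> * exp (- d * ?n\<^sup>2)"
      unfolding k norm_mult norm_exp_eq_Re Re_inverse_c by (simp add: d_def)
    also have "- d * ?n\<^sup>2 \<le> 1 / (100 * d) - ?n / 5"
    proof -
      have "0 \<le> (10 * d * ?n - 1)\<^sup>2 / (100 * d)" using d by simp
      also have "\<dots> = 1 / (100 * d) - ?n / 5 + d * ?n\<^sup>2" using d by (simp add: power2_eq_square field_simps)
      finally show ?thesis by simp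
    qed
    then have "norm \<kappa> * exp (- d * ?n\<^sup>2) \<le> norm \<kappa> * exp (1 / (100 * d) - ?n / 5)" by (intro mult_left_mono) auto
    also have "\<dots> = (norm \<kappa> * exp (1 / (100 * d))) * exp (- ?n / 5)" by (simp add: exp_add[symmetric])
    finally show ?thesis .
  qed
  then show thesis by (rule that) simp
qed

lemma PsiL_continuous: "norm E = 1 \<Longrightarrow> continuous_on UNIV (PsiL E s)"
proof -
  assume E: "norm E = 1"
  obtain \<kappa> where k: "\<And>u. PsiL E s u = \<kappa> * exp (- of_real ((norm (perp E u))\<^sup>2) / (2 * (1 - \<i> * of_real s)))"
    using PsiL_gauss[OF E, of s] by metis
  have "1 - \<i> * of_real s \<noteq> 0" by (simp add: complex_eq_iff)
  then show ?thesis unfolding k[abs_def] perp_def by (intro continuous_intros) auto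
qed

text \<open>Translation by \<open>h r\<close>, half a period of the oscillation, changes the sign of
  the exponential. So the integral is half of that against \<open>k u - k (u + h r)\<close>, which
  tends to 0 by continuity; the exponential bound is the majorant as long as
  \<open>norm (h r) \<le> 1\<close>.\<close>

lemma riemann_lebesgue_decay:
  fixes k :: "'a::euclidean_space \<Rightarrow> complex"
  assumes cont: "continuous_on UNIV k" and bd: "\<And>u. norm (k u) \<le> C * exp (- (1/5) * norm u)" and \<tau>: "\<tau> \<noteq> 0"
  shows "((\<lambda>r. \<integral>u. cis (- (r * (\<tau> \<bullet> u))) * k u \<partial>lborel) \<longlongrightarrow> 0) at_top"
proof -
  have [measurable]: "k \<in> borel_measurable borel" using cont by (rule borel_measurable_continuous_onI)
  have C0: "0 \<le> C"
  proof -
    have "0 \<le> C * exp (- (1/5) * norm (0::'a))" using order_trans[OF norm_ge_zero bd] .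
    then show ?thesis by simp
  qed
  define h where "h r = (pi / (r * (\<tau> \<bullet> \<tau>))) *\<^sub>R \<tau>" for r :: real
  have tt: "\<tau> \<bullet> \<tau> > 0" using \<tau> by simp
  have h0: "(h \<longlongrightarrow> 0) at_top"
  proof -
    have "((\<lambda>r. pi / (r * (\<tau> \<bullet> \<tau>))) \<longlongrightarrow> 0) at_top" using tt by real_asymp
    from tendsto_scaleR[OF this tendsto_const[of \<tau>]] show ?thesis by (simp add: h_def[abs_def])
  qed
  have int: "integrable lborel (\<lambda>u. cis (- (r * (\<tau> \<bullet> u))) * k (u + x))" if "norm x \<le> 1" for r x
  proof (rule norm_integral_le(1))
    show "integrable lborel (\<lambda>u::'a. (C * exp (1/5)) * exp (- (1/5) * norm u))"
      by (intro integrable_mult_right integrable_exp_norm) simp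
    show "norm (cis (- (r * (\<tau> \<bullet> u))) * k (u + x)) \<le> (C * exp (1/5)) * exp (- (1/5) * norm u)" for u
    proof -
      have "norm u \<le> norm (u + x) + 1" using norm_triangle_ineq4[of "u + x" x] that by simp
      then have "exp (- (1/5) * norm (u + x)) \<le> exp (1/5) * exp (- (1/5) * norm u)" by (simp add: exp_add[symmetric])
      then have "C * exp (- (1/5) * norm (u + x)) \<le> C * (exp (1/5) * exp (- (1/5) * norm u))" using C0 by (rule mult_left_mono)
      then show ?thesis using bd[of "u + x"] by (simp add: norm_mult mult.assoc)
    qed
  qed measurable
  have half: "(\<integral>u. cis (- (r * (\<tau> \<bullet> u))) * k u \<partial>lborel) = (1/2) * (\<integral>u. cis (- (r * (\<tau> \<bullet> u))) * (k u - k (u + h r)) \<partial>lborel)"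
    if r: "r > 0" "norm (h r) \<le> 1" for r
  proof -
    have "r * (\<tau> \<bullet> h r) = pi" using r tt by (simp add: h_def)
    then have c: "cis (- (r * (\<tau> \<bullet> (u + h r)))) = - cis (- (r * (\<tau> \<bullet> u)))" for u
      by (simp add: inner_add_right distrib_left cis_mult[symmetric] minus_add_distrib del: add_uminus_conv_diff minus_add_distrib)
        (simp add: cis.ctr complex_eq_iff)
    have "(\<integral>u. cis (- (r * (\<tau> \<bullet> u))) * k u \<partial>lborel) = (\<integral>u. cis (- (r * (\<tau> \<bullet> (u + h r)))) * k (u + h r) \<partial>lborel)"
      by (rule integral_lborel_translate[symmetric]) measurable
    also have "\<dots> = - (\<integral>u. cis (- (r * (\<tau> \<bullet> u))) * k (u + h r) \<partial>lborel)" unfolding c by simp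
    finally have "(\<integral>u. cis (- (r * (\<tau> \<bullet> u))) * k u \<partial>lborel) + (\<integral>u. cis (- (r * (\<tau> \<bullet> u))) * k u \<partial>lborel) =
       (\<integral>u. cis (- (r * (\<tau> \<bullet> u))) * k u \<partial>lborel) - (\<integral>u. cis (- (r * (\<tau> \<bullet> u))) * k (u + h r) \<partial>lborel)" by simp
    also have "\<dots> = (\<integral>u. cis (- (r * (\<tau> \<bullet> u))) * (k u - k (u + h r)) \<partial>lborel)"
      using int[of 0 r] int[of "h r" r] r by (simp add: right_diff_distrib)
    finally show ?thesis by (simp add: mult.commute[of _ 2])
  qed
  have ev: "\<forall>\<^sub>F r in at_top. r > 0 \<and> norm (h r) \<le> 1"
  proof -
    have "\<forall>\<^sub>F r in at_top. norm (h r) < 1" using tendstoD[OF h0, of 1] by (simp add: dist_norm)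
    then show ?thesis using eventually_gt_at_top[of 0] by eventually_elim auto
  qed
  have "((\<lambda>r. \<integral>u. (if r > 0 \<and> norm (h r) \<le> 1 then cis (- (r * (\<tau> \<bullet> u))) * (k u - k (u + h r)) else 0) \<partial>lborel) \<longlongrightarrow> (\<integral>(u::'a). 0 \<partial>lborel)) at_top"
  proof (rule integral_dominated_convergence_at_top)
    show "integrable lborel (\<lambda>u::'a. (C + C * exp (1/5)) * exp (- (1/5) * norm u))"
      by (intro integrable_mult_right integrable_exp_norm) simp
    show "\<forall>\<^sub>F r in at_top. AE u in lborel. norm (if r > 0 \<and> norm (h r) \<le> 1 then cis (- (r * (\<tau> \<bullet> u))) * (k u - k (u + h r)) else 0)
        \<le> (C + C * exp (1/5)) * exp (- (1/5) * norm u)"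
    proof (intro always_eventually allI AE_I2)
      fix r u
      show "norm (if r > 0 \<and> norm (h r) \<le> 1 then cis (- (r * (\<tau> \<bullet> u))) * (k u - k (u + h r)) else 0)
        \<le> (C + C * exp (1/5)) * exp (- (1/5) * norm u)"
      proof (cases "r > 0 \<and> norm (h r) \<le> 1")
        case True
        have "norm u \<le> norm (u + h r) + 1" using norm_triangle_ineq4[of "u + h r" "h r"] True by simp
        then have "exp (- (1/5) * norm (u + h r)) \<le> exp (1/5) * exp (- (1/5) * norm u)" by (simp add: exp_add[symmetric])
        then have "C * exp (- (1/5) * norm (u + h r)) \<le> C * (exp (1/5) * exp (- (1/5) * norm u))" using C0 by (rule mult_left_mono)
        then have "norm (k u - k (u + h r)) \<le> C * exp (- (1/5) * norm u) + C * (exp (1/5) * exp (- (1/5) * norm u))"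
          using bd[of u] bd[of "u + h r"] norm_triangle_ineq4[of "k u" "k (u + h r)"] by linarith
        then show ?thesis using True by (simp add: norm_mult distrib_right mult.assoc)
      qed (use C0 in auto)
    qed
    show "AE u in lborel. ((\<lambda>r. if r > 0 \<and> norm (h r) \<le> 1 then cis (- (r * (\<tau> \<bullet> u))) * (k u - k (u + h r)) else 0) \<longlongrightarrow> 0) at_top"
    proof (rule AE_I2, rule Lim_null_comparison)
      fix u
      have "((\<lambda>r. k (u + h r)) \<longlongrightarrow> k (u + 0)) at_top"
        using cont by (intro continuous_on_tendsto_compose[OF cont] tendsto_intros h0) auto
      then show "((\<lambda>r. norm (k u - k (u + h r))) \<longlongrightarrow> 0) at_top"
        using tendsto_norm[OF tendsto_diff[OF tendsto_const[of "k u"]]] by fastforce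
      show "\<forall>\<^sub>F r in at_top. norm (if r > 0 \<and> norm (h r) \<le> 1 then cis (- (r * (\<tau> \<bullet> u))) * (k u - k (u + h r)) else 0) \<le> norm (k u - k (u + h r))"
        by (intro always_eventually allI) (auto simp: norm_mult)
    qed
  qed measurable
  then have lim: "((\<lambda>r. (1/2) * (\<integral>u. (if r > 0 \<and> norm (h r) \<le> 1 then cis (- (r * (\<tau> \<bullet> u))) * (k u - k (u + h r)) else 0) \<partial>lborel)) \<longlongrightarrow> 0) at_top"
    using tendsto_mult_right_zero by fastforce
  show ?thesis
  proof (rule Lim_transform_eventually[OF lim])
    show "\<forall>\<^sub>F r in at_top. (1/2) * (\<integral>u. (if r > 0 \<and> norm (h r) \<le> 1 then cis (- (r * (\<tau> \<bullet> u))) * (k u - k (u + h r)) else 0) \<partial>lborel)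
      = (\<integral>u. cis (- (r * (\<tau> \<bullet> u))) * k u \<partial>lborel)"
      using ev by eventually_elim (simp add: half)
  qed
qed

section \<open>Asymptotics at the ends of a chord\<close>

text \<open>What remains of \<open>Tpk\<close> for large \<open>l\<close> when the slice over u /
  sqrt l runs from about qA / l to about w + (tau . u) / sqrt l - qB / l. The divergent phases l w
  and sqrt l (tau . u) are kept; \<open>\<tau>\<close> measures the tilt of the far end against
  \<open>E\<close>.\<close>

definition Npk :: "'a::euclidean_space \<Rightarrow> ('a \<Rightarrow> real) \<Rightarrow> ('a \<Rightarrow> real) \<Rightarrow> 'a \<Rightarrow> real \<Rightarrow> real \<Rightarrow> 'a \<Rightarrow> complex" where
  "Npk E qA qB \<tau> w l u = \<i> * (cis (- (l * w) - sqrt l * (\<tau> \<bullet> perp E u) + qB (perp E u)) * PsiL E w u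
     - cis (- qA (perp E u)) * PsiL E 0 u)"

text \<open>The slices of \<open>\<Omega>\<close> in direction \<open>E\<close> near the chord from \<open>x0\<close> to \<open>x0 + w E\<close>, at the scale \<open>l powr (-1/2)\<close>:
  second order expansion of both ends.\<close>
definition chord_expansion :: "'a::euclidean_space set \<Rightarrow> 'a \<Rightarrow> 'a \<Rightarrow> real \<Rightarrow> ('a \<Rightarrow> real) \<Rightarrow> ('a \<Rightarrow> real) \<Rightarrow> 'a \<Rightarrow> bool" where
  "chord_expansion \<Omega> x0 E w qA qB \<tau> \<longleftrightarrow> (\<forall>u. u \<bullet> E = 0 \<longrightarrow> (\<exists>a b::real \<Rightarrow> real.
     (\<forall>\<^sub>F l in at_top. a l \<le> b l \<and> {r. x0 + ((1 / sqrt l) *\<^sub>R u + r *\<^sub>R E) \<in> \<Omega>} = {a l..b l}) \<and>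
     ((\<lambda>l. l * a l) \<longlongrightarrow> qA u) at_top \<and>
     ((\<lambda>l. l * (b l - w) - sqrt l * (\<tau> \<bullet> u)) \<longlongrightarrow> - qB u) at_top))"

text \<open>The phase l s l diverges, so only a difference can converge: a unimodular factor
  carrying the divergent part l w + sqrt l c is split off, and the remaining factor has a
  limit.\<close>

lemma tendsto_cis_Psi:
  assumes s: "((\<lambda>l. l * (s l - w) - sqrt l * c) \<longlongrightarrow> q) at_top"
  shows "((\<lambda>l. cis (- (l * s l)) * Psi l E (s l) u - cis (- (l * w) - sqrt l * c - q) * PsiL E w u) \<longlongrightarrow> 0) at_top"
proof -
  have i: "((\<lambda>l::real. 1 / l) \<longlongrightarrow> 0) at_top" "((\<lambda>l::real. sqrt l / l) \<longlongrightarrow> 0) at_top" by real_asymp+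
  have "((\<lambda>l. (l * (s l - w) - sqrt l * c) * (1 / l) + (sqrt l / l) * c + w) \<longlongrightarrow> q * 0 + 0 * c + w) at_top"
    by (intro tendsto_intros s i)
  moreover have "\<forall>\<^sub>F l in at_top. (l * (s l - w) - sqrt l * c) * (1 / l) + (sqrt l / l) * c + w = s l"
    using eventually_gt_at_top[of 0] by eventually_elim (simp add: field_simps)
  ultimately have sw: "(s \<longlongrightarrow> w) at_top"
    using Lim_transform_eventually by fastforce
  have "((\<lambda>l. cis (- (l * (s l - w) - sqrt l * c)) * Psi l E (s l) u - cis (- q) * PsiL E w u) \<longlongrightarrow> cis (- q) * PsiL E w u - cis (- q) * PsiL E w u) at_top"
    by (intro tendsto_intros tendsto_Psi[OF sw] s)
  then have nl: "((\<lambda>l. norm (cis (- (l * (s l - w) - sqrt l * c)) * Psi l E (s l) u - cis (- q) * PsiL E w u)) \<longlongrightarrow> 0) at_top"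
    by (simp add: tendsto_norm_zero)
  have ne: "norm (cis (- (l * (s l - w) - sqrt l * c)) * Psi l E (s l) u - cis (- q) * PsiL E w u)
     = norm (cis (- (l * s l)) * Psi l E (s l) u - cis (- (l * w) - sqrt l * c - q) * PsiL E w u)" for l
  proof -
    have "cis (- (l * s l)) * Psi l E (s l) u - cis (- (l * w) - sqrt l * c - q) * PsiL E w u
      = cis (- (l * w) - sqrt l * c) * (cis (- (l * (s l - w) - sqrt l * c)) * Psi l E (s l) u - cis (- q) * PsiL E w u)"
    proof -
      have "- (l * w) - sqrt l * c + - (l * (s l - w) - sqrt l * c) = - (l * s l)"
        "- (l * w) - sqrt l * c + - q = - (l * w) - sqrt l * c - q" by (simp_all add: algebra_simps)
      then show ?thesis by (simp only: right_diff_distrib[of "cis _"] mult.assoc[symmetric] cis_mult)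
    qed
    then show ?thesis by (simp add: norm_mult)
  qed
  from nl[unfolded ne] show ?thesis by (rule tendsto_norm_zero_cancel)
qed

text \<open>Dominated convergence in \<open>u\<close>, with \<open>norm_Tpk_le\<close> and
  \<open>PsiL_decay\<close> as majorants and \<open>Tpk_slice\<close> with
  \<open>tendsto_cis_Psi\<close> at each point. Neither of the two terms needs a limit of its
  own.\<close>

lemma packet_limit:
  fixes \<Omega> :: "'a::euclidean_space set"
  assumes \<Omega>: "compact \<Omega>" "convex \<Omega>" and E: "norm E = 1"
    and ch: "chord_expansion \<Omega> x0 E w qA qB \<tau>"
    and q: "continuous_on UNIV qA" "continuous_on UNIV qB"
  shows "((\<lambda>l. Kd TYPE(real) 1 * Lpk \<Omega> x0 E l - (\<integral>u. exp (- (1 / 2) * of_real ((u \<bullet> E)\<^sup>2)) * Npk E qA qB \<tau> w l u \<partial>lborel)) \<longlongrightarrow> 0) at_top"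
proof -
  have [measurable]: "\<Omega> \<in> sets borel" using \<Omega>(1) by (simp add: compact_imp_closed borel_closed)
  have [measurable]: "qA \<in> borel_measurable borel" "qB \<in> borel_measurable borel"
    using q by (auto intro: borel_measurable_continuous_onI)
  have [measurable]: "PsiL E s \<in> borel_measurable borel" for s
    using PsiL_continuous[OF E] by (rule borel_measurable_continuous_onI)
  have [measurable]: "Tpk \<Omega> x0 E l \<in> borel_measurable borel" for l
    unfolding Tpk_def by measurable
  have [measurable]: "Npk E qA qB \<tau> w l \<in> borel_measurable borel" for l
    unfolding Npk_def by measurable
  obtain S where "\<And>x. x \<in> \<Omega> \<Longrightarrow> norm x \<le> S" using compact_imp_bounded[OF \<Omega>(1)] by (auto simp: bounded_iff)
  then have S: "norm (x - x0) \<le> S + norm x0" if "x \<in> \<Omega>" for x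
    using norm_triangle_ineq4[of x x0] that by force
  define CT where "CT = 2 * \<bar>packet_const TYPE('a) (S + norm x0)\<bar>"
  have T: "norm (Tpk \<Omega> x0 E l u) \<le> CT * exp (- norm (perp E u) / 5)" if "l \<ge> 1" for l u
    unfolding CT_def by (rule norm_Tpk_le[OF \<Omega> E that S])
  obtain C1 where C1: "\<And>u. norm (PsiL E w u) \<le> C1 * exp (- norm (perp E u) / 5)" using PsiL_decay[OF E] by metis
  obtain C2 where C2: "\<And>u. norm (PsiL E 0 u) \<le> C2 * exp (- norm (perp E u) / 5)" using PsiL_decay[OF E] by metis
  have N: "norm (Npk E qA qB \<tau> w l u) \<le> (C1 + C2) * exp (- norm (perp E u) / 5)" for l u
  proof -
    have "norm (Npk E qA qB \<tau> w l u) \<le> norm (cis (- (l * w) - sqrt l * (\<tau> \<bullet> perp E u) + qB (perp E u)) * PsiL E w u) + norm (cis (- qA (perp E u)) * PsiL E 0 u)"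
      unfolding Npk_def by (simp only: norm_mult[of \<i>] norm_ii mult_1_left norm_triangle_ineq4)
    also have "\<dots> \<le> (C1 + C2) * exp (- norm (perp E u) / 5)"
      using C1[of u] C2[of u] by (simp add: norm_mult distrib_right)
    finally show ?thesis .
  qed
  define \<phi> where "\<phi> u = exp (- (1 / 2) * complex_of_real ((u \<bullet> E)\<^sup>2))" for u
  have [measurable]: "\<phi> \<in> borel_measurable borel" unfolding \<phi>_def by measurable
  have \<phi>n: "norm (\<phi> u) = exp (- ((u \<bullet> E)\<^sup>2 / 2))" for u by (simp add: \<phi>_def norm_exp_eq_Re)
  have bd: "norm (\<phi> u * z) \<le> (2 * C) * exp (- (1/5) * norm u)" if z: "norm z \<le> C * exp (- norm (perp E u) / 5)" for u z C
  proof -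
    have C: "0 \<le> C"
    proof (rule ccontr)
      assume "\<not> 0 \<le> C"
      then have "C * exp (- norm (perp E u) / 5) < 0" by (simp add: mult_neg_pos)
      then show False using z norm_ge_zero[of z] by linarith
    qed
    have "norm (\<phi> u * z) \<le> exp (- ((u \<bullet> E)\<^sup>2 / 2)) * (C * exp (- norm (perp E u) / 5))"
      unfolding norm_mult \<phi>n by (rule mult_left_mono[OF z]) simp
    also have "\<dots> = C * (exp (- ((u \<bullet> E)\<^sup>2 / 2)) * exp (- norm (perp E u) / 5))" by simp
    also have "\<dots> \<le> C * (2 * exp (- (1/5) * norm u))"
      by (rule mult_left_mono[OF gauss_exp_decay[OF E] C])
    finally show ?thesis by simp
  qed
  have eint: "integrable lborel (\<lambda>u::'a. (2 * C) * exp (- (1/5) * norm u))" for C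
    by (intro integrable_mult_right integrable_exp_norm) simp
  have Ti: "integrable lborel (\<lambda>u. \<phi> u * Tpk \<Omega> x0 E l u)" if "l \<ge> 1" for l
    by (rule norm_integral_le(1)[OF _ eint bd[OF T[OF that]]]) measurable
  have Ni: "integrable lborel (\<lambda>u. \<phi> u * Npk E qA qB \<tau> w l u)" for l
    by (rule norm_integral_le(1)[OF _ eint bd[OF N]]) measurable
  have pw: "((\<lambda>l. \<phi> u * (Tpk \<Omega> x0 E l u - Npk E qA qB \<tau> w l u)) \<longlongrightarrow> 0) at_top" for u
  proof -
    let ?u = "perp E u"
    obtain a b where ab: "\<forall>\<^sub>F l in at_top. a l \<le> b l \<and> {r. x0 + ((1 / sqrt l) *\<^sub>R ?u + r *\<^sub>R E) \<in> \<Omega>} = {a l..b l}"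
      and a: "((\<lambda>l. l * a l) \<longlongrightarrow> qA ?u) at_top"
      and b: "((\<lambda>l. l * (b l - w) - sqrt l * (\<tau> \<bullet> ?u)) \<longlongrightarrow> - qB ?u) at_top"
      using ch perp_orth(1)[OF E] unfolding chord_expansion_def by meson
    have 1: "((\<lambda>l. cis (- (l * b l)) * Psi l E (b l) u - cis (- (l * w) - sqrt l * (\<tau> \<bullet> ?u) - (- qB ?u)) * PsiL E w u) \<longlongrightarrow> 0) at_top"
      by (rule tendsto_cis_Psi[OF b])
    have 2: "((\<lambda>l. cis (- (l * a l)) * Psi l E (a l) u - cis (- (l * 0) - sqrt l * 0 - qA ?u) * PsiL E 0 u) \<longlongrightarrow> 0) at_top"
      by (rule tendsto_cis_Psi) (use a in simp)
    have "((\<lambda>l. \<phi> u * (\<i> * ((cis (- (l * b l)) * Psi l E (b l) u - cis (- (l * w) - sqrt l * (\<tau> \<bullet> ?u) - (- qB ?u)) * PsiL E w u)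
       - (cis (- (l * a l)) * Psi l E (a l) u - cis (- (l * 0) - sqrt l * 0 - qA ?u) * PsiL E 0 u)))) \<longlongrightarrow> \<phi> u * (\<i> * (0 - 0))) at_top"
      by (intro tendsto_intros 1 2)
    then have lim: "((\<lambda>l. \<phi> u * (\<i> * ((cis (- (l * b l)) * Psi l E (b l) u - cis (- (l * w) - sqrt l * (\<tau> \<bullet> ?u) - (- qB ?u)) * PsiL E w u)
       - (cis (- (l * a l)) * Psi l E (a l) u - cis (- (l * 0) - sqrt l * 0 - qA ?u) * PsiL E 0 u)))) \<longlongrightarrow> 0) at_top"
      by simp
    show ?thesis
    proof (rule Lim_transform_eventually[OF lim])
      show "\<forall>\<^sub>F l in at_top. \<phi> u * (\<i> * ((cis (- (l * b l)) * Psi l E (b l) u - cis (- (l * w) - sqrt l * (\<tau> \<bullet> ?u) - (- qB ?u)) * PsiL E w u)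
       - (cis (- (l * a l)) * Psi l E (a l) u - cis (- (l * 0) - sqrt l * 0 - qA ?u) * PsiL E 0 u)))
         = \<phi> u * (Tpk \<Omega> x0 E l u - Npk E qA qB \<tau> w l u)"
        using ab eventually_gt_at_top[of 0]
      proof eventually_elim
        case (elim l)
        have t: "Tpk \<Omega> x0 E l u = \<i> * (cis (- (l * b l)) * Psi l E (b l) u - cis (- (l * a l)) * Psi l E (a l) u)"
          by (rule Tpk_slice[OF E elim(2) \<Omega>(1)]) (use elim(1) in auto)
        show ?case unfolding t Npk_def by (simp add: algebra_simps)
      qed
    qed
  qed
  have "((\<lambda>l. \<integral>u. (if l \<ge> 1 then \<phi> u * (Tpk \<Omega> x0 E l u - Npk E qA qB \<tau> w l u) else 0) \<partial>lborel) \<longlongrightarrow> (\<integral>(u::'a). 0 \<partial>lborel)) at_top"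
  proof (rule integral_dominated_convergence_at_top[OF _ _ eint[of "CT + (C1 + C2)"]])
    show "AE u in lborel. ((\<lambda>l. if l \<ge> 1 then \<phi> u * (Tpk \<Omega> x0 E l u - Npk E qA qB \<tau> w l u) else 0) \<longlongrightarrow> 0) at_top"
    proof (rule AE_I2, rule Lim_transform_eventually[OF pw])
      fix u
      show "\<forall>\<^sub>F l in at_top. \<phi> u * (Tpk \<Omega> x0 E l u - Npk E qA qB \<tau> w l u) = (if l \<ge> 1 then \<phi> u * (Tpk \<Omega> x0 E l u - Npk E qA qB \<tau> w l u) else 0)"
        using eventually_ge_at_top[of 1] by eventually_elim simp
    qed
    show "\<forall>\<^sub>F l in at_top. AE u in lborel. norm (if l \<ge> 1 then \<phi> u * (Tpk \<Omega> x0 E l u - Npk E qA qB \<tau> w l u) else 0) \<le> 2 * (CT + (C1 + C2)) * exp (- (1/5) * norm u)"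
      using eventually_ge_at_top[of 1]
    proof (eventually_elim, intro AE_I2)
      fix l :: real and u assume l: "1 \<le> l"
      have "norm (Tpk \<Omega> x0 E l u - Npk E qA qB \<tau> w l u) \<le> (CT + (C1 + C2)) * exp (- norm (perp E u) / 5)"
        using norm_triangle_ineq4[of "Tpk \<Omega> x0 E l u" "Npk E qA qB \<tau> w l u"] T[OF l, of u] N[of l u] by (simp add: distrib_right)
      from bd[OF this] show "norm (if l \<ge> 1 then \<phi> u * (Tpk \<Omega> x0 E l u - Npk E qA qB \<tau> w l u) else 0) \<le> 2 * (CT + (C1 + C2)) * exp (- (1/5) * norm u)"
        using l by simp
    qed
  qed measurable
  then have lim: "((\<lambda>l. \<integral>u. (if l \<ge> 1 then \<phi> u * (Tpk \<Omega> x0 E l u - Npk E qA qB \<tau> w l u) else 0) \<partial>lborel) \<longlongrightarrow> 0) at_top" by simp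
  have "((\<lambda>l. Kd TYPE(real) 1 * Lpk \<Omega> x0 E l - (\<integral>u. \<phi> u * Npk E qA qB \<tau> w l u \<partial>lborel)) \<longlongrightarrow> 0) at_top"
  proof (rule Lim_transform_eventually[OF lim])
    show "\<forall>\<^sub>F l in at_top. (\<integral>u. (if l \<ge> 1 then \<phi> u * (Tpk \<Omega> x0 E l u - Npk E qA qB \<tau> w l u) else 0) \<partial>lborel)
      = Kd TYPE(real) 1 * Lpk \<Omega> x0 E l - (\<integral>u. \<phi> u * Npk E qA qB \<tau> w l u \<partial>lborel)"
      using eventually_ge_at_top[of 1]
    proof eventually_elim
      case (elim l)
      have "Kd TYPE(real) 1 * Lpk \<Omega> x0 E l = (\<integral>u. \<phi> u * Tpk \<Omega> x0 E l u \<partial>lborel)"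
        unfolding \<phi>_def using elim by (intro Lpk_Tpk[OF E _ \<Omega>(1)]) simp
      then show ?case
        using elim Bochner_Integration.integral_diff[OF Ti[OF elim] Ni[of l]] by (simp add: right_diff_distrib)
    qed
  qed
  then show ?thesis unfolding \<phi>_def .
qed

text \<open>Amplitude contributed by a chord end at distance \<open>s\<close> from \<open>x0\<close>
  where the boundary is normal to \<open>E\<close>; \<open>q\<close> is the second order term
  there.\<close>

definition Mpk :: "'a::euclidean_space \<Rightarrow> ('a \<Rightarrow> real) \<Rightarrow> real \<Rightarrow> complex" where
  "Mpk E q s = (\<integral>u. exp (- (1 / 2) * of_real ((u \<bullet> E)\<^sup>2)) * (cis (q (perp E u)) * PsiL E s u) \<partial>lborel)"

text \<open>At distance 0 the kernel \<open>PsiL\<close> is a real Gaussian, so the amplitude is a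
  Gaussian chirp with quadratic form \<open>B\<close>.\<close>

lemma Mpk_start_nonzero:
  fixes B :: "'a::euclidean_space \<Rightarrow> 'a"
  assumes E: "norm E = 1" and B: "linear B" "\<And>u v. B u \<bullet> v = u \<bullet> B v"
    and q: "\<And>u. qA (perp E u) = (B u \<bullet> u) / 2"
  shows "Mpk E (\<lambda>u. - qA u) 0 \<noteq> 0"
proof -
  obtain \<kappa> where "\<And>u. PsiL E 0 u = \<kappa> * exp (- of_real ((norm (perp E u))\<^sup>2) / (2 * (1 - \<i> * of_real 0)))"
    "0 = (0::real) \<Longrightarrow> \<kappa> = Kd TYPE('a) 1" using PsiL_gauss[OF E, of 0] by metis
  then have P: "PsiL E 0 u = Kd TYPE('a) 1 * exp (- of_real ((norm (perp E u))\<^sup>2) / 2)" for u by simp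
  have "exp (- (1 / 2) * of_real ((u \<bullet> E)\<^sup>2)) * (cis (- qA (perp E u)) * PsiL E 0 u)
    = Kd TYPE('a) 1 * exp (- complex_of_real ((1 / 2) * (norm u)\<^sup>2) - (\<i> / 2) * of_real (B u \<bullet> u))" for u
  proof -
    have "exp (- (1 / 2) * of_real ((u \<bullet> E)\<^sup>2)) * (cis (- qA (perp E u)) * PsiL E 0 u)
      = Kd TYPE('a) 1 * exp (- (1 / 2) * of_real ((u \<bullet> E)\<^sup>2) + (\<i> * of_real (- qA (perp E u)) + - of_real ((norm (perp E u))\<^sup>2) / 2))"
      unfolding P cis_conv_exp exp_add by (simp only: mult_ac)
    also have "- (1 / 2) * of_real ((u \<bullet> E)\<^sup>2) + (\<i> * of_real (- qA (perp E u)) + - of_real ((norm (perp E u))\<^sup>2) / 2)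
      = - complex_of_real ((1 / 2) * (norm u)\<^sup>2) - (\<i> / 2) * of_real (B u \<bullet> u)"
      unfolding q norm_perp_sq[OF E] by (simp add: field_simps)
    finally show ?thesis .
  qed
  then have "Mpk E (\<lambda>u. - qA u) 0 = Kd TYPE('a) 1 * (\<integral>u. exp (- complex_of_real ((1 / 2) * (norm u)\<^sup>2) - (\<i> / 2) * of_real (B u \<bullet> u)) \<partial>lborel)"
    unfolding Mpk_def by simp
  moreover have "Kd TYPE('a) 1 \<noteq> 0" using Kd_real_pos[of 1, where 'a='a] by simp
  ultimately show ?thesis using gauss_chirp_nonzero[OF zero_less_one B] by simp
qed

text \<open>Vanishing packets say that cis (- l w) times the amplitude of the far end tends to the
  amplitude \<open>Mp\<close> of the near end, which is not 0. A nonzero tilt would make the far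
  amplitude oscillate with frequency sqrt l and vanish by Riemann-Lebesgue. Without tilt it is
  constant, and only its modulus can be compared, since the factor cis (- l w) is
  uncontrolled.\<close>

lemma packet_dichotomy:
  fixes \<Omega> :: "'a::euclidean_space set" and B :: "'a \<Rightarrow> 'a"
  assumes \<Omega>: "compact \<Omega>" "convex \<Omega>" and E: "norm E = 1"
    and ch: "chord_expansion \<Omega> x0 E w qA qB \<tau>" and \<tau>E: "\<tau> \<bullet> E = 0"
    and q: "continuous_on UNIV qA" "continuous_on UNIV qB"
    and B: "linear B" "\<And>u v. B u \<bullet> v = u \<bullet> B v" "\<And>u. qA (perp E u) = (B u \<bullet> u) / 2"
    and l: "filterlim l at_top sequentially" and lim: "(\<lambda>n. Lpk \<Omega> x0 E (l n)) \<longlonglongrightarrow> 0"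
  shows "\<tau> = 0" "norm (Mpk E qB w) = norm (Mpk E (\<lambda>u. - qA u) 0)"
proof -
  have [measurable]: "qA \<in> borel_measurable borel" "qB \<in> borel_measurable borel"
    using q by (auto intro: borel_measurable_continuous_onI)
  have [measurable]: "PsiL E s \<in> borel_measurable borel" for s
    using PsiL_continuous[OF E] by (rule borel_measurable_continuous_onI)
  define \<phi> where "\<phi> u = exp (- (1 / 2) * complex_of_real ((u \<bullet> E)\<^sup>2))" for u
  have [measurable]: "\<phi> \<in> borel_measurable borel" unfolding \<phi>_def by measurable
  have \<phi>n: "norm (\<phi> u) = exp (- ((u \<bullet> E)\<^sup>2 / 2))" for u by (simp add: \<phi>_def norm_exp_eq_Re)
  have bound: "\<exists>C. \<forall>u::'a. norm (\<phi> u * PsiL E s u) \<le> C * exp (- (1/5) * norm u)" for s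
  proof -
    obtain C where C: "\<And>u. norm (PsiL E s u) \<le> C * exp (- norm (perp E u) / 5)" "C \<ge> 0" using PsiL_decay[OF E] by metis
    have "norm (\<phi> u * PsiL E s u) \<le> (2 * C) * exp (- (1/5) * norm u)" for u
    proof -
      have "norm (\<phi> u * PsiL E s u) \<le> exp (- ((u \<bullet> E)\<^sup>2 / 2)) * (C * exp (- norm (perp E u) / 5))"
        unfolding norm_mult \<phi>n by (rule mult_left_mono[OF C(1)]) simp
      also have "\<dots> = C * (exp (- ((u \<bullet> E)\<^sup>2 / 2)) * exp (- norm (perp E u) / 5))" by simp
      also have "\<dots> \<le> C * (2 * exp (- (1/5) * norm u))"
        by (rule mult_left_mono[OF gauss_exp_decay[OF E] C(2)])
      finally show ?thesis by simp
    qed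
    then show ?thesis by blast
  qed
  have int: "integrable lborel (\<lambda>u. cis (g u) * (\<phi> u * PsiL E s u))" if [measurable]: "g \<in> borel_measurable borel" for g s
  proof -
    obtain C where C: "\<And>u::'a. norm (\<phi> u * PsiL E s u) \<le> C * exp (- (1/5) * norm u)" using bound by meson
    show ?thesis
    proof (rule norm_integral_le(1))
      show "integrable lborel (\<lambda>u::'a. C * exp (- (1/5) * norm u))" by (intro integrable_mult_right integrable_exp_norm) simp
      show "norm (cis (g u) * (\<phi> u * PsiL E s u)) \<le> C * exp (- (1/5) * norm u)" for u
        unfolding norm_mult[of "cis _"] norm_cis mult_1_left by (rule C)
    qed measurable
  qed
  define Mm Mp where "Mm l = (\<integral>u. cis (- (sqrt l * (\<tau> \<bullet> u))) * (cis (qB (perp E u)) * (\<phi> u * PsiL E w u)) \<partial>lborel)"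
    and "Mp = Mpk E (\<lambda>u. - qA u) 0" for l
  have \<tau>p: "\<tau> \<bullet> perp E u = \<tau> \<bullet> u" for u using \<tau>E by (simp add: perp_def inner_diff_right)
  have NM: "(\<integral>u. exp (- (1 / 2) * of_real ((u \<bullet> E)\<^sup>2)) * Npk E qA qB \<tau> w l u \<partial>lborel) = \<i> * (cis (- (l * w)) * Mm l - Mp)" for l
  proof -
    have "exp (- (1 / 2) * of_real ((u \<bullet> E)\<^sup>2)) * Npk E qA qB \<tau> w l u
      = \<i> * (cis (- (l * w)) * (cis (- (sqrt l * (\<tau> \<bullet> u)) + qB (perp E u)) * (\<phi> u * PsiL E w u)) - cis (- qA (perp E u)) * (\<phi> u * PsiL E 0 u))" for u
    proof -
      have "cis (- (l * w) - sqrt l * (\<tau> \<bullet> u) + qB (perp E u)) = cis (- (l * w)) * cis (- (sqrt l * (\<tau> \<bullet> u)) + qB (perp E u))"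
        by (simp add: cis_mult algebra_simps)
      then show ?thesis unfolding Npk_def \<phi>_def[symmetric] \<tau>p by (simp only: right_diff_distrib mult_ac)
    qed
    moreover have "Mm l = (\<integral>u. cis (- (sqrt l * (\<tau> \<bullet> u)) + qB (perp E u)) * (\<phi> u * PsiL E w u) \<partial>lborel)"
      unfolding Mm_def by (simp only: mult.assoc[symmetric] cis_mult)
    moreover have "Mp = (\<integral>u. cis (- qA (perp E u)) * (\<phi> u * PsiL E 0 u) \<partial>lborel)"
      unfolding Mp_def Mpk_def \<phi>_def[symmetric] by (simp only: mult.left_commute)
    ultimately show ?thesis
      using int[of "\<lambda>u. - (sqrt l * (\<tau> \<bullet> u)) + qB (perp E u)" w] int[of "\<lambda>u. - qA (perp E u)" 0] by simp
  qed
  have "(\<lambda>n. Kd TYPE(real) 1 * Lpk \<Omega> x0 E (l n) - \<i> * (cis (- (l n * w)) * Mm (l n) - Mp)) \<longlonglongrightarrow> 0"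
    using filterlim_compose[OF packet_limit[OF \<Omega> E ch q] l] by (simp only: NM)
  from tendsto_diff[OF tendsto_mult[OF tendsto_const[of "Kd TYPE(real) 1"] lim] this]
  have "(\<lambda>n. \<i> * (cis (- (l n * w)) * Mm (l n) - Mp)) \<longlonglongrightarrow> 0" by simp
  then have "(\<lambda>n. (- \<i>) * (\<i> * (cis (- (l n * w)) * Mm (l n) - Mp))) \<longlonglongrightarrow> (- \<i>) * 0" by (intro tendsto_intros)
  then have "(\<lambda>n. cis (- (l n * w)) * Mm (l n) - Mp) \<longlonglongrightarrow> 0" by (simp add: mult.assoc[symmetric] del: mult.assoc)
  then have "(\<lambda>n. cis (- (l n * w)) * Mm (l n)) \<longlonglongrightarrow> Mp" by (simp add: LIM_zero_iff)
  from tendsto_norm[OF this] have lim2: "(\<lambda>n. norm (Mm (l n))) \<longlonglongrightarrow> norm Mp" by (simp add: norm_mult)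
  show t0: "\<tau> = 0"
  proof (rule ccontr)
    assume \<tau>: "\<tau> \<noteq> 0"
    obtain C where C: "\<And>u::'a. norm (\<phi> u * PsiL E w u) \<le> C * exp (- (1/5) * norm u)" using bound by meson
    have "((\<lambda>r. \<integral>u. cis (- (r * (\<tau> \<bullet> u))) * (cis (qB (perp E u)) * (\<phi> u * PsiL E w u)) \<partial>lborel) \<longlongrightarrow> 0) at_top"
    proof (rule riemann_lebesgue_decay[OF _ _ \<tau>])
      have "continuous_on UNIV (\<lambda>u. qB (perp E u))"
        unfolding perp_def by (intro continuous_on_compose2[OF q(2)] continuous_intros) auto
      then show "continuous_on UNIV (\<lambda>u. cis (qB (perp E u)) * (\<phi> u * PsiL E w u))"
        unfolding \<phi>_def by (intro continuous_intros PsiL_continuous[OF E]) auto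
      show "norm (cis (qB (perp E u)) * (\<phi> u * PsiL E w u)) \<le> C * exp (- (1/5) * norm u)" for u
        using C[of u] by (simp add: norm_mult)
    qed
    moreover have "filterlim (\<lambda>n. sqrt (l n)) at_top sequentially"
      by (rule filterlim_compose[OF sqrt_at_top l])
    ultimately have "(\<lambda>n. Mm (l n)) \<longlonglongrightarrow> 0" unfolding Mm_def by (rule filterlim_compose)
    from tendsto_norm[OF this] have "norm Mp = 0" using lim2 LIMSEQ_unique by fastforce
    then show False using Mpk_start_nonzero[OF E B] by (simp add: Mp_def)
  qed
  have "Mm r = Mpk E qB w" for r unfolding Mm_def Mpk_def \<phi>_def[symmetric] t0 by (simp add: mult.left_commute)
  then have "(\<lambda>n. norm (Mpk E qB w)) \<longlonglongrightarrow> norm Mp" using lim2 by simp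
  then show "norm (Mpk E qB w) = norm (Mpk E (\<lambda>u. - qA u) 0)"
    unfolding Mp_def[symmetric] by (simp add: LIMSEQ_const_iff)
qed

section \<open>Second order behaviour of the boundary\<close>

text \<open>Second order description of the boundary at \<open>p\<close>: along a curve \<open>p + h t\<close> with
  \<open>h t = t z + o(t)\<close> the point is inside or outside according to the sign of \<open>g \<bullet> h t + H (t z) (t z)\<close>.\<close>
definition quad_bdry :: "'a::euclidean_space set \<Rightarrow> 'a \<Rightarrow> 'a \<Rightarrow> ('a \<Rightarrow> 'a \<Rightarrow> real) \<Rightarrow> bool" where
  "quad_bdry \<Omega> p g H \<longleftrightarrow> g \<noteq> 0 \<and> bounded_bilinear H \<and>
    (\<forall>h z k. ((\<lambda>t. h t /\<^sub>R t) \<longlongrightarrow> z) (at_right 0) \<longrightarrow> ((\<lambda>t. g \<bullet> h t / t\<^sup>2) \<longlongrightarrow> k) (at_right 0) \<longrightarrow>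
      (k + H z z > 0 \<longrightarrow> (\<forall>\<^sub>F t in at_right 0. p + h t \<in> interior \<Omega>)) \<and>
      (k + H z z < 0 \<longrightarrow> (\<forall>\<^sub>F t in at_right 0. p + h t \<notin> \<Omega>)))"

lemma quad_bdryD:
  assumes qb: "quad_bdry \<Omega> p g H"
    and hz: "((\<lambda>t. h t /\<^sub>R t) \<longlongrightarrow> z) (at_right 0)" and gk: "((\<lambda>t. g \<bullet> h t / t\<^sup>2) \<longlongrightarrow> k) (at_right 0)"
  shows "k + H z z > 0 \<Longrightarrow> \<forall>\<^sub>F t in at_right 0. p + h t \<in> interior \<Omega>"
    and "k + H z z < 0 \<Longrightarrow> \<forall>\<^sub>F t in at_right 0. p + h t \<notin> \<Omega>"
  using qb[unfolded quad_bdry_def, THEN conjunct2, THEN conjunct2, THEN spec, THEN spec, THEN spec, THEN mp, THEN mp, OF hz gk]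
  by simp_all

lemma tendsto_at_right_cong:
  fixes f g :: "real \<Rightarrow> 'b::topological_space"
  assumes "(f \<longlongrightarrow> l) (at_right 0)" "\<And>t. t > 0 \<Longrightarrow> f t = g t"
  shows "(g \<longlongrightarrow> l) (at_right 0)"
  using assms(1) by (rule Lim_transform_eventually) (use eventually_at_right_less[of "0::real"] in \<open>eventually_elim, simp add: assms(2)\<close>)

text \<open>\<open>\<Phi>\<close> is a defining function of the body near \<open>p\<close>. Along an
  admissible curve its Taylor expansion divided by t^2 tends to \<open>k + H z z\<close>, so a
  nonzero limit fixes its sign.\<close>

lemma quad_bdryI:
  fixes \<Phi> :: "'a::euclidean_space \<Rightarrow> real"
  assumes g: "g \<noteq> 0" and H: "bounded_bilinear H" and \<epsilon>: "\<epsilon> > 0"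
    and mem: "\<And>h. norm h < \<epsilon> \<Longrightarrow> p + h \<in> \<Omega> \<longleftrightarrow> \<Phi> h \<ge> 0"
    and cont: "continuous_on (ball 0 \<epsilon>) \<Phi>"
    and taylor: "\<And>h. norm h < \<epsilon> \<Longrightarrow> \<Phi> h = g \<bullet> h + H h h + \<rho> h * (norm h)\<^sup>2"
    and \<rho>: "(\<rho> \<longlongrightarrow> 0) (nhds 0)"
  shows "quad_bdry \<Omega> p g H"
  unfolding quad_bdry_def
proof (intro conjI allI impI)
  fix h :: "real \<Rightarrow> 'a" and z k
  assume hz: "((\<lambda>t. h t /\<^sub>R t) \<longlongrightarrow> z) (at_right 0)" and gk: "((\<lambda>t. g \<bullet> h t / t\<^sup>2) \<longlongrightarrow> k) (at_right 0)"
  interpret H: bounded_bilinear H by (rule H)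
  have pos: "\<forall>\<^sub>F t in at_right (0::real). t > 0" by (rule eventually_at_right_less)
  have "((\<lambda>t. t *\<^sub>R (h t /\<^sub>R t)) \<longlongrightarrow> 0 *\<^sub>R z) (at_right 0)"
    by (intro tendsto_scaleR tendsto_ident_at hz)
  then have "((\<lambda>t. t *\<^sub>R (h t /\<^sub>R t)) \<longlongrightarrow> 0) (at_right 0)" by simp
  then have h0: "(h \<longlongrightarrow> 0) (at_right 0)" by (rule tendsto_at_right_cong) simp
  have small: "\<forall>\<^sub>F t in at_right 0. norm (h t) < \<epsilon>"
    using tendstoD[OF h0 \<epsilon>] by (simp add: dist_norm)
  have "((\<lambda>t. g \<bullet> h t / t\<^sup>2 + H (h t /\<^sub>R t) (h t /\<^sub>R t) + \<rho> (h t) * (norm (h t /\<^sub>R t))\<^sup>2) \<longlongrightarrow> k + H z z + 0 * (norm z)\<^sup>2) (at_right 0)"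
    by (intro tendsto_intros gk H.tendsto hz filterlim_compose[OF \<rho> h0])
  moreover have "\<forall>\<^sub>F t in at_right 0. g \<bullet> h t / t\<^sup>2 + H (h t /\<^sub>R t) (h t /\<^sub>R t) + \<rho> (h t) * (norm (h t /\<^sub>R t))\<^sup>2 = \<Phi> (h t) / t\<^sup>2"
    using pos small
  proof eventually_elim
    case (elim t)
    show ?case unfolding taylor[OF elim(2)] using elim(1)
      by (simp add: H.scaleR_left H.scaleR_right power_mult_distrib power2_eq_square field_simps)
  qed
  ultimately have lim: "((\<lambda>t. \<Phi> (h t) / t\<^sup>2) \<longlongrightarrow> k + H z z) (at_right 0)"
    using Lim_transform_eventually by fastforce
  show "\<forall>\<^sub>F t in at_right 0. p + h t \<in> interior \<Omega>" if "k + H z z > 0"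
  proof -
    have "\<forall>\<^sub>F t in at_right 0. \<Phi> (h t) / t\<^sup>2 > 0" using order_tendstoD(1)[OF lim that] .
    then show ?thesis using pos small
    proof eventually_elim
      case (elim t)
      then have P: "\<Phi> (h t) > 0" by (simp add: zero_less_divide_iff)
      have "open (ball 0 \<epsilon> \<inter> \<Phi> -` {0<..})"
        using cont by (intro continuous_open_preimage) auto
      then have "open ((+) p ` (ball 0 \<epsilon> \<inter> \<Phi> -` {0<..}))" by (rule open_translation)
      moreover have "(+) p ` (ball 0 \<epsilon> \<inter> \<Phi> -` {0<..}) \<subseteq> \<Omega>" using mem by auto
      moreover have "p + h t \<in> (+) p ` (ball 0 \<epsilon> \<inter> \<Phi> -` {0<..})" using P elim by auto
      ultimately show ?case by (metis interiorI)
    qed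
  qed
  show "\<forall>\<^sub>F t in at_right 0. p + h t \<notin> \<Omega>" if "k + H z z < 0"
  proof -
    have "\<forall>\<^sub>F t in at_right 0. \<Phi> (h t) / t\<^sup>2 < 0" using order_tendstoD(2)[OF lim that] .
    then show ?thesis using pos small
    proof eventually_elim
      case (elim t)
      then have "\<Phi> (h t) < 0" by (simp add: divide_less_0_iff)
      then show ?case using mem[OF elim(3)] by simp
    qed
  qed
qed (use g H in auto)

text \<open>Tested with the curve t^2 (x - p), for which \<open>z\<close> is 0 and \<open>k\<close>
  is \<open>g \<bullet> (x - p)\<close>; convexity keeps it in the body for t < 1.\<close>

lemma quad_bdry_support:
  assumes qb: "quad_bdry \<Omega> p g H" and \<Omega>: "convex \<Omega>" and p: "p \<in> \<Omega>" and x: "x \<in> \<Omega>"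
  shows "g \<bullet> (x - p) \<ge> 0"
proof (rule ccontr)
  assume neg: "\<not> g \<bullet> (x - p) \<ge> 0"
  interpret H: bounded_bilinear H using qb by (simp add: quad_bdry_def)
  let ?h = "\<lambda>t::real. t\<^sup>2 *\<^sub>R (x - p)"
  have pos: "\<forall>\<^sub>F t in at_right (0::real). 0 < t \<and> t < 1"
    using eventually_at_right_less[of 0] eventually_at_right_field[of _ 0] by (auto simp: eventually_at_right_field intro: exI[of _ 1])
  have "((\<lambda>t::real. t *\<^sub>R (x - p)) \<longlongrightarrow> 0 *\<^sub>R (x - p)) (at_right 0)"
    by (intro tendsto_scaleR tendsto_ident_at tendsto_const)
  then have "((\<lambda>t::real. t *\<^sub>R (x - p)) \<longlongrightarrow> 0) (at_right 0)" by simp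
  then have 1: "((\<lambda>t. ?h t /\<^sub>R t) \<longlongrightarrow> 0) (at_right 0)"
    by (rule tendsto_at_right_cong) (simp add: power2_eq_square)
  have 2: "((\<lambda>t. g \<bullet> ?h t / t\<^sup>2) \<longlongrightarrow> g \<bullet> (x - p)) (at_right 0)"
    by (rule tendsto_at_right_cong[OF tendsto_const]) simp
  have "g \<bullet> (x - p) + H 0 0 < 0" using neg by (simp add: H.zero_left)
  then have "\<forall>\<^sub>F t in at_right 0. p + ?h t \<notin> \<Omega>" by (rule quad_bdryD(2)[OF qb 1 2])
  moreover have "\<forall>\<^sub>F t in at_right 0. p + ?h t \<in> \<Omega>"
    using pos
  proof eventually_elim
    case (elim t)
    have "(1 - t\<^sup>2) *\<^sub>R p + t\<^sup>2 *\<^sub>R x \<in> \<Omega>"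
      using elim p x \<Omega> by (intro convexD) (auto simp: power_le_one)
    then show ?case by (simp add: algebra_simps)
  qed
  ultimately have "\<forall>\<^sub>F t::real in at_right 0. False" by eventually_elim simp
  then show False by simp
qed

lemma quad_bdry_support_interior:
  assumes qb: "quad_bdry \<Omega> p g H" and \<Omega>: "convex \<Omega>" and p: "p \<in> \<Omega>" and x: "x \<in> interior \<Omega>"
  shows "g \<bullet> (x - p) > 0"
proof -
  have g: "g \<noteq> 0" using qb by (simp add: quad_bdry_def)
  obtain e where e: "e > 0" "cball x e \<subseteq> \<Omega>" using x by (auto simp: mem_interior_cball)
  have "x - (e / norm g) *\<^sub>R g \<in> \<Omega>" using e g by (intro subsetD[OF e(2)]) (auto simp: dist_norm)
  from quad_bdry_support[OF qb \<Omega> p this]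
  have "(e / norm g) * (g \<bullet> g) \<le> g \<bullet> (x - p)" by (simp add: inner_diff_right algebra_simps)
  moreover have "(e / norm g) * (g \<bullet> g) > 0" using e g by simp
  ultimately show ?thesis by linarith
qed

lemma quad_bdry_ray:
  assumes qb: "quad_bdry \<Omega> p g H" and "g \<bullet> z = 0"
  shows "k * (g \<bullet> E) + H z z > 0 \<Longrightarrow> \<forall>\<^sub>F t in at_right 0. p + (t *\<^sub>R z + (t\<^sup>2 * k) *\<^sub>R E) \<in> interior \<Omega>"
    and "k * (g \<bullet> E) + H z z < 0 \<Longrightarrow> \<forall>\<^sub>F t in at_right 0. p + (t *\<^sub>R z + (t\<^sup>2 * k) *\<^sub>R E) \<notin> \<Omega>"
proof -
  let ?h = "\<lambda>t::real. t *\<^sub>R z + (t\<^sup>2 * k) *\<^sub>R E"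
  have pos: "\<forall>\<^sub>F t in at_right (0::real). t > 0" by (rule eventually_at_right_less)
  have "((\<lambda>t::real. z + (t * k) *\<^sub>R E) \<longlongrightarrow> z + (0 * k) *\<^sub>R E) (at_right 0)"
    by (intro tendsto_intros tendsto_ident_at)
  then have "((\<lambda>t::real. z + (t * k) *\<^sub>R E) \<longlongrightarrow> z) (at_right 0)" by simp
  then have 1: "((\<lambda>t. ?h t /\<^sub>R t) \<longlongrightarrow> z) (at_right 0)"
    by (rule tendsto_at_right_cong) (simp add: power2_eq_square scaleR_add_right)
  have 2: "((\<lambda>t. g \<bullet> ?h t / t\<^sup>2) \<longlongrightarrow> k * (g \<bullet> E)) (at_right 0)"
    by (rule tendsto_at_right_cong[OF tendsto_const]) (simp add: inner_add_right assms(2))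
  show "k * (g \<bullet> E) + H z z > 0 \<Longrightarrow> \<forall>\<^sub>F t in at_right 0. p + ?h t \<in> interior \<Omega>"
    "k * (g \<bullet> E) + H z z < 0 \<Longrightarrow> \<forall>\<^sub>F t in at_right 0. p + ?h t \<notin> \<Omega>"
    by (rule quad_bdryD[OF qb 1 2], assumption)+
qed

text \<open>\<open>\<tau>\<close> is chosen such that
  \<open>u + (\<tau> \<bullet> u) *\<^sub>R E\<close> is orthogonal to \<open>gB\<close>, hence
  tangent at the far end. With t = 1 / sqrt l, \<open>quad_bdry_ray\<close> shows that moving the
  predicted end by eta / l to one side gives a point of the body and to the other side a point
  outside, which brackets the true end of the slice.\<close>

lemma chord_expansionI:
  fixes \<Omega> :: "'a::euclidean_space set"
  assumes \<Omega>: "compact \<Omega>" "convex \<Omega>" and E: "norm E = 1"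
    and qA: "quad_bdry \<Omega> x0 gA HA" and gA: "gA = \<alpha> *\<^sub>R E" "\<alpha> > 0"
    and qB: "quad_bdry \<Omega> (x0 + w *\<^sub>R E) gB HB" and gB: "gB \<bullet> E < 0" and w: "w > 0"
  defines "\<tau> \<equiv> - (1 / (gB \<bullet> E)) *\<^sub>R perp E gB"
  shows "chord_expansion \<Omega> x0 E w (\<lambda>u. - HA u u / \<alpha>)
     (\<lambda>u. HB (u + (\<tau> \<bullet> u) *\<^sub>R E) (u + (\<tau> \<bullet> u) *\<^sub>R E) / (gB \<bullet> E)) \<tau>"
  unfolding chord_expansion_def
proof (intro allI impI)
  fix u :: 'a assume u: "u \<bullet> E = 0"
  have EE: "E \<bullet> E = 1" using E by (simp add: dot_square_norm)
  define z where "z = u + (\<tau> \<bullet> u) *\<^sub>R E"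
  define cA cB where "cA = - HA u u / \<alpha>" and "cB = HB z z / (gB \<bullet> E)"
  define S where "S l = {r. x0 + ((1 / sqrt l) *\<^sub>R u + r *\<^sub>R E) \<in> \<Omega>}" for l :: real
  have gz: "gB \<bullet> z = 0"
  proof -
    have "perp E gB \<bullet> u = gB \<bullet> u" using u by (simp add: perp_def inner_diff_left inner_commute[of E u])
    then show ?thesis using gB by (simp add: z_def \<tau>_def inner_add_right inner_diff_right)
  qed
  have gu: "gA \<bullet> u = 0" using u by (simp add: gA inner_commute)
  have at: "filterlim (\<lambda>l. 1 / sqrt l) (at_right 0) at_top" by real_asymp
  have in_A: "\<forall>\<^sub>F l in at_top. (cA + \<eta>) / l \<in> S l" and out_A: "\<forall>\<^sub>F l in at_top. (cA - \<eta>) / l \<notin> S l"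
    and in_B: "\<forall>\<^sub>F l in at_top. w + (\<tau> \<bullet> u) / sqrt l + (- cB - \<eta>) / l \<in> S l"
    and out_B: "\<forall>\<^sub>F l in at_top. w + (\<tau> \<bullet> u) / sqrt l + (- cB + \<eta>) / l \<notin> S l" if \<eta>: "\<eta> > 0" for \<eta>
  proof -
    have A: "x0 + ((1 / sqrt l) *\<^sub>R u + ((1 / sqrt l)\<^sup>2 * k) *\<^sub>R E) \<in> \<Omega> \<longleftrightarrow> k / l \<in> S l" if "l > 0" for k l
      using that by (simp add: S_def power_divide)
    have B: "(x0 + w *\<^sub>R E) + ((1 / sqrt l) *\<^sub>R z + ((1 / sqrt l)\<^sup>2 * k) *\<^sub>R E) \<in> \<Omega> \<longleftrightarrow> w + (\<tau> \<bullet> u) / sqrt l + k / l \<in> S l" if "l > 0" for k l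
    proof -
      have "(x0 + w *\<^sub>R E) + ((1 / sqrt l) *\<^sub>R z + ((1 / sqrt l)\<^sup>2 * k) *\<^sub>R E) = x0 + ((1 / sqrt l) *\<^sub>R u + (w + (\<tau> \<bullet> u) / sqrt l + k / l) *\<^sub>R E)"
        using that by (simp add: z_def power_divide algebra_simps)
      then show ?thesis unfolding S_def by (simp only: mem_Collect_eq)
    qed
    have "(cA + \<eta>) * (gA \<bullet> E) + HA u u > 0" using gA \<eta> by (simp add: cA_def EE field_simps)
    from filterlim_iff[THEN iffD1, OF at, rule_format, OF quad_bdry_ray(1)[OF qA gu this]]
    show "\<forall>\<^sub>F l in at_top. (cA + \<eta>) / l \<in> S l"
      using eventually_gt_at_top[of 0] by eventually_elim (use A interior_subset in blast)
    have "(cA - \<eta>) * (gA \<bullet> E) + HA u u < 0" using gA \<eta> by (simp add: cA_def EE field_simps)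
    from filterlim_iff[THEN iffD1, OF at, rule_format, OF quad_bdry_ray(2)[OF qA gu this]]
    show "\<forall>\<^sub>F l in at_top. (cA - \<eta>) / l \<notin> S l"
      using eventually_gt_at_top[of 0] by eventually_elim (use A in blast)
    have "(- cB - \<eta>) * (gB \<bullet> E) + HB z z > 0"
      using gB \<eta> mult_pos_neg[of \<eta> "gB \<bullet> E"] by (simp add: cB_def left_diff_distrib)
    from filterlim_iff[THEN iffD1, OF at, rule_format, OF quad_bdry_ray(1)[OF qB gz this]]
    show "\<forall>\<^sub>F l in at_top. w + (\<tau> \<bullet> u) / sqrt l + (- cB - \<eta>) / l \<in> S l"
      using eventually_gt_at_top[of 0] by eventually_elim (use B interior_subset in blast)
    have "(- cB + \<eta>) * (gB \<bullet> E) + HB z z < 0"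
      using gB \<eta> mult_pos_neg[of \<eta> "gB \<bullet> E"] by (simp add: cB_def distrib_right left_diff_distrib)
    from filterlim_iff[THEN iffD1, OF at, rule_format, OF quad_bdry_ray(2)[OF qB gz this]]
    show "\<forall>\<^sub>F l in at_top. w + (\<tau> \<bullet> u) / sqrt l + (- cB + \<eta>) / l \<notin> S l"
      using eventually_gt_at_top[of 0] by eventually_elim (use B in blast)
  qed
  have slice: "S l = {} \<or> (\<exists>a b. a \<le> b \<and> S l = {a..b})" for l
    unfolding S_def add.assoc[symmetric] using compact_slice[OF \<Omega> E] by metis
  define a b where "a l = (SOME a. \<exists>b. a \<le> b \<and> S l = {a..b})" and "b l = (SOME b. a l \<le> b \<and> S l = {a l..b})" for l
  have ab: "a l \<le> b l \<and> S l = {a l..b l}" if "S l \<noteq> {}" for l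
  proof -
    have "\<exists>a b. a \<le> b \<and> S l = {a..b}" using slice[of l] that by blast
    then have "\<exists>b. a l \<le> b \<and> S l = {a l..b}" unfolding a_def by (rule someI_ex)
    then show ?thesis unfolding b_def by (rule someI_ex)
  qed
  have pos: "\<forall>\<^sub>F l::real in at_top. l > 0" by (rule eventually_gt_at_top)
  have sep: "\<forall>\<^sub>F l in at_top. (cA + \<eta>) / l < w + (\<tau> \<bullet> u) / sqrt l + (- cB - \<eta>) / l" for \<eta>
  proof -
    have "((\<lambda>l. w + (\<tau> \<bullet> u) / sqrt l + (- cB - \<eta>) / l - (cA + \<eta>) / l) \<longlongrightarrow> w) at_top" by real_asymp
    from order_tendstoD(1)[OF this w] show ?thesis by eventually_elim simp
  qed
  have bounds: "\<forall>\<^sub>F l in at_top. \<bar>l * a l - cA\<bar> < \<eta> \<and> \<bar>(l * (b l - w) - sqrt l * (\<tau> \<bullet> u)) - (- cB)\<bar> < \<eta> \<and> a l \<le> b l \<and> S l = {a l..b l}" if \<eta>: "\<eta> > 0" for \<eta>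
  proof -
    have \<eta>2: "\<eta> / 2 > 0" using \<eta> by simp
    show ?thesis using in_A[OF \<eta>2] out_A[OF \<eta>2] in_B[OF \<eta>2] out_B[OF \<eta>2] sep[of "\<eta> / 2"] pos
    proof eventually_elim
      case (elim l)
      have S: "a l \<le> b l" "S l = {a l..b l}" using ab[of l] elim(1) by auto
      have sq: "l / sqrt l = sqrt l" using elim(6) by (simp add: real_div_sqrt)
      have 1: "a l \<le> (cA + \<eta> / 2) / l" "(cA + \<eta> / 2) / l \<le> b l" using elim(1) S by auto
      have "(cA - \<eta> / 2) / l \<le> (cA + \<eta> / 2) / l" using elim(6) \<eta> by (intro divide_right_mono) auto
      then have 2: "(cA - \<eta> / 2) / l < a l" using elim(2) S 1 by auto
      have 3: "w + (\<tau> \<bullet> u) / sqrt l + (- cB - \<eta> / 2) / l \<le> b l" "a l \<le> w + (\<tau> \<bullet> u) / sqrt l + (- cB - \<eta> / 2) / l" using elim(3) S by auto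
      have "(- cB - \<eta> / 2) / l \<le> (- cB + \<eta> / 2) / l" using elim(6) \<eta> by (intro divide_right_mono) auto
      then have 4: "b l < w + (\<tau> \<bullet> u) / sqrt l + (- cB + \<eta> / 2) / l" using elim(4) S 3 by auto
      have A: "l * a l \<le> cA + \<eta> / 2" "cA - \<eta> / 2 < l * a l"
        using 1(1) 2 elim(6) by (simp_all add: field_simps)
      have "(- cB - \<eta> / 2) / l \<le> b l - w - (\<tau> \<bullet> u) / sqrt l" "b l - w - (\<tau> \<bullet> u) / sqrt l < (- cB + \<eta> / 2) / l"
        using 3(1) 4 by simp_all
      then have B: "- cB - \<eta> / 2 \<le> l * (b l - w - (\<tau> \<bullet> u) / sqrt l)" "l * (b l - w - (\<tau> \<bullet> u) / sqrt l) < - cB + \<eta> / 2"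
        using elim(6) by (simp_all only: pos_divide_le_eq pos_less_divide_eq mult.commute[of l])
      have "l * (b l - w - (\<tau> \<bullet> u) / sqrt l) = l * (b l - w) - (l / sqrt l) * (\<tau> \<bullet> u)" by (simp add: right_diff_distrib)
      then have C: "- cB - \<eta> / 2 \<le> l * (b l - w) - sqrt l * (\<tau> \<bullet> u)" "l * (b l - w) - sqrt l * (\<tau> \<bullet> u) < - cB + \<eta> / 2"
        using B by (simp_all only: sq)
      have "\<bar>l * a l - cA\<bar> < \<eta>" using A \<eta> by (simp only: abs_less_iff) linarith
      moreover have "\<bar>(l * (b l - w) - sqrt l * (\<tau> \<bullet> u)) - (- cB)\<bar> < \<eta>" using C \<eta> by (simp only: abs_less_iff) linarith
      ultimately show ?case using S by blast
    qed
  qed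
  show "\<exists>a b. (\<forall>\<^sub>F l in at_top. a l \<le> b l \<and> {r. x0 + ((1 / sqrt l) *\<^sub>R u + r *\<^sub>R E) \<in> \<Omega>} = {a l..b l}) \<and>
     ((\<lambda>l. l * a l) \<longlongrightarrow> - HA u u / \<alpha>) at_top \<and>
     ((\<lambda>l. l * (b l - w) - sqrt l * (\<tau> \<bullet> u)) \<longlongrightarrow> - (HB (u + (\<tau> \<bullet> u) *\<^sub>R E) (u + (\<tau> \<bullet> u) *\<^sub>R E) / (gB \<bullet> E))) at_top"
    unfolding S_def[symmetric] cA_def[symmetric] z_def[symmetric] cB_def[symmetric]
  proof (intro exI conjI)
    show "\<forall>\<^sub>F l in at_top. a l \<le> b l \<and> S l = {a l..b l}" using bounds[OF zero_less_one] by eventually_elim simp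
    show "((\<lambda>l. l * a l) \<longlongrightarrow> cA) at_top"
    proof (rule tendstoI)
      fix e :: real assume "e > 0"
      from bounds[OF this] show "\<forall>\<^sub>F l in at_top. dist (l * a l) cA < e" by eventually_elim (simp add: dist_real_def)
    qed
    show "((\<lambda>l. l * (b l - w) - sqrt l * (\<tau> \<bullet> u)) \<longlongrightarrow> - cB) at_top"
    proof (rule tendstoI)
      fix e :: real assume "e > 0"
      from bounds[OF this] show "\<forall>\<^sub>F l in at_top. dist (l * (b l - w) - sqrt l * (\<tau> \<bullet> u)) (- cB) < e" by eventually_elim (simp add: dist_real_def)
    qed
  qed
qed

lemma bounded_bilinear_continuous_quadratic:
  assumes "bounded_bilinear H" "continuous_on UNIV f"
  shows "continuous_on UNIV (\<lambda>u. H (f u) (f u))"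
  using bounded_bilinear.continuous_on[OF assms(1) assms(2) assms(2)] .

lemma chord_dichotomy:
  fixes \<Omega> :: "'a::euclidean_space set"
  assumes \<Omega>: "compact \<Omega>" "convex \<Omega>" and E: "norm E = 1"
    and qA: "quad_bdry \<Omega> x0 gA HA" and gA: "gA = \<alpha> *\<^sub>R E" "\<alpha> > 0"
    and qB: "quad_bdry \<Omega> (x0 + w *\<^sub>R E) gB HB" and gB: "gB \<bullet> E < 0" and w: "w > 0"
    and l: "filterlim l at_top sequentially" and lim: "(\<lambda>n. Lpk \<Omega> x0 E (l n)) \<longlonglongrightarrow> 0"
  shows "gB = (gB \<bullet> E) *\<^sub>R E"
    and "norm (Mpk E (\<lambda>u. HB u u / (gB \<bullet> E)) w) = norm (Mpk E (\<lambda>u. HA u u / \<alpha>) 0)"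
proof -
  have EE: "E \<bullet> E = 1" using E by (simp add: dot_square_norm)
  define \<tau> where "\<tau> = - (1 / (gB \<bullet> E)) *\<^sub>R perp E gB"
  interpret HA: bounded_bilinear HA using qA by (simp add: quad_bdry_def)
  have HB: "bounded_bilinear HB" using qB by (simp add: quad_bdry_def)
  \<comment> \<open>\<open>HA\<close> is symmetrized because a bilinear form from
    \<open>quad_bdry\<close> need not be symmetric, and composed with \<open>perp E\<close> because
    the chirp lemma asks for a form on the whole space.\<close>
  define B where "B u = (\<Sum>b\<in>Basis. (- (HA (perp E u) (perp E b) + HA (perp E b) (perp E u)) / \<alpha>) *\<^sub>R b)" for u
  have padd: "perp E (x + y) = perp E x + perp E y" and pscale: "perp E (c *\<^sub>R x) = c *\<^sub>R perp E x" for x y c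
    by (simp_all add: perp_def algebra_simps inner_add_left)
  have psum: "perp E (\<Sum>b\<in>Basis. f b) = (\<Sum>b\<in>Basis. perp E (f b))" for f :: "'a \<Rightarrow> 'a"
    by (simp add: perp_def inner_sum_left scaleR_sum_left sum_subtractf)
  have Binner: "B u \<bullet> v = - (HA (perp E u) (perp E v) + HA (perp E v) (perp E u)) / \<alpha>" for u v
  proof -
    have "B u \<bullet> v = (\<Sum>b\<in>Basis. (v \<bullet> b) * (- (HA (perp E u) (perp E b) + HA (perp E b) (perp E u)) / \<alpha>))"
      unfolding B_def inner_sum_left inner_scaleR_left by (intro sum.cong refl) (simp only: inner_commute[of _ v] mult.commute)
    also have "\<dots> = - (HA (perp E u) (\<Sum>b\<in>Basis. (v \<bullet> b) *\<^sub>R perp E b) + HA (\<Sum>b\<in>Basis. (v \<bullet> b) *\<^sub>R perp E b) (perp E u)) / \<alpha>"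
      unfolding HA.sum_right HA.sum_left HA.scaleR_left HA.scaleR_right sum.distrib[symmetric] sum_negf[symmetric] sum_divide_distrib
      by (intro sum.cong refl) (simp add: field_simps)
    also have "(\<Sum>b\<in>Basis. (v \<bullet> b) *\<^sub>R perp E b) = perp E v"
      by (simp only: pscale[symmetric] psum[symmetric] euclidean_representation)
    finally show ?thesis .
  qed
  have lin: "linear B"
  proof (rule linearI)
    show "B (x + y) = B x + B y" for x y
      by (rule euclidean_eqI) (simp only: inner_add_left Binner padd HA.add_left HA.add_right add_divide_distrib[symmetric] minus_add_distrib ac_simps)
    show "B (c *\<^sub>R x) = c *\<^sub>R B x" for c x
      by (rule euclidean_eqI) (simp only: inner_scaleR_left Binner pscale HA.scaleR_left HA.scaleR_right real_scaleR_def
          distrib_left[symmetric] mult_minus_right[symmetric] times_divide_eq_right)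
  qed
  have sym: "B u \<bullet> v = u \<bullet> B v" for u v
    unfolding inner_commute[of u "B v"] Binner by (simp only: add.commute)
  have qf: "- HA (perp E u) (perp E u) / \<alpha> = (B u \<bullet> u) / 2" for u by (simp add: Binner)
  have \<tau>E: "\<tau> \<bullet> E = 0" using perp_orth(1)[OF E, of gB] by (simp add: \<tau>_def)
  have cA: "continuous_on UNIV (\<lambda>u. - HA u u / \<alpha>)"
    using gA by (intro continuous_intros bounded_bilinear_continuous_quadratic[OF HA.bounded_bilinear_axioms]) auto
  have cB: "continuous_on UNIV (\<lambda>u. HB (u + (\<tau> \<bullet> u) *\<^sub>R E) (u + (\<tau> \<bullet> u) *\<^sub>R E) / (gB \<bullet> E))"
    using gB by (intro continuous_intros bounded_bilinear_continuous_quadratic[OF HB]) auto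
  note D = packet_dichotomy[OF \<Omega> E chord_expansionI[OF \<Omega> E qA gA qB gB w, folded \<tau>_def] \<tau>E cA cB lin sym qf l lim]
  have t0: "\<tau> = 0" by (rule D(1))
  then have "perp E gB = 0" using gB by (simp add: \<tau>_def)
  then show "gB = (gB \<bullet> E) *\<^sub>R E" by (simp add: perp_def)
  show "norm (Mpk E (\<lambda>u. HB u u / (gB \<bullet> E)) w) = norm (Mpk E (\<lambda>u. HA u u / \<alpha>) 0)"
    using D(2) by (simp add: t0)
qed

text \<open>The mean value theorem along the segment reduces the remainder to the first order errors
  of the partial derivatives at \<open>x\<close>, and each of these is differentiable there.
  \<open>H\<close> is half the derivative of the gradient; its symmetry is not claimed. In the proof
  \<open>\<epsilon>\<close> is r over twice the dimension because one error arises per basis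
  vector.\<close>

lemma taylor_peano2:
  fixes f :: "'a::euclidean_space \<Rightarrow> real"
  assumes U: "open U" and f: "Ck_on 2 U f" and x: "x \<in> U"
  obtains g H \<rho> where "bounded_bilinear H" "\<And>h. f (x + h) = f x + g \<bullet> h + H h h + \<rho> h * (norm h)\<^sup>2"
    "(\<rho> \<longlongrightarrow> 0) (nhds 0)"
proof -
  define G where "G b y = frechet_derivative f (at y) b" for b y
  have fd: "f differentiable_on U" and Gd: "G v differentiable_on U" for v
    using f by (auto simp: numeral_2_eq_2 G_def[abs_def])
  have fder: "(f has_derivative frechet_derivative f (at y)) (at y)" if "y \<in> U" for y
    using fd that U by (simp add: differentiable_on_eq_differentiable_at frechet_derivative_works)
  have lin: "linear (frechet_derivative f (at y))" if "y \<in> U" for y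
    using fder[OF that] has_derivative_linear by blast
  have Gsum: "frechet_derivative f (at y) h = (\<Sum>b\<in>Basis. (h \<bullet> b) * G b y)" if "y \<in> U" for y h
  proof -
    have "frechet_derivative f (at y) h = frechet_derivative f (at y) (\<Sum>b\<in>Basis. (h \<bullet> b) *\<^sub>R b)"
      by (simp add: euclidean_representation)
    also have "\<dots> = (\<Sum>b\<in>Basis. (h \<bullet> b) * G b y)"
      by (simp add: linear_sum[OF lin[OF that]] linear_scale[OF lin[OF that]] G_def)
    finally show ?thesis .
  qed
  define L where "L b = frechet_derivative (G b) (at x)" for b
  have Gder: "(G b has_derivative L b) (at x)" for b
    using Gd[of b] x U unfolding L_def by (simp add: differentiable_on_eq_differentiable_at frechet_derivative_works)
  have Lbl: "bounded_linear (L b)" for b using Gder has_derivative_bounded_linear by blast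
  define g where "g = (\<Sum>b\<in>Basis. G b x *\<^sub>R b)"
  have g: "g \<bullet> h = frechet_derivative f (at x) h" for h
    unfolding g_def inner_sum_left inner_scaleR_left Gsum[OF x] by (simp only: inner_commute[of _ h] mult.commute)
  define H where "H h k = (1/2) * (\<Sum>b\<in>Basis. (h \<bullet> b) * L b k)" for h k
  have H: "bounded_bilinear H"
    unfolding H_def bilinear_conv_bounded_bilinear[symmetric] bilinear_def
    by (auto intro!: linearI simp: inner_add_left sum.distrib distrib_left distrib_right sum_distrib_left add_divide_distrib mult_ac
        linear_add[OF bounded_linear.linear[OF Lbl]] linear_scale[OF bounded_linear.linear[OF Lbl]])
  interpret H: bounded_bilinear H by (rule H)
  define \<rho> where "\<rho> h = (if h = 0 then 0 else (f (x + h) - f x - g \<bullet> h - H h h) / (norm h)\<^sup>2)" for h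
  have "(\<rho> \<longlongrightarrow> \<rho> 0) (at 0)"
  proof (rule LIM_I)
    fix r :: real assume r: "0 < r"
    define \<epsilon> where "\<epsilon> = r / (2 * DIM('a))"
    have \<epsilon>: "\<epsilon> > 0" using r by (simp add: \<epsilon>_def)
    have "\<forall>\<^sub>F k in nhds 0. \<forall>b\<in>Basis. \<bar>G b (x + k) - G b x - L b k\<bar> \<le> \<epsilon> * norm k"
    proof (intro eventually_ball_finite ballI)
      fix b :: 'a assume "b \<in> Basis"
      obtain d where d: "d > 0" "\<And>y. norm (y - x) < d \<Longrightarrow> norm (G b y - G b x - L b (y - x)) \<le> \<epsilon> * norm (y - x)"
        using Gder[of b] \<epsilon> unfolding has_derivative_at_alt by meson
      show "\<forall>\<^sub>F k in nhds 0. \<bar>G b (x + k) - G b x - L b k\<bar> \<le> \<epsilon> * norm k"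
        unfolding eventually_nhds_metric
      proof (intro exI conjI allI impI)
        fix k :: 'a assume "dist k 0 < d"
        then show "\<bar>G b (x + k) - G b x - L b k\<bar> \<le> \<epsilon> * norm k" using d(2)[of "x + k"] by simp
      qed (rule d(1))
    qed simp
    then obtain d where d: "d > 0" "\<And>k b. norm k < d \<Longrightarrow> b \<in> Basis \<Longrightarrow> \<bar>G b (x + k) - G b x - L b k\<bar> \<le> \<epsilon> * norm k"
      unfolding eventually_nhds_metric by auto
    obtain e where e: "e > 0" "ball x e \<subseteq> U" using U x openE by blast
    show "\<exists>s>0. \<forall>h. h \<noteq> 0 \<and> norm (h - 0) < s \<longrightarrow> norm (\<rho> h - \<rho> 0) < r"
    proof (intro exI conjI allI impI)
      show "min d e > 0" using d e by simp
      fix h :: 'a assume h: "h \<noteq> 0 \<and> norm (h - 0) < min d e"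
      have hn: "norm h < d" "norm h < e" using h by auto
      define R where "R t = f (x + t *\<^sub>R h) - f x - t * (g \<bullet> h) - t\<^sup>2 * H h h" for t :: real
      define R' where "R' t = frechet_derivative f (at (x + t *\<^sub>R h)) h - g \<bullet> h - 2 * t * H h h" for t :: real
      have inU: "x + t *\<^sub>R h \<in> U" if "0 \<le> t" "t \<le> 1" for t
      proof -
        have "norm (t *\<^sub>R h) \<le> 1 * norm h" unfolding norm_scaleR using that by (intro mult_right_mono) auto
        then have "norm (t *\<^sub>R h) < e" using hn by linarith
        then show ?thesis by (intro subsetD[OF e(2)]) (simp add: dist_norm del: norm_scaleR)
      qed
      have der: "(R has_real_derivative R' t) (at t)" if t: "0 \<le> t" "t \<le> 1" for t
      proof -
        have "((\<lambda>t. f (x + t *\<^sub>R h)) has_derivative (\<lambda>s. frechet_derivative f (at (x + t *\<^sub>R h)) (s *\<^sub>R h))) (at t)"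
          by (rule has_derivative_compose[where f="\<lambda>t. x + t *\<^sub>R h" and g=f, OF _ fder[OF inU[OF t]]]) (auto intro!: derivative_eq_intros)
        then have "((\<lambda>t. f (x + t *\<^sub>R h)) has_real_derivative frechet_derivative f (at (x + t *\<^sub>R h)) h) (at t)"
          by (simp add: has_field_derivative_def linear_scale[OF lin[OF inU[OF t]]] mult.commute[of _ "frechet_derivative f (at (x + t *\<^sub>R h)) h"])
        then show ?thesis unfolding R_def R'_def by (auto intro!: derivative_eq_intros)
      qed
      have "\<exists>t>0. t < 1 \<and> R 1 - R 0 = (1 - 0) * R' t"
        using der by (intro MVT2) auto
      then obtain t where t: "0 < t" "t < 1" "R 1 - R 0 = R' t" by auto
      have nt: "norm (t *\<^sub>R h) \<le> norm h" using t by (simp add: mult_left_le_one_le)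
      have "R' t = (\<Sum>b\<in>Basis. (h \<bullet> b) * (G b (x + t *\<^sub>R h) - G b x - L b (t *\<^sub>R h)))"
      proof -
        have "2 * t * H h h = (\<Sum>b\<in>Basis. (h \<bullet> b) * L b (t *\<^sub>R h))"
          by (simp add: H_def sum_distrib_left linear_scale[OF bounded_linear.linear[OF Lbl]] mult_ac)
        then show ?thesis unfolding R'_def g Gsum[OF inU[OF less_imp_le[OF t(1)] less_imp_le[OF t(2)]]] Gsum[OF x]
          by (simp add: sum_subtractf right_diff_distrib)
      qed
      also have "\<bar>\<dots>\<bar> \<le> (\<Sum>b\<in>(Basis::'a set). norm h * (\<epsilon> * norm h))"
      proof (rule order_trans[OF sum_abs], rule sum_mono)
        fix b :: 'a assume b: "b \<in> Basis"
        have "\<bar>G b (x + t *\<^sub>R h) - G b x - L b (t *\<^sub>R h)\<bar> \<le> \<epsilon> * norm (t *\<^sub>R h)"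
          using nt hn by (intro d(2)[OF _ b]) linarith
        also have "\<dots> \<le> \<epsilon> * norm h" using nt \<epsilon> by (intro mult_left_mono) auto
        finally show "\<bar>(h \<bullet> b) * (G b (x + t *\<^sub>R h) - G b x - L b (t *\<^sub>R h))\<bar> \<le> norm h * (\<epsilon> * norm h)"
          unfolding abs_mult using Basis_le_norm[OF b, of h] by (intro mult_mono) auto
      qed
      also have "\<dots> = (r / 2) * (norm h)\<^sup>2" by (simp add: \<epsilon>_def power2_eq_square)
      finally have "\<bar>R 1\<bar> \<le> (r / 2) * (norm h)\<^sup>2" using t(3) by (simp add: R_def)
      moreover have "\<bar>\<rho> h\<bar> = \<bar>R 1\<bar> / (norm h)\<^sup>2" using h by (simp add: \<rho>_def R_def)
      moreover have "(norm h)\<^sup>2 > 0" using h by simp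
      ultimately have "\<bar>\<rho> h\<bar> \<le> r / 2" by (simp only: pos_divide_le_eq)
      then show "norm (\<rho> h - \<rho> 0) < r" using r by (simp add: \<rho>_def)
    qed
  qed
  then have \<rho>0: "(\<rho> \<longlongrightarrow> 0) (nhds 0)" using tendsto_at_iff_tendsto_nhds[of \<rho> 0] by (simp add: \<rho>_def)
  have "f (x + h) = f x + g \<bullet> h + H h h + \<rho> h * (norm h)\<^sup>2" for h
    by (simp add: \<rho>_def H.zero_left)
  then show thesis using H \<rho>0 that by blast
qed

lemma hproj_linear: "linear (hproj j)"
  by (rule linearI) (auto simp: hproj_def vec_eq_iff)

lemma norm_hproj_sq: "(norm (hproj j x))\<^sup>2 = (norm x)\<^sup>2 - (x $ j)\<^sup>2"
proof -
  have "(norm x)\<^sup>2 = (\<Sum>i\<in>UNIV. (x $ i)\<^sup>2)" "(norm (hproj j x))\<^sup>2 = (\<Sum>i\<in>UNIV. (hproj j x $ i)\<^sup>2)"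
    by (simp_all add: norm_vec_def L2_set_def sum_nonneg)
  moreover have "(\<Sum>i\<in>UNIV. (x $ i)\<^sup>2) = (x $ j)\<^sup>2 + (\<Sum>i\<in>UNIV - {j}. (x $ i)\<^sup>2)"
    "(\<Sum>i\<in>UNIV. (hproj j x $ i)\<^sup>2) = (hproj j x $ j)\<^sup>2 + (\<Sum>i\<in>UNIV - {j}. (hproj j x $ i)\<^sup>2)"
    by (simp_all add: sum.remove)
  moreover have "(\<Sum>i\<in>UNIV - {j}. (hproj j x $ i)\<^sup>2) = (\<Sum>i\<in>UNIV - {j}. (x $ i)\<^sup>2)"
    by (rule sum.cong) (auto simp: hproj_def)
  ultimately show ?thesis by (simp add: hproj_def)
qed

lemma norm_hproj_le: "norm (hproj j x) \<le> norm x"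
  by (rule power2_le_imp_le) (simp_all add: norm_hproj_sq)

text \<open>The defining function \<open>\<Phi>\<close> is the height above the graph in the rotated
  coordinates. It vanishes at \<open>p\<close>: closedness gives \<open>\<Phi> 0 \<ge> 0\<close>,
  and a positive value would make \<open>p\<close> interior.\<close>

lemma smooth_point_quad_bdry:
  fixes \<Omega> :: "(real^'n::finite) set"
  assumes sm: "smooth_pos_curv_at j \<Omega> p" and p: "p \<in> frontier \<Omega>" and \<Omega>: "closed \<Omega>"
  obtains g H where "quad_bdry \<Omega> p g H"
proof -
  obtain Q :: "real^'n^'n" and U f \<epsilon> where Q: "orthogonal_matrix Q" and U: "open U" and f: "smooth_on U f" and \<epsilon>: "\<epsilon> > 0"
    and loc: "\<And>w. w \<in> ball p \<epsilon> \<Longrightarrow> hproj j (Q *v w) \<in> U \<and> (w \<in> \<Omega> \<longleftrightarrow> f (hproj j (Q *v w)) \<le> (Q *v w) $ j)"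
    using sm unfolding smooth_pos_curv_at_def by blast
  define P where "P h = hproj j (Q *v h)" for h
  have linP: "linear P" unfolding P_def using linear_compose[OF matrix_vector_mul_linear hproj_linear] by (simp add: o_def)
  have Qn: "norm (Q *v h) = norm h" for h
    using Q by (metis orthogonal_transformation_matrix matrix_of_matrix_vector_mul matrix_vector_mul_linear orthogonal_transformation_norm)
  have Pn: "norm (P h) \<le> norm h" for h using norm_hproj_le[of j "Q *v h"] by (simp add: P_def Qn)
  have x: "P p \<in> U" using loc[of p] \<epsilon> by (simp add: P_def)
  have C2: "Ck_on 2 U f" using f by (simp add: smooth_on_def)
  obtain gf Hf \<rho>f where Hf: "bounded_bilinear Hf" and tf: "\<And>h. f (P p + h) = f (P p) + gf \<bullet> h + Hf h h + \<rho>f h * (norm h)\<^sup>2"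
    and \<rho>f: "(\<rho>f \<longlongrightarrow> 0) (nhds 0)" by (rule taylor_peano2[OF U C2 x]) (rule that)
  define \<Phi> where "\<Phi> h = (Q *v (p + h)) $ j - f (P (p + h))" for h
  have mem: "p + h \<in> \<Omega> \<longleftrightarrow> \<Phi> h \<ge> 0" if "norm h < \<epsilon>" for h
    using loc[of "p + h"] that by (simp add: \<Phi>_def P_def dist_norm)
  have contf: "continuous_on U f" using C2 by (simp add: numeral_2_eq_2 differentiable_imp_continuous_on)
  have contP: "continuous_on UNIV P" using linP by (simp add: linear_continuous_on linear_conv_bounded_linear)
  have cont: "continuous_on (ball 0 \<epsilon>) \<Phi>" unfolding \<Phi>_def
  proof (rule continuous_on_diff)
    show "continuous_on (ball 0 \<epsilon>) (\<lambda>h. (Q *v (p + h)) $ j)"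
      by (intro continuous_intros continuous_on_compose2[OF linear_continuous_on[OF matrix_vector_mul_bounded_linear]]) auto
    show "continuous_on (ball 0 \<epsilon>) (\<lambda>h. f (P (p + h)))"
    proof (rule continuous_on_compose2[OF contf])
      show "continuous_on (ball 0 \<epsilon>) (\<lambda>h. P (p + h))"
        by (rule continuous_on_compose2[OF contP]) (auto intro!: continuous_intros)
      show "(\<lambda>h. P (p + h)) ` ball 0 \<epsilon> \<subseteq> U"
        using loc by (auto simp: P_def dist_norm)
    qed
  qed
  have "p \<in> \<Omega>" using p \<Omega> frontier_subset_closed by blast
  then have "\<Phi> 0 \<ge> 0" using mem[of 0] \<epsilon> by simp
  moreover have "\<not> \<Phi> 0 > 0"
  proof
    assume pos: "\<Phi> 0 > 0"
    have "open (ball 0 \<epsilon> \<inter> \<Phi> -` {0<..})" using cont by (intro continuous_open_preimage) auto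
    then have "open ((+) p ` (ball 0 \<epsilon> \<inter> \<Phi> -` {0<..}))" by (rule open_translation)
    moreover have "(+) p ` (ball 0 \<epsilon> \<inter> \<Phi> -` {0<..}) \<subseteq> \<Omega>" using mem by auto
    moreover have "p \<in> (+) p ` (ball 0 \<epsilon> \<inter> \<Phi> -` {0<..})" using pos \<epsilon> by (auto intro: image_eqI[of _ _ 0])
    ultimately have "p \<in> interior \<Omega>" by (metis interiorI)
    then show False using p by (simp add: frontier_def)
  qed
  ultimately have \<Phi>0: "\<Phi> 0 = 0" by simp
  define g where "g = (\<Sum>b\<in>Basis. ((Q *v b) $ j - gf \<bullet> P b) *\<^sub>R b)"
  have linF: "linear (\<lambda>h. (Q *v h) $ j - gf \<bullet> P h)"
    by (rule linearI) (simp_all add: matrix_vector_right_distrib matrix_vector_mult_scaleR linear_add[OF linP] linear_scale[OF linP]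
        inner_add_right algebra_simps)
  have g: "g \<bullet> h = (Q *v h) $ j - gf \<bullet> P h" for h
  proof -
    have "(Q *v h) $ j - gf \<bullet> P h = (\<Sum>b\<in>Basis. (h \<bullet> b) * ((Q *v b) $ j - gf \<bullet> P b))"
      using linear_sum[OF linF, of "\<lambda>b. (h \<bullet> b) *\<^sub>R b" Basis] linear_scale[OF linF] by (simp add: euclidean_representation)
    then show ?thesis unfolding g_def inner_sum_left inner_scaleR_left
      by (simp only: inner_commute[of _ h] mult.commute)
  qed
  have g0: "g \<noteq> 0"
  proof
    assume "g = 0"
    \<comment> \<open>The vertical direction of the rotated coordinates, along which
      \<open>\<Phi>\<close> has slope 1.\<close>
    let ?v = "transpose Q *v axis j 1"
    have "Q *v ?v = axis j 1" using Q unfolding orthogonal_matrix_def by (simp only: matrix_vector_mul_assoc matrix_vector_mul_lid)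
    then have "g \<bullet> ?v = 1 - gf \<bullet> hproj j (axis j 1)" by (simp add: g P_def)
    moreover have "hproj j (axis j (1::real)) = (0 :: real^'n)" by (simp add: hproj_def vec_eq_iff axis_def)
    ultimately show False using \<open>g = 0\<close> by simp
  qed
  define H where "H h k = - Hf (P h) (P k)" for h k
  interpret Hf: bounded_bilinear Hf by (rule Hf)
  have H: "bounded_bilinear H"
    unfolding H_def bilinear_conv_bounded_bilinear[symmetric] bilinear_def
    by (auto intro!: linearI simp: linear_add[OF linP] linear_scale[OF linP] Hf.add_left Hf.add_right Hf.scaleR_left Hf.scaleR_right)
  define \<rho> where "\<rho> h = (if h = 0 then 0 else - \<rho>f (P h) * (norm (P h))\<^sup>2 / (norm h)\<^sup>2)" for h
  have ta: "\<Phi> h = g \<bullet> h + H h h + \<rho> h * (norm h)\<^sup>2" for h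
  proof -
    have P0: "P 0 = 0" by (rule linear_0[OF linP])
    have "\<Phi> h = \<Phi> 0 + (Q *v h) $ j - (gf \<bullet> P h + Hf (P h) (P h) + \<rho>f (P h) * (norm (P h))\<^sup>2)"
      unfolding \<Phi>_def linear_add[OF linP] tf by (simp add: matrix_vector_right_distrib P0 Hf.zero_left)
    then show ?thesis by (simp add: \<Phi>0 g H_def \<rho>_def P0)
  qed
  have "(\<rho> \<longlongrightarrow> 0) (nhds 0)"
  proof (rule Lim_null_comparison)
    have "(P \<longlongrightarrow> P 0) (at 0)" using contP by (simp add: continuous_on_eq_continuous_at isCont_def)
    then have "(P \<longlongrightarrow> P 0) (nhds 0)" by (simp only: tendsto_at_iff_tendsto_nhds)
    then have "(P \<longlongrightarrow> 0) (nhds 0)" by (simp only: linear_0[OF linP])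
    then have "((\<lambda>h. \<rho>f (P h)) \<longlongrightarrow> 0) (nhds 0)" by (rule filterlim_compose[OF \<rho>f])
    then show "((\<lambda>h. norm (\<rho>f (P h))) \<longlongrightarrow> 0) (nhds 0)" by (rule tendsto_norm_zero)
    show "\<forall>\<^sub>F h in nhds 0. norm (\<rho> h) \<le> norm (\<rho>f (P h))"
    proof (intro always_eventually allI)
      fix h
      have "(norm (P h))\<^sup>2 \<le> (norm h)\<^sup>2" using Pn by (intro power_mono) auto
      then have "\<bar>\<rho>f (P h)\<bar> * (norm (P h))\<^sup>2 \<le> \<bar>\<rho>f (P h)\<bar> * (norm h)\<^sup>2" by (intro mult_left_mono) auto
      note le = this
      show "norm (\<rho> h) \<le> norm (\<rho>f (P h))"
      proof (cases "h = 0")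
        case False
        then have p: "(norm h)\<^sup>2 > 0" by simp
        have "\<bar>\<rho> h\<bar> = \<bar>\<rho>f (P h)\<bar> * (norm (P h))\<^sup>2 / (norm h)\<^sup>2"
          using False by (simp add: \<rho>_def abs_mult)
        also have "\<dots> \<le> \<bar>\<rho>f (P h)\<bar>" using le by (simp only: pos_divide_le_eq[OF p])
        finally show ?thesis by (simp only: real_norm_def)
      qed (simp add: \<rho>_def)
    qed
  qed
  then have "quad_bdry \<Omega> p g H"
    by (intro quad_bdryI[OF g0 H \<epsilon> mem cont ta]) auto
  then show thesis by (rule that)
qed

section \<open>Lattice points and the Fourier transform\<close>

declare transpose_matrix_vector [simp del]

lemma matrix_vmul_measurable [measurable]: "(*v) (A::real^'n::finite^'n) \<in> borel_measurable borel"
  by (intro borel_measurable_continuous_onI linear_continuous_on matrix_vector_mul_bounded_linear)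

lemma vec_nth_measurable [measurable]: "(\<lambda>x::real^'n::finite. x $ k) \<in> borel_measurable borel"
  by (intro borel_measurable_continuous_onI continuous_intros)

lemma orthogonal_matrix_vmul:
  fixes Q :: "real^'n::finite^'n"
  assumes "orthogonal_matrix Q"
  shows "orthogonal_transformation ((*v) Q)" "transpose Q *v (Q *v x) = x" "Q *v (transpose Q *v x) = x"
    "norm (Q *v x) = norm x" "(transpose Q *v x) \<bullet> y = x \<bullet> (Q *v y)" "norm (transpose Q *v x) = norm x"
    "orthogonal_transformation ((*v) (transpose Q))"
proof -
  show 1: "orthogonal_transformation ((*v) Q)"
    using assms by (simp add: orthogonal_transformation_matrix)
  have "orthogonal_matrix (transpose Q)" using assms by (simp add: orthogonal_matrix_transpose)
  then show 2: "orthogonal_transformation ((*v) (transpose Q))"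
    by (simp add: orthogonal_transformation_matrix)
  show "transpose Q *v (Q *v x) = x" "Q *v (transpose Q *v x) = x"
    using assms unfolding orthogonal_matrix_def by (simp_all only: matrix_vector_mul_assoc matrix_vector_mul_lid)
  show "norm (Q *v x) = norm x" "norm (transpose Q *v x) = norm x"
    using 1 2 orthogonal_transformation_norm by blast+
  show "(transpose Q *v x) \<bullet> y = x \<bullet> (Q *v y)" by (metis dot_lmul_matrix inner_commute transpose_matrix_vector)
qed

lemma nn_integral_orthogonal:
  fixes f :: "'a::euclidean_space \<Rightarrow> ennreal" and T :: "'a \<Rightarrow> 'a"
  assumes T: "orthogonal_transformation T" and [measurable]: "f \<in> borel_measurable borel"
  shows "(\<integral>\<^sup>+x. f (T x) \<partial>lborel) = (\<integral>\<^sup>+x. f x \<partial>lborel)"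
proof -
  have [measurable]: "T \<in> borel_measurable borel"
    using orthogonal_transformation_linear[OF T]
    by (intro borel_measurable_continuous_onI linear_continuous_on) (simp add: linear_conv_bounded_linear)
  have "(\<integral>\<^sup>+x. f x \<partial>lborel) = (\<integral>\<^sup>+x. f x \<partial>(distr lborel borel T))" by (simp add: lborel_distr_orthogonal[OF T])
  also have "\<dots> = (\<integral>\<^sup>+x. f (T x) \<partial>lborel)" by (subst nn_integral_distr) auto
  finally show ?thesis ..
qed

lemma integral_orthogonal:
  fixes f :: "'a::euclidean_space \<Rightarrow> 'b::{banach, second_countable_topology}" and T :: "'a \<Rightarrow> 'a"
  assumes T: "orthogonal_transformation T" and [measurable]: "f \<in> borel_measurable borel"
  shows "(\<integral>x. f (T x) \<partial>lborel) = (\<integral>x. f x \<partial>lborel)"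
proof -
  have [measurable]: "T \<in> borel_measurable borel"
    using orthogonal_transformation_linear[OF T]
    by (intro borel_measurable_continuous_onI linear_continuous_on) (simp add: linear_conv_bounded_linear)
  have "(\<integral>x. f x \<partial>lborel) = (\<integral>x. f x \<partial>(distr lborel borel T))" by (simp add: lborel_distr_orthogonal[OF T])
  also have "\<dots> = (\<integral>x. f (T x) \<partial>lborel)" by (subst integral_distr) auto
  finally show ?thesis ..
qed

lemma orthogonal_transformation_uminus: "orthogonal_transformation (uminus :: 'a::euclidean_space \<Rightarrow> 'a)"
  by (simp add: orthogonal_transformation_def linear_iff)

definition lat :: "real \<Rightarrow> (real^'n::finite) set" where
  "lat N = {z \<in> int_lattice. norm z \<le> N}"

lemma finite_lat: "finite (lat N :: (real^'n::finite) set)"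
proof -
  define m where "m = \<lceil>N\<rceil>"
  have "lat N \<subseteq> (\<lambda>f. \<chi> i. of_int (f i)) ` (PiE (UNIV::'n set) (\<lambda>_. {-m..m}))"
  proof
    fix z :: "real^'n" assume z: "z \<in> lat N"
    have i: "z $ i = of_int \<lfloor>z $ i\<rfloor>" "\<lfloor>z $ i\<rfloor> \<in> {-m..m}" for i
    proof -
      have zi: "z $ i \<in> \<int>" and "\<bar>z $ i\<bar> \<le> N"
        using z component_le_norm_cart[of z i] by (auto simp: lat_def int_lattice_def intro: order_trans)
      then obtain k where k: "z $ i = of_int k" by (auto elim: Ints_cases)
      have "\<bar>real_of_int k\<bar> \<le> of_int m" using \<open>\<bar>z $ i\<bar> \<le> N\<close> by (metis k m_def le_of_int_ceiling order_trans)
      then have "\<bar>k\<bar> \<le> m" by linarith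
      then show "z $ i = of_int \<lfloor>z $ i\<rfloor>" "\<lfloor>z $ i\<rfloor> \<in> {-m..m}" by (auto simp: k)
    qed
    show "z \<in> (\<lambda>f. \<chi> i. of_int (f i)) ` (PiE (UNIV::'n set) (\<lambda>_. {-m..m}))"
      by (rule image_eqI[of _ _ "\<lambda>i. \<lfloor>z $ i\<rfloor>"]) (use i in \<open>auto simp: vec_eq_iff\<close>)
  qed
  then show ?thesis by (rule finite_subset) (intro finite_imageI finite_PiE, auto)
qed

abbreviation (input) "cube \<equiv> cbox (0::real^'n::finite) One"

lemma mem_cube:
  fixes t :: "real^'n::finite"
  shows "t \<in> cube \<longleftrightarrow> (\<forall>i. 0 \<le> t $ i \<and> t $ i \<le> 1)"
proof -
  have "(One :: real^'n) $ i = 1" for i :: 'n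
  proof -
    have "axis i (1::real) \<in> (Basis :: (real^'n) set)" by (auto simp: Basis_vec_def)
    then have "(One :: real^'n) \<bullet> axis i 1 = 1" by (simp add: inner_sum_left inner_Basis cong: sum.cong)
    then show ?thesis by (simp only: cart_eq_inner_axis)
  qed
  then show ?thesis by (simp add: mem_box_cart)
qed

text \<open>The index set of the sum depends neither on the rotation nor on \<open>t\<close>, so the
  count becomes a fixed finite sum that can be measured and integrated term by term.\<close>

lemma card_slice_eq:
  fixes \<Omega> :: "(real^'n::finite) set"
  assumes \<sigma>: "orthogonal_matrix \<sigma>" and R: "R > 0" and B: "\<And>x. x \<in> \<Omega> \<Longrightarrow> norm x \<le> B" and t: "norm t \<le> T"
  shows "real (card (int_lattice \<inter> (\<lambda>x. R *\<^sub>R (\<sigma> *v x) + t) ` \<Omega>))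
    = (\<Sum>z\<in>lat (R * B + T). indicator \<Omega> ((1 / R) *\<^sub>R (transpose \<sigma> *v (z - t))))"
proof -
  have eq: "z \<in> (\<lambda>x. R *\<^sub>R (\<sigma> *v x) + t) ` \<Omega> \<longleftrightarrow> (1 / R) *\<^sub>R (transpose \<sigma> *v (z - t)) \<in> \<Omega>" for z
  proof
    assume "z \<in> (\<lambda>x. R *\<^sub>R (\<sigma> *v x) + t) ` \<Omega>"
    then obtain x where "x \<in> \<Omega>" "z = R *\<^sub>R (\<sigma> *v x) + t" by blast
    then show "(1 / R) *\<^sub>R (transpose \<sigma> *v (z - t)) \<in> \<Omega>"
      using R orthogonal_matrix_vmul(2)[OF \<sigma>] by (simp add: matrix_vector_mult_scaleR)
  next
    assume m: "(1 / R) *\<^sub>R (transpose \<sigma> *v (z - t)) \<in> \<Omega>"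
    have "z = R *\<^sub>R (\<sigma> *v ((1 / R) *\<^sub>R (transpose \<sigma> *v (z - t)))) + t"
      using R orthogonal_matrix_vmul(3)[OF \<sigma>] by (simp add: matrix_vector_mult_scaleR)
    then show "z \<in> (\<lambda>x. R *\<^sub>R (\<sigma> *v x) + t) ` \<Omega>" using m by blast
  qed
  have sub: "norm z \<le> R * B + T" if zim: "z \<in> (\<lambda>x. R *\<^sub>R (\<sigma> *v x) + t) ` \<Omega>" for z
  proof -
    obtain x where x: "x \<in> \<Omega>" "z = R *\<^sub>R (\<sigma> *v x) + t" using zim by blast
    have "norm z \<le> norm (R *\<^sub>R (\<sigma> *v x)) + norm t" unfolding x by (rule norm_triangle_ineq)
    also have "\<dots> \<le> R * B + T" using R B[OF x(1)] t by (simp add: orthogonal_matrix_vmul(4)[OF \<sigma>] mult_left_mono add_mono)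
    finally show ?thesis .
  qed
  have "int_lattice \<inter> (\<lambda>x. R *\<^sub>R (\<sigma> *v x) + t) ` \<Omega>
     = {z \<in> lat (R * B + T). (1 / R) *\<^sub>R (transpose \<sigma> *v (z - t)) \<in> \<Omega>}"
    using eq sub by (auto simp: lat_def)
  then show ?thesis by (simp add: indicator_def sum.If_cases finite_lat Int_def)
qed

lemma integral_cube_cis: "(\<integral>(t::real^'n::finite). indicator cube t * cis (2 * pi * t $ k) \<partial>lborel) = 0"
proof -
  let ?E = "axis k (1::real) :: real^'n"
  have E: "norm ?E = 1" by simp
  have inner: "t \<bullet> ?E = t $ k" for t by (simp add: inner_axis)
  define H :: "real^'n \<Rightarrow> complex" where "H t = indicator cube t * cis (2 * pi * t $ k)" for t
  have [measurable]: "H \<in> borel_measurable borel" unfolding H_def by measurable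
  have H: "integrable lborel H"
    by (rule norm_integral_le(1)[OF _ finite_measure_compact[of cube]]) (auto simp: H_def norm_mult indicator_def)
  define \<phi> :: "real \<Rightarrow> complex" where "\<phi> r = exp (- (1 / 2) * of_real ((norm r)\<^sup>2))" for r
  have \<phi>: "integrable lborel \<phi>" and \<phi>0: "(\<integral>r. \<phi> r \<partial>lborel) \<noteq> 0"
    using integrable_cgauss[of 1, where 'a=real] Kd_real_pos[of 1, where 'a=real] by (simp_all add: \<phi>_def[abs_def] Kd_def)
  have "(\<integral>r. H (perp ?E t + r *\<^sub>R ?E) \<partial>lborel) = 0" for t
  proof -
    define c where "c = (indicator {t. \<forall>i. i \<noteq> k \<longrightarrow> 0 \<le> t $ i \<and> t $ i \<le> 1} t :: complex)"
    have comp: "(perp ?E t + r *\<^sub>R ?E) $ i = (if i = k then r else t $ i)" for r i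
      unfolding perp_def inner by (simp add: axis_def)
    have Hr: "H (perp ?E t + r *\<^sub>R ?E) = c * (indicator {0..1} r *\<^sub>R cis (2 * pi * r))" for r
    proof -
      define y where "y = perp ?E t + r *\<^sub>R ?E"
      have yi: "y $ i = (if i = k then r else t $ i)" for i unfolding y_def by (rule comp)
      have "y \<in> cube \<longleftrightarrow> (\<forall>i. i \<noteq> k \<longrightarrow> 0 \<le> t $ i \<and> t $ i \<le> 1) \<and> 0 \<le> r \<and> r \<le> 1"
        unfolding mem_cube yi by auto
      then show ?thesis unfolding y_def[symmetric] H_def c_def using yi[of k] by (simp add: indicator_def)
    qed
    have "(\<integral>r. H (perp ?E t + r *\<^sub>R ?E) \<partial>lborel) = c * (\<integral>r. indicator {0..1} r *\<^sub>R cis (2 * pi * r) \<partial>lborel)"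
      unfolding Hr by (rule integral_mult_right_zero)
    also have "(\<integral>r. indicator {0..1} r *\<^sub>R cis (2 * pi * r) \<partial>lborel) = (- \<i> / (2 * pi)) * cis (2 * pi * 1) - (- \<i> / (2 * pi)) * cis (2 * pi * 0)"
    proof (rule integral_FTC_atLeastAtMost)
      show "continuous_on {0..1} (\<lambda>r. cis (2 * pi * r))" by (intro continuous_intros)
      fix r :: real
      have "((\<lambda>z. (- \<i> / (2 * pi)) * exp (\<i> * (of_real (2 * pi) * z))) has_field_derivative
          (- \<i> / (2 * pi)) * (exp (\<i> * (of_real (2 * pi) * of_real r)) * (\<i> * of_real (2 * pi)))) (at (of_real r))"
        by (auto intro!: derivative_eq_intros simp: algebra_simps)
      from has_vector_derivative_real_field[OF this]
      show "((\<lambda>r. (- \<i> / (2 * pi)) * cis (2 * pi * r)) has_vector_derivative cis (2 * pi * r)) (at r within {0..1})"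
        by (simp add: cis_conv_exp mult_ac)
    qed simp
    also have "\<dots> = 0" by simp
    finally show ?thesis by simp
  qed
  then have "(\<integral>r. \<phi> r \<partial>lborel) * (\<integral>t. H t \<partial>lborel) = 0"
    using integral_along_line(1)[OF E H \<phi>] by simp
  then show ?thesis using \<phi>0 by (simp add: H_def)
qed

lemma AE_not_integer_coord: "AE x in lborel. \<forall>i. (x::real^'n::finite) $ i \<notin> \<int>"
proof -
  have "AE x in lborel. (x::real^'n) $ i \<noteq> of_int m" for i and m :: int
  proof -
    have "negligible {x::real^'n. axis i 1 \<bullet> x = of_int m}"
      by (rule negligible_hyperplane) simp
    then have "{x::real^'n. axis i 1 \<bullet> x = of_int m} \<in> null_sets (completion lborel)"
      by (simp add: negligible_iff_null_sets)
    moreover have "{x::real^'n. axis i 1 \<bullet> x = of_int m} \<in> sets lborel"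
      by (simp add: borel_closed closed_hyperplane)
    ultimately have "{x::real^'n. axis i 1 \<bullet> x = of_int m} \<in> null_sets lborel"
      using null_sets_completion_iff by blast
    from AE_not_in[OF this] have "AE x in lborel. x \<notin> {x::real^'n. axis i 1 \<bullet> x = of_int m}" .
    then show ?thesis by (simp add: inner_axis' )
  qed
  then have "AE x in lborel. \<forall>i. \<forall>m::int. (x::real^'n) $ i \<noteq> of_int m"
    by (subst AE_all_countable, intro allI)+ 
  then show ?thesis by (rule AE_mp) (auto intro!: AE_I2 elim: Ints_cases)
qed

text \<open>Translates of the closed cube overlap only in faces, which the noninteger coordinates
  rule out. The only contributing \<open>z\<close> is the coordinatewise ceiling of
  \<open>x\<close>, and the bound on \<open>N\<close> ensures that it is counted.\<close>

lemma lattice_tiling: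
  fixes x :: "real^'n::finite"
  assumes x: "\<forall>i. x $ i \<notin> \<int>" and nx: "norm x + real CARD('n) \<le> N"
  shows "(\<Sum>z\<in>lat N. indicator cube (z - x)) = (1::complex)"
proof -
  define z0 :: "real^'n" where "z0 = (\<chi> i. of_int \<lceil>x $ i\<rceil>)"
  have eq: "z \<in> int_lattice \<and> z - x \<in> cube \<longleftrightarrow> z = z0" for z
  proof
    assume z: "z \<in> int_lattice \<and> z - x \<in> cube"
    have "z $ i = of_int \<lceil>x $ i\<rceil>" for i
    proof -
      obtain k where k: "z $ i = of_int k" using z by (auto simp: int_lattice_def elim: Ints_cases)
      have "0 \<le> (z - x) $ i \<and> (z - x) $ i \<le> 1" using z unfolding mem_cube by blast
      then have b: "0 \<le> of_int k - x $ i" "of_int k - x $ i \<le> 1" by (simp_all add: k)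
      have "x $ i \<noteq> of_int (k - 1)" using x by (metis Ints_of_int)
      then have "of_int k - 1 < x $ i" using b by auto
      then have "\<lceil>x $ i\<rceil> = k" using b by (simp add: ceiling_eq_iff)
      then show ?thesis using k by simp
    qed
    then show "z = z0" by (simp add: z0_def vec_eq_iff)
  next
    assume "z = z0"
    moreover have "0 \<le> of_int \<lceil>a\<rceil> - a \<and> of_int \<lceil>a\<rceil> - a \<le> 1" for a :: real by linarith
    ultimately show "z \<in> int_lattice \<and> z - x \<in> cube" by (auto simp: z0_def int_lattice_def mem_cube)
  qed
  have "norm (z0 - x) \<le> (\<Sum>i\<in>UNIV. \<bar>(z0 - x) $ i\<bar>)" by (rule norm_le_l1_cart)
  also have "\<dots> \<le> (\<Sum>i\<in>(UNIV::'n set). 1)"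
    using eq[of z0] by (intro sum_mono) (auto simp: mem_cube abs_le_iff)
  finally have "norm (z0 - x) \<le> real CARD('n)" by simp
  then have "norm z0 \<le> N" using nx norm_triangle_ineq[of "z0 - x" x] by simp
  then have z0: "z0 \<in> lat N" using eq[of z0] by (auto simp: lat_def)
  have "(\<Sum>z\<in>lat N. indicator cube (z - x)) = (\<Sum>z\<in>lat N. if z = z0 then 1 else (0::complex))"
    using eq by (intro sum.cong) (auto simp: indicator_def lat_def)
  also have "\<dots> = 1" using z0 by (simp add: finite_lat)
  finally show ?thesis .
qed

text \<open>The first moment in \<open>t\<close> dominates every Fourier coefficient in
  \<open>t\<close>. At the frequency \<open>axis k 1\<close> the volume term drops out, and
  unfolding the lattice sum from the cube to the whole space leaves the Fourier transform of the
  rotated and dilated body.\<close>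

lemma discrepancy_fourier:
  fixes \<Omega> :: "(real^'n::finite) set"
  assumes \<sigma>: "orthogonal_matrix \<sigma>" and R: "R > 0" and \<Omega>: "compact \<Omega>"
  shows "integrable lborel (\<lambda>t. indicator cube t * \<bar>discrepancy \<Omega> R \<sigma> t\<bar>)"
    and "R ^ CARD('n) * norm (fhat \<Omega> ((2 * pi * R) *\<^sub>R (transpose \<sigma> *v axis k 1)))
      \<le> (\<integral>t. indicator cube t * \<bar>discrepancy \<Omega> R \<sigma> t\<bar> \<partial>lborel)"
proof -
  have [measurable]: "\<Omega> \<in> sets borel" using \<Omega> by (simp add: compact_imp_closed borel_closed)
  obtain B where B: "\<And>x. x \<in> \<Omega> \<Longrightarrow> norm x \<le> B" using compact_imp_bounded[OF \<Omega>] by (auto simp: bounded_iff)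
  let ?n = "CARD('n)"
  have tn: "norm t \<le> real ?n" if "t \<in> cube" for t :: "real^'n"
  proof -
    have "norm t \<le> (\<Sum>i\<in>UNIV. \<bar>t $ i\<bar>)" by (rule norm_le_l1_cart)
    also have "\<dots> \<le> (\<Sum>i\<in>(UNIV::'n set). 1)" using that by (intro sum_mono) (auto simp: mem_cube abs_le_iff)
    finally show ?thesis by simp
  qed
  define N where "N = R * B + real ?n"
  define V where "V = R ^ ?n * measure lebesgue \<Omega>"
  define w where "w z t = (indicator \<Omega> ((1 / R) *\<^sub>R (transpose \<sigma> *v (z - t))) :: real)" for z t
  have [measurable]: "w z \<in> borel_measurable borel" for z unfolding w_def by measurable
  have D: "indicator cube t * discrepancy \<Omega> R \<sigma> t = indicator cube t * (V - (\<Sum>z\<in>lat N. w z t))" for t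
    using card_slice_eq[OF \<sigma> R B tn, where t=t] by (auto simp: indicator_def discrepancy_def V_def N_def w_def)
  have Dabs: "indicator cube t * \<bar>discrepancy \<Omega> R \<sigma> t\<bar> = \<bar>indicator cube t * (V - (\<Sum>z\<in>lat N. w z t))\<bar>" for t
    using D[of t] by (auto simp: indicator_def)
  have w01: "\<bar>w z t\<bar> \<le> 1" for z t by (simp add: w_def indicator_def)
  have Dint: "integrable lborel (\<lambda>t. indicator cube t * (V - (\<Sum>z\<in>lat N. w z t)))"
  proof (rule norm_integral_le(1))
    show "integrable lborel (\<lambda>t::real^'n. indicator cube t * (\<bar>V\<bar> + real (card (lat N :: (real^'n) set))) :: real)"
      by (intro integrable_mult_left finite_measure_compact) simp
    show "norm (indicator cube t * (V - (\<Sum>z\<in>lat N. w z t))) \<le> indicator cube t * (\<bar>V\<bar> + real (card (lat N :: (real^'n) set)))" for t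
    proof -
      have "\<bar>\<Sum>z\<in>lat N. w z t\<bar> \<le> (\<Sum>z\<in>(lat N :: (real^'n) set). 1)"
        by (rule order_trans[OF sum_abs sum_mono]) (rule w01)
      then have "\<bar>V - (\<Sum>z\<in>lat N. w z t)\<bar> \<le> \<bar>V\<bar> + real (card (lat N :: (real^'n) set))"
        by (simp add: abs_le_iff) linarith
      then show ?thesis by (simp add: indicator_def)
    qed
  qed measurable
  show int: "integrable lborel (\<lambda>t. indicator cube t * \<bar>discrepancy \<Omega> R \<sigma> t\<bar>)"
    unfolding Dabs using Dint by (rule integrable_abs)
  define e where "e t = cis (2 * pi * t $ k)" for t :: "real^'n"
  have [measurable]: "e \<in> borel_measurable borel" unfolding e_def by measurable
  define F where "F x = complex_of_real (indicator \<Omega> ((1 / R) *\<^sub>R (transpose \<sigma> *v x))) * cis (- (2 * pi * x $ k))" for x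
  have [measurable]: "F \<in> borel_measurable borel" unfolding F_def by measurable
  have ci: "integrable lborel (\<lambda>t. indicator cube t * (of_real (g t) * e t))"
    if [measurable]: "g \<in> borel_measurable borel" and "\<And>t. \<bar>g t\<bar> \<le> C" for g C
  proof (rule norm_integral_le(1))
    show "integrable lborel (\<lambda>t::real^'n. indicator cube t * C)"
      by (intro integrable_mult_left finite_measure_compact) simp
  qed (use that in \<open>auto simp: norm_mult indicator_def e_def\<close>)
  have shift: "(\<integral>t. indicator cube t * (of_real (w z t) * e t) \<partial>lborel) = (\<integral>x. indicator cube (z - x) * F x \<partial>lborel)" if z: "z \<in> lat N" for z
  proof -
    let ?g = "\<lambda>x. indicator cube x * (of_real (w z x) * e x)"
    have "(\<integral>x. ?g x \<partial>lborel) = (\<integral>x. ?g (x + z) \<partial>lborel)" by (rule integral_lborel_translate[symmetric]) measurable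
    also have "\<dots> = (\<integral>x. ?g (- x + z) \<partial>lborel)"
      by (rule integral_orthogonal[OF orthogonal_transformation_uminus, symmetric]) measurable
    also have "\<dots> = (\<integral>x. indicator cube (z - x) * F x \<partial>lborel)"
    proof (rule Bochner_Integration.integral_cong[OF refl])
      fix x
      obtain m :: int where "z $ k = of_int m" using z by (auto simp: lat_def int_lattice_def elim: Ints_cases)
      then have "e (z - x) = cis (2 * pi * of_int m + - (2 * pi * x $ k))"
        by (simp add: e_def right_diff_distrib)
      then have "e (z - x) = cis (2 * pi * of_int m) * cis (- (2 * pi * x $ k))"
        by (simp only: cis_mult)
      then have "e (z - x) = cis (- (2 * pi * x $ k))" by (simp add: cis_multiple_2pi)
      then show "?g (- x + z) = indicator cube (z - x) * F x" by (simp add: w_def F_def)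
    qed
    finally show ?thesis .
  qed
  have Fint: "integrable lborel F"
  proof (rule norm_integral_le(1))
    show "integrable lborel (\<lambda>x::real^'n. indicator (cball 0 (R * B)) x :: real)" by (rule finite_measure_compact) simp
    show "norm (F x) \<le> indicator (cball 0 (R * B)) x" for x
    proof (cases "(1 / R) *\<^sub>R (transpose \<sigma> *v x) \<in> \<Omega>")
      case True
      from B[OF this] have "norm x \<le> R * B" using R by (simp add: orthogonal_matrix_vmul(6)[OF \<sigma>] field_simps)
      then show ?thesis by (simp add: F_def norm_mult indicator_def)
    qed (simp add: F_def indicator_def)
  qed simp
  have Fint': "integrable lborel (\<lambda>x. indicator cube (z - x) * F x)" for z
    by (rule Bochner_Integration.integrable_bound[OF Fint]) (auto simp: norm_mult indicator_def)
  have tile: "(\<integral>x. (\<Sum>z\<in>lat N. indicator cube (z - x)) * F x \<partial>lborel) = (\<integral>x. F x \<partial>lborel)"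
  proof (rule integral_cong_AE)
    show "AE x in lborel. (\<Sum>z\<in>lat N. indicator cube (z - x)) * F x = F x"
      using AE_not_integer_coord
    proof eventually_elim
      case (elim x)
      show ?case
      proof (cases "(1 / R) *\<^sub>R (transpose \<sigma> *v x) \<in> \<Omega>")
        case True
        from B[OF this] have "norm x \<le> R * B" using R by (simp add: orthogonal_matrix_vmul(6)[OF \<sigma>] field_simps)
        then show ?thesis using lattice_tiling[OF elim, of N] by (simp add: N_def)
      qed (simp add: F_def)
    qed
  qed measurable
  have change: "(\<integral>x. F x \<partial>lborel) = R ^ ?n * fhat \<Omega> ((2 * pi * R) *\<^sub>R (transpose \<sigma> *v axis k 1))"
  proof -
    let ?h = "\<lambda>y. indicator \<Omega> y * cis (- (((2 * pi * R) *\<^sub>R (transpose \<sigma> *v axis k 1)) \<bullet> y))"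
    have "?h (transpose \<sigma> *v x) = F (R *\<^sub>R x)" for x
    proof -
      have "(transpose \<sigma> *v axis k 1) \<bullet> (transpose \<sigma> *v x) = x $ k"
        by (simp add: orthogonal_matrix_vmul(5)[OF \<sigma>] orthogonal_matrix_vmul(3)[OF \<sigma>] inner_axis' )
      then show ?thesis using R by (simp add: F_def matrix_vector_mult_scaleR indicator_def mult_ac)
    qed
    then have "fhat \<Omega> ((2 * pi * R) *\<^sub>R (transpose \<sigma> *v axis k 1)) = (\<integral>x. F (R *\<^sub>R x) \<partial>lborel)"
      unfolding fhat_def using integral_orthogonal[OF orthogonal_matrix_vmul(7)[OF \<sigma>], of ?h] by simp
    also have "\<dots> = (1 / R ^ ?n) *\<^sub>R (\<integral>x. F x \<partial>lborel)"
      using integral_lborel_scale[of F R] R by simp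
    finally show ?thesis using R by (simp add: scaleR_conv_of_real)
  qed
  have "(\<integral>t. of_real (indicator cube t * (V - (\<Sum>z\<in>lat N. w z t))) * e t \<partial>lborel)
     = (\<integral>t. of_real V * (indicator cube t * e t) - (\<Sum>z\<in>lat N. indicator cube t * (of_real (w z t) * e t)) \<partial>lborel)"
    by (intro Bochner_Integration.integral_cong refl) (simp add: indicator_def left_diff_distrib sum_distrib_right)
  also have "\<dots> = of_real V * (\<integral>t. indicator cube t * e t \<partial>lborel) - (\<Sum>z\<in>lat N. (\<integral>t. indicator cube t * (of_real (w z t) * e t) \<partial>lborel))"
    using ci[of "\<lambda>_. 1" 1] ci[OF _ w01] by (subst Bochner_Integration.integral_diff) (auto intro!: Bochner_Integration.integrable_sum)
  also have "\<dots> = - (\<Sum>z\<in>lat N. (\<integral>x. indicator cube (z - x) * F x \<partial>lborel))"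
    using integral_cube_cis[of k] by (simp add: e_def[symmetric] shift)
  also have "(\<Sum>z\<in>lat N. (\<integral>x. indicator cube (z - x) * F x \<partial>lborel)) = (\<integral>x. (\<Sum>z\<in>lat N. indicator cube (z - x)) * F x \<partial>lborel)"
    unfolding sum_distrib_right by (rule Bochner_Integration.integral_sum[OF Fint', symmetric])
  also have "\<dots> = R ^ ?n * fhat \<Omega> ((2 * pi * R) *\<^sub>R (transpose \<sigma> *v axis k 1))" unfolding tile change ..
  finally have eq: "(\<integral>t. of_real (indicator cube t * (V - (\<Sum>z\<in>lat N. w z t))) * e t \<partial>lborel)
     = - (R ^ ?n * fhat \<Omega> ((2 * pi * R) *\<^sub>R (transpose \<sigma> *v axis k 1)))" .
  have "norm (\<integral>t. of_real (indicator cube t * (V - (\<Sum>z\<in>lat N. w z t))) * e t \<partial>lborel)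
     \<le> (\<integral>t. indicator cube t * \<bar>discrepancy \<Omega> R \<sigma> t\<bar> \<partial>lborel)"
    by (rule norm_integral_le(2)[OF _ int]) (auto simp: Dabs norm_mult e_def simp del: of_real_mult)
  then show "R ^ ?n * norm (fhat \<Omega> ((2 * pi * R) *\<^sub>R (transpose \<sigma> *v axis k 1)))
      \<le> (\<integral>t. indicator cube t * \<bar>discrepancy \<Omega> R \<sigma> t\<bar> \<partial>lborel)"
    unfolding eq using R by (simp add: norm_mult norm_power)
qed

section \<open>Averages over rotations\<close>

lemma transpose_vmul_continuous: "continuous_on UNIV (\<lambda>p::(real^'n::finite^'n) \<times> (real^'n). transpose (fst p) *v snd p)"
  unfolding matrix_vector_mult_def transpose_def by (intro continuous_intros)

lemma transpose_vmul_measurable [measurable]: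
  assumes [measurable]: "f \<in> borel_measurable M" "g \<in> borel_measurable M"
  shows "(\<lambda>x. transpose (f x :: real^'n::finite^'n) *v g x) \<in> borel_measurable M"
proof -
  have "(\<lambda>x. (f x, g x)) \<in> M \<rightarrow>\<^sub>M borel \<Otimes>\<^sub>M borel" by (rule measurable_Pair) (rule assms)+
  then have "(\<lambda>x. (f x, g x)) \<in> M \<rightarrow>\<^sub>M borel" by (simp add: borel_prod)
  from measurable_compose[OF this borel_measurable_continuous_onI[OF transpose_vmul_continuous]]
  show ?thesis by simp
qed

lemma SOd_orthogonal: "\<sigma> \<in> SOd \<Longrightarrow> orthogonal_matrix \<sigma>"
  by (simp add: SOd_def)

context
  fixes \<mu> :: "(real^'n::finite^'n) measure"
  assumes haar: "haar_SO \<mu>" and card: "CARD('n) \<ge> 2"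
begin

lemma haar_prob: "prob_space \<mu>" and haar_space: "space \<mu> = SOd"
  and haar_distr: "\<rho> \<in> SOd \<Longrightarrow> distr \<mu> \<mu> (\<lambda>\<sigma>. \<rho> ** \<sigma>) = \<mu>"
  using haar by (auto simp: haar_SO_def)

lemma haar_id_measurable: "(\<lambda>\<sigma>. \<sigma>) \<in> borel_measurable \<mu>"
proof -
  have "sets \<mu> = sets (restrict_space borel SOd)" using haar by (simp add: haar_SO_def)
  then show ?thesis by (subst measurable_cong_sets[OF _ refl]) (auto intro: measurable_restrict_space1)
qed

lemma haar_mult_measurable: "\<rho> \<in> SOd \<Longrightarrow> (\<lambda>\<sigma>. \<rho> ** \<sigma>) \<in> \<mu> \<rightarrow>\<^sub>M \<mu>"
proof -
  assume \<rho>: "\<rho> \<in> SOd"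
  have s: "sets \<mu> = sets (restrict_space borel SOd)" using haar by (simp add: haar_SO_def)
  have "continuous_on UNIV (\<lambda>\<sigma>. \<rho> ** \<sigma>)"
    unfolding matrix_matrix_mult_def by (intro continuous_intros)
  then have "(\<lambda>\<sigma>. \<rho> ** \<sigma>) \<in> borel \<rightarrow>\<^sub>M borel" by (rule borel_measurable_continuous_onI)
  from measurable_compose[OF haar_id_measurable this] have "(\<lambda>\<sigma>. \<rho> ** \<sigma>) \<in> \<mu> \<rightarrow>\<^sub>M borel" .
  moreover have "(\<lambda>\<sigma>. \<rho> ** \<sigma>) \<in> space \<mu> \<rightarrow> SOd"
    using \<rho> by (auto simp: haar_space SOd_def orthogonal_matrix_mul det_mul)
  ultimately have "(\<lambda>\<sigma>. \<rho> ** \<sigma>) \<in> \<mu> \<rightarrow>\<^sub>M restrict_space borel SOd"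
    by (intro measurable_restrict_space2) auto
  then show ?thesis by (simp add: measurable_cong_sets[OF refl s])
qed

text \<open>The transpose turns left multiplication of \<open>\<sigma>\<close> into a change of
  \<open>\<theta>\<close>, so left invariance suffices. Dimension at least 2 provides a rotation
  between two given vectors of equal length.\<close>

lemma haar_rotate:
  fixes f :: "real^'n \<Rightarrow> ennreal"
  assumes [measurable]: "f \<in> borel_measurable borel" and n: "norm \<theta> = norm \<theta>'"
  shows "(\<integral>\<^sup>+\<sigma>. f (transpose \<sigma> *v \<theta>) \<partial>\<mu>) = (\<integral>\<^sup>+\<sigma>. f (transpose \<sigma> *v \<theta>') \<partial>\<mu>)"
proof -
  have [measurable]: "(\<lambda>\<sigma>. \<sigma>) \<in> borel_measurable \<mu>" by (rule haar_id_measurable)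
  obtain T where T: "orthogonal_transformation T" "det (matrix T) = 1" "T \<theta> = \<theta>'"
    using rotation_exists[OF card n] by blast
  define \<rho> where "\<rho> = transpose (matrix T)"
  have lin: "linear T" using T orthogonal_transformation_linear by blast
  have om: "orthogonal_matrix (matrix T)" using T orthogonal_transformation_matrix by blast
  have \<rho>: "\<rho> \<in> SOd" using om T(2) by (simp add: SOd_def \<rho>_def orthogonal_matrix_transpose)
  have eq: "transpose (\<rho> ** \<sigma>) *v \<theta> = transpose \<sigma> *v \<theta>'" for \<sigma>
  proof -
    have "transpose (\<rho> ** \<sigma>) *v \<theta> = transpose \<sigma> *v (matrix T *v \<theta>)"
      by (simp add: matrix_transpose_mul \<rho>_def matrix_vector_mul_assoc[symmetric])
    also have "matrix T *v \<theta> = \<theta>'" using matrix_works[of T \<theta>] lin T(3) by (simp add: linear_matrix_vector_mul_eq)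
    finally show ?thesis .
  qed
  have "(\<integral>\<^sup>+\<sigma>. f (transpose \<sigma> *v \<theta>) \<partial>\<mu>) = (\<integral>\<^sup>+\<sigma>. f (transpose \<sigma> *v \<theta>) \<partial>(distr \<mu> \<mu> (\<lambda>\<sigma>. \<rho> ** \<sigma>)))"
    by (simp add: haar_distr[OF \<rho>])
  also have "\<dots> = (\<integral>\<^sup>+\<sigma>. f (transpose (\<rho> ** \<sigma>) *v \<theta>) \<partial>\<mu>)"
    by (rule nn_integral_distr[OF haar_mult_measurable[OF \<rho>]]) simp
  finally show ?thesis unfolding eq .
qed

text \<open>If almost every direction missed the part of \<open>V\<close> on the sphere, then by
  \<open>haar_rotate\<close> so would, for almost every \<open>\<sigma>\<close>, the images of all
  points of a countable dense subset of the sphere. But for a single rotation these images are still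
  dense in the sphere and meet \<open>V\<close>.\<close>

lemma haar_hits_open:
  assumes V: "open V" and E0: "E0 \<in> V" "norm E0 = 1" and e: "norm e = 1"
    and P: "AE \<sigma> in \<mu>. P (transpose \<sigma> *v e)"
  shows "\<exists>E\<in>V. norm E = 1 \<and> P E"
proof (rule ccontr)
  assume no: "\<not> (\<exists>E\<in>V. norm E = 1 \<and> P E)"
  have [measurable]: "V \<in> sets borel" using V by simp
  have [measurable]: "(\<lambda>\<sigma>. \<sigma>) \<in> borel_measurable \<mu>" by (rule haar_id_measurable)
  interpret prob_space \<mu> by (rule haar_prob)
  have "AE \<sigma> in \<mu>. transpose \<sigma> *v e \<notin> V"
    using P AE_space
  proof eventually_elim
    case (elim \<sigma>)
    then have "norm (transpose \<sigma> *v e) = 1"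
      using e orthogonal_matrix_vmul(6)[of \<sigma> e] by (simp add: haar_space SOd_orthogonal)
    then show ?case using no elim(1) by blast
  qed
  then have 0: "(\<integral>\<^sup>+\<sigma>. indicator V (transpose \<sigma> *v e) \<partial>\<mu>) = 0"
    by (subst nn_integral_0_iff_AE) (auto elim!: eventually_mono simp: indicator_def)
  obtain C where C: "countable C" "C \<subseteq> sphere (0::real^'n) 1" "sphere 0 1 \<subseteq> closure C"
    using separable[of "sphere (0::real^'n) 1"] by blast
  have "AE \<sigma> in \<mu>. \<forall>\<theta>\<in>C. transpose \<sigma> *v \<theta> \<notin> V"
  proof (subst AE_ball_countable[OF C(1)], intro ballI)
    fix \<theta> assume "\<theta> \<in> C"
    then have "norm \<theta> = 1" using C by auto
    then have "(\<integral>\<^sup>+\<sigma>. indicator V (transpose \<sigma> *v \<theta>) \<partial>\<mu>) = 0"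
      using haar_rotate[of "indicator V" \<theta> e] e 0 by simp
    then show "AE \<sigma> in \<mu>. transpose \<sigma> *v \<theta> \<notin> V"
      by (subst (asm) nn_integral_0_iff_AE) (auto elim!: eventually_mono simp: indicator_def split: if_splits)
  qed
  then have "AE \<sigma> in \<mu>. False"
    using AE_space
  proof eventually_elim
    case (elim \<sigma>)
    then have om: "orthogonal_matrix \<sigma>" by (simp add: haar_space SOd_orthogonal)
    have "open ((*v) (transpose \<sigma>) -` V)"
      by (intro open_vimage V linear_continuous_on matrix_vector_mul_bounded_linear)
    moreover have "\<sigma> *v E0 \<in> (*v) (transpose \<sigma>) -` V" using E0 by (simp add: orthogonal_matrix_vmul(2)[OF om])
    moreover have "\<sigma> *v E0 \<in> closure C" using C(3) E0(2) orthogonal_matrix_vmul(4)[OF om, of E0] by auto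
    ultimately obtain \<theta> where "\<theta> \<in> C" "transpose \<sigma> *v \<theta> \<in> V"
      using open_Int_closure_eq_empty[of "(*v) (transpose \<sigma>) -` V" C] by auto
    then show False using elim(1) by blast
  qed
  then show False by simp
qed

lemma theta_equivariant:
  fixes T :: "real^'n \<Rightarrow> real^'n"
  assumes T: "orthogonal_transformation T"
  shows "theta l (T e) (T v) = T (theta l e v)"
proof -
  have lin: "linear T" and inn: "\<And>x y. T x \<bullet> T y = x \<bullet> y" using T by (auto simp: orthogonal_transformation_def)
  have p: "perp (T e) (T v) = T (perp e v)" by (simp add: perp_def inn linear_diff[OF lin] linear_scale[OF lin])
  then have "kap l (T e) (T v) = kap l e v" by (simp add: kap_def orthogonal_transformation_norm[OF T])
  then show ?thesis by (simp add: theta_def p linear_add[OF lin] linear_scale[OF lin])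
qed

lemma fhat_measurable: "\<Omega> \<in> sets borel \<Longrightarrow> fhat \<Omega> \<in> borel_measurable borel" for \<Omega> :: "(real^'n) set"
proof -
  assume [measurable]: "\<Omega> \<in> sets borel"
  show ?thesis unfolding fhat_def by measurable
qed

text \<open>Substituting \<open>transpose \<sigma> *v v\<close> for \<open>v\<close>, equivariance
  writes the frequency as \<open>transpose \<sigma>\<close> applied to l times the unit vector
  \<open>theta l e v\<close>, which does not involve \<open>\<sigma>\<close>;
  \<open>haar_rotate\<close> then replaces it by \<open>e\<close>. The base point enters only
  through a phase, so it may depend on the direction.\<close>

lemma packet_average:
  fixes \<Omega> :: "(real^'n) set" and x0 :: "real^'n \<Rightarrow> real^'n"
  assumes \<Omega>: "compact \<Omega>" and l: "l > 0" and e: "norm e = 1"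
  shows "(\<integral>\<^sup>+\<sigma>. norm (Lpk \<Omega> (x0 (transpose \<sigma> *v e)) (transpose \<sigma> *v e) l) \<partial>\<mu>)
    \<le> ennreal (l powr ((real CARD('n) + 1) / 2)) * (ennreal (K1 TYPE(real^'n)) * (\<integral>\<^sup>+\<sigma>. norm (fhat \<Omega> (l *\<^sub>R (transpose \<sigma> *v e))) \<partial>\<mu>))"
proof -
  have [measurable]: "\<Omega> \<in> sets borel" using \<Omega> by (simp add: compact_imp_closed borel_closed)
  have [measurable]: "fhat \<Omega> \<in> borel_measurable borel" by (rule fhat_measurable) simp
  have [measurable]: "(\<lambda>\<sigma>. \<sigma>) \<in> borel_measurable \<mu>" by (rule haar_id_measurable)
  interpret prob_space \<mu> by (rule haar_prob)
  interpret P: pair_sigma_finite \<mu> "lborel :: (real^'n) measure" ..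
  let ?g = "\<lambda>v::real^'n. exp (- ((norm v)\<^sup>2 / 2))"
  let ?p = "l powr ((real CARD('n) + 1) / 2)"
  have bd: "ennreal (norm (Lpk \<Omega> (x0 (transpose \<sigma> *v e)) (transpose \<sigma> *v e) l)) \<le> ennreal ?p * (\<integral>\<^sup>+v. ennreal (?g v) * norm (fhat \<Omega> (l *\<^sub>R (transpose \<sigma> *v theta l e v))) \<partial>lborel)"
    if \<sigma>: "\<sigma> \<in> space \<mu>" for \<sigma>
  proof -
    have om: "orthogonal_matrix \<sigma>" using \<sigma> by (simp add: haar_space SOd_orthogonal)
    let ?T = "(*v) (transpose \<sigma>)"
    have T: "orthogonal_transformation ?T" by (rule orthogonal_matrix_vmul(7)[OF om])
    let ?E = "?T e"
    let ?f = "\<lambda>v. of_real (?g v * (2 * kap l ?E v - 1)) * cis (l * (theta l ?E v \<bullet> x0 ?E)) * fhat \<Omega> (l *\<^sub>R theta l ?E v)"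
    have "ennreal (norm (\<integral>v. ?f v \<partial>lborel)) \<le> (\<integral>\<^sup>+v. norm (?f v) \<partial>lborel)"
      by (cases "integrable lborel ?f") (auto intro: integral_norm_bound_ennreal simp: not_integrable_integral_eq)
    also have "\<dots> \<le> (\<integral>\<^sup>+v. ennreal (?g v * norm (fhat \<Omega> (l *\<^sub>R theta l ?E v))) \<partial>lborel)"
    proof (rule nn_integral_mono, rule ennreal_leI)
      fix v
      have "norm (?f v) = norm (complex_of_real (?g v * (2 * kap l ?E v - 1))) * norm (fhat \<Omega> (l *\<^sub>R theta l ?E v))"
        by (simp only: norm_mult norm_cis mult_1_right)
      also have "\<dots> \<le> ?g v * norm (fhat \<Omega> (l *\<^sub>R theta l ?E v))"
        by (rule mult_right_mono[OF weight_le[OF l]]) simp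
      finally show "norm (?f v) \<le> ?g v * norm (fhat \<Omega> (l *\<^sub>R theta l ?E v))" .
    qed
    also have "\<dots> = (\<integral>\<^sup>+v. ennreal (?g (?T v) * norm (fhat \<Omega> (l *\<^sub>R theta l ?E (?T v)))) \<partial>lborel)"
      by (rule nn_integral_orthogonal[OF T, symmetric]) measurable
    also have "\<dots> = (\<integral>\<^sup>+v. ennreal (?g v) * norm (fhat \<Omega> (l *\<^sub>R (transpose \<sigma> *v theta l e v))) \<partial>lborel)"
      unfolding theta_equivariant[OF T] orthogonal_matrix_vmul(6)[OF om] by (simp only: ennreal_mult'' norm_ge_zero)
    finally have 1: "ennreal (norm (\<integral>v. ?f v \<partial>lborel)) \<le> (\<integral>\<^sup>+v. ennreal (?g v) * norm (fhat \<Omega> (l *\<^sub>R (transpose \<sigma> *v theta l e v))) \<partial>lborel)" .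
    have "norm (Lpk \<Omega> (x0 ?E) ?E l) = ?p * norm (\<integral>v. ?f v \<partial>lborel)"
      unfolding Lpk_def norm_mult norm_of_real by simp
    then have "ennreal (norm (Lpk \<Omega> (x0 ?E) ?E l)) = ennreal ?p * ennreal (norm (\<integral>v. ?f v \<partial>lborel))"
      by (simp only: ennreal_mult' powr_ge_zero)
    then show ?thesis using 1 by (simp only: mult_left_mono zero_le)
  qed
  have "(\<integral>\<^sup>+\<sigma>. norm (Lpk \<Omega> (x0 (transpose \<sigma> *v e)) (transpose \<sigma> *v e) l) \<partial>\<mu>)
    \<le> (\<integral>\<^sup>+\<sigma>. ennreal ?p * (\<integral>\<^sup>+v. ennreal (?g v) * norm (fhat \<Omega> (l *\<^sub>R (transpose \<sigma> *v theta l e v))) \<partial>lborel) \<partial>\<mu>)"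
    by (rule nn_integral_mono) (rule bd)
  also have "\<dots> = ennreal ?p * (\<integral>\<^sup>+\<sigma>. (\<integral>\<^sup>+v. ennreal (?g v) * norm (fhat \<Omega> (l *\<^sub>R (transpose \<sigma> *v theta l e v))) \<partial>lborel) \<partial>\<mu>)"
    by (rule nn_integral_cmult) measurable
  also have "(\<integral>\<^sup>+\<sigma>. (\<integral>\<^sup>+v. ennreal (?g v) * norm (fhat \<Omega> (l *\<^sub>R (transpose \<sigma> *v theta l e v))) \<partial>lborel) \<partial>\<mu>)
     = (\<integral>\<^sup>+v. (\<integral>\<^sup>+\<sigma>. ennreal (?g v) * norm (fhat \<Omega> (l *\<^sub>R (transpose \<sigma> *v theta l e v))) \<partial>\<mu>) \<partial>lborel)"
    by (rule P.Fubini'[symmetric]) measurable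
  also have "\<dots> = (\<integral>\<^sup>+v. ennreal (?g v) * (\<integral>\<^sup>+\<sigma>. norm (fhat \<Omega> (l *\<^sub>R (transpose \<sigma> *v e))) \<partial>\<mu>) \<partial>lborel)"
  proof (rule nn_integral_cong)
    fix v
    have "(\<integral>\<^sup>+\<sigma>. ennreal (?g v) * norm (fhat \<Omega> (l *\<^sub>R (transpose \<sigma> *v theta l e v))) \<partial>\<mu>)
       = ennreal (?g v) * (\<integral>\<^sup>+\<sigma>. norm (fhat \<Omega> (l *\<^sub>R (transpose \<sigma> *v theta l e v))) \<partial>\<mu>)"
      by (rule nn_integral_cmult) measurable
    also have "(\<integral>\<^sup>+\<sigma>. norm (fhat \<Omega> (l *\<^sub>R (transpose \<sigma> *v theta l e v))) \<partial>\<mu>) = (\<integral>\<^sup>+\<sigma>. norm (fhat \<Omega> (l *\<^sub>R (transpose \<sigma> *v e))) \<partial>\<mu>)"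
      by (rule haar_rotate[of "\<lambda>x. ennreal (norm (fhat \<Omega> (l *\<^sub>R x)))"]) (simp_all add: norm_theta[OF e l] e)
    finally show "(\<integral>\<^sup>+\<sigma>. ennreal (?g v) * norm (fhat \<Omega> (l *\<^sub>R (transpose \<sigma> *v theta l e v))) \<partial>\<mu>)
      = ennreal (?g v) * (\<integral>\<^sup>+\<sigma>. norm (fhat \<Omega> (l *\<^sub>R (transpose \<sigma> *v e))) \<partial>\<mu>)" .
  qed
  also have "\<dots> = (\<integral>\<^sup>+v. ennreal (?g v) \<partial>lborel) * (\<integral>\<^sup>+\<sigma>. norm (fhat \<Omega> (l *\<^sub>R (transpose \<sigma> *v e))) \<partial>\<mu>)"
    by (rule nn_integral_multc) measurable
  also have "(\<integral>\<^sup>+v. ennreal (?g v) \<partial>lborel) = ennreal (K1 TYPE(real^'n))"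
    unfolding K1_def using integrable_gauss_half[where 'a="real^'n"] by (subst nn_integral_eq_integral) auto
  finally show ?thesis .
qed

lemma Lpk_measurable:
  fixes \<Omega> :: "(real^'n) set" and x0 :: "real^'n \<Rightarrow> real^'n"
  assumes \<Omega>: "compact \<Omega>" and [measurable]: "x0 \<in> borel_measurable borel"
  shows "(\<lambda>\<sigma>. Lpk \<Omega> (x0 (transpose \<sigma> *v e)) (transpose \<sigma> *v e) l) \<in> borel_measurable \<mu>"
proof -
  have [measurable]: "\<Omega> \<in> sets borel" using \<Omega> by (simp add: compact_imp_closed borel_closed)
  have [measurable]: "fhat \<Omega> \<in> borel_measurable borel" by (rule fhat_measurable) simp
  have [measurable]: "(\<lambda>\<sigma>. \<sigma>) \<in> borel_measurable \<mu>" by (rule haar_id_measurable)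
  have "(\<lambda>E. Lpk \<Omega> (x0 E) E l) \<in> borel_measurable borel"
    unfolding Lpk_def theta_def kap_def perp_def by measurable
  from measurable_compose[OF _ this, of "\<lambda>\<sigma>. transpose \<sigma> *v e" \<mu>] show ?thesis by simp
qed

text \<open>Convergence of the means gives convergence almost everywhere along a subsequence
  \<open>r\<close>. The same subsequence serves every open set \<open>V\<close>.\<close>

lemma packets_vanish:
  fixes \<Omega> :: "(real^'n) set" and x0 :: "real^'n \<Rightarrow> real^'n" and l J :: "nat \<Rightarrow> real"
  assumes \<Omega>: "compact \<Omega>" and x0: "x0 \<in> borel_measurable borel" and e: "norm e = 1"
    and l: "\<And>n. l n > 0" and J: "\<And>n. (\<integral>\<^sup>+\<sigma>. norm (fhat \<Omega> (l n *\<^sub>R (transpose \<sigma> *v e))) \<partial>\<mu>) \<le> ennreal (J n)"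
    and J0: "\<And>n. J n \<ge> 0"
    and lim: "(\<lambda>n. l n powr ((real CARD('n) + 1) / 2) * J n) \<longlonglongrightarrow> 0"
  obtains r where "strict_mono r" "\<And>V E0. open V \<Longrightarrow> E0 \<in> V \<Longrightarrow> norm E0 = 1 \<Longrightarrow>
     \<exists>E\<in>V. norm E = 1 \<and> (\<lambda>n. Lpk \<Omega> (x0 E) E (l (r n))) \<longlonglongrightarrow> 0"
proof -
  let ?u = "\<lambda>n \<sigma>. Lpk \<Omega> (x0 (transpose \<sigma> *v e)) (transpose \<sigma> *v e) (l n)"
  let ?b = "\<lambda>n. K1 TYPE(real^'n) * (l n powr ((real CARD('n) + 1) / 2) * J n)"
  have K: "K1 TYPE(real^'n) \<ge> 0" using K1_pos[where 'a="real^'n"] by simp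
  have b: "(\<integral>\<^sup>+\<sigma>. norm (?u n \<sigma>) \<partial>\<mu>) \<le> ennreal (?b n)" for n
  proof -
    have "(\<integral>\<^sup>+\<sigma>. norm (?u n \<sigma>) \<partial>\<mu>) \<le> ennreal (l n powr ((real CARD('n) + 1) / 2)) * (ennreal (K1 TYPE(real^'n)) * ennreal (J n))"
      by (rule order_trans[OF packet_average[OF \<Omega> l e]]) (intro mult_left_mono J, auto)
    also have "\<dots> = ennreal (?b n)" using K J0[of n] by (simp add: ennreal_mult'[symmetric] mult_ac)
    finally show ?thesis .
  qed
  have int: "integrable \<mu> (?u n)" for n
    by (rule integrableI_bounded[OF Lpk_measurable[OF \<Omega> x0]]) (use b[of n] in \<open>auto intro: le_less_trans\<close>)
  have "(\<lambda>n. (\<integral>\<sigma>. norm (?u n \<sigma>) \<partial>\<mu>)) \<longlonglongrightarrow> 0"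
  proof (rule tendsto_sandwich[where f="\<lambda>_. 0" and h="?b"])
    show "(\<lambda>n. ?b n) \<longlonglongrightarrow> 0" using tendsto_mult[OF tendsto_const lim] by simp
    show "\<forall>\<^sub>F n in sequentially. (\<integral>\<sigma>. norm (?u n \<sigma>) \<partial>\<mu>) \<le> ?b n"
    proof (intro always_eventually allI)
      fix n
      have "ennreal (\<integral>\<sigma>. norm (?u n \<sigma>) \<partial>\<mu>) = (\<integral>\<^sup>+\<sigma>. norm (?u n \<sigma>) \<partial>\<mu>)"
        using int[of n] by (subst nn_integral_eq_integral) auto
      then have "ennreal (\<integral>\<sigma>. norm (?u n \<sigma>) \<partial>\<mu>) \<le> ennreal (?b n)" using b[of n] by simp
      then show "(\<integral>\<sigma>. norm (?u n \<sigma>) \<partial>\<mu>) \<le> ?b n" using K J0[of n] by (subst (asm) ennreal_le_iff) auto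
    qed
    show "\<forall>\<^sub>F n in sequentially. 0 \<le> (\<integral>\<sigma>. norm (?u n \<sigma>) \<partial>\<mu>)" by simp
  qed simp
  from tendsto_L1_AE_subseq[OF int this] obtain r where r: "strict_mono r"
    "AE \<sigma> in \<mu>. (\<lambda>n. ?u (r n) \<sigma>) \<longlonglongrightarrow> 0" by blast
  show thesis
  proof (rule that[OF r(1)])
    fix V :: "(real^'n) set" and E0 assume "open V" "E0 \<in> V" "norm E0 = 1"
    then show "\<exists>E\<in>V. norm E = 1 \<and> (\<lambda>n. Lpk \<Omega> (x0 E) E (l (r n))) \<longlonglongrightarrow> 0"
      by (rule haar_hits_open[OF _ _ _ e, where P="\<lambda>E. (\<lambda>n. Lpk \<Omega> (x0 E) E (l (r n))) \<longlonglongrightarrow> 0"]) (rule r(2))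
  qed
qed

end

section \<open>The boundary near the origin\<close>

lemma hproj_decomp: "x = hproj j x + (x $ j) *\<^sub>R axis j 1"
  by (auto simp: hproj_def axis_def vec_eq_iff)

lemma hproj_nth [simp]: "hproj j x $ j = 0"
  by (simp add: hproj_def)

lemma hproj_axis [simp]: "hproj j (axis j 1) = 0"
  by (simp add: hproj_def axis_def vec_eq_iff)

lemma hproj_idem [simp]: "hproj j (hproj j x) = hproj j x"
  by (auto simp: hproj_def vec_eq_iff)

lemma inner_hproj: "x \<bullet> y = hproj j x \<bullet> hproj j y + x $ j * y $ j"
proof -
  have "x \<bullet> y = (\<Sum>i\<in>UNIV. x $ i * y $ i)" by (simp add: inner_vec_def)
  also have "\<dots> = x $ j * y $ j + (\<Sum>i\<in>UNIV - {j}. x $ i * y $ i)" by (simp add: sum.remove)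
  also have "(\<Sum>i\<in>UNIV - {j}. x $ i * y $ i) = (\<Sum>i\<in>UNIV - {j}. hproj j x $ i * hproj j y $ i)"
    by (rule sum.cong) (auto simp: hproj_def)
  also have "\<dots> = (\<Sum>i\<in>UNIV. hproj j x $ i * hproj j y $ i)"
    by (subst sum.remove[of UNIV j]) simp_all
  finally show ?thesis by (simp add: inner_vec_def)
qed

lemma hproj_add: "hproj j (x + y) = hproj j x + hproj j y"
  and hproj_diff: "hproj j (x - y) = hproj j x - hproj j y"
  and hproj_scaleR: "hproj j (c *\<^sub>R x) = c *\<^sub>R hproj j x"
  by (simp_all add: linear_add[OF hproj_linear] linear_diff[OF hproj_linear] linear_cmul[OF hproj_linear])

lemma hproj_graph_point: "hproj j (hproj j x + c *\<^sub>R axis j 1) = hproj j x" "(hproj j x + c *\<^sub>R axis j 1) $ j = c"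
  by (simp_all add: hproj_add hproj_scaleR)

lemma horizontal_unit:
  assumes "CARD('n::finite) \<ge> 2"
  obtains d :: "real^'n" where "norm d = 1" "hproj j d = d"
proof -
  have "UNIV \<noteq> {j}" using assms by (metis card.empty card.insert_remove finite.emptyI insert_absorb insert_not_empty numeral_le_one_iff One_nat_def semiring_norm(69) empty_Diff)
  then obtain i where i: "i \<noteq> j" by blast
  have "norm (axis i 1 :: real^'n) = 1" by simp
  moreover have "hproj j (axis i 1 :: real^'n) = axis i 1"
    using i by (auto simp: hproj_def axis_def vec_eq_iff)
  ultimately show ?thesis using that by blast
qed

text \<open>The hypothesis describes only the frontier near the origin; convexity decides which side
  is inside. A point above the graph lies on a horizontal segment between two opposite graph points
  of its own height. If a point below belonged to the body, the segment from it to an interior point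
  above would cross the graph in an interior point.\<close>

lemma standing_graph:
  fixes \<Omega> :: "(real^'n::finite) set"
  assumes card: "CARD('n) \<ge> 2" and \<gamma>: "\<gamma> \<ge> 2" and st: "standing_assms j \<gamma> \<Omega>"
  obtains \<delta> where "\<delta> > 0" "\<delta> \<le> 1"
    "\<And>w. norm w < \<delta> \<Longrightarrow> norm (hproj j w) powr \<gamma> < w $ j \<Longrightarrow> w \<in> interior \<Omega>"
    "\<And>w. norm w < \<delta> \<Longrightarrow> norm (hproj j w) powr \<gamma> = w $ j \<Longrightarrow> w \<in> frontier \<Omega>"
    "\<And>w. norm w < \<delta> \<Longrightarrow> norm (hproj j w) powr \<gamma> > w $ j \<Longrightarrow> w \<notin> \<Omega>"
proof -
  have \<Omega>: "compact \<Omega>" "convex \<Omega>" "closed \<Omega>" using st by (auto simp: standing_assms_def convex_body_def compact_imp_closed)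
  obtain \<epsilon>0 where \<epsilon>0: "\<epsilon>0 > 0" "\<And>w. w \<in> ball 0 \<epsilon>0 \<Longrightarrow> w \<in> frontier \<Omega> \<longleftrightarrow> w $ j = norm (hproj j w) powr \<gamma>"
    using st unfolding standing_assms_def by blast
  define \<epsilon> where "\<epsilon> = min \<epsilon>0 1"
  have \<epsilon>: "\<epsilon> > 0" "\<epsilon> \<le> 1" using \<epsilon>0(1) by (auto simp: \<epsilon>_def)
  have fr: "w \<in> frontier \<Omega> \<longleftrightarrow> w $ j = norm (hproj j w) powr \<gamma>" if "norm w < \<epsilon>" for w
    using \<epsilon>0(2)[of w] that by (auto simp: \<epsilon>_def)
  have frsub: "w \<in> \<Omega>" if "w \<in> frontier \<Omega>" for w using \<Omega>(3) that frontier_subset_closed by blast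
  \<comment> \<open>A height below the first term has graph radius below
    \<open>\<epsilon>/2\<close>; the second term bounds the height itself, so the graph points of
    that height stay in the ball of radius \<open>\<epsilon>\<close>.\<close>
  define \<delta>1 where "\<delta>1 = min ((\<epsilon>/2) powr \<gamma>) (\<epsilon>/2)"
  have \<delta>1: "\<delta>1 > 0" "\<delta>1 \<le> \<epsilon>/2" "\<delta>1 \<le> (\<epsilon>/2) powr \<gamma>" using \<epsilon> by (auto simp: \<delta>1_def)
  have above: "w \<in> interior \<Omega>" if w: "norm w < \<delta>1" "norm (hproj j w) powr \<gamma> < w $ j" for w
  proof -
    define y where "y = w $ j"
    define r where "r = y powr (1/\<gamma>)"
    have y0: "y > 0" using w(2) by (simp add: y_def) (meson powr_ge_zero le_less_trans)
    have y1: "y < \<delta>1" using w(1) component_le_norm_cart[of w j] y0 by (simp add: y_def)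
    have r0: "r > 0" using y0 by (simp add: r_def)
    have ry: "r powr \<gamma> = y" using y0 \<gamma> by (simp add: r_def powr_powr)
    have r1: "r < \<epsilon>/2"
    proof (rule ccontr)
      assume "\<not> r < \<epsilon>/2"
      then have "(\<epsilon>/2) powr \<gamma> \<le> r powr \<gamma>" using \<epsilon> \<gamma> by (intro powr_mono2) auto
      then show False using ry y1 \<delta>1 by simp
    qed
    obtain d where d: "norm d = 1" "hproj j d = d" "hproj j w = norm (hproj j w) *\<^sub>R d"
    proof (cases "hproj j w = 0")
      case True
      then show ?thesis using horizontal_unit[OF card, of j] that by auto
    next
      case False
      have "norm ((1 / norm (hproj j w)) *\<^sub>R hproj j w) = 1"
        "hproj j ((1 / norm (hproj j w)) *\<^sub>R hproj j w) = (1 / norm (hproj j w)) *\<^sub>R hproj j w"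
        "hproj j w = norm (hproj j w) *\<^sub>R ((1 / norm (hproj j w)) *\<^sub>R hproj j w)"
        using False by (simp_all add: hproj_scaleR)
      then show ?thesis using that by blast
    qed
    define a where "a = norm (hproj j w)"
    have a: "a < r" 
    proof (rule ccontr)
      assume "\<not> a < r"
      then have "r powr \<gamma> \<le> a powr \<gamma>" using r0 \<gamma> by (intro powr_mono2) auto
      then show False using ry w(2) by (simp add: a_def y_def)
    qed
    have a0: "a \<ge> 0" by (simp add: a_def)
    have pt: "c *\<^sub>R d + y *\<^sub>R axis j 1 \<in> \<Omega>" if "\<bar>c\<bar> = r" for c
    proof -
      have "norm (c *\<^sub>R d + y *\<^sub>R axis j 1) \<le> r + y"
        by (rule order.trans[OF norm_triangle_ineq]) (use that y0 d in simp)
      then have n: "norm (c *\<^sub>R d + y *\<^sub>R axis j 1) < \<epsilon>" using r1 y1 \<delta>1 by linarith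
      have h: "hproj j (c *\<^sub>R d + y *\<^sub>R axis j 1) = c *\<^sub>R d" by (simp add: hproj_add hproj_scaleR d)
      have "d $ j = 0" by (metis d(2) hproj_nth)
      then have "(c *\<^sub>R d + y *\<^sub>R axis j 1) $ j = y" by simp
      then show ?thesis using fr[OF n] h that d ry frsub by simp
    qed
    have weq: "w = a *\<^sub>R d + y *\<^sub>R axis j 1" using hproj_decomp[of w j] d(3) by (simp add: a_def y_def)
    define s where "s = (r + a) / (2 * r)"
    have s: "0 \<le> s" "s \<le> 1" using r0 a a0 by (auto simp: s_def field_simps)
    have "(1 - s) *\<^sub>R ((- r) *\<^sub>R d + y *\<^sub>R axis j 1) + s *\<^sub>R (r *\<^sub>R d + y *\<^sub>R axis j 1) \<in> \<Omega>"
      using \<Omega>(2) pt[of "-r"] pt[of r] s r0 by (auto simp: convex_alt)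
    moreover have "(1 - s) *\<^sub>R ((- r) *\<^sub>R d + y *\<^sub>R axis j 1) + s *\<^sub>R (r *\<^sub>R d + y *\<^sub>R axis j 1)
       = ((2 * s - 1) * r) *\<^sub>R d + y *\<^sub>R axis j (1::real)" by (simp add: algebra_simps flip: scaleR_left_distrib scaleR_left_diff_distrib)
    moreover have "(2 * s - 1) * r = a" using r0 by (simp add: s_def field_simps)
    ultimately have "w \<in> \<Omega>" using weq by simp
    moreover have "norm w < \<epsilon>" using w(1) \<delta>1 \<epsilon> by linarith
    then have "w \<notin> frontier \<Omega>" using fr[of w] w(2) by simp
    ultimately show ?thesis using \<Omega>(3) by (simp add: frontier_def)
  qed
  show ?thesis
  \<comment> \<open>Room for the auxiliary point \<open>q'\<close> at vertical distance
    \<open>\<delta>1/4\<close> above the graph, which must still have norm below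
    \<open>\<delta>1\<close>.\<close>
  proof (rule that[of "\<delta>1/4"])
    show "\<delta>1/4 > 0" "\<delta>1/4 \<le> 1" using \<delta>1 \<epsilon> by auto
    show "w \<in> interior \<Omega>" if "norm w < \<delta>1/4" "norm (hproj j w) powr \<gamma> < w $ j" for w
      using above[of w] that norm_ge_zero[of w] by linarith
    show "w \<in> frontier \<Omega>" if "norm w < \<delta>1/4" "norm (hproj j w) powr \<gamma> = w $ j" for w
      using fr[of w] that \<delta>1 \<epsilon> by simp
    show "w \<notin> \<Omega>" if w: "norm w < \<delta>1/4" "norm (hproj j w) powr \<gamma> > w $ j" for w
    proof
      assume wO: "w \<in> \<Omega>"
      define a where "a = norm (hproj j w)"
      have a: "0 \<le> a" "a < \<delta>1/4" using norm_hproj_le[of j w] w(1) by (auto simp: a_def)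
      have a1: "a \<le> 1" using a \<delta>1 \<epsilon> by linarith
      have ap: "a powr \<gamma> \<le> a"
        using powr_mono'[of 1 \<gamma> a] a a1 \<gamma> by simp
      define q where "q = hproj j w + (a powr \<gamma>) *\<^sub>R axis j (1::real)"
      define q' where "q' = hproj j w + (a powr \<gamma> + \<delta>1/4) *\<^sub>R axis j (1::real)"
      have nq: "norm q \<le> a + a powr \<gamma>" unfolding q_def
        by (rule order.trans[OF norm_triangle_ineq]) (simp add: a_def)
      have nq': "norm q' \<le> a + (a powr \<gamma> + \<delta>1/4)" unfolding q'_def
        by (rule order.trans[OF norm_triangle_ineq]) (use \<delta>1 in \<open>simp add: a_def\<close>)
      have hq: "hproj j q = hproj j w" "q $ j = a powr \<gamma>" "hproj j q' = hproj j w" "q' $ j = a powr \<gamma> + \<delta>1/4"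
        unfolding q_def q'_def by (rule hproj_graph_point)+
      have q'i: "q' \<in> interior \<Omega>" using above[of q'] nq' ap a hq \<delta>1 by (simp add: a_def)
      have qf: "q \<in> frontier \<Omega>" using fr[of q] nq ap a hq \<delta>1 \<epsilon> by (simp add: a_def)
      define s where "s = (a powr \<gamma> - w $ j) / (a powr \<gamma> + \<delta>1/4 - w $ j)"
      have D: "a powr \<gamma> - w $ j > 0" using w(2) by (simp add: a_def)
      have s: "0 < s" "s < 1" using D \<delta>1 by (auto simp: s_def field_simps)
      have seq: "(1 - s) * w $ j + s * (a powr \<gamma> + \<delta>1/4) = a powr \<gamma>"
      proof -
        have "s * (a powr \<gamma> + \<delta>1/4 - w $ j) = a powr \<gamma> - w $ j" using D \<delta>1 by (simp add: s_def)
        then show ?thesis by (simp add: algebra_simps)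
      qed
      have "(1 - s) *\<^sub>R w + s *\<^sub>R q' = q"
      proof -
        have "(1 - s) *\<^sub>R w + s *\<^sub>R q' = (1 - s) *\<^sub>R (hproj j w + (w $ j) *\<^sub>R axis j 1) + s *\<^sub>R q'"
          using hproj_decomp[of w j] by simp
        also have "\<dots> = hproj j w + ((1 - s) * w $ j + s * (a powr \<gamma> + \<delta>1/4)) *\<^sub>R axis j 1"
          by (simp add: q'_def algebra_simps)
        finally show ?thesis by (simp only: seq q_def)
      qed
      moreover have "w \<noteq> q'" using hq D \<delta>1 by auto
      ultimately have "q \<in> open_segment w q'" using s by (auto simp: in_segment)
      then have "q \<in> open_segment q' w" by (simp add: open_segment_commute)
      then have "q \<in> interior \<Omega>"
        using in_interior_closure_convex_segment[OF \<Omega>(2) q'i, of w] wO closure_subset by blast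
      then show False using qf by (simp add: frontier_def)
    qed
  qed
qed

lemma powr_above_tangent:
  fixes r a p :: real
  assumes r: "r \<ge> 0" and a: "a \<ge> 0" and p: "p \<ge> 1"
  shows "r powr p \<ge> a powr p + p * a powr (p - 1) * (r - a)"
proof (cases "p = 1 \<or> a = 0 \<or> r = 0")
  case True
  then consider "a = 0" | "a > 0" "p = 1" | "a > 0" "r = 0" using a by fastforce
  then show ?thesis
  proof cases
    case 1 then show ?thesis by (cases "p = 1") (use r in auto)
  next
    case 2 then show ?thesis using r by simp
  next
    case 3
    have "a powr p = a * a powr (p - 1)" using 3(1) by (metis powr_mult_base less_imp_le diff_add_cancel add.commute)
    then have "a powr p + p * a powr (p - 1) * (r - a) = (1 - p) * (a * a powr (p - 1))" using 3 by (simp add: algebra_simps)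
    also have "\<dots> \<le> 0" using p 3 by (intro mult_nonpos_nonneg) auto
    finally show ?thesis using powr_ge_zero[of r p] by linarith
  qed
next
  case False
  then have r: "r > 0" and a: "a > 0" and p: "p > 1" using assms by auto
  have conv: "convex_on {0<..} (\<lambda>x::real. x powr p)"
  proof (rule f''_ge0_imp_convex[where f' = "\<lambda>x. p * x powr (p - 1)" and f'' = "\<lambda>x. p * ((p - 1) * x powr (p - 1 - 1))"])
    show "convex {0::real<..}" by simp
    fix x :: real assume x: "x \<in> {0<..}"
    show "((\<lambda>x. x powr p) has_real_derivative p * x powr (p - 1)) (at x)"
      using x by (auto intro!: derivative_eq_intros)
    show "((\<lambda>x. p * x powr (p - 1)) has_real_derivative p * ((p - 1) * x powr (p - 1 - 1))) (at x)"
      using x by (auto intro!: derivative_eq_intros)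
    show "p * ((p - 1) * x powr (p - 1 - 1)) \<ge> 0" using p by simp
  qed
  have "((\<lambda>x. x powr p) has_real_derivative p * a powr (p - 1)) (at a within {0<..})"
    using a by (auto intro!: derivative_eq_intros)
  from convex_on_imp_above_tangent[OF conv _ _ _ this, of r] show ?thesis
    using a r interior_open[of "{0::real<..}"] by (simp add: connected_Ioi)
qed

section \<open>Support points of the graph and double normals\<close>

definition graph_radius :: "'n::finite \<Rightarrow> real \<Rightarrow> real^'n \<Rightarrow> real" where
  "graph_radius j \<gamma> E = (norm (hproj j E) / (\<gamma> * E $ j)) powr (1 / (\<gamma> - 1))"

text \<open>The minimizer of \<open>\<lambda>z. z \<bullet> E\<close> on the graph: there the slope \<open>\<gamma> r powr (\<gamma> - 1)\<close> of the profile is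
  \<open>norm (hproj j E) / E $ j\<close>.\<close>
definition graph_support :: "'n::finite \<Rightarrow> real \<Rightarrow> real^'n \<Rightarrow> real^'n" where
  "graph_support j \<gamma> E = - (graph_radius j \<gamma> E / norm (hproj j E)) *\<^sub>R hproj j E + (graph_radius j \<gamma> E powr \<gamma>) *\<^sub>R axis j 1"

lemma hproj_measurable [measurable]: "hproj j \<in> borel_measurable borel"
  by (intro borel_measurable_continuous_onI linear_continuous_on) (simp add: hproj_linear linear_linear)

lemma graph_support_measurable: "graph_support j \<gamma> \<in> borel_measurable borel"
proof -
  have [measurable]: "(\<lambda>E. E $ j) \<in> borel_measurable (borel :: (real^'n) measure)" for j :: "'n::finite" by (rule vec_nth_measurable)
  show ?thesis unfolding graph_support_def[abs_def] graph_radius_def by measurable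
qed

lemma graph_support_coords:
  assumes "\<gamma> \<ge> 2"
  shows "hproj j (graph_support j \<gamma> E) = - (graph_radius j \<gamma> E / norm (hproj j E)) *\<^sub>R hproj j E"
    and "graph_support j \<gamma> E $ j = graph_radius j \<gamma> E powr \<gamma>"
    and "norm (hproj j (graph_support j \<gamma> E)) = graph_radius j \<gamma> E"
proof -
  have 0: "graph_radius j \<gamma> E \<ge> 0" by (simp add: graph_radius_def)
  show 1: "hproj j (graph_support j \<gamma> E) = - (graph_radius j \<gamma> E / norm (hproj j E)) *\<^sub>R hproj j E"
    by (simp add: graph_support_def hproj_diff hproj_add hproj_scaleR)
  show "graph_support j \<gamma> E $ j = graph_radius j \<gamma> E powr \<gamma>" by (simp add: graph_support_def)
  show "norm (hproj j (graph_support j \<gamma> E)) = graph_radius j \<gamma> E"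
    unfolding 1 using 0 by (cases "hproj j E = 0") (simp_all add: graph_radius_def)
qed

lemma graph_radius_powr:
  assumes "\<gamma> \<ge> 2" "E $ j > 0"
  shows "norm (hproj j E) = \<gamma> * E $ j * graph_radius j \<gamma> E powr (\<gamma> - 1)"
proof -
  have "graph_radius j \<gamma> E powr (\<gamma> - 1) = norm (hproj j E) / (\<gamma> * E $ j)"
    using assms by (simp add: graph_radius_def powr_powr)
  then show ?thesis using assms by (simp add: field_simps)
qed

text \<open>Near the support point the inequality is Cauchy-Schwarz in the horizontal variables
  together with the tangent of r powr gamma at the radius whose slope matches \<open>E\<close>. An
  arbitrary point of the body is first moved towards the support point, which by convexity stays in
  the body and only scales the inequality.\<close>

lemma graph_support_supports:
  fixes \<Omega> :: "(real^'n::finite) set"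
  assumes \<gamma>: "\<gamma> \<ge> 2" and \<Omega>: "convex \<Omega>" and E: "E $ j > 0"
    and below: "\<And>w. norm w < \<delta> \<Longrightarrow> norm (hproj j w) powr \<gamma> > w $ j \<Longrightarrow> w \<notin> \<Omega>"
    and x0: "norm (graph_support j \<gamma> E) < \<delta>" "graph_support j \<gamma> E \<in> \<Omega>" and z: "z \<in> \<Omega>"
  shows "(z - graph_support j \<gamma> E) \<bullet> E \<ge> 0"
proof -
  define x where "x = graph_support j \<gamma> E"
  define \<rho> where "\<rho> = graph_radius j \<gamma> E"
  have \<rho>0: "\<rho> \<ge> 0" by (simp add: \<rho>_def graph_radius_def)
  have loc: "(y - x) \<bullet> E \<ge> 0" if y: "y \<in> \<Omega>" "norm y < \<delta>" for y
  proof -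
    define r where "r = norm (hproj j y)"
    have yj: "y $ j \<ge> r powr \<gamma>" using below[OF y(2)] y(1) by (force simp: r_def)
    have "- (r * norm (hproj j E)) \<le> hproj j y \<bullet> hproj j E"
      using Cauchy_Schwarz_ineq2[of "hproj j y" "hproj j E"] by (simp add: r_def)
    then have 1: "y \<bullet> E \<ge> - (r * norm (hproj j E)) + r powr \<gamma> * E $ j"
      using inner_hproj[of y E j] mult_right_mono[OF yj, of "E $ j"] E by linarith
    have "(\<rho> / norm (hproj j E)) * (hproj j E \<bullet> hproj j E) = \<rho> * norm (hproj j E)"
      by (simp add: dot_square_norm power2_eq_square)
    then have 2: "x \<bullet> E = - (\<rho> * norm (hproj j E)) + \<rho> powr \<gamma> * E $ j"
      using inner_hproj[of x E j] graph_support_coords(1,2)[OF \<gamma>, of j E] by (simp add: x_def \<rho>_def)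
    have nh: "norm (hproj j E) = \<gamma> * E $ j * \<rho> powr (\<gamma> - 1)" using graph_radius_powr[of \<gamma> E j] \<gamma> E by (simp add: \<rho>_def)
    have "r powr \<gamma> \<ge> \<rho> powr \<gamma> + \<gamma> * \<rho> powr (\<gamma> - 1) * (r - \<rho>)"
      using \<gamma> \<rho>0 by (intro powr_above_tangent) (auto simp: r_def)
    from mult_left_mono[OF this, of "E $ j"] E
    have "E $ j * r powr \<gamma> \<ge> E $ j * (\<rho> powr \<gamma> + \<gamma> * \<rho> powr (\<gamma> - 1) * (r - \<rho>))" by simp
    then show ?thesis using 1 2 unfolding nh by (simp add: inner_diff_left algebra_simps)
  qed
  define s where "s = min 1 ((\<delta> - norm x) / (2 * (norm (z - x) + 1)))"
  have np: "norm (z - x) + 1 > 0" by (simp add: add_nonneg_pos)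
  have s: "0 < s" "s \<le> 1" using x0 np by (auto simp: s_def x_def)
  have "s * norm (z - x) \<le> (\<delta> - norm x) / (2 * (norm (z - x) + 1)) * norm (z - x)"
    by (rule mult_right_mono) (auto simp: s_def)
  also have "\<dots> < \<delta> - norm x"
  proof -
    have "(\<delta> - norm x) * norm (z - x) < (\<delta> - norm x) * (2 * (norm (z - x) + 1))"
      using x0(1) np by (intro mult_strict_left_mono) (auto simp: x_def)
    then show ?thesis using np by (simp add: field_simps)
  qed
  finally have sn: "s * norm (z - x) < \<delta> - norm x" .
  have "norm (x + s *\<^sub>R (z - x)) \<le> norm x + s * norm (z - x)"
    by (rule order.trans[OF norm_triangle_ineq]) (use s in simp)
  then have n: "norm (x + s *\<^sub>R (z - x)) < \<delta>" using sn by linarith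
  have "(1 - s) *\<^sub>R x + s *\<^sub>R z \<in> \<Omega>" using \<Omega> x0(2) z s by (auto simp: convex_alt x_def)
  then have "x + s *\<^sub>R (z - x) \<in> \<Omega>" by (simp add: algebra_simps)
  from loc[OF this n] have "s * ((z - x) \<bullet> E) \<ge> 0" by simp
  then show ?thesis using s by (simp add: zero_le_mult_iff x_def)
qed

text \<open>Every \<open>z\<close> with \<open>g \<bullet> z > 0\<close> points into the body and
  hence satisfies \<open>z \<bullet> E \<ge> 0\<close>. If \<open>g\<close> had a component
  \<open>v\<close> orthogonal to \<open>E\<close>, then \<open>v - s *\<^sub>R E\<close> with small
  positive \<open>s\<close> would violate this.\<close>

lemma quad_bdry_normal_unique:
  assumes qb: "quad_bdry \<Omega> p g H" and E: "norm E = 1" and sup: "\<And>z. z \<in> \<Omega> \<Longrightarrow> (z - p) \<bullet> E \<ge> 0"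
  obtains \<alpha> where "\<alpha> > 0" "g = \<alpha> *\<^sub>R E"
proof -
  interpret H: bounded_bilinear H using qb by (simp add: quad_bdry_def)
  have EE: "E \<bullet> E = 1" using E by (simp add: dot_square_norm)
  have imp: "z \<bullet> E \<ge> 0" if z: "g \<bullet> z > 0" for z
  proof -
    let ?h = "\<lambda>t::real. t\<^sup>2 *\<^sub>R z"
    have "((\<lambda>t::real. t *\<^sub>R z) \<longlongrightarrow> 0 *\<^sub>R z) (at_right 0)"
      by (intro tendsto_scaleR tendsto_ident_at tendsto_const)
    then have "((\<lambda>t::real. t *\<^sub>R z) \<longlongrightarrow> 0) (at_right 0)" by simp
    then have 1: "((\<lambda>t. ?h t /\<^sub>R t) \<longlongrightarrow> 0) (at_right 0)"
      by (rule tendsto_at_right_cong) (simp add: power2_eq_square)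
    have 2: "((\<lambda>t. g \<bullet> ?h t / t\<^sup>2) \<longlongrightarrow> g \<bullet> z) (at_right 0)"
      by (rule tendsto_at_right_cong[OF tendsto_const]) simp
    have "\<forall>\<^sub>F t in at_right 0. p + ?h t \<in> interior \<Omega>"
      using quad_bdryD(1)[OF qb 1 2] z by (simp add: H.zero_left)
    then have "\<forall>\<^sub>F t in at_right (0::real). p + ?h t \<in> interior \<Omega> \<and> t > 0"
      by (rule eventually_conj) (rule eventually_at_right_less)
    then obtain t :: real where t: "p + t\<^sup>2 *\<^sub>R z \<in> interior \<Omega>" "t > 0"
      using eventually_happens trivial_limit_at_right_real by blast
    have "t\<^sup>2 * (z \<bullet> E) \<ge> 0" using sup[OF subsetD[OF interior_subset t(1)]] by simp
    then show ?thesis using t(2) by (simp add: zero_le_mult_iff)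
  qed
  define \<alpha> where "\<alpha> = g \<bullet> E"
  have g0: "g \<noteq> 0" using qb by (simp add: quad_bdry_def)
  have gE: "g = \<alpha> *\<^sub>R E"
  proof (rule ccontr)
    assume "g \<noteq> \<alpha> *\<^sub>R E"
    define v where "v = g - \<alpha> *\<^sub>R E"
    have v0: "v \<noteq> 0" using \<open>g \<noteq> \<alpha> *\<^sub>R E\<close> by (simp add: v_def)
    have vE: "v \<bullet> E = 0" by (simp add: v_def \<alpha>_def inner_diff_left EE)
    have gv: "g \<bullet> v = v \<bullet> v"
    proof -
      have "g = v + \<alpha> *\<^sub>R E" by (simp add: v_def)
      then have "g \<bullet> v = (v + \<alpha> *\<^sub>R E) \<bullet> v" by simp
      then show ?thesis using vE by (simp add: inner_add_right inner_commute)
    qed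
    define s where "s = (v \<bullet> v) / (2 * (\<bar>\<alpha>\<bar> + 1))"
    have s: "s > 0" using v0 by (simp add: s_def)
    have "s * \<alpha> \<le> s * (\<bar>\<alpha>\<bar> + 1)" using s by (intro mult_left_mono) auto
    also have "\<dots> = (v \<bullet> v) / 2" by (simp add: s_def field_simps)
    also have "\<dots> < v \<bullet> v" using v0 by simp
    finally have "g \<bullet> (v - s *\<^sub>R E) > 0" by (simp add: inner_diff_right gv \<alpha>_def)
    from imp[OF this] show False using s vE EE by (simp add: inner_diff_left)
  qed
  have "\<alpha> \<noteq> 0" using gE g0 by auto
  moreover have "\<not> \<alpha> < 0"
  proof
    assume "\<alpha> < 0"
    then have "g \<bullet> (- E) > 0" by (simp add: \<alpha>_def)
    from imp[OF this] show False using EE by simp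
  qed
  ultimately have "\<alpha> > 0" by linarith
  then show ?thesis using gE by (rule that)
qed

lemma double_normal:
  fixes \<Omega> :: "(real^'n::finite) set"
  assumes \<gamma>: "\<gamma> \<ge> 2" and st: "standing_assms j \<gamma> \<Omega>"
    and E: "norm E = 1" "E $ j > 0"
    and x0: "x0 \<in> frontier \<Omega>" "x0 \<noteq> 0" "x0 $ j \<ge> 0" and sup: "\<And>z. z \<in> \<Omega> \<Longrightarrow> (z - x0) \<bullet> E \<ge> 0"
    and l: "filterlim l at_top sequentially" and lim: "(\<lambda>n. Lpk \<Omega> x0 E (l n)) \<longlonglongrightarrow> 0"
  obtains w gB HB where "w > 0" "x0 + w *\<^sub>R E \<in> frontier \<Omega>" "quad_bdry \<Omega> (x0 + w *\<^sub>R E) gB HB"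
    "gB = (gB \<bullet> E) *\<^sub>R E" "gB \<bullet> E < 0" "\<And>z. z \<in> \<Omega> \<Longrightarrow> z \<bullet> E \<le> x0 \<bullet> E + w"
    "\<And>gA HA \<alpha>. quad_bdry \<Omega> x0 gA HA \<Longrightarrow> gA = \<alpha> *\<^sub>R E \<Longrightarrow> \<alpha> > 0 \<Longrightarrow>
       norm (Mpk E (\<lambda>u. HB u u / (gB \<bullet> E)) w) = norm (Mpk E (\<lambda>u. HA u u / \<alpha>) 0)"
proof -
  have \<Omega>: "compact \<Omega>" "convex \<Omega>" "closed \<Omega>" using st by (auto simp: standing_assms_def convex_body_def compact_imp_closed)
  have sm: "smooth_pos_curv_at j \<Omega> p" if "p \<in> frontier \<Omega>" "p \<noteq> 0" for p
    using st that by (auto simp: standing_assms_def)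
  have EE: "E \<bullet> E = 1" using E by (simp add: dot_square_norm)
  obtain gA HA where qA: "quad_bdry \<Omega> x0 gA HA"
    using smooth_point_quad_bdry[OF sm[OF x0(1,2)] x0(1) \<Omega>(3)] by blast
  interpret HA: bounded_bilinear HA using qA by (simp add: quad_bdry_def)
  obtain \<alpha> where \<alpha>: "\<alpha> > 0" "gA = \<alpha> *\<^sub>R E" using quad_bdry_normal_unique[OF qA E(1) sup] by blast
  have "\<forall>\<^sub>F t in at_right 0. x0 + (t *\<^sub>R 0 + (t\<^sup>2 * 1) *\<^sub>R E) \<in> interior \<Omega>"
    by (rule quad_bdry_ray(1)[OF qA]) (use \<alpha> EE in \<open>simp_all add: HA.zero_left\<close>)
  then have "\<forall>\<^sub>F t in at_right (0::real). x0 + (t *\<^sub>R 0 + (t\<^sup>2 * 1) *\<^sub>R E) \<in> interior \<Omega> \<and> t > 0"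
    by (rule eventually_conj) (rule eventually_at_right_less)
  then obtain t :: real where t: "x0 + (t *\<^sub>R 0 + (t\<^sup>2 * 1) *\<^sub>R E) \<in> interior \<Omega>" "t > 0"
    using eventually_happens trivial_limit_at_right_real by blast
  define a where "a = t\<^sup>2"
  have a: "a > 0" "x0 + a *\<^sub>R E \<in> interior \<Omega>" using t by (simp_all add: a_def)
  define S where "S = {s. x0 + s *\<^sub>R E \<in> \<Omega>}"
  have aS: "a \<in> S" using a interior_subset by (auto simp: S_def)
  have "closed S" unfolding S_def
    using continuous_closed_vimage[OF \<Omega>(3), of "\<lambda>s. x0 + s *\<^sub>R E"] by (simp add: vimage_def)
  moreover have "bounded S"
  proof -
    obtain B where B: "\<And>z. z \<in> \<Omega> \<Longrightarrow> norm z \<le> B" using \<Omega>(1) compact_imp_bounded bounded_iff by metis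
    have "norm s \<le> B + norm x0" if "s \<in> S" for s
    proof -
      have "norm (s *\<^sub>R E) \<le> norm (x0 + s *\<^sub>R E) + norm x0"
        using norm_triangle_ineq4[of "x0 + s *\<^sub>R E" x0] by simp
      then show ?thesis using B[of "x0 + s *\<^sub>R E"] that E by (simp add: S_def)
    qed
    then show ?thesis using bounded_iff by blast
  qed
  ultimately have "compact S" by (simp add: compact_eq_bounded_closed)
  then obtain w where w: "w \<in> S" "\<And>s. s \<in> S \<Longrightarrow> s \<le> w" using compact_attains_sup[of S] aS by blast
  have w0: "w > 0" using w(2)[OF aS] a by linarith
  define p where "p = x0 + w *\<^sub>R E"
  have pO: "p \<in> \<Omega>" using w by (simp add: p_def S_def)
  have pni: "p \<notin> interior \<Omega>"
  proof
    assume "p \<in> interior \<Omega>"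
    then obtain e where e: "e > 0" "cball p e \<subseteq> \<Omega>" by (auto simp: mem_interior_cball)
    have "p + e *\<^sub>R E \<in> \<Omega>" using e E by (intro subsetD[OF e(2)]) (auto simp: dist_norm)
    then have "w + e \<in> S" by (simp add: S_def p_def algebra_simps)
    then show False using w(2)[of "w + e"] e by simp
  qed
  have pf: "p \<in> frontier \<Omega>" using pO pni closure_subset by (auto simp: frontier_def)
  have "p $ j > 0" using x0(3) w0 E(2) by (simp add: p_def add_nonneg_pos)
  then have p0: "p \<noteq> 0" by auto
  obtain gB HB where qB: "quad_bdry \<Omega> p gB HB"
    using smooth_point_quad_bdry[OF sm[OF pf p0] pf \<Omega>(3)] by blast
  have "a \<noteq> w" using a pni by (auto simp: p_def)
  then have aw: "a < w" using w(2)[OF aS] by simp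
  have "gB \<bullet> ((x0 + a *\<^sub>R E) - p) > 0" by (rule quad_bdry_support_interior[OF qB \<Omega>(2) pO a(2)])
  then have "(w - a) * (gB \<bullet> E) < 0" by (simp add: p_def inner_diff_right inner_add_right algebra_simps)
  then have gBE: "gB \<bullet> E < 0" using aw by (simp add: mult_less_0_iff)
  note cd = chord_dichotomy[OF \<Omega>(1,2) E(1) _ _ _ qB[unfolded p_def] gBE w0 l lim]
  have gB: "gB = (gB \<bullet> E) *\<^sub>R E" by (rule cd(1)[OF qA \<alpha>(2,1)])
  have top: "z \<bullet> E \<le> x0 \<bullet> E + w" if z: "z \<in> \<Omega>" for z
  proof -
    have "gB \<bullet> (z - p) \<ge> 0" by (rule quad_bdry_support[OF qB \<Omega>(2) pO z])
    then have "(gB \<bullet> E) * (E \<bullet> (z - p)) \<ge> 0" by (subst (asm) gB) simp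
    then have "E \<bullet> (z - p) \<le> 0" using gBE by (simp add: zero_le_mult_iff)
    then show ?thesis by (simp add: p_def inner_diff_right inner_add_right EE inner_commute)
  qed
  show ?thesis
  proof (rule that[OF w0 pf[unfolded p_def] qB[unfolded p_def] gB gBE])
    show "z \<bullet> E \<le> x0 \<bullet> E + w" if "z \<in> \<Omega>" for z by (rule top[OF that])
    fix gA HA and \<alpha> :: real assume "quad_bdry \<Omega> x0 gA HA" "gA = \<alpha> *\<^sub>R E" "\<alpha> > 0"
    then show "norm (Mpk E (\<lambda>u. HB u u / (gB \<bullet> E)) w) = norm (Mpk E (\<lambda>u. HA u u / \<alpha>) 0)" by (rule cd(2))
  qed
qed

lemma graph_radius_tendsto:
  assumes "\<gamma> \<ge> 2"
  shows "(graph_radius j \<gamma> \<longlongrightarrow> 0) (nhds (axis j 1))"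
proof -
  have h: "((\<lambda>E. norm (hproj j E)) \<longlongrightarrow> norm (hproj j (axis j 1))) (nhds (axis j 1))"
    using linear_continuous_at[OF linear_linear[THEN iffD2, OF hproj_linear], of "axis j 1" j]
    by (intro tendsto_norm) (simp add: isCont_def tendsto_at_iff_tendsto_nhds del: hproj_axis)
  have "((\<lambda>E. norm (hproj j E) / (\<gamma> * E $ j)) \<longlongrightarrow> norm (hproj j (axis j 1)) / (\<gamma> * axis j 1 $ j)) (nhds (axis j (1::real)))"
    by (intro tendsto_intros h filterlim_ident tendsto_vec_nth) (use assms in auto)
  then have 1: "((\<lambda>E. norm (hproj j E) / (\<gamma> * E $ j)) \<longlongrightarrow> 0) (nhds (axis j 1))" by simp
  have "((\<lambda>E. \<bar>norm (hproj j E) / (\<gamma> * E $ j)\<bar> powr (1 / (\<gamma> - 1))) \<longlongrightarrow> 0) (nhds (axis j 1))"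
    by (rule tendsto_zero_powrI[OF _ tendsto_const]) (use tendsto_rabs_zero[OF 1] assms in auto)
  moreover have "\<forall>\<^sub>F E in nhds (axis j (1::real)). \<bar>norm (hproj j E) / (\<gamma> * E $ j)\<bar> powr (1 / (\<gamma> - 1)) = graph_radius j \<gamma> E"
  proof -
    have "((\<lambda>E. E $ j) \<longlongrightarrow> axis j 1 $ j) (nhds (axis j (1::real)))" by (intro tendsto_vec_nth filterlim_ident)
    then have "\<forall>\<^sub>F E in nhds (axis j (1::real)). E $ j > 0" by (rule order_tendstoD) simp
    then show ?thesis by eventually_elim (use assms in \<open>simp add: graph_radius_def\<close>)
  qed
  ultimately show ?thesis by (rule Lim_transform_eventually)
qed

lemma graph_support_tendsto:
  assumes "\<gamma> \<ge> 2"
  shows "(graph_support j \<gamma> \<longlongrightarrow> 0) (nhds (axis j 1))"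
proof (rule Lim_null_comparison)
  have "norm (graph_support j \<gamma> E) \<le> graph_radius j \<gamma> E + \<bar>graph_radius j \<gamma> E\<bar> powr \<gamma>" for E
  proof -
    have "norm (graph_support j \<gamma> E) \<le> norm (hproj j (graph_support j \<gamma> E)) + norm ((graph_support j \<gamma> E $ j) *\<^sub>R axis j (1::real))"
      by (subst hproj_decomp[of "graph_support j \<gamma> E" j]) (rule norm_triangle_ineq)
    then show ?thesis using graph_support_coords(2,3)[OF assms, of j E] by (simp add: graph_radius_def)
  qed
  then show "\<forall>\<^sub>F E in nhds (axis j 1). norm (graph_support j \<gamma> E) \<le> graph_radius j \<gamma> E + \<bar>graph_radius j \<gamma> E\<bar> powr \<gamma>" by simp
  have "((\<lambda>E. graph_radius j \<gamma> E + \<bar>graph_radius j \<gamma> E\<bar> powr \<gamma>) \<longlongrightarrow> 0 + 0) (nhds (axis j 1))"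
    using assms tendsto_rabs_zero[OF graph_radius_tendsto[OF assms]]
    by (intro tendsto_add graph_radius_tendsto tendsto_zero_powrI[OF _ tendsto_const]) auto
  then show "((\<lambda>E. graph_radius j \<gamma> E + \<bar>graph_radius j \<gamma> E\<bar> powr \<gamma>) \<longlongrightarrow> 0) (nhds (axis j 1))" by simp
qed

lemma graph_support_near_pole:
  fixes \<Omega> :: "(real^'n::finite) set"
  assumes card: "CARD('n) \<ge> 2" and \<gamma>: "\<gamma> \<ge> 2" and st: "standing_assms j \<gamma> \<Omega>" and \<delta>: "\<delta> > 0"
    and fr: "\<And>w. norm w < \<delta> \<Longrightarrow> norm (hproj j w) powr \<gamma> = w $ j \<Longrightarrow> w \<in> frontier \<Omega>"
    and below: "\<And>w. norm w < \<delta> \<Longrightarrow> norm (hproj j w) powr \<gamma> > w $ j \<Longrightarrow> w \<notin> \<Omega>"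
  obtains \<eta> where "\<eta> > 0" "\<And>E::real^'n. dist E (axis j 1) < \<eta> \<Longrightarrow> E $ j > 0"
    "\<And>E. dist E (axis j 1) < \<eta> \<Longrightarrow> norm (graph_support j \<gamma> E) < \<delta>"
    "\<And>E. dist E (axis j 1) < \<eta> \<Longrightarrow> graph_support j \<gamma> E \<in> frontier \<Omega>"
    "\<And>E z. dist E (axis j 1) < \<eta> \<Longrightarrow> z \<in> \<Omega> \<Longrightarrow> (z - graph_support j \<gamma> E) \<bullet> E \<ge> 0"
proof -
  have \<Omega>: "convex \<Omega>" "closed \<Omega>" using st by (auto simp: standing_assms_def convex_body_def compact_imp_closed)
  have "((\<lambda>E. E $ j) \<longlongrightarrow> axis j 1 $ j) (nhds (axis j (1::real)))" by (intro tendsto_vec_nth filterlim_ident)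
  then have "\<forall>\<^sub>F E in nhds (axis j (1::real)). E $ j > 0" by (rule order_tendstoD) simp
  moreover have "\<forall>\<^sub>F E in nhds (axis j (1::real)). dist (graph_support j \<gamma> E) 0 < \<delta>"
    by (rule tendstoD[OF graph_support_tendsto[OF \<gamma>] \<delta>])
  ultimately have "\<forall>\<^sub>F E in nhds (axis j (1::real)). E $ j > 0 \<and> dist (graph_support j \<gamma> E) 0 < \<delta>"
    by (rule eventually_conj)
  then obtain \<eta> where \<eta>': "\<eta> > 0" "\<And>E::real^'n. dist E (axis j 1) < \<eta> \<Longrightarrow> E $ j > 0 \<and> dist (graph_support j \<gamma> E) 0 < \<delta>"
    unfolding eventually_nhds_metric by blast
  have \<eta>: "\<eta> > 0" "\<And>E::real^'n. dist E (axis j 1) < \<eta> \<Longrightarrow> E $ j > 0"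
      "\<And>E. dist E (axis j 1) < \<eta> \<Longrightarrow> norm (graph_support j \<gamma> E) < \<delta>"
    using \<eta>'(1) conjunct1[OF \<eta>'(2)] conjunct2[OF \<eta>'(2)] by simp_all
  have F: "graph_support j \<gamma> E \<in> frontier \<Omega>" if "dist E (axis j 1) < \<eta>" for E
    by (rule fr[OF \<eta>(3)[OF that]]) (simp only: graph_support_coords(2,3)[OF \<gamma>])
  show ?thesis
  proof (rule that[OF \<eta> F])
    fix E z :: "real^'n" assume E: "dist E (axis j 1) < \<eta>" and z: "z \<in> \<Omega>"
    show "(z - graph_support j \<gamma> E) \<bullet> E \<ge> 0"
      using graph_support_supports[OF \<gamma> \<Omega>(1) \<eta>(2)[OF E] below \<eta>(3)[OF E] _ z] F[OF E] frontier_subset_closed[OF \<Omega>(2)] by blast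
  qed
qed

lemma tilted_axis:
  fixes j i :: "'n::finite"
  assumes "i \<noteq> j" "\<bar>s\<bar> \<le> 1"
  defines "v \<equiv> s *\<^sub>R axis j 1 + sqrt (1 - s\<^sup>2) *\<^sub>R (axis i 1 :: real^'n)"
  shows "norm v = 1" "v $ j = s" "hproj j v = sqrt (1 - s\<^sup>2) *\<^sub>R axis i 1"
proof -
  have s2: "s\<^sup>2 \<le> 1" using assms(2) by (simp add: abs_square_le_1)
  show vj: "v $ j = s" using assms(1) by (simp add: v_def axis_def)
  have "hproj j (axis i 1 :: real^'n) = axis i 1" using assms(1) by (auto simp: hproj_def axis_def vec_eq_iff)
  then show h: "hproj j v = sqrt (1 - s\<^sup>2) *\<^sub>R axis i 1" by (simp add: v_def hproj_add hproj_scaleR)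
  have "(norm v)\<^sup>2 = (norm (hproj j v))\<^sup>2 + (v $ j)\<^sup>2" by (simp add: norm_hproj_sq)
  also have "\<dots> = 1" using s2 by (simp add: h vj)
  finally show "norm v = 1" by (simp add: power2_eq_1_iff) (smt (verit) norm_ge_zero)
qed

section \<open>The support function\<close>

definition support_fun :: "'a::real_inner set \<Rightarrow> 'a \<Rightarrow> real" where
  "support_fun \<Omega> E = (SUP x\<in>\<Omega>. x \<bullet> E)"

lemma support_fun_attained:
  fixes \<Omega> :: "'a::real_inner set"
  assumes "p \<in> \<Omega>" "\<And>z. z \<in> \<Omega> \<Longrightarrow> z \<bullet> E \<le> p \<bullet> E"
  shows "support_fun \<Omega> E = p \<bullet> E"
proof -
  have "p \<bullet> E \<in> (\<lambda>x. x \<bullet> E) ` \<Omega>" by (rule imageI[OF assms(1)])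
  moreover have "y \<le> p \<bullet> E" if "y \<in> (\<lambda>x. x \<bullet> E) ` \<Omega>" for y using that assms(2) by blast
  ultimately show ?thesis unfolding support_fun_def by (rule cSup_eq_maximum)
qed

lemma support_fun_upper:
  fixes \<Omega> :: "'a::real_inner set"
  assumes "bounded \<Omega>" "x \<in> \<Omega>"
  shows "x \<bullet> E \<le> support_fun \<Omega> E"
proof -
  obtain B where B: "\<And>z. z \<in> \<Omega> \<Longrightarrow> norm z \<le> B" using assms(1) bounded_iff by metis
  have "z \<bullet> E \<le> B * norm E" if "z \<in> \<Omega>" for z
    using norm_cauchy_schwarz[of z E] mult_right_mono[OF B[OF that] norm_ge_zero[of E]] by linarith
  then have "bdd_above ((\<lambda>x. x \<bullet> E) ` \<Omega>)" by (intro bdd_aboveI2)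
  then show ?thesis unfolding support_fun_def using assms(2) by (rule cSUP_upper2) simp
qed

lemma support_fun_continuous:
  fixes \<Omega> :: "'a::real_inner set"
  assumes "bounded \<Omega>" "\<Omega> \<noteq> {}"
  shows "continuous_on UNIV (support_fun \<Omega>)"
proof -
  obtain B where B: "\<And>z. z \<in> \<Omega> \<Longrightarrow> norm z \<le> B" using assms(1) bounded_iff by metis
  obtain z0 where "z0 \<in> \<Omega>" using assms(2) by blast
  then have B0: "B \<ge> 0" using B[of z0] norm_ge_zero[of z0] by linarith
  have le: "support_fun \<Omega> E \<le> support_fun \<Omega> F + B * norm (E - F)" for E F
    unfolding support_fun_def[of \<Omega> E]
  proof (rule cSUP_least[OF assms(2)])
    fix x assume x: "x \<in> \<Omega>"
    have "x \<bullet> E = x \<bullet> F + x \<bullet> (E - F)" by (simp add: inner_diff_right)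
    moreover have "x \<bullet> (E - F) \<le> B * norm (E - F)" if x: "x \<in> \<Omega>" for x
      using norm_cauchy_schwarz[of x "E - F"] mult_right_mono[OF B[OF x] norm_ge_zero[of "E - F"]] by linarith
    moreover have "x \<bullet> F \<le> support_fun \<Omega> F" by (rule support_fun_upper[OF assms(1) x])
    ultimately show "x \<bullet> E \<le> support_fun \<Omega> F + B * norm (E - F)" using x by fastforce
  qed
  have "dist (support_fun \<Omega> E) (support_fun \<Omega> F) \<le> B * dist E F" for E F
    using le[of E F] le[of F E] by (simp add: dist_norm norm_minus_commute abs_le_iff)
  then have "B-lipschitz_on UNIV (support_fun \<Omega>)" using B0 by (intro lipschitz_onI) auto
  then show ?thesis by (rule lipschitz_on_continuous_on)
qed

section \<open>Anisotropic Gaussian integrals\<close>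

text \<open>For orthonormal \<open>E\<close> and \<open>f\<close>: the integrand of
  \<open>Mpk\<close> has this shape when the boundary has one distinguished principal direction
  \<open>f\<close> and equal curvatures in the others.\<close>

definition gauss3 :: "complex \<Rightarrow> complex \<Rightarrow> complex \<Rightarrow> 'a::euclidean_space \<Rightarrow> 'a \<Rightarrow> 'a \<Rightarrow> complex" where
  "gauss3 a b c E f u = exp (- (a / 2) * of_real ((u \<bullet> E)\<^sup>2)) * exp (- (b / 2) * of_real ((u \<bullet> f)\<^sup>2))
     * exp (- (c / 2) * of_real ((norm u)\<^sup>2 - (u \<bullet> E)\<^sup>2 - (u \<bullet> f)\<^sup>2))"

lemma gauss3_swap: "gauss3 a b c E f = gauss3 b a c f E"
proof
  fix u
  have "(norm u)\<^sup>2 - (u \<bullet> E)\<^sup>2 - (u \<bullet> f)\<^sup>2 = (norm u)\<^sup>2 - (u \<bullet> f)\<^sup>2 - (u \<bullet> E)\<^sup>2" by simp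
  then show "gauss3 a b c E f u = gauss3 b a c f E u" by (simp only: gauss3_def mult.commute mult.assoc mult.left_commute)
qed

lemma bessel2:
  fixes E f u :: "'a::real_inner"
  assumes "norm E = 1" "norm f = 1" "E \<bullet> f = 0"
  shows "(u \<bullet> E)\<^sup>2 + (u \<bullet> f)\<^sup>2 \<le> (norm u)\<^sup>2"
    and "(norm (u - (u \<bullet> E) *\<^sub>R E - (u \<bullet> f) *\<^sub>R f))\<^sup>2 = (norm u)\<^sup>2 - (u \<bullet> E)\<^sup>2 - (u \<bullet> f)\<^sup>2"
proof -
  have "E \<bullet> E = 1" "f \<bullet> f = 1" "f \<bullet> E = 0" using assms by (simp_all add: dot_square_norm inner_commute)
  then show 2: "(norm (u - (u \<bullet> E) *\<^sub>R E - (u \<bullet> f) *\<^sub>R f))\<^sup>2 = (norm u)\<^sup>2 - (u \<bullet> E)\<^sup>2 - (u \<bullet> f)\<^sup>2"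
    unfolding power2_norm_eq_inner using assms(3)
    by (simp add: inner_diff_left inner_diff_right inner_commute power2_eq_square algebra_simps)
  show "(u \<bullet> E)\<^sup>2 + (u \<bullet> f)\<^sup>2 \<le> (norm u)\<^sup>2"
    using zero_le_power2[of "norm (u - (u \<bullet> E) *\<^sub>R E - (u \<bullet> f) *\<^sub>R f)"] unfolding 2 by linarith
qed

lemma integrable_gauss3:
  fixes E f :: "'a::euclidean_space"
  assumes o: "norm E = 1" "norm f = 1" "E \<bullet> f = 0" and c: "Re a > 0" "Re b > 0" "Re c > 0"
  shows "integrable lborel (gauss3 a b c E f)"
proof -
  define m where "m = min (Re a) (min (Re b) (Re c))"
  have m: "m > 0" "m \<le> Re a" "m \<le> Re b" "m \<le> Re c" using c by (auto simp: m_def)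
  show ?thesis
  proof (rule norm_integral_le(1))
    show "gauss3 a b c E f \<in> borel_measurable lborel" unfolding gauss3_def[abs_def] by measurable
    show "integrable lborel (\<lambda>u::'a. exp (- (m / 2) * (norm u)\<^sup>2))" using m by (intro integrable_gauss) simp
    fix u :: 'a
    have r: "(norm u)\<^sup>2 - (u \<bullet> E)\<^sup>2 - (u \<bullet> f)\<^sup>2 \<ge> 0" using bessel2(1)[OF o, of u] by linarith
    have "m * (norm u)\<^sup>2 = m * (u \<bullet> E)\<^sup>2 + m * (u \<bullet> f)\<^sup>2 + m * ((norm u)\<^sup>2 - (u \<bullet> E)\<^sup>2 - (u \<bullet> f)\<^sup>2)"
      by (simp add: algebra_simps)
    also have "\<dots> \<le> Re a * (u \<bullet> E)\<^sup>2 + Re b * (u \<bullet> f)\<^sup>2 + Re c * ((norm u)\<^sup>2 - (u \<bullet> E)\<^sup>2 - (u \<bullet> f)\<^sup>2)"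
      using m r by (intro add_mono mult_right_mono) auto
    finally have le: "m * (norm u)\<^sup>2 \<le> Re a * (u \<bullet> E)\<^sup>2 + Re b * (u \<bullet> f)\<^sup>2 + Re c * ((norm u)\<^sup>2 - (u \<bullet> E)\<^sup>2 - (u \<bullet> f)\<^sup>2)" .
    have "norm (gauss3 a b c E f u) = exp (- (Re a / 2) * (u \<bullet> E)\<^sup>2 + - (Re b / 2) * (u \<bullet> f)\<^sup>2
        + - (Re c / 2) * ((norm u)\<^sup>2 - (u \<bullet> E)\<^sup>2 - (u \<bullet> f)\<^sup>2))"
      unfolding exp_add gauss3_def norm_mult norm_exp_eq_Re by (simp del: of_real_diff of_real_power)
    then show "norm (gauss3 a b c E f u) \<le> exp (- (m / 2) * (norm u)\<^sup>2)" using le by simp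
  qed
qed

lemma norm_gauss3_step:
  fixes E f :: "'a::euclidean_space"
  assumes o: "norm E = 1" "norm f = 1" "E \<bullet> f = 0" and c: "Re a > 0" "Re b > 0" "Re c > 0"
  shows "norm (\<integral>u. gauss3 a b c E f u \<partial>lborel) / sqrt (norm c) = norm (\<integral>u. gauss3 c b c E f u \<partial>lborel) / sqrt (norm a)"
proof -
  let ?k = "\<lambda>a (r::real). exp (- (a / 2) * complex_of_real (r\<^sup>2))"
  let ?h = "\<lambda>y::'a. exp (- (b / 2) * complex_of_real ((y \<bullet> f)\<^sup>2)) * exp (- (c / 2) * complex_of_real ((norm y)\<^sup>2 - (y \<bullet> f)\<^sup>2))"
  have eq: "gauss3 a b c E f = (\<lambda>u. ?k a (u \<bullet> E) * ?h (perp E u))" for a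
  proof
    fix u :: 'a
    have "perp E u \<bullet> f = u \<bullet> f" by (simp add: perp_def inner_diff_left o(3))
    then show "gauss3 a b c E f u = ?k a (u \<bullet> E) * ?h (perp E u)"
      unfolding gauss3_def norm_perp_sq[OF o(1)] by simp
  qed
  have Kr: "(\<integral>r. ?k a r \<partial>lborel) = Kd TYPE(real) a" for a by (simp add: Kd_def)
  have nK: "norm (Kd TYPE(real) a) = K1 TYPE(real) / sqrt (norm a)" if "Re a > 0" for a using norm_Kd[OF that, where 'a=real] by simp
  have kint: "integrable lborel (?k c)" using integrable_cgauss[OF c(3), where 'a=real] by simp
  have "Kd TYPE(real) c * (\<integral>u. gauss3 a b c E f u \<partial>lborel) = Kd TYPE(real) a * (\<integral>u. gauss3 c b c E f u \<partial>lborel)"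
    using integral_line_factor[OF o(1) integrable_gauss3[OF o c, unfolded eq] kint] unfolding eq Kr .
  from arg_cong[OF this, of norm]
  have "K1 TYPE(real) * (norm (\<integral>u. gauss3 a b c E f u \<partial>lborel) / sqrt (norm c))
      = K1 TYPE(real) * (norm (\<integral>u. gauss3 c b c E f u \<partial>lborel) / sqrt (norm a))"
    unfolding norm_mult nK[OF c(1)] nK[OF c(3)] by simp
  then show ?thesis using K1_pos[where 'a=real] by (simp only: mult_left_cancel[OF less_imp_neq[THEN not_sym]])
qed

text \<open>Exchanging the parameter along \<open>E\<close> and then, after a swap, the one along
  \<open>f\<close> for \<open>c\<close> leads to the isotropic Gaussian; by
  \<open>norm_gauss3_step\<close> each exchange costs a quotient of square roots.\<close>

lemma norm_gauss3:
  fixes E f :: "'a::euclidean_space"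
  assumes o: "norm E = 1" "norm f = 1" "E \<bullet> f = 0" and c: "Re b > 0" "Re c > 0"
  shows "norm (\<integral>u. gauss3 1 b c E f u \<partial>lborel) = K1 TYPE('a) * norm c / (sqrt (norm b) * sqrt (norm c) ^ DIM('a))"
proof -
  have o': "f \<bullet> E = 0" using o(3) by (simp add: inner_commute)
  have bc: "sqrt (norm b) > 0" "sqrt (norm c) > 0" using c by auto
  have "norm (\<integral>u. gauss3 1 b c E f u \<partial>lborel) = sqrt (norm c) * norm (\<integral>u. gauss3 c b c E f u \<partial>lborel)"
    using norm_gauss3_step[OF o, of 1 b c] c bc by (simp add: divide_eq_eq mult.commute)
  also have "norm (\<integral>u. gauss3 c b c E f u \<partial>lborel) / sqrt (norm c) = norm (\<integral>u. gauss3 c c c E f u \<partial>lborel) / sqrt (norm b)"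
    using norm_gauss3_step[OF o(2,1) o', of b c c] c unfolding gauss3_swap[of _ _ _ f E] by simp
  then have "norm (\<integral>u. gauss3 c b c E f u \<partial>lborel) = sqrt (norm c) * norm (\<integral>u. gauss3 c c c E f u \<partial>lborel) / sqrt (norm b)"
    using bc(2) by (simp only: divide_eq_eq times_divide_eq_left mult.commute) auto
  also have "gauss3 c c c E f = (\<lambda>u. exp (- (c / 2) * of_real ((norm u)\<^sup>2)))"
    by (simp add: gauss3_def fun_eq_iff exp_add[symmetric] algebra_simps)
  also have "norm (\<integral>(u::'a). exp (- (c / 2) * of_real ((norm u)\<^sup>2)) \<partial>lborel) = K1 TYPE('a) / sqrt (norm c) ^ DIM('a)"
    using norm_Kd[OF c(2), where 'a='a] by (simp add: Kd_def)
  finally show ?thesis by (simp add: field_simps)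
qed

text \<open>\<open>qf\<close> and \<open>qt\<close> are the coefficients of the second order term
  along \<open>f\<close> and across it. The Gaussian parameters are 1 / c - 2 i qf and 1 / c - 2 i
  qt; multiplied by \<open>c\<close> they become the factors in the denominator, and this absorbs
  all powers of c contributed by \<open>PsiL_gauss\<close>.\<close>

lemma norm_Mpk:
  fixes E f :: "'a::euclidean_space" and s qf qt :: real
  assumes o: "norm E = 1" "norm f = 1" "E \<bullet> f = 0" and d: "DIM('a) = Suc (Suc m)"
    and q: "\<And>u. u \<bullet> E = 0 \<Longrightarrow> q u = qf * (u \<bullet> f)\<^sup>2 + qt * ((norm u)\<^sup>2 - (u \<bullet> f)\<^sup>2)"
  defines "c \<equiv> 1 - \<i> * of_real s"
  shows "norm (Mpk E q s) = (K1 TYPE('a))\<^sup>2 / (sqrt (norm (1 - 2 * \<i> * c * of_real qf)) * sqrt (norm (1 - 2 * \<i> * c * of_real qt)) ^ m)"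
proof -
  have c: "Re c > 0" by (simp add: c_def)
  then have c0: "c \<noteq> 0" "norm c > 0" by auto
  obtain \<kappa> where \<kappa>: "\<And>u. PsiL E s u = \<kappa> * exp (- of_real ((norm (perp E u))\<^sup>2) / (2 * c))"
    "norm \<kappa> = K1 TYPE('a) * sqrt (norm c) / sqrt (norm c) ^ DIM('a)"
    using PsiL_gauss[OF o(1), of s] unfolding c_def by metis
  define cf ct where "cf = 1 / c - 2 * \<i> * of_real qf" and "ct = 1 / c - 2 * \<i> * of_real qt"
  have "Re (1 / c) > 0" using c c0 by (simp add: Re_divide divide_pos_pos sum_power2_gt_zero_iff)
  then have re: "Re cf > 0" "Re ct > 0" by (simp_all add: cf_def ct_def)
  then have cft0: "norm cf > 0" "norm ct > 0" by auto
  have "exp (- (1 / 2) * of_real ((u \<bullet> E)\<^sup>2)) * (cis (q (perp E u)) * PsiL E s u) = \<kappa> * gauss3 1 cf ct E f u" for u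
  proof -
    define b where "b = (u \<bullet> f)\<^sup>2"
    define r where "r = (norm u)\<^sup>2 - (u \<bullet> E)\<^sup>2 - (u \<bullet> f)\<^sup>2"
    have N: "(norm (perp E u))\<^sup>2 = b + r" using norm_perp_sq[OF o(1), of u] by (simp add: b_def r_def)
    have pf: "perp E u \<bullet> f = u \<bullet> f" by (simp add: perp_def inner_diff_left o(3))
    have Q: "q (perp E u) = qf * b + qt * r"
      using q[OF perp_orth(1)[OF o(1)], of u] unfolding N pf by (simp add: b_def)
    have "cis (q (perp E u)) * exp (- of_real ((norm (perp E u))\<^sup>2) / (2 * c))
      = exp (- (cf / 2) * of_real b) * exp (- (ct / 2) * of_real r)"
      unfolding cis_conv_exp exp_add[symmetric] N Q using c0
      by (intro arg_cong[of _ _ exp]) (simp add: cf_def ct_def field_simps)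
    moreover have "(norm u)\<^sup>2 - (u \<bullet> E)\<^sup>2 - b = r" by (simp add: b_def r_def)
    ultimately show ?thesis unfolding \<kappa>(1) gauss3_def b_def[symmetric] by (simp add: mult_ac del: of_real_diff of_real_power)
  qed
  then have "Mpk E q s = \<kappa> * (\<integral>u. gauss3 1 cf ct E f u \<partial>lborel)" by (simp add: Mpk_def)
  then have 1: "norm (Mpk E q s) = (K1 TYPE('a) * sqrt (norm c) / sqrt (norm c) ^ DIM('a))
      * (K1 TYPE('a) * norm ct / (sqrt (norm cf) * sqrt (norm ct) ^ DIM('a)))"
    by (simp add: norm_mult \<kappa>(2) norm_gauss3[OF o re])
  have eqf: "1 - 2 * \<i> * c * of_real qf = c * cf" "1 - 2 * \<i> * c * of_real qt = c * ct"
    using c0 by (simp_all add: cf_def ct_def field_simps)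
  define C F T where "C = sqrt (norm c)" and "F = sqrt (norm cf)" and "T = sqrt (norm ct)"
  have pos: "C > 0" "F > 0" "T > 0" using c0 cft0 by (simp_all add: C_def F_def T_def)
  have "norm ct = T * T" using cft0 by (simp add: T_def)
  then show ?thesis unfolding 1 eqf norm_mult real_sqrt_mult d C_def[symmetric] F_def[symmetric] T_def[symmetric]
    using pos by (simp add: field_simps power2_eq_square)
qed

text \<open>\<open>\<rho>f\<close> and \<open>\<rho>t\<close> are twice the principal radii at the
  near end. For each direction the near factor is (rho + 2 i) / rho, and the far one is -(rho + 2 i)
  / (2 w - rho) because 2 w - rho - 2 i (1 - i w) = -(rho + 2 i). The numerators cancel in modulus;
  what is left says that the Gaussian curvatures at the two ends are equal.\<close>

lemma Mpk_match:
  fixes E f :: "'a::euclidean_space" and w \<rho>f \<rho>t :: real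
  assumes o: "norm E = 1" "norm f = 1" "E \<bullet> f = 0" and d: "DIM('a) = Suc (Suc m)"
    and \<rho>: "\<rho>f > 0" "\<rho>t > 0" "2 * w > \<rho>f" "2 * w > \<rho>t"
    and q: "\<And>u. u \<bullet> E = 0 \<Longrightarrow> q u = (u \<bullet> f)\<^sup>2 / (2 * w - \<rho>f) + ((norm u)\<^sup>2 - (u \<bullet> f)\<^sup>2) / (2 * w - \<rho>t)"
    and q': "\<And>u. u \<bullet> E = 0 \<Longrightarrow> q' u = - ((u \<bullet> f)\<^sup>2 / \<rho>f) - ((norm u)\<^sup>2 - (u \<bullet> f)\<^sup>2) / \<rho>t"
    and eq: "norm (Mpk E q w) = norm (Mpk E q' 0)"
  shows "\<rho>f * \<rho>t ^ m = (2 * w - \<rho>f) * (2 * w - \<rho>t) ^ m"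
proof -
  define c where "c = 1 - \<i> * complex_of_real w"
  have 1: "norm (Mpk E q w) = (K1 TYPE('a))\<^sup>2 / (sqrt (norm (1 - 2 * \<i> * c * of_real (1 / (2 * w - \<rho>f)))) * sqrt (norm (1 - 2 * \<i> * c * of_real (1 / (2 * w - \<rho>t)))) ^ m)"
    unfolding c_def by (rule norm_Mpk[OF o d]) (simp add: q)
  have 2: "norm (Mpk E q' 0) = (K1 TYPE('a))\<^sup>2 / (sqrt (norm (1 - 2 * \<i> * (1 - \<i> * complex_of_real 0) * of_real (- (1 / \<rho>f)))) * sqrt (norm (1 - 2 * \<i> * (1 - \<i> * complex_of_real 0) * of_real (- (1 / \<rho>t)))) ^ m)"
    by (rule norm_Mpk[OF o d]) (simp add: q')
  have A: "norm (1 - 2 * \<i> * c * of_real (1 / (2 * w - \<rho>))) = norm (complex_of_real \<rho> + 2 * \<i>) / (2 * w - \<rho>)" if "2 * w > \<rho>" for \<rho>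
  proof -
    have "(1 - 2 * \<i> * c * of_real (1 / (2 * w - \<rho>))) * of_real (2 * w - \<rho>) = of_real (2 * w - \<rho>) - 2 * \<i> * c * (of_real (1 / (2 * w - \<rho>)) * of_real (2 * w - \<rho>))"
      by (simp only: left_diff_distrib mult_1_left mult.assoc)
    also have "of_real (1 / (2 * w - \<rho>)) * of_real (2 * w - \<rho>) = (1::complex)"
      using that by (simp only: of_real_mult[symmetric]) simp
    also have "of_real (2 * w - \<rho>) - 2 * \<i> * c * 1 = - (complex_of_real \<rho> + 2 * \<i>)"
      by (simp add: c_def algebra_simps)
    finally have "norm (1 - 2 * \<i> * c * of_real (1 / (2 * w - \<rho>))) * norm (complex_of_real (2 * w - \<rho>)) = norm (complex_of_real \<rho> + 2 * \<i>)"
      by (metis norm_mult norm_minus_cancel)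
    moreover have "norm (complex_of_real (2 * w - \<rho>)) = 2 * w - \<rho>" using that by (simp only: norm_of_real)
    ultimately show ?thesis using that by (simp only: eq_divide_eq) simp
  qed
  have B: "norm (1 - 2 * \<i> * (1 - \<i> * complex_of_real 0) * of_real (- (1 / \<rho>))) = norm (complex_of_real \<rho> + 2 * \<i>) / \<rho>" if "\<rho> > 0" for \<rho>
  proof -
    have "1 - 2 * \<i> * (1 - \<i> * complex_of_real 0) * of_real (- (1 / \<rho>)) = (complex_of_real \<rho> + 2 * \<i>) / of_real \<rho>"
      using that by (simp add: field_simps)
    then show ?thesis using that by (simp only: norm_divide norm_of_real abs_of_pos)
  qed
  define F T where "F = norm (complex_of_real \<rho>f + 2 * \<i>)" and "T = norm (complex_of_real \<rho>t + 2 * \<i>)"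
  have FT: "F > 0" "T > 0" using \<rho> by (auto simp: F_def T_def complex_eq_iff)
  have "sqrt (F / (2 * w - \<rho>f)) * sqrt (T / (2 * w - \<rho>t)) ^ m = sqrt (F / \<rho>f) * sqrt (T / \<rho>t) ^ m"
  proof -
    have K: "(K1 TYPE('a))\<^sup>2 \<noteq> 0" using K1_pos[where 'a='a] by simp
    have "(K1 TYPE('a))\<^sup>2 / (sqrt (F / (2 * w - \<rho>f)) * sqrt (T / (2 * w - \<rho>t)) ^ m) = (K1 TYPE('a))\<^sup>2 / (sqrt (F / \<rho>f) * sqrt (T / \<rho>t) ^ m)"
      using eq unfolding 1 2 A[OF \<rho>(3)] A[OF \<rho>(4)] B[OF \<rho>(1)] B[OF \<rho>(2)] F_def T_def .
    then show ?thesis using K FT \<rho> by (simp add: divide_simps)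
  qed
  then have "(sqrt (F / (2 * w - \<rho>f)) * sqrt (T / (2 * w - \<rho>t)) ^ m)\<^sup>2 = (sqrt (F / \<rho>f) * sqrt (T / \<rho>t) ^ m)\<^sup>2" by simp
  then have "(sqrt (F / (2 * w - \<rho>f)))\<^sup>2 * ((sqrt (T / (2 * w - \<rho>t)))\<^sup>2) ^ m = (sqrt (F / \<rho>f))\<^sup>2 * ((sqrt (T / \<rho>t))\<^sup>2) ^ m"
    by (simp only: power_mult_distrib power_commutes flip: power_mult) (simp only: mult.commute)
  then have "F / (2 * w - \<rho>f) * (T / (2 * w - \<rho>t)) ^ m = F / \<rho>f * (T / \<rho>t) ^ m"
    using FT \<rho> by simp
  then show ?thesis using FT \<rho> by (simp add: power_divide divide_simps)
qed

section \<open>Double normals near the pole\<close>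

text \<open>The situation to be refuted: packets that vanish along \<open>l\<close> in a dense set
  of directions. \<open>\<delta>\<close> is the radius in which the body is the region above the
  graph, and \<open>\<eta>\<close> the radius around the pole in which supporting hyperplanes touch
  the graph.\<close>

locale vanishing_packets =
  fixes \<Omega> :: "(real^'n::finite) set" and j :: 'n and \<gamma> :: real and l :: "nat \<Rightarrow> real" and \<delta> \<eta> :: real
  assumes card: "CARD('n) \<ge> 2" and \<gamma>: "\<gamma> \<ge> 2" and st: "standing_assms j \<gamma> \<Omega>"
    and l: "filterlim l at_top sequentially"
    and dense: "\<And>V E0. open V \<Longrightarrow> E0 \<in> V \<Longrightarrow> norm E0 = 1 \<Longrightarrow>
      \<exists>E\<in>V. norm E = 1 \<and> (\<lambda>n. Lpk \<Omega> (graph_support j \<gamma> E) E (l n)) \<longlonglongrightarrow> 0"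
    and \<delta>: "\<delta> > 0"
    and above: "\<And>w. norm w < \<delta> \<Longrightarrow> norm (hproj j w) powr \<gamma> < w $ j \<Longrightarrow> w \<in> interior \<Omega>"
    and on_graph: "\<And>w. norm w < \<delta> \<Longrightarrow> norm (hproj j w) powr \<gamma> = w $ j \<Longrightarrow> w \<in> frontier \<Omega>"
    and below: "\<And>w. norm w < \<delta> \<Longrightarrow> norm (hproj j w) powr \<gamma> > w $ j \<Longrightarrow> w \<notin> \<Omega>"
    and \<eta>: "\<eta> > 0" and near_pos: "\<And>E :: real^'n. dist E (axis j 1) < \<eta> \<Longrightarrow> E $ j > 0"
    and near_small: "\<And>E. dist E (axis j 1) < \<eta> \<Longrightarrow> norm (graph_support j \<gamma> E) < \<delta>"
    and near_frontier: "\<And>E. dist E (axis j 1) < \<eta> \<Longrightarrow> graph_support j \<gamma> E \<in> frontier \<Omega>"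
    and near_support: "\<And>E z. dist E (axis j 1) < \<eta> \<Longrightarrow> z \<in> \<Omega> \<Longrightarrow> (z - graph_support j \<gamma> E) \<bullet> E \<ge> 0"
begin

abbreviation "X \<equiv> graph_support j \<gamma>"

text \<open>The width of the body in direction \<open>E\<close>, as \<open>X E\<close> is a lowest
  point in that direction when \<open>E\<close> is near the pole. In good directions it is the
  length of the chord, but it makes sense and is continuous without a double normal.\<close>

definition "width E = support_fun \<Omega> E - X E \<bullet> E"

text \<open>The pole is excluded because its support point is the origin.\<close>

definition "good E \<longleftrightarrow> norm E = 1 \<and> dist E (axis j 1) < \<eta> \<and> hproj j E \<noteq> 0 \<and> (\<lambda>n. Lpk \<Omega> (X E) E (l n)) \<longlonglongrightarrow> 0"

lemma \<Omega>: "compact \<Omega>" "convex \<Omega>" "closed \<Omega>" "bounded \<Omega>"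
  using st by (auto simp: standing_assms_def convex_body_def compact_imp_closed compact_imp_bounded)

lemma frontier_mem: "p \<in> frontier \<Omega> \<Longrightarrow> p \<in> \<Omega>"
  using frontier_subset_closed[OF \<Omega>(3)] by blast

lemma zero_mem: "0 \<in> \<Omega>"
  using on_graph[of 0] \<delta> \<gamma> frontier_mem by (simp add: linear_0[OF hproj_linear])

lemma X_nth: "X E $ j = graph_radius j \<gamma> E powr \<gamma>" and norm_hproj_X: "norm (hproj j (X E)) = graph_radius j \<gamma> E"
  by (rule graph_support_coords[OF \<gamma>])+

lemma radius_pos: "dist E (axis j 1) < \<eta> \<Longrightarrow> hproj j E \<noteq> 0 \<Longrightarrow> graph_radius j \<gamma> E > 0"
  using near_pos[of E] \<gamma> by (simp add: graph_radius_def)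

lemma good_double_normal:
  assumes g: "good E"
  obtains gB HB where "width E > 0" "X E + width E *\<^sub>R E \<in> frontier \<Omega>" "quad_bdry \<Omega> (X E + width E *\<^sub>R E) gB HB"
    "gB = (gB \<bullet> E) *\<^sub>R E" "gB \<bullet> E < 0"
    "\<And>gA HA \<alpha>. quad_bdry \<Omega> (X E) gA HA \<Longrightarrow> gA = \<alpha> *\<^sub>R E \<Longrightarrow> \<alpha> > 0 \<Longrightarrow>
       norm (Mpk E (\<lambda>u. HB u u / (gB \<bullet> E)) (width E)) = norm (Mpk E (\<lambda>u. HA u u / \<alpha>) 0)"
proof -
  have E: "norm E = 1" and d: "dist E (axis j 1) < \<eta>" and h: "hproj j E \<noteq> 0"
    and L: "(\<lambda>n. Lpk \<Omega> (X E) E (l n)) \<longlonglongrightarrow> 0" using g by (simp_all add: good_def)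
  have "X E \<noteq> 0" using radius_pos[OF d h] norm_hproj_X[of E] by (auto simp: linear_0[OF hproj_linear])
  moreover have "X E $ j \<ge> 0" by (simp add: X_nth)
  ultimately obtain w gB HB where w: "w > 0" "X E + w *\<^sub>R E \<in> frontier \<Omega>" "quad_bdry \<Omega> (X E + w *\<^sub>R E) gB HB"
    "gB = (gB \<bullet> E) *\<^sub>R E" "gB \<bullet> E < 0" "\<And>z. z \<in> \<Omega> \<Longrightarrow> z \<bullet> E \<le> X E \<bullet> E + w"
    "\<And>gA HA \<alpha>. quad_bdry \<Omega> (X E) gA HA \<Longrightarrow> gA = \<alpha> *\<^sub>R E \<Longrightarrow> \<alpha> > 0 \<Longrightarrow>
       norm (Mpk E (\<lambda>u. HB u u / (gB \<bullet> E)) w) = norm (Mpk E (\<lambda>u. HA u u / \<alpha>) 0)"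
    using double_normal[OF \<gamma> st E near_pos[OF d] near_frontier[OF d] _ _ near_support[OF d] l L] by blast
  have "(X E + w *\<^sub>R E) \<bullet> E = X E \<bullet> E + w" using E by (simp add: inner_add_left dot_square_norm)
  then have "support_fun \<Omega> E = X E \<bullet> E + w"
    using support_fun_attained[OF frontier_mem[OF w(2)], of E] w(6) by simp
  then have "width E = w" by (simp add: width_def)
  then show ?thesis using that w(1-5,7) by blast
qed

lemma end_mem_of_good: "good E \<Longrightarrow> X E + width E *\<^sub>R E \<in> \<Omega>"
  using good_double_normal frontier_mem by metis

lemma good_dense:
  assumes "norm E0 = 1" "dist E0 (axis j 1) < \<eta>" "hproj j E0 \<noteq> 0" "\<epsilon> > 0"
  obtains E where "good E" "dist E E0 < \<epsilon>"
proof -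
  let ?V = "ball E0 \<epsilon> \<inter> ball (axis j 1) \<eta> \<inter> hproj j -` (- {0})"
  have "continuous_on UNIV (hproj j :: real^'n \<Rightarrow> _)" by (rule linear_continuous_on) (simp add: hproj_linear linear_linear)
  then have "open ?V" by (intro open_Int open_ball open_vimage) auto
  moreover have "E0 \<in> ?V" using assms by (simp add: dist_commute)
  ultimately obtain E where "E \<in> ?V" "norm E = 1" "(\<lambda>n. Lpk \<Omega> (X E) E (l n)) \<longlonglongrightarrow> 0"
    using dense assms(1) by blast
  then have "good E" "dist E E0 < \<epsilon>" by (simp_all add: good_def dist_commute)
  then show ?thesis by (rule that)
qed

lemma good_near_pole:
  assumes "\<epsilon> > 0"
  obtains E where "good E" "dist E (axis j 1) < \<epsilon>"
proof -
  obtain i where i: "i \<noteq> j" using card by (metis (full_types) UNIV_eq_I card_1_singleton_iff insertI1 is_singletonI is_singleton_altdef one_less_numeral_iff semiring_norm(76) not_less singleton_iff)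
  define m where "m = min (\<epsilon>/2) \<eta>"
  have m: "m > 0" using assms \<eta> by (simp add: m_def)
  \<comment> \<open>A unit vector with \<open>j\<close>-th coordinate \<open>s\<close> has squared
    distance 2 - 2 s from the pole, which is then less than m^2; as s < 1, it is not the
    pole.\<close>
  define s where "s = 1 - min 1 (m\<^sup>2 / 4)"
  have s: "0 \<le> s" "s < 1" using m by (auto simp: s_def)
  define v where "v = s *\<^sub>R axis j 1 + sqrt (1 - s\<^sup>2) *\<^sub>R (axis i 1 :: real^'n)"
  have v: "norm v = 1" "v $ j = s" "hproj j v = sqrt (1 - s\<^sup>2) *\<^sub>R axis i 1"
    unfolding v_def using tilted_axis[OF i, of s] s by simp_all
  have "s\<^sup>2 < 1" using s by (simp add: power_less_one_iff abs_square_less_1)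
  then have h: "hproj j v \<noteq> 0" by (simp add: v(3))
  have "(norm (v - axis j 1))\<^sup>2 = (norm v)\<^sup>2 + (norm (axis j (1::real)))\<^sup>2 - 2 * (v \<bullet> axis j 1)"
    unfolding power2_norm_eq_inner by (simp add: inner_diff_left inner_diff_right inner_commute)
  also have "\<dots> = 2 - 2 * s" by (simp add: v(1,2) inner_axis)
  also have "\<dots> < m\<^sup>2" using m by (auto simp: s_def min_def)
  finally have dv: "dist v (axis j 1) < m" using m by (simp add: dist_norm power2_less_imp_less)
  have e2: "\<epsilon>/2 > 0" using assms by simp
  obtain E where E: "good E" "dist E v < \<epsilon>/2"
    using good_dense[OF v(1) _ h e2] dv by (auto simp: m_def)
  have "dist E (axis j 1) < \<epsilon>" using E(2) dv dist_triangle[of E "axis j 1" v] by (simp add: m_def)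
  then show ?thesis using E(1) that by blast
qed

lemma inner_X_le_0:
  assumes "dist E (axis j 1) < \<eta>" shows "X E \<bullet> E \<le> 0"
  using near_support[OF assms zero_mem] by simp

lemma isCont_support_fun: "isCont (support_fun \<Omega>) E"
  using support_fun_continuous[OF \<Omega>(4)] zero_mem by (auto simp: continuous_on_eq_continuous_at)

text \<open>Far ends of good directions tending to the pole converge to
  \<open>w0 *\<^sub>R e\<close>, so this point is in the body. Let r be the graph radius of a good
  \<open>E\<close>. Testing the support function of \<open>E\<close> with that point gives width E
  >= w0 E_j, while the height of the far end of \<open>E\<close> is at most \<open>w0\<close>.
  Together r^gamma <= w0 (1 - E_j^2), which is \<open>w0\<close> times the squared horizontal part
  of \<open>E\<close> and hence at most w0 gamma^2 r^(2 gamma - 2).\<close>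

lemma flat_pole_False:
  assumes \<gamma>2: "\<gamma> > 2"
  shows False
proof -
  define e where "e = (axis j 1 :: real^'n)"
  have "\<exists>E. good E \<and> dist E e < inverse (real (Suc n))" for n
    using good_near_pole[of "inverse (real (Suc n))"] by (auto simp: e_def)
  then obtain F where F: "\<And>n. good (F n)" "\<And>n. dist (F n) e < inverse (real (Suc n))" by metis
  have "(\<lambda>n. dist (F n) e) \<longlonglongrightarrow> 0"
    by (rule tendsto_sandwich[OF _ _ tendsto_const LIMSEQ_inverse_real_of_nat]) (use less_imp_le[OF F(2)] in simp_all)
  then have Fe: "F \<longlonglongrightarrow> e" by (simp add: tendsto_dist_iff[of F])
  define w0 where "w0 = support_fun \<Omega> e"
  have w00: "w0 \<ge> 0" using support_fun_upper[OF \<Omega>(4) zero_mem, of e] by (simp add: w0_def)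
  have S: "(\<lambda>n. support_fun \<Omega> (F n)) \<longlonglongrightarrow> w0"
    unfolding w0_def by (rule isCont_tendsto_compose[OF isCont_support_fun Fe])
  have XF: "(\<lambda>n. X (F n)) \<longlonglongrightarrow> 0"
    by (rule filterlim_compose[OF graph_support_tendsto[OF \<gamma>]]) (use Fe in \<open>simp add: e_def\<close>)
  have rF: "(\<lambda>n. graph_radius j \<gamma> (F n)) \<longlonglongrightarrow> 0"
    by (rule filterlim_compose[OF graph_radius_tendsto[OF \<gamma>]]) (use Fe in \<open>simp add: e_def\<close>)
  have "(\<lambda>n. X (F n) + width (F n) *\<^sub>R F n) \<longlonglongrightarrow> 0 + (w0 - 0 \<bullet> e) *\<^sub>R e"
    unfolding width_def by (intro tendsto_intros XF S Fe)
  then have "(\<lambda>n. X (F n) + width (F n) *\<^sub>R F n) \<longlonglongrightarrow> w0 *\<^sub>R e" by simp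
  then have w0e: "w0 *\<^sub>R e \<in> \<Omega>"
    by (rule closed_sequentially[OF \<Omega>(3), rotated]) (rule end_mem_of_good[OF F(1)])
  have key: "1 \<le> w0 * \<gamma>\<^sup>2 * graph_radius j \<gamma> (F n) powr (\<gamma> - 2)" for n
  proof -
    define E where "E = F n"
    define r where "r = graph_radius j \<gamma> E"
    have g: "good E" using F by (simp add: E_def)
    then have n1: "norm E = 1" and d: "dist E (axis j 1) < \<eta>" and h: "hproj j E \<noteq> 0" by (simp_all add: good_def)
    have Ej: "E $ j > 0" "E $ j \<le> 1" using near_pos[OF d] component_le_norm_cart[of E j] n1 by auto
    have r: "r > 0" using radius_pos[OF d h] by (simp add: r_def)
    have "w0 * E $ j \<le> support_fun \<Omega> E"
      using support_fun_upper[OF \<Omega>(4) w0e, of E] by (simp add: e_def inner_axis' )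
    then have W: "w0 * E $ j \<le> width E" using inner_X_le_0[OF d] by (simp add: width_def)
    have "(X E + width E *\<^sub>R E) \<bullet> e \<le> w0"
      unfolding w0_def by (rule support_fun_upper[OF \<Omega>(4) end_mem_of_good[OF g]])
    then have "r powr \<gamma> + width E * E $ j \<le> w0" by (simp add: e_def inner_axis X_nth r_def)
    then have "r powr \<gamma> \<le> w0 - (w0 * E $ j) * E $ j" using mult_right_mono[OF W, of "E $ j"] Ej by linarith
    also have "\<dots> = w0 * (norm (hproj j E))\<^sup>2" by (subst norm_hproj_sq) (simp add: n1 power2_eq_square algebra_simps)
    also have "norm (hproj j E) \<le> \<gamma> * r powr (\<gamma> - 1)"
      using graph_radius_powr[OF \<gamma> Ej(1)] Ej \<gamma> mult_right_mono[of "\<gamma> * E $ j" \<gamma> "r powr (\<gamma> - 1)"] by (simp add: r_def)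
    then have "w0 * (norm (hproj j E))\<^sup>2 \<le> w0 * (\<gamma> * r powr (\<gamma> - 1))\<^sup>2"
      using w00 by (intro mult_left_mono power_mono) auto
    also have "\<dots> = w0 * \<gamma>\<^sup>2 * r powr (\<gamma> - 2) * r powr \<gamma>"
    proof -
      have "(r powr (\<gamma> - 1))\<^sup>2 = r powr (\<gamma> - 2) * r powr \<gamma>"
        using r by (simp add: power2_eq_square flip: powr_add) 
      then show ?thesis by (simp add: power_mult_distrib)
    qed
    finally have "1 * r powr \<gamma> \<le> w0 * \<gamma>\<^sup>2 * r powr (\<gamma> - 2) * r powr \<gamma>" by simp
    then show ?thesis using r by (simp only: mult_le_cancel_right_pos powr_gt_zero r_def E_def)
  qed
  have "(\<lambda>n. \<bar>graph_radius j \<gamma> (F n)\<bar> powr (\<gamma> - 2)) \<longlonglongrightarrow> 0"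
    by (rule tendsto_zero_powrI[OF _ tendsto_const]) (use tendsto_rabs_zero[OF rF] \<gamma>2 in auto)
  then have "(\<lambda>n. w0 * \<gamma>\<^sup>2 * graph_radius j \<gamma> (F n) powr (\<gamma> - 2)) \<longlonglongrightarrow> w0 * \<gamma>\<^sup>2 * 0"
    by (intro tendsto_mult tendsto_const) (simp add: graph_radius_def)
  from LIMSEQ_le_const[OF this, of 1] key show False by auto
qed

end

section \<open>The paraboloid\<close>

definition pnorm :: "'n::finite \<Rightarrow> real^'n \<Rightarrow> real" where
  "pnorm j x = sqrt (1 + 4 * (norm (hproj j x))\<^sup>2)"

text \<open>The inner unit normal of the graph of the squared norm. It inverts
  \<open>graph_support\<close> with exponent 2 and thus parametrizes the directions near the pole by
  horizontal positions.\<close>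

definition pnormal :: "'n::finite \<Rightarrow> real^'n \<Rightarrow> real^'n" where
  "pnormal j x = (1 / pnorm j x) *\<^sub>R (axis j 1 - 2 *\<^sub>R hproj j x)"

lemma inner_hproj_axis [simp]: "hproj j x \<bullet> axis j 1 = 0" "axis j 1 \<bullet> hproj j x = 0"
  by (simp_all add: inner_axis inner_axis')

lemma pnorm_eq: "pnorm j x = norm (axis j 1 - 2 *\<^sub>R hproj j x)"
proof -
  have "(norm (axis j 1 - 2 *\<^sub>R hproj j x))\<^sup>2 = 1 + 4 * (norm (hproj j x))\<^sup>2"
    unfolding power2_norm_eq_inner by (simp add: inner_diff_left inner_diff_right)
  then show ?thesis unfolding pnorm_def by (metis norm_ge_zero real_sqrt_unique)
qed

lemma pnorm_ge_1: "pnorm j x \<ge> 1" and pnorm_pos: "pnorm j x > 0" and pnorm_sq: "(pnorm j x)\<^sup>2 = 1 + 4 * (norm (hproj j x))\<^sup>2"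
  by (simp_all add: pnorm_def add_pos_nonneg)

lemma norm_pnormal [simp]: "norm (pnormal j x) = 1"
  using pnorm_pos[of j x] by (simp add: pnormal_def pnorm_eq)

lemma pnormal_nth: "pnormal j x $ j = 1 / pnorm j x"
  and hproj_pnormal: "hproj j (pnormal j x) = - (2 / pnorm j x) *\<^sub>R hproj j x"
  by (simp_all add: pnormal_def hproj_diff hproj_scaleR)

lemma pnormal_0: "pnormal j 0 = axis j 1"
  by (simp add: pnormal_def pnorm_def linear_0[OF hproj_linear])

lemma graph_support_parabola:
  assumes "E $ j > 0"
  shows "graph_support j 2 E = - (1 / (2 * E $ j)) *\<^sub>R hproj j E + ((norm (hproj j E))\<^sup>2 / (4 * (E $ j)\<^sup>2)) *\<^sub>R axis j 1"
proof -
  have r: "graph_radius j 2 E = norm (hproj j E) / (2 * E $ j)" using assms by (simp add: graph_radius_def)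
  have p: "graph_radius j 2 E powr 2 = (norm (hproj j E))\<^sup>2 / (4 * (E $ j)\<^sup>2)"
    unfolding r using assms by (simp add: powr_numeral power_divide power_mult_distrib)
  show ?thesis unfolding graph_support_def p unfolding r by (cases "hproj j E = 0") simp_all
qed

lemma graph_support_pnormal: "graph_support j 2 (pnormal j x) = hproj j x + ((norm (hproj j x))\<^sup>2) *\<^sub>R axis j 1"
proof -
  have q: "pnorm j x > 0" by (rule pnorm_pos)
  have "graph_support j 2 (pnormal j x) = - (1 / (2 * (1 / pnorm j x))) *\<^sub>R (- (2 / pnorm j x) *\<^sub>R hproj j x)
     + ((norm (- (2 / pnorm j x) *\<^sub>R hproj j x))\<^sup>2 / (4 * (1 / pnorm j x)\<^sup>2)) *\<^sub>R axis j 1"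
    using graph_support_parabola[of "pnormal j x" j] q unfolding pnormal_nth hproj_pnormal by simp
  then show ?thesis using q by (simp add: power_mult_distrib power_divide)
qed

lemma pnormal_graph_support:
  assumes E: "norm E = 1" "E $ j > 0"
  shows "pnormal j (graph_support j 2 E) = E" "pnorm j (graph_support j 2 E) = 1 / E $ j"
proof -
  have h: "hproj j (graph_support j 2 E) = - (1 / (2 * E $ j)) *\<^sub>R hproj j E"
    unfolding graph_support_parabola[of E j, OF E(2)] by (simp add: hproj_diff hproj_add hproj_scaleR)
  have "1 + 4 * (norm (hproj j (graph_support j 2 E)))\<^sup>2 = 1 + (norm (hproj j E))\<^sup>2 / (E $ j)\<^sup>2"
    unfolding h using E(2) by (simp add: power_mult_distrib power_divide)
  also have "\<dots> = (1 / E $ j)\<^sup>2" using E by (simp add: norm_hproj_sq field_simps)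
  finally show q: "pnorm j (graph_support j 2 E) = 1 / E $ j"
    unfolding pnorm_def using E(2) by (simp add: real_sqrt_unique)
  have "pnormal j (graph_support j 2 E) = (E $ j) *\<^sub>R axis j 1 + hproj j E"
    unfolding pnormal_def q h using E(2) by (simp add: algebra_simps)
  then show "pnormal j (graph_support j 2 E) = E" using hproj_decomp[of E j] by (simp add: add.commute)
qed

text \<open>Normalization has Lipschitz constant at most 2 on vectors of norm at least 1, and the
  unnormalized normal moves by at most twice the distance.\<close>

lemma dist_pnormal_le: "dist (pnormal j x) (pnormal j y) \<le> 4 * dist x y"
proof -
  define u v where "u = axis j 1 - 2 *\<^sub>R hproj j x" and "v = axis j 1 - 2 *\<^sub>R hproj j y"
  have n: "norm u \<ge> 1" "norm v \<ge> 1" using pnorm_ge_1[of j x] pnorm_ge_1[of j y] by (simp_all add: pnorm_eq u_def v_def)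
  have nu: "norm u > 0" "norm v > 0" using n by linarith+
  have "pnormal j x - pnormal j y = (1 / norm u) *\<^sub>R (u - v) + (1 / norm u - 1 / norm v) *\<^sub>R v"
    by (simp add: pnormal_def pnorm_eq u_def v_def algebra_simps)
  then have "norm (pnormal j x - pnormal j y) \<le> norm ((1 / norm u) *\<^sub>R (u - v)) + norm ((1 / norm u - 1 / norm v) *\<^sub>R v)"
    by (simp only: norm_triangle_ineq)
  also have "norm ((1 / norm u - 1 / norm v) *\<^sub>R v) = \<bar>norm v - norm u\<bar> / norm u"
  proof -
    have "1 / norm u - 1 / norm v = (norm v - norm u) / (norm u * norm v)" using nu by (simp add: diff_frac_eq)
    then have "norm ((1 / norm u - 1 / norm v) *\<^sub>R v) = \<bar>norm v - norm u\<bar> / (norm u * norm v) * norm v"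
      using nu by simp
    then show ?thesis using nu by simp
  qed
  also have "norm ((1 / norm u) *\<^sub>R (u - v)) = norm (u - v) / norm u" using nu by simp
  also have "\<bar>norm v - norm u\<bar> \<le> norm (u - v)" using norm_triangle_ineq3[of u v] by (simp add: abs_minus_commute)
  finally have "norm (pnormal j x - pnormal j y) \<le> norm (u - v) / norm u + norm (u - v) / norm u"
    using nu by (simp add: divide_right_mono)
  also have "norm (u - v) / norm u \<le> norm (u - v)" using n nu by (simp add: divide_le_eq mult_le_cancel_left1)
  also have "norm (u - v) = 2 * norm (hproj j (x - y))"
  proof -
    have "u - v = - 2 *\<^sub>R hproj j (x - y)" by (simp add: u_def v_def hproj_diff algebra_simps)
    then show ?thesis by (simp only: norm_scaleR)
  qed
  also have "norm (hproj j (x - y)) \<le> norm (x - y)" by (rule norm_hproj_le)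
  finally show ?thesis by (simp add: dist_norm)
qed

lemma pnormal_deriv:
  assumes x: "hproj j x = x" and \<xi>: "hproj j \<xi> = \<xi>"
  shows "((\<lambda>t. (pnormal j (x + t *\<^sub>R \<xi>) - pnormal j x) /\<^sub>R t) \<longlongrightarrow> - (2 / pnorm j x) *\<^sub>R perp (pnormal j x) \<xi>) (at_right 0)"
proof -
  define v where "v = axis j 1 - 2 *\<^sub>R x"
  define q where "q = norm v"
  define Q where "Q t = norm (v - (2 * t) *\<^sub>R \<xi>)" for t
  have q1: "pnorm j x = q" "pnormal j x = (1 / q) *\<^sub>R v" by (simp_all add: pnorm_eq pnormal_def q_def v_def x)
  have q0: "q > 0" using pnorm_pos[of j x] q1 by simp
  have vt: "axis j 1 - 2 *\<^sub>R hproj j (x + t *\<^sub>R \<xi>) = v - (2 * t) *\<^sub>R \<xi>" for t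
    by (simp add: v_def hproj_add hproj_scaleR x \<xi> algebra_simps)
  have Qp: "pnorm j (x + t *\<^sub>R \<xi>) = Q t" "pnormal j (x + t *\<^sub>R \<xi>) = (1 / Q t) *\<^sub>R (v - (2 * t) *\<^sub>R \<xi>)" for t
    unfolding pnorm_eq pnormal_def vt Q_def by simp_all
  have Q0: "Q t > 0" for t using pnorm_pos[of j "x + t *\<^sub>R \<xi>"] Qp by simp
  \<comment> \<open>The difference of the reciprocals of \<open>Q t\<close> and \<open>q\<close> is
    obtained from \<open>q\<^sup>2 - (Q t)\<^sup>2\<close>, a polynomial divisible by
    \<open>t\<close>. The quotient is therefore explicit and continuous before the limit is
    taken.\<close>
  have eq: "((4 * (v \<bullet> \<xi>) - 4 * t * (\<xi> \<bullet> \<xi>)) / (q * Q t * (q + Q t))) *\<^sub>R (v - (2 * t) *\<^sub>R \<xi>) - (2 / q) *\<^sub>R \<xi>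
      = (pnormal j (x + t *\<^sub>R \<xi>) - pnormal j x) /\<^sub>R t" if t: "t > 0" for t
  proof -
    have "q\<^sup>2 - (Q t)\<^sup>2 = t * (4 * (v \<bullet> \<xi>) - 4 * t * (\<xi> \<bullet> \<xi>))"
      unfolding q_def Q_def power2_norm_eq_inner by (simp add: inner_diff_left inner_diff_right inner_commute algebra_simps)
    moreover have "q\<^sup>2 - (Q t)\<^sup>2 = (1 / Q t - 1 / q) * (q * Q t * (q + Q t))"
      using q0 Q0[of t] by (simp add: field_simps power2_eq_square)
    ultimately have "(1 / Q t - 1 / q) * (q * Q t * (q + Q t)) = t * (4 * (v \<bullet> \<xi>) - 4 * t * (\<xi> \<bullet> \<xi>))" by simp
    moreover have "q * Q t * (q + Q t) > 0" using q0 Q0[of t] by simp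
    ultimately have A: "1 / Q t - 1 / q = t * ((4 * (v \<bullet> \<xi>) - 4 * t * (\<xi> \<bullet> \<xi>)) / (q * Q t * (q + Q t)))"
      by (metis less_irrefl nonzero_eq_divide_eq times_divide_eq_right)
    have "pnormal j (x + t *\<^sub>R \<xi>) - pnormal j x = (1 / Q t - 1 / q) *\<^sub>R (v - (2 * t) *\<^sub>R \<xi>) - (t * (2 / q)) *\<^sub>R \<xi>"
      unfolding Qp q1 by (simp add: algebra_simps)
    also have "\<dots> = t *\<^sub>R (((4 * (v \<bullet> \<xi>) - 4 * t * (\<xi> \<bullet> \<xi>)) / (q * Q t * (q + Q t))) *\<^sub>R (v - (2 * t) *\<^sub>R \<xi>) - (2 / q) *\<^sub>R \<xi>)"
      unfolding A by (simp only: scaleR_diff_right[of t] scaleR_scaleR)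
    finally show ?thesis using t by simp
  qed
  have Qlim: "(Q \<longlongrightarrow> norm (v - (2 * 0) *\<^sub>R \<xi>)) (at_right 0)" unfolding Q_def by (intro tendsto_intros)
  then have Qlim: "(Q \<longlongrightarrow> q) (at_right 0)" by (simp add: q_def)
  have "((\<lambda>t. ((4 * (v \<bullet> \<xi>) - 4 * t * (\<xi> \<bullet> \<xi>)) / (q * Q t * (q + Q t))) *\<^sub>R (v - (2 * t) *\<^sub>R \<xi>) - (2 / q) *\<^sub>R \<xi>)
     \<longlongrightarrow> ((4 * (v \<bullet> \<xi>) - 4 * 0 * (\<xi> \<bullet> \<xi>)) / (q * q * (q + q))) *\<^sub>R (v - (2 * 0) *\<^sub>R \<xi>) - (2 / q) *\<^sub>R \<xi>) (at_right 0)"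
    using q0 by (intro tendsto_intros Qlim) auto
  from tendsto_at_right_cong[OF this eq]
  have "((\<lambda>t. (pnormal j (x + t *\<^sub>R \<xi>) - pnormal j x) /\<^sub>R t) \<longlongrightarrow> ((4 * (v \<bullet> \<xi>)) / (q * q * (q + q))) *\<^sub>R v - (2 / q) *\<^sub>R \<xi>) (at_right 0)"
    by simp
  also have "((4 * (v \<bullet> \<xi>)) / (q * q * (q + q))) *\<^sub>R v - (2 / q) *\<^sub>R \<xi> = - (2 / pnorm j x) *\<^sub>R perp (pnormal j x) \<xi>"
    unfolding q1 perp_def using q0 by (simp add: scaleR_diff_right inner_commute field_simps)
  finally show ?thesis .
qed

text \<open>The defining function is a polynomial of degree 2, so the expansion has no remainder.
  The minus sign sits in the second argument so that the form is an inner product composed with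
  linear maps.\<close>

lemma quad_bdry_parabola:
  fixes \<Omega> :: "(real^'n::finite) set"
  assumes mem: "\<And>w. norm w < \<delta> \<Longrightarrow> w \<in> \<Omega> \<longleftrightarrow> (norm (hproj j w))\<^sup>2 \<le> w $ j"
    and x: "hproj j x = x" "norm (x + ((norm x)\<^sup>2) *\<^sub>R axis j 1) < \<delta>"
  shows "quad_bdry \<Omega> (x + ((norm x)\<^sup>2) *\<^sub>R axis j 1) (pnorm j x *\<^sub>R pnormal j x) (\<lambda>h k. hproj j h \<bullet> (- hproj j k))"
proof (rule quad_bdryI[where \<rho> = "\<lambda>_. 0"])
  let ?p = "x + ((norm x)\<^sup>2) *\<^sub>R axis j (1::real)" and ?g = "pnorm j x *\<^sub>R pnormal j x"
  have g: "?g = axis j 1 - 2 *\<^sub>R x" using pnorm_pos[of j x] by (simp add: pnormal_def x)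
  have "pnormal j x \<noteq> 0" using norm_pnormal[of j x] by (metis norm_zero zero_neq_one)
  then show "?g \<noteq> 0" using pnorm_pos[of j x] by simp
  have bl: "bounded_linear (hproj j :: real^'n \<Rightarrow> _)" using hproj_linear linear_linear by blast
  show "bounded_bilinear (\<lambda>h k. hproj j h \<bullet> (- hproj j k :: real^'n))"
    by (rule bounded_bilinear.comp[OF bounded_bilinear_inner bl bounded_linear_minus[OF bl]])
  show "\<delta> - norm ?p > 0" using x by simp
  show "?p + h \<in> \<Omega> \<longleftrightarrow> 0 \<le> ?g \<bullet> h - (norm (hproj j h))\<^sup>2" if h: "norm h < \<delta> - norm ?p" for h
  proof -
    have "norm (?p + h) < \<delta>" using norm_triangle_ineq[of ?p h] h by linarith
    moreover have hp: "hproj j (?p + h) = x + hproj j h" by (simp add: hproj_add hproj_scaleR x)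
    moreover have xj: "x $ j = 0" by (metis x(1) hproj_nth)
    moreover have "(norm (x + hproj j h))\<^sup>2 = (norm x)\<^sup>2 + 2 * (x \<bullet> hproj j h) + (norm (hproj j h))\<^sup>2"
      unfolding power2_norm_eq_inner by (simp add: inner_add_left inner_add_right inner_commute)
    moreover have "x \<bullet> h = x \<bullet> hproj j h" using inner_hproj[of x h j] by (simp add: x xj)
    then have "?g \<bullet> h = h $ j - 2 * (x \<bullet> hproj j h)" unfolding g by (simp add: inner_diff_left inner_axis')
    ultimately show ?thesis using mem[of "?p + h"] by auto
  qed
  show "continuous_on (ball 0 (\<delta> - norm ?p)) (\<lambda>h. ?g \<bullet> h - (norm (hproj j h))\<^sup>2)"
    by (intro continuous_intros linear_continuous_on bl)
  show "?g \<bullet> h - (norm (hproj j h))\<^sup>2 = ?g \<bullet> h + hproj j h \<bullet> (- hproj j h) + 0 * (norm h)\<^sup>2" for h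
    by (simp add: power2_norm_eq_inner)
qed simp

locale parabolic_pole = vanishing_packets \<Omega> j 2 l \<delta> \<eta>
  for \<Omega> :: "(real^'n::finite) set" and j :: 'n and l :: "nat \<Rightarrow> real" and \<delta> \<eta> :: real
begin

lemma near_pnormal: "norm x < \<eta> / 4 \<Longrightarrow> dist (pnormal j x) (axis j 1) < \<eta>"
  using dist_pnormal_le[of j x 0] by (simp add: pnormal_0)

lemma X_continuous:
  assumes "dist E (axis j 1) < \<eta>" and F: "F \<longlonglongrightarrow> E" "\<And>n. dist (F n) (axis j 1) < \<eta>"
  shows "(\<lambda>n. X (F n)) \<longlonglongrightarrow> X E"
proof -
  have h: "(\<lambda>n. hproj j (F n)) \<longlonglongrightarrow> hproj j E"
    by (rule isCont_tendsto_compose[OF linear_continuous_at F(1)]) (simp add: hproj_linear linear_linear)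
  show ?thesis
    unfolding graph_support_parabola[OF near_pos[OF assms(1)]] graph_support_parabola[OF near_pos[OF F(2)]]
    using near_pos[OF assms(1)] by (intro tendsto_intros h tendsto_vec_nth F) auto
qed

text \<open>Membership of the far end is a closed condition and both of its ingredients are
  continuous, so it passes from good directions to all unit vectors near the pole, including the
  pole itself.\<close>

lemma end_mem:
  assumes E: "norm E = 1" "dist E (axis j 1) < \<eta>"
  shows "X E + width E *\<^sub>R E \<in> \<Omega>"
proof -
  have "\<exists>F. good F \<and> dist F E < inverse (real (Suc n))" for n
  proof (cases "hproj j E = 0")
    case True
    then have "E = (E $ j) *\<^sub>R axis j 1" using hproj_decomp[of E j] by simp
    moreover have "\<bar>E $ j\<bar> = 1" using E(1) calculation by (metis mult.right_neutral norm_axis_1 norm_scaleR)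
    ultimately have "E = axis j 1" using near_pos[OF E(2)] by simp
    then show ?thesis using good_near_pole[of "inverse (real (Suc n))"] by auto
  next
    case False
    then show ?thesis using good_dense[OF E False, of "inverse (real (Suc n))"] by auto
  qed
  then obtain F where F: "\<And>n. good (F n)" "\<And>n. dist (F n) E < inverse (real (Suc n))" by metis
  have "(\<lambda>n. dist (F n) E) \<longlonglongrightarrow> 0"
    by (rule tendsto_sandwich[OF _ _ tendsto_const LIMSEQ_inverse_real_of_nat]) (use less_imp_le[OF F(2)] in simp_all)
  then have FE: "F \<longlonglongrightarrow> E" by (simp add: tendsto_dist_iff[of F])
  have Fn: "dist (F n) (axis j 1) < \<eta>" for n using F(1) by (simp add: good_def)
  have XF: "(\<lambda>n. X (F n)) \<longlonglongrightarrow> X E" by (rule X_continuous[OF E(2) FE Fn])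
  have S: "(\<lambda>n. support_fun \<Omega> (F n)) \<longlonglongrightarrow> support_fun \<Omega> E"
    by (rule isCont_tendsto_compose[OF isCont_support_fun FE])
  have "(\<lambda>n. X (F n) + width (F n) *\<^sub>R F n) \<longlonglongrightarrow> X E + width E *\<^sub>R E"
    unfolding width_def by (intro tendsto_intros XF S FE)
  then show ?thesis
    by (rule closed_sequentially[OF \<Omega>(3), rotated]) (rule end_mem_of_good[OF F(1)])
qed

text \<open>The far end of \<open>F\<close> tests the support function in direction
  \<open>E\<close>, and \<open>X F\<close> tests the minimality of \<open>X E\<close>.\<close>

lemma width_le:
  assumes E: "norm E = 1" "dist E (axis j 1) < \<eta>" and F: "norm F = 1" "dist F (axis j 1) < \<eta>"
  shows "width F * (F \<bullet> E) \<le> width E"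
proof -
  have "(X F + width F *\<^sub>R F) \<bullet> E \<le> support_fun \<Omega> E" by (rule support_fun_upper[OF \<Omega>(4) end_mem[OF F]])
  moreover have "(X F - X E) \<bullet> E \<ge> 0" by (rule near_support[OF E(2) frontier_mem[OF near_frontier[OF F(2)]]])
  ultimately show ?thesis by (simp add: width_def inner_add_left inner_diff_left)
qed

text \<open>By \<open>width_le\<close> the increments of the width are bounded quadratically, so its derivative vanishes.\<close>
lemma width_const:
  obtains c where "\<And>x. norm x < \<eta> / 4 \<Longrightarrow> width (pnormal j x) = c"
proof -
  obtain B where B: "\<And>z. z \<in> \<Omega> \<Longrightarrow> norm z \<le> B" using \<Omega>(4) bounded_iff by metis
  have wB: "width E \<le> 2 * B" if E: "norm E = 1" "dist E (axis j 1) < \<eta>" for E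
  proof -
    have "norm (width E *\<^sub>R E) \<le> norm (X E + width E *\<^sub>R E) + norm (X E)"
      using norm_triangle_ineq4[of "X E + width E *\<^sub>R E" "X E"] by simp
    also have "\<dots> \<le> B + B" by (intro add_mono B end_mem E frontier_mem near_frontier)
    finally show ?thesis using E by simp
  qed
  have B0: "B \<ge> 0" using B[OF zero_mem] by simp
  \<comment> \<open>Unit vectors satisfy 1 - F . E = (dist F E)^2 / 2. With the width at most 2 B
    and the Lipschitz constant 4 of \<open>pnormal\<close> this gives B times 4^2.\<close>
  have one: "width (pnormal j y) - width (pnormal j x) \<le> 16 * B * (norm (y - x))\<^sup>2"
    if "norm x < \<eta> / 4" "norm y < \<eta> / 4" for x y
  proof -
    let ?E = "pnormal j x" and ?F = "pnormal j y"
    have n: "dist ?E (axis j 1) < \<eta>" "dist ?F (axis j 1) < \<eta>" using near_pnormal that by auto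
    have 1: "?E \<bullet> ?E = 1" "?F \<bullet> ?F = 1" by (simp_all add: dot_square_norm)
    have eq: "1 - ?F \<bullet> ?E = (dist ?F ?E)\<^sup>2 / 2"
      unfolding dist_norm power2_norm_eq_inner using 1
      by (simp add: inner_diff_left inner_diff_right inner_commute)
    have "width ?F - width ?E \<le> width ?F * (1 - ?F \<bullet> ?E)"
      using width_le[OF norm_pnormal n(1) norm_pnormal n(2)] by (simp add: algebra_simps)
    also have "\<dots> \<le> (2 * B) * (1 - ?F \<bullet> ?E)"
      by (intro mult_right_mono wB norm_pnormal n) (simp add: eq)
    also have "\<dots> = B * (dist ?F ?E)\<^sup>2" by (simp add: eq)
    also have "\<dots> \<le> B * (4 * dist y x)\<^sup>2" by (intro mult_left_mono power_mono dist_pnormal_le B0) simp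
    finally show ?thesis by (simp add: dist_norm power_mult_distrib)
  qed
  have "((\<lambda>x. width (pnormal j x)) has_derivative (\<lambda>h. 0)) (at x within ball 0 (\<eta> / 4))" if x: "x \<in> ball 0 (\<eta> / 4)" for x
    unfolding has_derivative_within
  proof (intro conjI bounded_linear_zero)
    let ?g = "\<lambda>y. (1 / norm (y - x)) *\<^sub>R (width (pnormal j y) - (width (pnormal j x) + 0))"
    show "(?g \<longlongrightarrow> 0) (at x within ball 0 (\<eta> / 4))"
    proof (rule Lim_null_comparison)
      have "norm (?g y) \<le> 16 * B * norm (y - x)" if y: "y \<in> ball 0 (\<eta> / 4)" "y \<noteq> x" for y
      proof -
        have p: "norm (y - x) > 0" using y by simp
        have "\<bar>width (pnormal j y) - width (pnormal j x)\<bar> \<le> 16 * B * (norm (y - x))\<^sup>2"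
          using one[of x y] one[of y x] x y by (simp add: norm_minus_commute abs_le_iff)
        then show ?thesis using p by (simp add: divide_le_eq power2_eq_square mult.assoc)
      qed
      then show "\<forall>\<^sub>F y in at x within ball 0 (\<eta> / 4). norm (?g y) \<le> 16 * B * norm (y - x)"
        unfolding eventually_at_filter by (auto intro!: always_eventually)
      have "((\<lambda>y. 16 * B * norm (y - x)) \<longlongrightarrow> 16 * B * norm (x - x)) (at x within ball 0 (\<eta> / 4))"
        by (intro tendsto_intros)
      then show "((\<lambda>y. 16 * B * norm (y - x)) \<longlongrightarrow> 0) (at x within ball 0 (\<eta> / 4))" by simp
    qed
  qed
  from has_derivative_zero_constant[OF convex_ball this]
  obtain c where "\<And>x. x \<in> ball 0 (\<eta> / 4) \<Longrightarrow> width (pnormal j x) = c" by blast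
  then show ?thesis using that by simp
qed

end

text \<open>Otherwise the tangent direction \<open>z\<close> would enter the interior, which lies
  strictly on one side of the supporting hyperplane.\<close>

lemma quad_bdry_nonpos:
  assumes qb: "quad_bdry \<Omega> p g H" and \<Omega>: "convex \<Omega>" "p \<in> \<Omega>" and z: "g \<bullet> z = 0"
  shows "H z z \<le> 0"
proof (rule ccontr)
  assume "\<not> H z z \<le> 0"
  then have "\<forall>\<^sub>F t in at_right 0. p + (t *\<^sub>R z + (t\<^sup>2 * 0) *\<^sub>R 0) \<in> interior \<Omega>"
    by (intro quad_bdry_ray(1)[OF qb z]) simp
  then obtain t :: real where t: "p + t *\<^sub>R z \<in> interior \<Omega>"
    using eventually_happens trivial_limit_at_right_real by fastforce
  from quad_bdry_support_interior[OF qb \<Omega> this] z show False by simp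
qed

context parabolic_pole
begin

text \<open>Constant width makes the far ends over x + t xi run in the boundary, so neither strict
  sign in \<open>quad_bdry\<close> can occur and \<open>k + H z z\<close> is 0. Here
  \<open>z\<close> is the velocity of that curve and \<open>k\<close> its second order component
  along \<open>g\<close>; this reads off \<open>H\<close> at the far end from the
  paraboloid.\<close>

lemma width_curve:
  assumes x: "hproj j x = x" "norm x < \<eta> / 4" and c: "\<And>y. norm y < \<eta> / 4 \<Longrightarrow> width (pnormal j y) = c"
    and qB: "quad_bdry \<Omega> (X (pnormal j x) + c *\<^sub>R pnormal j x) g H" and g: "g = \<beta> *\<^sub>R pnormal j x"
    and \<xi>: "hproj j \<xi> = \<xi>"
  defines "q \<equiv> pnorm j x" and "P \<equiv> perp (pnormal j x) \<xi>"
  defines "z \<equiv> \<xi> + (2 * (x \<bullet> \<xi>)) *\<^sub>R axis j 1 - (2 * c / q) *\<^sub>R P"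
  shows "H z z = - \<beta> * ((norm \<xi>)\<^sup>2 / q - (2 * c / q\<^sup>2) * (norm P)\<^sup>2)"
proof -
  define E where "E = pnormal j x"
  define n where "n t = pnormal j (x + t *\<^sub>R \<xi>)" for t
  define y where "y t = X (n t) + c *\<^sub>R n t" for t
  define h where "h t = y t - y 0" for t
  have EE: "E \<bullet> E = 1" "n t \<bullet> n t = 1" for t by (simp_all add: E_def n_def dot_square_norm)
  have q0: "q > 0" by (simp add: q_def pnorm_pos)
  have n0: "n 0 = E" by (simp add: n_def E_def)
  have hx: "hproj j (x + t *\<^sub>R \<xi>) = x + t *\<^sub>R \<xi>" for t by (simp add: hproj_add hproj_scaleR x \<xi>)
  have Xn: "X (n t) = x + t *\<^sub>R \<xi> + ((norm (x + t *\<^sub>R \<xi>))\<^sup>2) *\<^sub>R axis j 1" for t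
    unfolding n_def graph_support_pnormal hx ..
  have sq: "(norm (x + t *\<^sub>R \<xi>))\<^sup>2 = (norm x)\<^sup>2 + 2 * t * (x \<bullet> \<xi>) + t\<^sup>2 * (norm \<xi>)\<^sup>2" for t
    unfolding power2_norm_eq_inner by (simp add: inner_add_left inner_add_right inner_commute power2_eq_square)
  have heq: "h t = t *\<^sub>R \<xi> + (2 * t * (x \<bullet> \<xi>) + t\<^sup>2 * (norm \<xi>)\<^sup>2) *\<^sub>R axis j 1 + c *\<^sub>R (n t - E)" for t
  proof -
    have "h t = X (n t) - X (n 0) + c *\<^sub>R (n t - n 0)" by (simp add: h_def y_def algebra_simps)
    then show ?thesis unfolding Xn by (simp add: n0 sq algebra_simps)
  qed
  have nd: "((\<lambda>t. (n t - E) /\<^sub>R t) \<longlongrightarrow> - (2 / q) *\<^sub>R P) (at_right 0)"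
    unfolding n_def E_def q_def P_def by (rule pnormal_deriv[OF x(1) \<xi>])
  have A1: "((\<lambda>t. \<xi> + (2 * (x \<bullet> \<xi>) + t * (norm \<xi>)\<^sup>2) *\<^sub>R axis j 1 + c *\<^sub>R ((n t - E) /\<^sub>R t))
     \<longlongrightarrow> \<xi> + (2 * (x \<bullet> \<xi>) + 0 * (norm \<xi>)\<^sup>2) *\<^sub>R axis j 1 + c *\<^sub>R (- (2 / q) *\<^sub>R P)) (at_right 0)"
    by (intro tendsto_intros nd)
  have A2: "\<xi> + (2 * (x \<bullet> \<xi>) + 0 * (norm \<xi>)\<^sup>2) *\<^sub>R axis j 1 + c *\<^sub>R (- (2 / q) *\<^sub>R P) = z"
    by (simp add: z_def mult.commute)
  have A3: "\<xi> + (2 * (x \<bullet> \<xi>) + t * (norm \<xi>)\<^sup>2) *\<^sub>R axis j 1 + c *\<^sub>R ((n t - E) /\<^sub>R t) = h t /\<^sub>R t" if "t > 0" for t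
  proof -
    have "h t = t *\<^sub>R (\<xi> + (2 * (x \<bullet> \<xi>) + t * (norm \<xi>)\<^sup>2) *\<^sub>R axis j 1 + c *\<^sub>R ((n t - E) /\<^sub>R t))"
      unfolding heq scaleR_add_right scaleR_scaleR using that by (simp add: power2_eq_square algebra_simps)
    then show ?thesis using that by simp
  qed
  have lz: "((\<lambda>t. h t /\<^sub>R t) \<longlongrightarrow> z) (at_right 0)" by (rule tendsto_at_right_cong[OF A1[unfolded A2] A3])
  have xax: "x \<bullet> axis j 1 = 0" "\<xi> \<bullet> axis j 1 = 0" using inner_hproj_axis(1)[of j x] inner_hproj_axis(1)[of j \<xi>] x \<xi> by simp_all
  have E\<xi>: "E \<bullet> \<xi> = - 2 * (x \<bullet> \<xi>) / q" "E \<bullet> axis j 1 = 1 / q"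
    using xax inner_hproj_axis(2)[of j \<xi>] \<xi> by (simp_all add: E_def pnormal_def q_def x inner_diff_left inner_axis_axis)
  \<comment> \<open>For unit vectors the difference is, along one of them, already of second order.
    So the first derivative of the normal determines the second order term of the curve along
    \<open>g\<close>.\<close>
  have En: "E \<bullet> (n t - E) = - ((norm (n t - E))\<^sup>2 / 2)" for t
    unfolding power2_norm_eq_inner using EE by (simp add: inner_diff_left inner_diff_right inner_commute field_simps)
  have gh: "\<beta> * ((norm \<xi>)\<^sup>2 / q - c * (norm ((n t - E) /\<^sub>R t))\<^sup>2 / 2) = g \<bullet> h t / t\<^sup>2" if t: "t > 0" for t
  proof -
    have "E \<bullet> h t = t\<^sup>2 * (norm \<xi>)\<^sup>2 / q - c * (norm (n t - E))\<^sup>2 / 2"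
      unfolding heq inner_add_right inner_scaleR_right E\<xi> En using q0 by (simp add: field_simps)
    also have "\<dots> = t\<^sup>2 * ((norm \<xi>)\<^sup>2 / q - c * (norm ((n t - E) /\<^sub>R t))\<^sup>2 / 2)"
    proof -
      have "(norm ((n t - E) /\<^sub>R t))\<^sup>2 = (norm (n t - E))\<^sup>2 / t\<^sup>2"
        using t by (simp only: norm_scaleR) (simp add: power_mult_distrib power_divide divide_inverse mult.commute flip: power_inverse)
      then show ?thesis using t by (simp only:) (simp add: right_diff_distrib)
    qed
    finally show ?thesis using t by (simp add: g E_def[symmetric])
  qed
  have "((\<lambda>t. \<beta> * ((norm \<xi>)\<^sup>2 / q - c * (norm ((n t - E) /\<^sub>R t))\<^sup>2 / 2))
      \<longlongrightarrow> \<beta> * ((norm \<xi>)\<^sup>2 / q - c * (norm (- (2 / q) *\<^sub>R P))\<^sup>2 / 2)) (at_right 0)"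
    by (intro tendsto_intros nd) (use q0 in auto)
  from tendsto_at_right_cong[OF this gh]
  have lk: "((\<lambda>t. g \<bullet> h t / t\<^sup>2) \<longlongrightarrow> \<beta> * ((norm \<xi>)\<^sup>2 / q - c * (norm (- (2 / q) *\<^sub>R P))\<^sup>2 / 2)) (at_right 0)" .
  have kk: "c * (norm (- (2 / q) *\<^sub>R P))\<^sup>2 / 2 = (2 * c / q\<^sup>2) * (norm P)\<^sup>2"
    by (simp add: power_mult_distrib power_divide)
  note lk = lk[unfolded kk]
  have py: "(X (pnormal j x) + c *\<^sub>R pnormal j x) + h t = y t" for t by (simp add: h_def y_def n0 E_def)
  have near: "\<forall>\<^sub>F t in at_right (0::real). norm (x + t *\<^sub>R \<xi>) < \<eta> / 4"
  proof -
    have "((\<lambda>t::real. norm (x + t *\<^sub>R \<xi>)) \<longlongrightarrow> norm (x + 0 *\<^sub>R \<xi>)) (at_right 0)" by (intro tendsto_intros)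
    then show ?thesis by (rule order_tendstoD) (use x in simp)
  qed
  have yin: "y t \<in> \<Omega> \<and> y t \<notin> interior \<Omega>" if t: "norm (x + t *\<^sub>R \<xi>) < \<eta> / 4" for t
  proof
    have d: "dist (n t) (axis j 1) < \<eta>" unfolding n_def by (rule near_pnormal[OF t])
    have w: "width (n t) = c" unfolding n_def by (rule c[OF t])
    show yO: "y t \<in> \<Omega>" using end_mem[OF _ d] w by (simp add: y_def n_def)
    show "y t \<notin> interior \<Omega>"
    proof
      assume "y t \<in> interior \<Omega>"
      then obtain e where e: "e > 0" "cball (y t) e \<subseteq> \<Omega>" by (auto simp: mem_interior_cball)
      have "y t + e *\<^sub>R n t \<in> \<Omega>" using e by (intro subsetD[OF e(2)]) (auto simp: dist_norm n_def)
      from support_fun_upper[OF \<Omega>(4) this, of "n t"] have "y t \<bullet> n t + e \<le> support_fun \<Omega> (n t)"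
        using EE by (simp add: inner_add_left)
      moreover have "y t \<bullet> n t = support_fun \<Omega> (n t)"
        using w EE by (simp add: y_def inner_add_left width_def)
      ultimately show False using e by simp
    qed
  qed
  let ?v = "\<beta> * ((norm \<xi>)\<^sup>2 / q - (2 * c / q\<^sup>2) * (norm P)\<^sup>2) + H z z"
  have "\<not> ?v > 0"
  proof
    assume "?v > 0"
    from quad_bdryD(1)[OF qB lz lk this] have "\<forall>\<^sub>F t in at_right 0. y t \<in> interior \<Omega>" by (simp add: py)
    then have "\<forall>\<^sub>F t in at_right (0::real). False" using near by eventually_elim (use yin in blast)
    then show False by simp
  qed
  moreover have "\<not> ?v < 0"
  proof
    assume "?v < 0"
    from quad_bdryD(2)[OF qB lz lk this] have "\<forall>\<^sub>F t in at_right 0. y t \<notin> \<Omega>" by (simp add: py)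
    then have "\<forall>\<^sub>F t in at_right (0::real). False" using near by eventually_elim (use yin in blast)
    then show False by simp
  qed
  ultimately show ?thesis by linarith
qed

text \<open>The far ends form a parallel surface of the paraboloid, so the principal radii of curvature there are \<open>c\<close>
  minus those of the paraboloid, which are \<open>q ^ 3 / 2\<close> (once, in direction \<open>f\<close>) and \<open>q / 2\<close>.\<close>
lemma good_equation:
  assumes E: "good E" and small: "norm (hproj j (X E)) < \<eta> / 4"
    and c: "\<And>y. norm y < \<eta> / 4 \<Longrightarrow> width (pnormal j y) = c"
    and q: "q = 1 / E $ j" and c_ne: "2 * c \<noteq> q ^ 3" and m: "CARD('n) = Suc (Suc m)"
  shows "2 * c > q ^ 3" "q ^ 3 * q ^ m = (2 * c - q ^ 3) * (2 * c - q) ^ m"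
proof -
  have nE: "norm E = 1" and d: "dist E (axis j 1) < \<eta>" and h: "hproj j E \<noteq> 0" using E by (simp_all add: good_def)
  have Ej: "E $ j > 0" by (rule near_pos[OF d])
  define x where "x = hproj j (X E)"
  have hx: "hproj j x = x" by (simp add: x_def)
  have xs: "norm x < \<eta> / 4" using small by (simp add: x_def)
  have pn: "pnormal j y = pnormal j (hproj j y)" "pnorm j y = pnorm j (hproj j y)" for y by (simp_all add: pnormal_def pnorm_def)
  have Nx: "pnormal j x = E" "pnorm j x = q"
    using pnormal_graph_support[OF nE Ej] pn[of "X E"] by (simp_all add: x_def q)
  have q0: "q > 0" and q1: "q \<ge> 1" using pnorm_pos[of j x] pnorm_ge_1[of j x] by (simp_all add: Nx)
  have EE: "E \<bullet> E = 1" by (simp add: dot_square_norm nE)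
  define e where "e = (axis j 1 :: real^'n)"
  have ee: "e \<bullet> e = 1" "x \<bullet> e = 0" "e \<bullet> x = 0" using inner_hproj_axis[of j x] hx by (simp_all add: e_def inner_axis_axis)
  define r where "r = norm x"
  have r0: "r > 0" using radius_pos[OF d h] norm_hproj_X[of E] by (simp add: r_def x_def)
  have xx: "x \<bullet> x = r\<^sup>2" by (simp add: r_def dot_square_norm)
  have qr: "q\<^sup>2 = 1 + 4 * r\<^sup>2" using pnorm_sq[of j x] by (simp add: Nx hx r_def)
  have Eeq: "E = (1 / q) *\<^sub>R (e - 2 *\<^sub>R x)" using Nx(1) by (simp add: pnormal_def Nx(2) hx e_def)
  have pos: "1 + 4 * r\<^sup>2 \<noteq> 0" using zero_le_power2[of r] by linarith
  have qq: "1 - 4 * r\<^sup>2 / q\<^sup>2 = 1 / q\<^sup>2"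
  proof -
    have "1 - 4 * r\<^sup>2 / q\<^sup>2 = (q\<^sup>2 - 4 * r\<^sup>2) / q\<^sup>2" using q0 by (simp add: diff_divide_distrib)
    also have "q\<^sup>2 - 4 * r\<^sup>2 = 1" using qr by linarith
    finally show ?thesis .
  qed
  \<comment> \<open>The unit vector orthogonal to \<open>E\<close> in the plane of \<open>E\<close>
    and the axis: the meridian direction, tangent at both ends of the chord.\<close>
  define f where "f = (1 / (q * r)) *\<^sub>R x + (2 * r / q) *\<^sub>R e"
  have Ef: "E \<bullet> f = 0" unfolding Eeq f_def using q0 r0
    by (simp add: inner_add_right inner_diff_left ee xx field_simps power2_eq_square)
  have "f \<bullet> f = (1 + 4 * r\<^sup>2) / q\<^sup>2" unfolding f_def using q0 r0
    by (simp add: inner_add_right inner_add_left ee xx field_simps power2_eq_square)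
  then have ff: "f \<bullet> f = 1" using qr q0 pos by simp
  then have nf: "norm f = 1" by (simp add: norm_eq_sqrt_inner)
  have e_eq: "e = (1 / q) *\<^sub>R E + (2 * r / q) *\<^sub>R f"
  proof -
    have "(1 / q) *\<^sub>R E + (2 * r / q) *\<^sub>R f = ((1 + 4 * r\<^sup>2) / q\<^sup>2) *\<^sub>R e + (2 / q\<^sup>2 - 2 / q\<^sup>2) *\<^sub>R x"
      unfolding Eeq f_def using q0 r0 by (simp add: algebra_simps power2_eq_square add_divide_distrib)
    then show ?thesis using qr q0 pos by simp
  qed
  have xj: "u $ j = u \<bullet> e" for u by (simp add: e_def inner_axis)
  obtain gB HB where gB: "width E > 0" "X E + width E *\<^sub>R E \<in> frontier \<Omega>" "quad_bdry \<Omega> (X E + width E *\<^sub>R E) gB HB"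
    "gB = (gB \<bullet> E) *\<^sub>R E" "gB \<bullet> E < 0"
    "\<And>gA HA \<alpha>. quad_bdry \<Omega> (X E) gA HA \<Longrightarrow> gA = \<alpha> *\<^sub>R E \<Longrightarrow> \<alpha> > 0 \<Longrightarrow>
       norm (Mpk E (\<lambda>u. HB u u / (gB \<bullet> E)) (width E)) = norm (Mpk E (\<lambda>u. HA u u / \<alpha>) 0)"
    using good_double_normal[OF E] by blast
  define \<beta> where "\<beta> = gB \<bullet> E"
  have \<beta>: "\<beta> < 0" "gB = \<beta> *\<^sub>R E" using gB(4,5) by (simp_all add: \<beta>_def)
  have wc: "width E = c" using c[OF xs] by (simp add: Nx)
  have qB: "quad_bdry \<Omega> (X (pnormal j x) + c *\<^sub>R pnormal j x) gB HB" using gB(3) by (simp add: Nx wc)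
  have gBx: "gB = \<beta> *\<^sub>R pnormal j x" by (simp add: Nx \<beta>)
  \<comment> \<open>Let v = a f + zeta be a tangent vector at the near end and xi its horizontal
    part. The velocity of the far end is then the vector \<open>u\<close>: the map from near to far
    tangent vectors is diagonal with factors 1 - 2 c / q^3 along \<open>f\<close> and 1 - 2 c / q
    across.\<close>
  have val: "HB u u / \<beta> = - (a\<^sup>2 / q ^ 3 * (1 - 2 * c / q ^ 3) + (norm \<zeta>)\<^sup>2 / q * (1 - 2 * c / q))"
    if o: "\<zeta> \<bullet> E = 0" "\<zeta> \<bullet> f = 0" and u: "u = (a * (1 - 2 * c / q ^ 3)) *\<^sub>R f + (1 - 2 * c / q) *\<^sub>R \<zeta>" for a \<zeta> u
  proof -
    define v where "v = a *\<^sub>R f + \<zeta>"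
    define \<xi> where "\<xi> = hproj j v"
    have vE: "v \<bullet> E = 0" using Ef o by (simp add: v_def inner_add_left inner_add_right inner_commute)
    have \<zeta>e: "\<zeta> \<bullet> e = 0" by (subst e_eq) (simp add: inner_add_right o)
    have fe: "f \<bullet> e = 2 * r / q" by (subst e_eq) (simp add: inner_add_right ff Ef inner_commute[of f E])
    have ve: "v \<bullet> e = 2 * r / q * a" by (simp add: v_def inner_add_left \<zeta>e fe)
    have \<xi>v: "\<xi> = v - (v \<bullet> e) *\<^sub>R e" using hproj_decomp[of v j] unfolding \<xi>_def xj e_def by (metis add_diff_cancel_right')
    have "v \<bullet> E = (1 / q) * (v \<bullet> e - 2 * (v \<bullet> x))" unfolding Eeq by (simp add: inner_diff_right)
    then have "v \<bullet> e = 2 * (v \<bullet> x)" using vE q0 by simp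
    moreover have "x \<bullet> \<xi> = v \<bullet> x" unfolding \<xi>v by (simp add: inner_diff_right ee inner_commute)
    ultimately have x\<xi>: "2 * (x \<bullet> \<xi>) = v \<bullet> e" by simp
    have pe: "perp E e = (2 * r / q) *\<^sub>R f"
    proof -
      have "e \<bullet> E = 1 / q" by (subst e_eq) (simp add: inner_add_left EE Ef inner_commute[of f])
      moreover have "e - (1 / q) *\<^sub>R E = (2 * r / q) *\<^sub>R f" by (subst e_eq) simp
      ultimately show ?thesis by (simp add: perp_def)
    qed
    have "perp E \<xi> = perp E v - (v \<bullet> e) *\<^sub>R perp E e"
      unfolding \<xi>v by (simp add: perp_def inner_diff_left algebra_simps)
    also have "perp E v = v" by (simp add: perp_def vE)
    finally have "perp E \<xi> = (a * (1 - 4 * r\<^sup>2 / q\<^sup>2)) *\<^sub>R f + \<zeta>"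
      unfolding ve pe by (simp add: v_def algebra_simps power2_eq_square)
    then have P: "perp E \<xi> = (a / q\<^sup>2) *\<^sub>R f + \<zeta>" unfolding qq by simp
    have z: "\<xi> + (2 * (x \<bullet> \<xi>)) *\<^sub>R axis j 1 - (2 * c / q) *\<^sub>R perp E \<xi> = u"
    proof -
      have "\<xi> + (2 * (x \<bullet> \<xi>)) *\<^sub>R axis j 1 = v" unfolding x\<xi> by (simp add: \<xi>v e_def)
      then show ?thesis unfolding P u v_def using q0
        by (simp add: algebra_simps power2_eq_square power3_eq_cube)
    qed
    have pyth: "(norm (b *\<^sub>R f + \<zeta>))\<^sup>2 = b\<^sup>2 + (norm \<zeta>)\<^sup>2" for b
      unfolding power2_norm_eq_inner using o by (simp add: inner_add_left inner_add_right ff inner_commute[of f \<zeta>] power2_eq_square)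
    have n\<xi>: "(norm \<xi>)\<^sup>2 = a\<^sup>2 / q\<^sup>2 + (norm \<zeta>)\<^sup>2"
    proof -
      have "(norm \<xi>)\<^sup>2 = (norm v)\<^sup>2 - (v $ j)\<^sup>2" by (simp add: \<xi>_def norm_hproj_sq)
      also have "\<dots> = a\<^sup>2 * (1 - 4 * r\<^sup>2 / q\<^sup>2) + (norm \<zeta>)\<^sup>2"
        unfolding xj ve unfolding v_def pyth by (simp add: power_mult_distrib power_divide algebra_simps)
      finally show ?thesis unfolding qq by simp
    qed
    have nP: "(norm (perp E \<xi>))\<^sup>2 = (a / q\<^sup>2)\<^sup>2 + (norm \<zeta>)\<^sup>2" unfolding P by (rule pyth)
    have "HB u u = - \<beta> * ((norm \<xi>)\<^sup>2 / q - (2 * c / q\<^sup>2) * (norm (perp E \<xi>))\<^sup>2)"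
      using width_curve[OF hx xs c qB gBx, of \<xi>] unfolding Nx z by (simp add: \<xi>_def)
    then have "HB u u / \<beta> = - ((norm \<xi>)\<^sup>2 / q - (2 * c / q\<^sup>2) * (norm (perp E \<xi>))\<^sup>2)" using \<beta>(1) by simp
    also have "\<dots> = - (a\<^sup>2 / q ^ 3 * (1 - 2 * c / q ^ 3) + (norm \<zeta>)\<^sup>2 / q * (1 - 2 * c / q))"
      unfolding n\<xi> nP using q0 by (simp add: field_simps power2_eq_square power3_eq_cube)
    finally show ?thesis .
  qed
  have p_mem: "X E + width E *\<^sub>R E \<in> \<Omega>" by (rule frontier_mem[OF gB(2)])
  \<comment> \<open>As 2 c differs from q^3, the vector \<open>f\<close> itself is a velocity of far
    ends. If 2 c < q^3, the value of \<open>HB f f\<close> would be positive, against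
    \<open>quad_bdry_nonpos\<close>.\<close>
  show gt: "2 * c > q ^ 3"
  proof (rule ccontr)
    assume "\<not> 2 * c > q ^ 3"
    then have lt: "q ^ 3 - 2 * c > 0" using c_ne by simp
    have D: "1 - 2 * c / q ^ 3 = (q ^ 3 - 2 * c) / q ^ 3" using q0 by (simp add: diff_divide_distrib)
    have "f = (q ^ 3 / (q ^ 3 - 2 * c) * (1 - 2 * c / q ^ 3)) *\<^sub>R f + (1 - 2 * c / q) *\<^sub>R 0"
      unfolding D using lt q0 by simp
    from val[OF _ _ this] have "HB f f / \<beta> = - ((q ^ 3 / (q ^ 3 - 2 * c))\<^sup>2 / q ^ 3 * (1 - 2 * c / q ^ 3))" by simp
    moreover have "(q ^ 3 / (q ^ 3 - 2 * c))\<^sup>2 / q ^ 3 * (1 - 2 * c / q ^ 3) > 0"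
      unfolding D using lt q0 by simp
    ultimately have "HB f f / \<beta> < 0" by linarith
    moreover have "HB f f \<le> 0"
      by (rule quad_bdry_nonpos[OF gB(3) \<Omega>(2) p_mem]) (simp add: \<beta>(2) Ef)
    then have "HB f f / \<beta> \<ge> 0" using \<beta>(1) by (simp add: divide_nonpos_neg)
    ultimately show False by simp
  qed
  have q13: "q \<le> q ^ 3" using q1 by (simp add: self_le_power)
  have gt': "2 * c > q" using gt q13 by linarith
  \<comment> \<open>Both diagonal factors are nonzero, so every tangent vector at the far end is
    such a velocity and \<open>val\<close> determines \<open>HB\<close> on all of them.\<close>
  have full: "HB u u / \<beta> = (u \<bullet> f)\<^sup>2 / (2 * c - q ^ 3) + ((norm u)\<^sup>2 - (u \<bullet> f)\<^sup>2) / (2 * c - q)" if u: "u \<bullet> E = 0" for u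
  proof -
    define b where "b = u \<bullet> f"
    define y where "y = u - b *\<^sub>R f"
    have yo: "y \<bullet> E = 0" "y \<bullet> f = 0" using u Ef ff by (simp_all add: y_def b_def inner_diff_left inner_commute[of f E])
    define A where "A = 1 - 2 * c / q ^ 3"
    define B where "B = 1 - 2 * c / q"
    have AB: "A * q ^ 3 = q ^ 3 - 2 * c" "B * q = q - 2 * c" using q0 by (simp_all add: A_def B_def field_simps)
    have A0: "A \<noteq> 0" "B \<noteq> 0" using AB gt gt' q0 by auto
    have "u = (b / A * A) *\<^sub>R f + B *\<^sub>R ((1 / B) *\<^sub>R y)" using A0 by (simp add: y_def)
    from val[OF _ _ this[unfolded A_def B_def]] yo
    have "HB u u / \<beta> = - ((b / A)\<^sup>2 / q ^ 3 * A + (norm ((1 / B) *\<^sub>R y))\<^sup>2 / q * B)" by (simp add: A_def B_def)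
    also have "\<dots> = - (b\<^sup>2 / (A * q ^ 3) + (norm y)\<^sup>2 / (B * q))"
      using A0 q0 by (simp add: power_mult_distrib power_divide field_simps power2_eq_square)
    also have "\<dots> = b\<^sup>2 / (2 * c - q ^ 3) + (norm y)\<^sup>2 / (2 * c - q)"
    proof -
      have "s / (a - b) = - (s / (b - a))" for s a b :: real by (simp only: minus_divide_right minus_diff_eq)
      from this[of _ "q ^ 3" "2 * c"] this[of _ q "2 * c"] show ?thesis unfolding AB by simp
    qed
    also have "(norm y)\<^sup>2 = (norm u)\<^sup>2 - b\<^sup>2"
      unfolding power2_norm_eq_inner y_def b_def
      by (simp add: inner_diff_left inner_diff_right ff inner_commute power2_eq_square algebra_simps)
    finally show ?thesis by (simp add: b_def)
  qed
  have mem: "w \<in> \<Omega> \<longleftrightarrow> (norm (hproj j w))\<^sup>2 \<le> w $ j" if w: "norm w < \<delta>" for w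
  proof -
    have p: "norm (hproj j w) powr 2 = (norm (hproj j w))\<^sup>2" by (cases "hproj j w = 0") (simp_all add: powr_numeral)
    show ?thesis
      using above[OF w] on_graph[OF w] below[OF w] frontier_mem interior_subset[of \<Omega>] unfolding p
      by (meson linorder_cases not_le order_le_less subsetD)
  qed
  have XE: "x + ((norm x)\<^sup>2) *\<^sub>R axis j 1 = X E"
    using graph_support_pnormal[of j x] by (simp add: Nx hx)
  have qA: "quad_bdry \<Omega> (X E) (q *\<^sub>R E) (\<lambda>h k. hproj j h \<bullet> (- hproj j k))"
    using quad_bdry_parabola[OF mem hx] near_small[OF d] unfolding XE Nx by blast
  have eqM: "norm (Mpk E (\<lambda>u. HB u u / \<beta>) c) = norm (Mpk E (\<lambda>u. hproj j u \<bullet> (- hproj j u) / q) 0)"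
    using gB(6)[OF qA refl q0] by (simp add: \<beta>_def wc)
  have qA': "hproj j u \<bullet> (- hproj j u) / q = - ((u \<bullet> f)\<^sup>2 / q ^ 3) - ((norm u)\<^sup>2 - (u \<bullet> f)\<^sup>2) / q" if u: "u \<bullet> E = 0" for u
  proof -
    have "u $ j = 2 * r / q * (u \<bullet> f)" unfolding xj by (subst e_eq) (simp add: inner_add_right u)
    then have "(norm (hproj j u))\<^sup>2 = (norm u)\<^sup>2 - 4 * r\<^sup>2 / q\<^sup>2 * (u \<bullet> f)\<^sup>2"
      by (simp add: norm_hproj_sq power_mult_distrib power_divide)
    also have "4 * r\<^sup>2 / q\<^sup>2 = 1 - 1 / q\<^sup>2" using qq by linarith
    finally have N: "(norm (hproj j u))\<^sup>2 = (norm u)\<^sup>2 - (1 - 1 / q\<^sup>2) * (u \<bullet> f)\<^sup>2" .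
    have "hproj j u \<bullet> (- hproj j u) / q = - ((norm (hproj j u))\<^sup>2 / q)" by (simp add: dot_square_norm)
    then show ?thesis unfolding N using q0 by (simp add: field_simps power2_eq_square power3_eq_cube)
  qed
  have DIM: "DIM(real^'n) = Suc (Suc m)" using m by simp
  have "q ^ 3 > 0" using q0 by simp
  from Mpk_match[OF nE nf Ef DIM this q0 gt gt' full qA' eqM]
  show "q ^ 3 * q ^ m = (2 * c - q ^ 3) * (2 * c - q) ^ m" .
qed

text \<open>With \<open>c\<close> fixed, the left side of the equation in
  \<open>good_equation\<close> increases strictly with \<open>q\<close>, while the right side does
  not increase as long as 2 c > q^3. So at most one q > 1 solves it, whereas good directions near
  the pole supply different values.\<close>

lemma parabolic_pole_False: False
proof -
  obtain c where c: "\<And>x. norm x < \<eta> / 4 \<Longrightarrow> width (pnormal j x) = c" using width_const by blast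
  obtain m where m: "CARD('n) = Suc (Suc m)"
    using card by (metis Suc_le_D numeral_2_eq_2 Suc_le_mono)
  have ex: "\<exists>E. good E \<and> norm (hproj j (X E)) < \<eta> / 4 \<and> 1 / E $ j < b \<and> 1 < 1 / E $ j" if b: "b > 1" for b
  proof -
    have "\<forall>\<^sub>F E in nhds (axis j 1). dist (graph_radius j 2 E) 0 < \<eta> / 4"
      by (rule tendstoD[OF graph_radius_tendsto]) (use \<eta> in simp_all)
    moreover have "((\<lambda>E. E $ j) \<longlongrightarrow> axis j 1 $ j) (nhds (axis j (1::real)))" by (intro tendsto_vec_nth filterlim_ident)
    then have "\<forall>\<^sub>F E in nhds (axis j (1::real)). E $ j > 1 / b" by (rule order_tendstoD) (use b in simp)
    ultimately have "\<forall>\<^sub>F E in nhds (axis j (1::real)). dist (graph_radius j 2 E) 0 < \<eta> / 4 \<and> E $ j > 1 / b" by (rule eventually_conj)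
    then obtain \<epsilon> where \<epsilon>: "\<epsilon> > 0" "\<And>E. dist E (axis j 1) < \<epsilon> \<Longrightarrow> dist (graph_radius j 2 E) 0 < \<eta> / 4 \<and> E $ j > 1 / b"
      unfolding eventually_nhds_metric by blast
    obtain E where E: "good E" "dist E (axis j 1) < \<epsilon>" using good_near_pole[OF \<epsilon>(1)] by blast
    have d: "dist E (axis j 1) < \<eta>" and n: "norm E = 1" and h: "hproj j E \<noteq> 0" using E(1) by (simp_all add: good_def)
    have Ej: "E $ j > 0" by (rule near_pos[OF d])
    have "(E $ j)\<^sup>2 < 1"
    proof -
      have "(norm (hproj j E))\<^sup>2 > 0" using h by simp
      then show ?thesis unfolding norm_hproj_sq n by simp
    qed
    then have "E $ j < 1" using Ej by (simp add: abs_square_less_1)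
    moreover have "norm (hproj j (X E)) < \<eta> / 4" using \<epsilon>(2)[OF E(2)] norm_hproj_X[of E] norm_ge_zero[of "hproj j (X E)"] by simp
    moreover have "E $ j > 1 / b" using \<epsilon>(2)[OF E(2)] by simp
    ultimately show ?thesis using E(1) Ej b by (intro exI[of _ E]) (simp add: field_simps)
  qed
  define ok where "ok q \<longleftrightarrow> q > 1 \<and> 2 * c > q ^ 3 \<and> q ^ 3 * q ^ m = (2 * c - q ^ 3) * (2 * c - q) ^ m" for q
  have ok_ex: "\<exists>q. 1 < q \<and> q < b \<and> ok q" if b: "b > 1" for b
  proof -
    obtain E where E: "good E" "norm (hproj j (X E)) < \<eta> / 4" "1 / E $ j < b" "1 < 1 / E $ j" using ex[OF b] by blast
    obtain F where F: "good F" "norm (hproj j (X F)) < \<eta> / 4" "1 / F $ j < 1 / E $ j" "1 < 1 / F $ j" using ex[OF E(4)] by blast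
    \<comment> \<open>\<open>good_equation\<close> excludes the value with 2 c = q^3; of two
      directions with different slopes at least one avoids it.\<close>
    have "(1 / F $ j) ^ 3 < (1 / E $ j) ^ 3" by (intro power_strict_mono) (use F(3,4) in linarith)+
    then consider "2 * c \<noteq> (1 / E $ j) ^ 3" | "2 * c \<noteq> (1 / F $ j) ^ 3" by linarith
    then show ?thesis
    proof cases
      case 1
      then show ?thesis using good_equation[OF E(1,2) c refl 1 m] E by (auto simp: ok_def intro!: exI[of _ "1 / E $ j"])
    next
      case 2
      then show ?thesis using good_equation[OF F(1,2) c refl 2 m] E F by (auto simp: ok_def intro!: exI[of _ "1 / F $ j"])
    qed
  qed
  obtain q2 where q2: "ok q2" "1 < q2" using ok_ex[of 2] by auto
  obtain q1 where q1: "ok q1" "1 < q1" "q1 < q2" using ok_ex[OF q2(2)] by auto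
  have cube: "q1 ^ 3 < q2 ^ 3" using q1 by (intro power_strict_mono) auto
  have "q2 \<le> q2 ^ 3" using q2 by (simp add: self_le_power)
  then have gt: "2 * c > q2" using q2 by (simp add: ok_def)
  have gt3: "2 * c > q2 ^ 3" using q2 by (simp add: ok_def)
  have "q1 ^ 3 * q1 ^ m < q2 ^ 3 * q2 ^ m"
    using cube q1 by (intro mult_less_le_imp_less power_mono) auto
  also have "\<dots> = (2 * c - q2 ^ 3) * (2 * c - q2) ^ m" using q2 by (simp add: ok_def)
  also have "\<dots> \<le> (2 * c - q1 ^ 3) * (2 * c - q1) ^ m"
    using cube q1 gt gt3 by (intro mult_mono power_mono) auto
  also have "\<dots> = q1 ^ 3 * q1 ^ m" using q1 by (simp add: ok_def)
  finally show False by simp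
qed

end

section \<open>The lower bound\<close>

lemma no_vanishing_packets:
  fixes \<Omega> :: "(real^'n::finite) set"
  assumes card: "CARD('n) \<ge> 2" and \<gamma>: "\<gamma> \<ge> 2" and st: "standing_assms j \<gamma> \<Omega>"
    and l: "filterlim l at_top sequentially"
    and dense: "\<And>V E0. open V \<Longrightarrow> E0 \<in> V \<Longrightarrow> norm E0 = 1 \<Longrightarrow>
      \<exists>E\<in>V. norm E = 1 \<and> (\<lambda>n. Lpk \<Omega> (graph_support j \<gamma> E) E (l n)) \<longlonglongrightarrow> 0"
  shows False
proof -
  obtain \<delta> where \<delta>: "\<delta> > 0" "\<delta> \<le> 1"
    and above: "\<And>w. norm w < \<delta> \<Longrightarrow> norm (hproj j w) powr \<gamma> < w $ j \<Longrightarrow> w \<in> interior \<Omega>"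
    and on_graph: "\<And>w. norm w < \<delta> \<Longrightarrow> norm (hproj j w) powr \<gamma> = w $ j \<Longrightarrow> w \<in> frontier \<Omega>"
    and below: "\<And>w. norm w < \<delta> \<Longrightarrow> norm (hproj j w) powr \<gamma> > w $ j \<Longrightarrow> w \<notin> \<Omega>"
    by (rule standing_graph[OF card \<gamma> st]) (rule that)
  obtain \<eta> where \<eta>: "\<eta> > 0" "\<And>E::real^'n. dist E (axis j 1) < \<eta> \<Longrightarrow> E $ j > 0"
    "\<And>E. dist E (axis j 1) < \<eta> \<Longrightarrow> norm (graph_support j \<gamma> E) < \<delta>"
    "\<And>E. dist E (axis j 1) < \<eta> \<Longrightarrow> graph_support j \<gamma> E \<in> frontier \<Omega>"
    "\<And>E z. dist E (axis j 1) < \<eta> \<Longrightarrow> z \<in> \<Omega> \<Longrightarrow> (z - graph_support j \<gamma> E) \<bullet> E \<ge> 0"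
    using graph_support_near_pole[OF card \<gamma> st \<delta>(1) on_graph below] by blast
  have vp: "vanishing_packets \<Omega> j \<gamma> l \<delta> \<eta>"
    using card \<gamma> st l dense \<delta>(1) above on_graph below \<eta> by (rule vanishing_packets.intro)
  show False
  proof (cases "\<gamma> = 2")
    case True
    then have "parabolic_pole \<Omega> j l \<delta> \<eta>" using vp by (simp add: parabolic_pole_def)
    then show False by (rule parabolic_pole.parabolic_pole_False)
  next
    case False
    then have "\<gamma> > 2" using \<gamma> by simp
    with vp show False by (rule vanishing_packets.flat_pole_False)
  qed
qed

lemma norm_fhat_le:
  assumes "compact \<Omega>"
  shows "norm (fhat \<Omega> \<xi>) \<le> measure lborel \<Omega>"
proof -
  have [measurable]: "\<Omega> \<in> sets borel" using assms by (simp add: compact_imp_closed borel_closed)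
  have "norm (fhat \<Omega> \<xi>) \<le> (\<integral>x. indicator \<Omega> x \<partial>lborel)"
    unfolding fhat_def by (rule norm_integral_le(2)[OF _ finite_measure_compact[OF assms]]) (auto simp: indicator_def)
  then show ?thesis by simp
qed

lemma measure_cube: "measure lborel (cube :: (real^'n::finite) set) = 1"
  by (subst measure_lborel_cbox_eq) (simp add: inner_sum_left inner_Basis cong: sum.cong)

text \<open>The power mean inequality by a tangent: x powr p lies above its tangent at M, where M is
  the mean of the Fourier bound. Integrated over \<open>t\<close> and \<open>\<sigma>\<close>, the
  linear term has mean 0 and M powr p remains.\<close>

lemma discrepancy_moment_lower:
  fixes \<Omega> :: "(real^'n::finite) set" and \<mu> :: "(real^'n^'n) measure"
  assumes card: "CARD('n) \<ge> 2" and haar: "haar_SO \<mu>" and \<Omega>: "compact \<Omega>" and R: "R > 0" and p: "p \<ge> 1"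
  shows "R ^ CARD('n) * (\<integral>\<sigma>. norm (fhat \<Omega> ((2 * pi * R) *\<^sub>R (transpose \<sigma> *v axis k 1))) \<partial>\<mu>)
    \<le> (\<integral>\<sigma>. (\<integral>t\<in>cbox (0::real^'n) One. \<bar>discrepancy \<Omega> R \<sigma> t\<bar> powr p \<partial>lborel) \<partial>\<mu>) powr (1 / p)"
    and "integrable \<mu> (\<lambda>\<sigma>. norm (fhat \<Omega> ((2 * pi * R) *\<^sub>R (transpose \<sigma> *v axis k 1))))"
proof -
  interpret prob_space \<mu> by (rule haar_prob[OF haar card])
  let ?n = "CARD('n)"
  have [measurable]: "\<Omega> \<in> sets borel" using \<Omega> by (simp add: compact_imp_closed borel_closed)
  have [measurable]: "(\<lambda>\<sigma>. \<sigma>) \<in> borel_measurable \<mu>" by (rule haar_id_measurable[OF haar card])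
  have [measurable]: "fhat \<Omega> \<in> borel_measurable borel" by (rule fhat_measurable[OF haar card]) measurable
  obtain B where B: "\<And>x. x \<in> \<Omega> \<Longrightarrow> norm x \<le> B" using compact_imp_bounded[OF \<Omega>] by (auto simp: bounded_iff)
  have tn: "norm t \<le> real ?n" if "t \<in> cube" for t :: "real^'n"
  proof -
    have "norm t \<le> (\<Sum>i\<in>UNIV. \<bar>t $ i\<bar>)" by (rule norm_le_l1_cart)
    also have "\<dots> \<le> (\<Sum>i\<in>(UNIV::'n set). 1)" using that by (intro sum_mono) (auto simp: mem_cube abs_le_iff)
    finally show ?thesis by simp
  qed
  define L where "L = (lat (R * B + real ?n) :: (real^'n) set)"
  define V where "V = R ^ ?n * measure lebesgue \<Omega>"
  \<comment> \<open>Agrees with the discrepancy for rotations \<open>\<sigma>\<close> and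
    \<open>t\<close> in the cube, but is a finite sum with a fixed index set, hence jointly
    measurable and bounded.\<close>
  define D where "D \<sigma> t = V - (\<Sum>z\<in>L. indicator \<Omega> ((1 / R) *\<^sub>R (transpose \<sigma> *v (z - t))))" for \<sigma> :: "real^'n^'n" and t
  define C where "C = \<bar>V\<bar> + real (card L)"
  define G where "G \<sigma> = (\<integral>t. indicator cube t * \<bar>D \<sigma> t\<bar> powr p \<partial>lborel)" for \<sigma>
  define \<phi> where "\<phi> \<sigma> = norm (fhat \<Omega> ((2 * pi * R) *\<^sub>R (transpose \<sigma> *v axis k 1)))" for \<sigma> :: "real^'n^'n"
  have DD: "discrepancy \<Omega> R \<sigma> t = D \<sigma> t" if "\<sigma> \<in> space \<mu>" "t \<in> cube" for \<sigma> t
    using card_slice_eq[OF SOd_orthogonal R B tn[OF that(2)], of \<sigma>] that(1)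
    by (simp add: haar_space[OF haar card] discrepancy_def D_def V_def L_def)
  have Dle: "\<bar>D \<sigma> t\<bar> \<le> C" for \<sigma> t
  proof -
    have "\<bar>\<Sum>z\<in>L. indicator \<Omega> ((1 / R) *\<^sub>R (transpose \<sigma> *v (z - t))) :: real\<bar> \<le> (\<Sum>z\<in>L. 1)"
      by (rule order_trans[OF sum_abs sum_mono]) (simp add: indicator_def)
    then show ?thesis unfolding D_def C_def by simp
  qed
  have cube_int: "integrable lborel (\<lambda>t::real^'n. indicator cube t * c :: real)" for c
    by (intro integrable_mult_left finite_measure_compact) simp
  have cube_val: "(\<integral>(t::real^'n). indicator cube t * c \<partial>lborel) = (c::real)" for c
    using measure_cube[where 'n='n] by simp
  have Gint: "integrable lborel (\<lambda>t. indicator cube t * \<bar>D \<sigma> t\<bar> powr p)" for \<sigma>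
  proof (rule norm_integral_le(1)[OF _ cube_int[of "C powr p"]])
    show "(\<lambda>t. indicator cube t * \<bar>D \<sigma> t\<bar> powr p) \<in> borel_measurable lborel" unfolding D_def by measurable
    show "norm (indicator cube t * \<bar>D \<sigma> t\<bar> powr p) \<le> indicator cube t * C powr p" for t
      using powr_mono2[of p "\<bar>D \<sigma> t\<bar>" C] Dle[of \<sigma> t] p by (simp add: indicator_def)
  qed
  have G0: "G \<sigma> \<ge> 0" and GC: "G \<sigma> \<le> C powr p" for \<sigma>
  proof -
    show "G \<sigma> \<ge> 0" unfolding G_def by (intro Bochner_Integration.integral_nonneg) (simp add: indicator_def)
    have "G \<sigma> \<le> (\<integral>(t::real^'n). indicator cube t * C powr p \<partial>lborel)" unfolding G_def
      using powr_mono2[of p _ C] Dle p by (intro integral_mono Gint cube_int) (simp add: indicator_def)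
    then show "G \<sigma> \<le> C powr p" by (simp only: cube_val)
  qed
  have Gm: "G \<in> borel_measurable \<mu>"
    unfolding G_def[abs_def] D_def by (rule lborel.borel_measurable_lebesgue_integral) measurable
  have Gi: "integrable \<mu> G"
    by (rule integrable_const_bound[of _ "C powr p"]) (use G0 GC Gm in auto)
  have \<phi>m[measurable]: "\<phi> \<in> borel_measurable \<mu>" unfolding \<phi>_def[abs_def] by measurable
  have \<phi>i: "integrable \<mu> \<phi>"
    by (rule integrable_const_bound[of _ "measure lborel \<Omega>"]) (auto simp: \<phi>_def norm_fhat_le[OF \<Omega>])
  show "integrable \<mu> (\<lambda>\<sigma>. norm (fhat \<Omega> ((2 * pi * R) *\<^sub>R (transpose \<sigma> *v axis k 1))))"
    using \<phi>i by (simp add: \<phi>_def[abs_def])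
  define M where "M = R ^ ?n * (\<integral>\<sigma>. \<phi> \<sigma> \<partial>\<mu>)"
  have M0: "M \<ge> 0" unfolding M_def using R by (intro mult_nonneg_nonneg Bochner_Integration.integral_nonneg) (auto simp: \<phi>_def)
  have low: "M powr p + p * M powr (p - 1) * (R ^ ?n * \<phi> \<sigma> - M) \<le> G \<sigma>" if \<sigma>: "\<sigma> \<in> space \<mu>" for \<sigma>
  proof -
    have om: "orthogonal_matrix \<sigma>" using \<sigma> by (simp add: haar_space[OF haar card] SOd_orthogonal)
    have eq: "indicator cube t * \<bar>discrepancy \<Omega> R \<sigma> t\<bar> = indicator cube t * \<bar>D \<sigma> t\<bar>" for t
      using DD[OF \<sigma>, of t] by (auto simp: indicator_def)
    note df = discrepancy_fourier(1)[OF om R \<Omega>, unfolded eq] discrepancy_fourier(2)[OF om R \<Omega>, of k, unfolded eq]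
    let ?a = "M powr p - p * M powr (p - 1) * M" and ?b = "p * M powr (p - 1)"
    have "?b * (R ^ ?n * \<phi> \<sigma>) \<le> ?b * (\<integral>t. indicator cube t * \<bar>D \<sigma> t\<bar> \<partial>lborel)"
      using df(2) p by (intro mult_left_mono) (auto simp: \<phi>_def)
    also have "?a + \<dots> = (\<integral>t. indicator cube t * ?a + ?b * (indicator cube t * \<bar>D \<sigma> t\<bar>) \<partial>lborel)"
      by (subst Bochner_Integration.integral_add[OF cube_int integrable_mult_right[OF df(1)]])
         (simp only: cube_val integral_mult_right_zero)
    also have "\<dots> \<le> G \<sigma>" unfolding G_def
    proof (rule integral_mono[OF Bochner_Integration.integrable_add[OF cube_int integrable_mult_right[OF df(1)]] Gint])
      fix t :: "real^'n"
      have "\<bar>D \<sigma> t\<bar> powr p \<ge> M powr p + p * M powr (p - 1) * (\<bar>D \<sigma> t\<bar> - M)"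
        by (rule powr_above_tangent) (use M0 p in auto)
      then show "indicator cube t * ?a + ?b * (indicator cube t * \<bar>D \<sigma> t\<bar>) \<le> indicator cube t * \<bar>D \<sigma> t\<bar> powr p"
        by (simp add: indicator_def algebra_simps)
    qed
    finally show ?thesis by (simp add: algebra_simps)
  qed
  have "M powr p = (\<integral>\<sigma>. M powr p + p * M powr (p - 1) * (R ^ ?n * \<phi> \<sigma> - M) \<partial>\<mu>)"
    using \<phi>i by (simp add: prob_space M_def)
  also have "\<dots> \<le> (\<integral>\<sigma>. G \<sigma> \<partial>\<mu>)"
    by (rule integral_mono) (use \<phi>i Gi low in auto)
  also have "\<dots> = (\<integral>\<sigma>. (\<integral>t\<in>cbox (0::real^'n) One. \<bar>discrepancy \<Omega> R \<sigma> t\<bar> powr p \<partial>lborel) \<partial>\<mu>)"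
  proof (rule Bochner_Integration.integral_cong[OF refl])
    fix \<sigma> assume "\<sigma> \<in> space \<mu>"
    then show "G \<sigma> = (\<integral>t\<in>cbox (0::real^'n) One. \<bar>discrepancy \<Omega> R \<sigma> t\<bar> powr p \<partial>lborel)"
      unfolding G_def set_lebesgue_integral_def
      by (intro Bochner_Integration.integral_cong) (auto simp: indicator_def DD)
  qed
  finally have "(M powr p) powr (1 / p) \<le> (\<integral>\<sigma>. (\<integral>t\<in>cbox (0::real^'n) One. \<bar>discrepancy \<Omega> R \<sigma> t\<bar> powr p \<partial>lborel) \<partial>\<mu>) powr (1 / p)"
    using p by (intro powr_mono2) auto
  moreover have "(M powr p) powr (1 / p) = M" using p M0 by (simp add: powr_powr)
  ultimately show "R ^ CARD('n) * (\<integral>\<sigma>. norm (fhat \<Omega> ((2 * pi * R) *\<^sub>R (transpose \<sigma> *v axis k 1))) \<partial>\<mu>)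
    \<le> (\<integral>\<sigma>. (\<integral>t\<in>cbox (0::real^'n) One. \<bar>discrepancy \<Omega> R \<sigma> t\<bar> powr p \<partial>lborel) \<partial>\<mu>) powr (1 / p)"
    by (simp add: M_def \<phi>_def)
qed

theorem theorem4:
  fixes \<Omega> :: "(real^'n::finite) set" and j :: 'n and \<gamma> :: real
    and \<mu> :: "(real^'n^'n) measure"
  assumes "CARD('n) \<ge> 2" and "\<gamma> \<ge> 2"
    and "standing_assms j \<gamma> \<Omega>"
    and "haar_SO \<mu>"
  shows "\<forall>p::real. p \<ge> 1 \<longrightarrow> (\<exists>c>0. \<forall>\<^sub>F R in at_top.
           (\<integral>\<sigma>. (\<integral>t\<in>cbox (0::real^'n) One. \<bar>discrepancy \<Omega> R \<sigma> t\<bar> powr p \<partial>lborel) \<partial>\<mu>) powr (1 / p)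
             \<ge> c * R powr ((real CARD('n) - 1) / 2))"
proof (intro allI impI)
  fix p :: real assume p: "p \<ge> 1"
  define I where "I R = (\<integral>\<sigma>. (\<integral>t\<in>cbox (0::real^'n) One. \<bar>discrepancy \<Omega> R \<sigma> t\<bar> powr p \<partial>lborel) \<partial>\<mu>) powr (1 / p)" for R
  have \<Omega>: "compact \<Omega>" using assms(3) by (simp add: standing_assms_def convex_body_def)
  have "\<exists>c>0. \<forall>\<^sub>F R in at_top. I R \<ge> c * R powr ((real CARD('n) - 1) / 2)"
  proof (rule ccontr)
    assume no: "\<not> ?thesis"
    \<comment> \<open>The constant 1 / (n + 1) fails for arbitrarily large radii, in particular for
      one beyond n + 1.\<close>
    have "\<exists>R\<ge>real (Suc n). I R < 1 / real (Suc n) * R powr ((real CARD('n) - 1) / 2)" for n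
    proof -
      have "\<not> (\<forall>\<^sub>F R in at_top. I R \<ge> 1 / real (Suc n) * R powr ((real CARD('n) - 1) / 2))"
        using no by (metis of_nat_0_less_iff zero_less_Suc zero_less_divide_1_iff)
      then show ?thesis unfolding eventually_at_top_linorder by (meson not_le)
    qed
    then obtain R where R: "\<And>n. R n \<ge> real (Suc n)"
      and I: "\<And>n. I (R n) < 1 / real (Suc n) * R n powr ((real CARD('n) - 1) / 2)" by metis
    have Rp: "R n > 0" for n using R[of n] by (rule less_le_trans[rotated]) simp
    define l where "l n = 2 * pi * R n" for n
    define J where "J n = (\<integral>\<sigma>. norm (fhat \<Omega> (l n *\<^sub>R (transpose \<sigma> *v axis j 1))) \<partial>\<mu>)" for n
    have J0: "J n \<ge> 0" for n unfolding J_def by (intro Bochner_Integration.integral_nonneg) simp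
    note low = discrepancy_moment_lower[OF assms(1,4) \<Omega> Rp p, of _ j]
    have "(\<integral>\<^sup>+\<sigma>. norm (fhat \<Omega> (l n *\<^sub>R (transpose \<sigma> *v axis j 1))) \<partial>\<mu>) = ennreal (J n)" for n
      unfolding J_def l_def by (rule nn_integral_eq_integral[OF low(2)]) simp
    then have JJ: "(\<integral>\<^sup>+\<sigma>. norm (fhat \<Omega> (l n *\<^sub>R (transpose \<sigma> *v axis j 1))) \<partial>\<mu>) \<le> ennreal (J n)" for n by simp
    define d where "d = real CARD('n)"
    \<comment> \<open>R^d J is at most the p-th mean, which is below R^((d - 1) / 2) / (n + 1).
      Multiplying by R^((1 - d) / 2) leaves the exponent (d + 1) / 2 of the packets, and the power
      of 2 pi accounts for l = 2 pi R.\<close>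
    have bound: "l n powr ((d + 1) / 2) * J n \<le> (2 * pi) powr ((d + 1) / 2) * inverse (real (Suc n))" for n
    proof -
      have "R n powr d * J n \<le> 1 / real (Suc n) * R n powr ((d - 1) / 2)"
        using low(1)[of n] I[of n] Rp[of n] by (simp add: I_def J_def l_def d_def powr_realpow)
      then have "R n powr ((1 - d) / 2) * (R n powr d * J n) \<le> R n powr ((1 - d) / 2) * (1 / real (Suc n) * R n powr ((d - 1) / 2))"
        by (rule mult_left_mono) simp
      also have "R n powr ((1 - d) / 2) * (R n powr d * J n) = R n powr ((d + 1) / 2) * J n"
        by (simp add: mult.assoc[symmetric] powr_add[symmetric] field_simps)
      also have "R n powr ((1 - d) / 2) * (1 / real (Suc n) * R n powr ((d - 1) / 2)) = inverse (real (Suc n)) * (R n powr ((1 - d) / 2 + (d - 1) / 2))"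
        by (simp only: powr_add divide_inverse mult_1_left mult_ac)
      also have "(1 - d) / 2 + (d - 1) / 2 = 0" by (simp add: field_simps)
      finally have "R n powr ((d + 1) / 2) * J n \<le> inverse (real (Suc n))" using Rp[of n] by simp
      then have "(2 * pi) powr ((d + 1) / 2) * (R n powr ((d + 1) / 2) * J n) \<le> (2 * pi) powr ((d + 1) / 2) * inverse (real (Suc n))"
        by (rule mult_left_mono) simp
      then show ?thesis using Rp[of n] by (simp add: l_def powr_mult mult.assoc)
    qed
    have "(\<lambda>n. (2 * pi) powr ((d + 1) / 2) * inverse (real (Suc n))) \<longlonglongrightarrow> (2 * pi) powr ((d + 1) / 2) * 0"
      by (intro tendsto_mult tendsto_const LIMSEQ_inverse_real_of_nat)
    then have up: "(\<lambda>n. (2 * pi) powr ((d + 1) / 2) * inverse (real (Suc n))) \<longlonglongrightarrow> 0" by simp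
    have lim: "(\<lambda>n. l n powr ((real CARD('n) + 1) / 2) * J n) \<longlonglongrightarrow> 0"
      unfolding d_def[symmetric] by (rule tendsto_sandwich[OF _ _ tendsto_const up]) (use bound J0 in auto)
    have lp: "l n > 0" for n using Rp by (simp add: l_def)
    obtain r where r: "strict_mono r" "\<And>V E0. open V \<Longrightarrow> E0 \<in> V \<Longrightarrow> norm E0 = 1 \<Longrightarrow>
       \<exists>E\<in>V. norm E = 1 \<and> (\<lambda>n. Lpk \<Omega> (graph_support j \<gamma> E) E (l (r n))) \<longlonglongrightarrow> 0"
      using packets_vanish[OF assms(4,1) \<Omega> graph_support_measurable norm_axis_1 lp JJ J0 lim] by blast
    have Rt: "filterlim R at_top sequentially"
      by (rule filterlim_at_top_mono[OF filterlim_real_sequentially]) (use R in \<open>auto intro!: always_eventually simp: order_trans[OF _ R]\<close>)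
    have "filterlim l at_top sequentially"
      unfolding l_def by (rule filterlim_tendsto_pos_mult_at_top[OF tendsto_const _ Rt]) simp
    then have "filterlim (\<lambda>n. l (r n)) at_top sequentially"
      by (rule filterlim_compose) (rule filterlim_subseq[OF r(1)])
    from no_vanishing_packets[OF assms(1-3) this r(2)] show False .
  qed
  then show "\<exists>c>0. \<forall>\<^sub>F R in at_top.
           (\<integral>\<sigma>. (\<integral>t\<in>cbox (0::real^'n) One. \<bar>discrepancy \<Omega> R \<sigma> t\<bar> powr p \<partial>lborel) \<partial>\<mu>) powr (1 / p)
             \<ge> c * R powr ((real CARD('n) - 1) / 2)"
    by (simp only: I_def)
qed

end
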